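(* Let $G$ be a countably infinite, locally finite, connected graph and let $\Gamma$ be a closed unimodular subgroup of $\mathrm{Aut}(G)$ that acts transitively on (the vertices of) $G$. Then the following conditions are equivalent: (i) $G$ is amenable; (ii) there is a $\Gamma$-invariant random spanning tree of $G$ with at most $2$ ends almost surely; (iii) there is a $\Gamma$-invariant random nonempty connected subgraph $\omega$ of $G$ that satisfies $p_c(\omega)=1$ with positive probability; (iv) there is a $\Gamma$-invariant random spanning double ray in $G^3$; (v) there is a $\Gamma$-invariant random spanning double ray in $G^k$ for some integer $k\ge 1$; (vi) $\Gamma$ is amenable.
   Context: For $k\ge 1$, $G^k$ denotes the graph with vertex set $V(G)$ in which two distinct vertices are adjacent iff their distance in $G$ is at most $k$. Every automorphism of $G$ acts as an automorphism of $G^k$. $\mathrm{Aut}(G)$ carries the topology of pointwise convergence on $V(G)$, with which its closed subgroup $\Gamma$ is a locally compact group; unimodularity (left Haar measure is also right-invariant) and amenability of $\Gamma$ are understood as for locally compact groups. The graph $G$ is amenable if for every $\varepsilon>0$ there is a finite nonempty $F\subseteq V(G)$ such that the number of edges of $G$ with exactly one endpoint in $F$ is at most $\varepsilon|F|$. A spanning double ray of a graph $X$ is a connected subgraph of $X$ containing all vertices of $X$ in which every vertex has exactly two neighbours. The number of ends of a tree is the number of rays (one-way infinite paths) starting at a fixed vertex. A random subgraph of a graph $X$ is a random element of $2^{V(X)}\times 2^{E(X)}$ (or of $2^{E(X)}$ in the case of spanning subgraphs), with the $\sigma$-algebra generated by cylinder sets, that is almost surely a subgraph of the required type. It is $\Gamma$-invariant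 if its distribution is invariant under the induced action of $\Gamma$. $p_c(\omega)$ is the critical probability of Bernoulli bond percolation on $\omega$, i.e. the supremum of the $p\in[0,1]$ for which the random subgraph of $\omega$ obtained by keeping each edge independently with probability $p$ almost surely has no infinite component. *)

theory Defs
  imports
    "HOL-Probability.Probability"
    "HOL-Algebra.Bij"
    "HOL-Algebra.Coset"
begin

section \<open>Graphs\<close>

text \<open>Graphs are undirected and simple. They are pairs of a vertex set and an edge set, an edge
  being the two-element set of its endpoints, so that an element of \<open>2\<^sup>V \<times> 2\<^sup>E\<close>
  has the same type as a graph.\<close>

type_synonym 'a ugraph = "'a set \<times> 'a set set"

abbreviation verts :: "'a ugraph \<Rightarrow> 'a set" where "verts \<equiv> fst"
abbreviation edges :: "'a ugraph \<Rightarrow> 'a set set" where "edges \<equiv> snd"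

definition simple_graph :: "'a ugraph \<Rightarrow> bool" where
  "simple_graph X \<longleftrightarrow> (\<forall>e \<in> edges X. e \<subseteq> verts X \<and> card e = 2)"

definition adjacent :: "'a ugraph \<Rightarrow> 'a \<Rightarrow> 'a \<Rightarrow> bool" where
  "adjacent X u v \<longleftrightarrow> {u, v} \<in> edges X"

definition neighbours :: "'a ugraph \<Rightarrow> 'a \<Rightarrow> 'a set" where
  "neighbours X v = {w \<in> verts X. adjacent X v w}"

definition locally_finite_graph :: "'a ugraph \<Rightarrow> bool" where
  "locally_finite_graph X \<longleftrightarrow> (\<forall>v \<in> verts X. finite (neighbours X v))"

definition walks :: "'a ugraph \<Rightarrow> 'a \<Rightarrow> 'a \<Rightarrow> 'a list set" where
  "walks X u v = {xs. xs \<noteq> [] \<and> hd xs = u \<and> last xs = v \<and>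
                      set xs \<subseteq> verts X \<and> successively (adjacent X) xs}"

definition connected_graph :: "'a ugraph \<Rightarrow> bool" where
  "connected_graph X \<longleftrightarrow> (\<forall>u \<in> verts X. \<forall>v \<in> verts X. walks X u v \<noteq> {})"

definition component :: "'a ugraph \<Rightarrow> 'a \<Rightarrow> 'a set" where
  "component X v = {w \<in> verts X. walks X v w \<noteq> {}}"

text \<open>The distance is \<open>\<infinity>\<close> (the infimum of the empty set) between different components.\<close>

definition graph_dist :: "'a ugraph \<Rightarrow> 'a \<Rightarrow> 'a \<Rightarrow> enat" where
  "graph_dist X u v = (INF xs \<in> walks X u v. enat (length xs - 1))"

definition graph_power :: "'a ugraph \<Rightarrow> nat \<Rightarrow> 'a ugraph" where
  "graph_power X k =
     (verts X, {{u, v} | u v. u \<in> verts X \<and> v \<in> verts X \<and> u \<noteq> v \<and> graph_dist X u v \<le> enat k})"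

definition subgraph_of :: "'a ugraph \<Rightarrow> 'a ugraph \<Rightarrow> bool" where
  "subgraph_of Y X \<longleftrightarrow> simple_graph Y \<and> verts Y \<subseteq> verts X \<and> edges Y \<subseteq> edges X"

definition cycle_in :: "'a ugraph \<Rightarrow> 'a list \<Rightarrow> bool" where
  "cycle_in X xs \<longleftrightarrow> length xs \<ge> 3 \<and> distinct xs \<and> set xs \<subseteq> verts X \<and>
     successively (adjacent X) xs \<and> adjacent X (last xs) (hd xs)"

definition tree :: "'a ugraph \<Rightarrow> bool" where
  "tree X \<longleftrightarrow> simple_graph X \<and> verts X \<noteq> {} \<and> connected_graph X \<and> \<not> (\<exists>xs. cycle_in X xs)"

definition rays_from :: "'a ugraph \<Rightarrow> 'a \<Rightarrow> (nat \<Rightarrow> 'a) set" where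
  "rays_from X v = {r. r 0 = v \<and> inj r \<and> range r \<subseteq> verts X \<and> (\<forall>n. adjacent X (r n) (r (Suc n)))}"

text \<open>The number of ends is meaningful for trees only, where it does not depend on the vertex.\<close>

definition num_ends :: "'a ugraph \<Rightarrow> enat" where
  "num_ends T = (let R = rays_from T (SOME v. v \<in> verts T)
                 in if finite R then enat (card R) else \<infinity>)"

definition spanning_tree :: "'a ugraph \<Rightarrow> 'a ugraph \<Rightarrow> bool" where
  "spanning_tree X T \<longleftrightarrow> subgraph_of T X \<and> verts T = verts X \<and> tree T"

definition spanning_double_ray :: "'a ugraph \<Rightarrow> 'a ugraph \<Rightarrow> bool" where
  "spanning_double_ray X D \<longleftrightarrow> subgraph_of D X \<and> verts D = verts X \<and> connected_graph D \<and>
     (\<forall>v \<in> verts D. card (neighbours D v) = 2)"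

definition amenable_graph :: "'a ugraph \<Rightarrow> bool" where
  "amenable_graph X \<longleftrightarrow> (\<forall>\<epsilon>::real. \<epsilon> > 0 \<longrightarrow>
     (\<exists>F. finite F \<and> F \<noteq> {} \<and> F \<subseteq> verts X \<and>
          real (card {e \<in> edges X. card (e \<inter> F) = 1}) \<le> \<epsilon> * real (card F)))"


section \<open>Locally compact groups\<close>

text \<open>A topological group is given by a group \<open>\<G>\<close> and a topology \<open>T\<close> on its carrier.\<close>

definition borel_of :: "'a topology \<Rightarrow> 'a measure" where
  "borel_of T = sigma (topspace T) {U. openin T U}"

definition left_haar_measure :: "('a, 'b) monoid_scheme \<Rightarrow> 'a topology \<Rightarrow> 'a measure \<Rightarrow> bool" where
  "left_haar_measure \<G> T \<mu> \<longleftrightarrow>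
     sets \<mu> = sets (borel_of T) \<and>
     emeasure \<mu> (space \<mu>) \<noteq> 0 \<and>
     (\<forall>K. compactin T K \<longrightarrow> emeasure \<mu> K < \<infinity>) \<and>
     (\<forall>A \<in> sets \<mu>. emeasure \<mu> A = (INF U \<in> {U. openin T U \<and> A \<subseteq> U}. emeasure \<mu> U)) \<and>
     (\<forall>U. openin T U \<longrightarrow> emeasure \<mu> U = (SUP K \<in> {K. compactin T K \<and> K \<subseteq> U}. emeasure \<mu> K)) \<and>
     (\<forall>g \<in> carrier \<G>. \<forall>A \<in> sets \<mu>. emeasure \<mu> (g <#\<^bsub>\<G>\<^esub> A) = emeasure \<mu> A)"

definition unimodular :: "('a, 'b) monoid_scheme \<Rightarrow> 'a topology \<Rightarrow> bool" where
  "unimodular \<G> T \<longleftrightarrow> (\<exists>\<mu>. left_haar_measure \<G> T \<mu> \<and>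
     (\<forall>g \<in> carrier \<G>. \<forall>A \<in> sets \<mu>. emeasure \<mu> (A #>\<^bsub>\<G>\<^esub> g) = emeasure \<mu> A))"

text \<open>Elements of \<open>L\<^sup>\<infinity>\<close> are represented by functions. The positivity clause of a mean below
  makes it depend only on the almost everywhere class. (For groups that are not
  \<open>\<sigma>\<close>-compact, locally null sets would have to be used instead of null sets.)\<close>

definition ess_bounded :: "'a measure \<Rightarrow> ('a \<Rightarrow> real) set" where
  "ess_bounded \<mu> = {f \<in> borel_measurable \<mu>. \<exists>C. AE x in \<mu>. \<bar>f x\<bar> \<le> C}"

definition left_invariant_mean ::
    "('a, 'b) monoid_scheme \<Rightarrow> 'a measure \<Rightarrow> (('a \<Rightarrow> real) \<Rightarrow> real) \<Rightarrow> bool" where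
  "left_invariant_mean \<G> \<mu> m \<longleftrightarrow>
     (\<forall>f \<in> ess_bounded \<mu>. \<forall>h \<in> ess_bounded \<mu>. m (\<lambda>x. f x + h x) = m f + m h) \<and>
     (\<forall>f \<in> ess_bounded \<mu>. \<forall>c. m (\<lambda>x. c * f x) = c * m f) \<and>
     (\<forall>f \<in> ess_bounded \<mu>. (AE x in \<mu>. 0 \<le> f x) \<longrightarrow> 0 \<le> m f) \<and>
     m (\<lambda>x. 1) = 1 \<and>
     (\<forall>f \<in> ess_bounded \<mu>. \<forall>g \<in> carrier \<G>. m (\<lambda>x. f (g \<otimes>\<^bsub>\<G>\<^esub> x)) = m f)"

definition amenable_group :: "('a, 'b) monoid_scheme \<Rightarrow> 'a topology \<Rightarrow> bool" where
  "amenable_group \<G> T \<longleftrightarrow> (\<exists>\<mu> m. left_haar_measure \<G> T \<mu> \<and> left_invariant_mean \<G> \<mu> m)"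


section \<open>Automorphism groups\<close>

text \<open>As in \<^term>\<open>BijGroup\<close>, automorphisms are extensional functions, i.e. \<^term>\<open>undefined\<close>
  outside the vertex set; hence they are points of the product space below.\<close>

definition automorphisms :: "'a ugraph \<Rightarrow> ('a \<Rightarrow> 'a) set" where
  "automorphisms X = {f \<in> Bij (verts X).
     \<forall>u \<in> verts X. \<forall>v \<in> verts X. adjacent X (f u) (f v) \<longleftrightarrow> adjacent X u v}"

definition aut_group :: "'a ugraph \<Rightarrow> ('a \<Rightarrow> 'a) monoid" where
  "aut_group X = BijGroup (verts X) \<lparr>carrier := automorphisms X\<rparr>"

definition aut_topology :: "'a ugraph \<Rightarrow> ('a \<Rightarrow> 'a) topology" where
  "aut_topology X =
     subtopology (product_topology (\<lambda>_. discrete_topology (verts X)) (verts X)) (automorphisms X)"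

definition transitive_on_verts :: "('a \<Rightarrow> 'a) set \<Rightarrow> 'a ugraph \<Rightarrow> bool" where
  "transitive_on_verts \<Gamma> X \<longleftrightarrow> (\<forall>u \<in> verts X. \<forall>v \<in> verts X. \<exists>\<gamma> \<in> \<Gamma>. \<gamma> u = v)"


section \<open>Invariant random subgraphs\<close>

text \<open>Random subgraphs are represented by their distributions.\<close>

definition cylinder_space :: "'i set \<Rightarrow> 'i set measure" where
  "cylinder_space I = sigma (Pow I) {{A \<in> Pow I. i \<in> A} | i. i \<in> I}"

definition act_edges :: "('a \<Rightarrow> 'a) \<Rightarrow> 'a set set \<Rightarrow> 'a set set" where
  "act_edges \<gamma> F = (\<lambda>e. \<gamma> ` e) ` F"

definition act_graph :: "('a \<Rightarrow> 'a) \<Rightarrow> 'a ugraph \<Rightarrow> 'a ugraph" where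
  "act_graph \<gamma> Y = (\<gamma> ` verts Y, act_edges \<gamma> (edges Y))"

definition invariant_random_subgraph ::
    "('a \<Rightarrow> 'a) set \<Rightarrow> 'a ugraph \<Rightarrow> ('a ugraph \<Rightarrow> bool) \<Rightarrow> 'a ugraph measure \<Rightarrow> bool" where
  "invariant_random_subgraph \<Gamma> X P M \<longleftrightarrow>
     prob_space M \<and>
     sets M = sets (cylinder_space (verts X) \<Otimes>\<^sub>M cylinder_space (edges X)) \<and>
     (\<forall>\<gamma> \<in> \<Gamma>. distr M M (act_graph \<gamma>) = M) \<and>
     (AE Y in M. subgraph_of Y X \<and> P Y)"

definition invariant_random_spanning_subgraph ::
    "('a \<Rightarrow> 'a) set \<Rightarrow> 'a ugraph \<Rightarrow> ('a ugraph \<Rightarrow> bool) \<Rightarrow> 'a set set measure \<Rightarrow> bool" where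
  "invariant_random_spanning_subgraph \<Gamma> X P M \<longleftrightarrow>
     prob_space M \<and>
     sets M = sets (cylinder_space (edges X)) \<and>
     (\<forall>\<gamma> \<in> \<Gamma>. distr M M (act_edges \<gamma>) = M) \<and>
     (AE F in M. P (verts X, F))"


section \<open>Bernoulli percolation\<close>

definition p_c :: "'a ugraph \<Rightarrow> real" where
  "p_c X = Sup {p \<in> {0..1}.
     AE \<eta> in (\<Pi>\<^sub>M e \<in> edges X. measure_pmf (bernoulli_pmf p)).
       \<not> (\<exists>v \<in> verts X. infinite (component (verts X, {e \<in> edges X. \<eta> e}) v))}"

end

theory Submission
  imports Defs
begin

text \<open>Unimodularity enters through the mass transport principle, which is read off from Haar measure.

  (i) and (vi): on a nonamenable graph there is a bounded flow with excess at least one at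
  every vertex; averaging it over the translates by an invariant mean would violate mass transport.
  Conversely, a limit of averages along Foelner sets is an invariant mean.

  (iii) implies (i): the clusters of percolation on \<open>\<omega>\<close> at a level below one are finite. Assigning
  each vertex of \<open>G\<close> to its nearest vertex in \<open>\<omega>\<close> turns them into an invariant partition into
  finite cells, and a vertex is separated from its neighbours with a probability that vanishes as the
  level tends to one. If \<open>G\<close> were not amenable, the expected number of edges from a vertex to
  another cell would be bounded from below. The same holds for the powers of \<open>G\<close>, and a locally
  finite graph with finitely many rays from some vertex has critical probability one, which gives
  the implications from (ii) and (v).

  (i) implies (ii): independently chosen translates of Foelner sets yield increasing invariant partitions
  into finite cells that eventually join any two neighbours. Take the minimal spanning tree, where
  edges joined earlier are smaller. In a finite cell the excess over two of the numbers of
  infinite branches adds up to at most the number of edges leaving the cell, so by mass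
  transport almost surely no vertex has three infinite branches. Traversing the finite branches of this tree
  with steps of length at most three gives the double ray in (iv).\<close>

section \<open>Generalized limits\<close>

text \<open>Besides the subgraph given in (iii), all randomness comes from independent uniform
  labels whose indices are permuted by \<Gamma>. Invariance in law thus reduces to equivariance of a
  deterministic construction, in which no choice may single out a vertex: nearest points, the order
  of the edges and the two sides of a block are settled by labels, almost surely distinct. The
  constructions must also be measurable. Connectedness and infinite branches are therefore expressed
  by quantifiers over countable sets, and the neighbours in the double ray by formulas whose
  functionality is proved separately; measurability and equivariance then follow the shape of the
  formulas. Transport is balanced because the set of group elements taking x to y has a Haar measure
  that depends neither on y (left invariance) nor on x (right invariance). The cube enters in (iv)
  because a finite tree has in general no Hamiltonian path, whereas its cube has one from the root
  to any child of the root; this is the core of Sekanina's theorem on cubes of connected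
  graphs.\<close>

definition bseq :: "(nat \<Rightarrow> real) \<Rightarrow> bool" where
  "bseq a \<longleftrightarrow> (\<exists>C. \<forall>n. \<bar>a n\<bar> \<le> C)"

text \<open>Tychonoff's theorem for a product of intervals. It is used for generalized limits and
  for the existence of a minimising flow.\<close>

lemma compact_bounded_functions: "compact {f :: 'b \<Rightarrow> real. \<forall>i. \<bar>f i\<bar> \<le> B i}"
proof -
  have "compactin (product_topology (\<lambda>_. euclidean) UNIV) (PiE UNIV (\<lambda>i. cball (0::real) (B i)))"
    by (subst compactin_PiE) auto
  moreover have "PiE UNIV (\<lambda>i. cball (0::real) (B i)) = {f :: 'b \<Rightarrow> real. \<forall>i. \<bar>f i\<bar> \<le> B i}"
    by (auto simp: PiE_def Pi_def)
  ultimately show ?thesis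
    by (simp add: euclidean_product_topology)
qed

text \<open>The properties of a Banach limit apart from shift invariance; the limit along a free
  ultrafilter is an example.\<close>

definition generalized_limit :: "((nat \<Rightarrow> real) \<Rightarrow> real) \<Rightarrow> bool" where
  "generalized_limit L \<longleftrightarrow>
    (\<forall>a b. bseq a \<longrightarrow> bseq b \<longrightarrow> L (\<lambda>n. a n + b n) = L a + L b) \<and>
    (\<forall>a c. bseq a \<longrightarrow> L (\<lambda>n. c * a n) = c * L a) \<and>
    (\<forall>a. bseq a \<longrightarrow> eventually (\<lambda>n. 0 \<le> a n) sequentially \<longrightarrow> 0 \<le> L a) \<and>
    (\<forall>a l. a \<longlonglongrightarrow> l \<longrightarrow> bseq a \<longrightarrow> L a = l)"

lemma bseq_add: "bseq a \<Longrightarrow> bseq b \<Longrightarrow> bseq (\<lambda>n. a n + b n)"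
  unfolding bseq_def by (metis abs_triangle_ineq add_mono order_trans)

lemma bseq_mult:
  assumes "bseq a" shows "bseq (\<lambda>n. c * a n)"
proof -
  obtain C where "\<forall>n. \<bar>a n\<bar> \<le> C" using assms unfolding bseq_def by auto
  then have "\<forall>n. \<bar>c * a n\<bar> \<le> \<bar>c\<bar> * C"
    by (auto simp: abs_mult intro: mult_left_mono)
  then show ?thesis unfolding bseq_def by blast
qed

lemma bseq_const: "bseq (\<lambda>n. c)"
  unfolding bseq_def by auto

text \<open>The evaluations at n lie in a product of compact intervals and hence have a cluster
  point. A relation between values that holds for the evaluations at all large n passes to the
  cluster point.\<close>

lemma generalized_limit_exists: "\<exists>L. generalized_limit L"
proof -
  define B where "B a = (if bseq a then (SOME C. \<forall>n. \<bar>a n\<bar> \<le> C) else 0)" for a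
  have B: "\<bar>a n\<bar> \<le> B a" if "bseq a" for a n
    using that someI_ex[of "\<lambda>C. \<forall>n. \<bar>a n\<bar> \<le> C"] unfolding B_def bseq_def by auto
  have B0: "B a = 0" if "\<not> bseq a" for a using that by (simp add: B_def)
  \<comment> \<open>Unbounded sequences are sent to 0, which keeps every evaluation in the box given
    by \<open>B\<close>.\<close>
  define ev where "ev n = (\<lambda>a. if bseq a then a n else 0)" for n :: nat
  define F where "F = filtermap ev sequentially"
  have "F \<noteq> bot"
    unfolding F_def by (simp add: filtermap_bot_iff)
  moreover have "eventually (\<lambda>f. f \<in> {f. \<forall>a. \<bar>f a\<bar> \<le> B a}) F"
    unfolding F_def eventually_filtermap by (rule always_eventually) (auto simp: ev_def B B0)
  ultimately obtain L where L: "inf (nhds L) F \<noteq> bot"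
    using compact_bounded_functions[of B] unfolding compact_filter by blast
  \<comment> \<open>\<open>H\<close> refines the filter of the evaluations and converges to
    \<open>L\<close> in every coordinate, so that properties of \<open>L\<close> can be read off as
    limits along \<open>H\<close>.\<close>
  define H where "H = inf (nhds L) F"
  have H: "H \<noteq> bot" "H \<le> nhds L" "H \<le> F"
    using L by (auto simp: H_def)
  have lim: "((\<lambda>f. f a) \<longlongrightarrow> L a) H" for a
  proof (rule filterlim_mono[OF _ order.refl H(2)])
    show "((\<lambda>f. f a) \<longlongrightarrow> L a) (nhds L)"
    proof (rule topological_tendstoI)
      fix S :: "real set" assume S: "open S" "L a \<in> S"
      have "open ((\<lambda>f. f a) -` S)"
        using continuous_on_product_coordinates[of a] S(1) by (rule open_vimage[rotated])
      with S(2) show "eventually (\<lambda>f. f a \<in> S) (nhds L)"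
        unfolding eventually_nhds by (intro exI[of _ "(\<lambda>f. f a) -` S"]) auto
    qed
  qed
  have evH: "eventually P H" if "eventually (\<lambda>n. P (ev n)) sequentially" for P
    using that H(3) unfolding F_def by (auto simp: le_filter_def eventually_filtermap)
  have "generalized_limit L"
    unfolding generalized_limit_def
  proof (intro conjI allI impI)
    fix a b assume ab: "bseq a" "bseq b"
    have "((\<lambda>f. f (\<lambda>n. a n + b n)) \<longlongrightarrow> L a + L b) H"
    proof (rule Lim_transform_eventually[OF tendsto_add[OF lim lim]])
      show "\<forall>\<^sub>F f in H. f a + f b = f (\<lambda>n. a n + b n)"
        by (rule evH, rule always_eventually) (auto simp: ev_def ab bseq_add)
    qed
    then show "L (\<lambda>n. a n + b n) = L a + L b"
      using tendsto_unique[OF H(1) lim] by blast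
  next
    fix a c assume a: "bseq a"
    have "((\<lambda>f. f (\<lambda>n. c * a n)) \<longlongrightarrow> c * L a) H"
    proof (rule Lim_transform_eventually[OF tendsto_mult[OF tendsto_const lim]])
      show "\<forall>\<^sub>F f in H. c * f a = f (\<lambda>n. c * a n)"
        by (rule evH, rule always_eventually) (auto simp: ev_def a bseq_mult)
    qed
    then show "L (\<lambda>n. c * a n) = c * L a"
      using tendsto_unique[OF H(1) lim] by blast
  next
    fix a assume a: "bseq a" "eventually (\<lambda>n. 0 \<le> a n) sequentially"
    have "\<forall>\<^sub>F f in H. 0 \<le> f a"
      by (rule evH, rule eventually_mono[OF a(2)]) (auto simp: ev_def a)
    then show "0 \<le> L a"
      using tendsto_lowerbound[OF lim _ H(1)] by blast
  next
    fix a l assume a: "a \<longlonglongrightarrow> l" "bseq a"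
    have "((\<lambda>f. f a) \<longlongrightarrow> l) H"
    proof (rule tendstoI)
      fix e :: real assume "e > 0"
      then have "eventually (\<lambda>n. dist (a n) l < e) sequentially"
        using a(1) by (auto simp: tendsto_iff)
      then show "\<forall>\<^sub>F f in H. dist (f a) l < e"
        by (intro evH) (auto elim!: eventually_mono simp: ev_def a)
    qed
    then show "L a = l"
      using tendsto_unique[OF H(1) lim] by blast
  qed
  then show ?thesis by blast
qed

context
  fixes L assumes L: "generalized_limit L"
begin

lemma glim_add: "bseq a \<Longrightarrow> bseq b \<Longrightarrow> L (\<lambda>n. a n + b n) = L a + L b"
  and glim_mult: "bseq a \<Longrightarrow> L (\<lambda>n. c * a n) = c * L a"
  and glim_nonneg: "bseq a \<Longrightarrow> eventually (\<lambda>n. 0 \<le> a n) sequentially \<Longrightarrow> 0 \<le> L a"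
  and glim_eq: "a \<longlonglongrightarrow> l \<Longrightarrow> bseq a \<Longrightarrow> L a = l"
  using L unfolding generalized_limit_def by blast+

lemma glim_const: "L (\<lambda>n. c) = c"
  by (rule glim_eq[OF tendsto_const bseq_const])

lemma glim_diff: "bseq a \<Longrightarrow> bseq b \<Longrightarrow> L (\<lambda>n. a n - b n) = L a - L b"
  using glim_add[of a "\<lambda>n. (-1) * b n"] glim_mult[of b "-1"] bseq_mult[of b "-1"] by simp

lemma bseq_diff: "bseq a \<Longrightarrow> bseq b \<Longrightarrow> bseq (\<lambda>n. a n - b n)"
  using bseq_add[of a "\<lambda>n. (-1) * b n"] bseq_mult[of b "-1"] by simp

lemma glim_sum:
  assumes "finite I" "\<And>i. i \<in> I \<Longrightarrow> bseq (f i)"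
  shows "bseq (\<lambda>n. \<Sum>i\<in>I. f i n) \<and> L (\<lambda>n. \<Sum>i\<in>I. f i n) = (\<Sum>i\<in>I. L (f i))"
  using assms by (induction I rule: finite_induct) (auto simp: glim_const bseq_const glim_add bseq_add)

lemma glim_mono:
  assumes "bseq a" "bseq b" "eventually (\<lambda>n. a n \<le> b n) sequentially"
  shows "L a \<le> L b"
proof -
  have "0 \<le> L (\<lambda>n. b n - a n)"
    using assms by (intro glim_nonneg bseq_diff) (auto elim: eventually_mono)
  then show ?thesis using glim_diff[OF assms(2,1)] by simp
qed

end

section \<open>Connectedness through a set of edges\<close>

text \<open>Connectedness through a bare set of edges. Percolation clusters, cells and trees with a
  vertex removed are all of this form, and monotonicity in the edge set comes for free;
  \<open>walks_conn\<close> links it to walks.\<close>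

definition conn :: "'a set set \<Rightarrow> 'a \<Rightarrow> 'a \<Rightarrow> bool" where
  "conn F x y \<longleftrightarrow> (x, y) \<in> {(a, b). {a, b} \<in> F}\<^sup>*"

lemma conn_refl [simp]: "conn F x x"
  by (simp add: conn_def)

lemma conn_trans [trans]: "conn F x y \<Longrightarrow> conn F y z \<Longrightarrow> conn F x z"
  unfolding conn_def by (rule rtrancl_trans)

lemma conn_sym: "conn F x y \<Longrightarrow> conn F y x"
proof -
  have "sym {(a, b). {a, b} \<in> F}"
    by (auto simp: sym_def insert_commute)
  then show "conn F x y \<Longrightarrow> conn F y x"
    unfolding conn_def by (metis sym_rtrancl symD)
qed

lemma conn_commute: "conn F x y \<longleftrightarrow> conn F y x"
  using conn_sym by metis

lemma conn_edge: "{x, y} \<in> F \<Longrightarrow> conn F x y"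
  unfolding conn_def by auto

lemma conn_step: "conn F x y \<Longrightarrow> {y, z} \<in> F \<Longrightarrow> conn F x z"
  using conn_trans conn_edge by metis

lemma conn_induct [consumes 1, case_names refl step]:
  assumes "conn F x y" "P x" "\<And>y z. conn F x y \<Longrightarrow> {y, z} \<in> F \<Longrightarrow> P y \<Longrightarrow> P z"
  shows "P y"
  using assms unfolding conn_def by (induction rule: rtrancl_induct) auto

lemma conn_mono: "conn F x y \<Longrightarrow> F \<subseteq> F' \<Longrightarrow> conn F' x y"
  by (induction rule: conn_induct) (auto intro: conn_step)

lemma conn_lift:
  assumes "conn F x y" "\<And>a b. {a, b} \<in> F \<Longrightarrow> conn F' a b"
  shows "conn F' x y"
  using assms(1) by (induction rule: conn_induct) (auto intro: conn_trans assms(2))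

lemma conn_closed: "conn F x y \<Longrightarrow> x \<in> S \<Longrightarrow> (\<And>e a b. e \<in> F \<Longrightarrow> e = {a, b} \<Longrightarrow> a \<in> S \<Longrightarrow> b \<in> S) \<Longrightarrow> y \<in> S"
  by (induction rule: conn_induct) auto

lemma conn_in_verts: "conn F x y \<Longrightarrow> x \<in> V \<Longrightarrow> \<Union>F \<subseteq> V \<Longrightarrow> y \<in> V"
  by (erule conn_closed) auto

text \<open>A path has finitely many edges, so a single member of the sequence contains them
  all.\<close>

lemma conn_incseq:
  assumes "incseq F" "conn (\<Union>n. F n) x y"
  shows "\<exists>n::nat. conn (F n) x y"
  using assms(2)
proof (induction rule: conn_induct)
  case (step y z)
  then obtain n m where "conn (F n) x y" "{y, z} \<in> F m" by auto
  moreover have "F n \<subseteq> F (max n m)" "F m \<subseteq> F (max n m)"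
    using assms(1) by (auto simp: incseq_def)
  ultimately have "conn (F (max n m)) x z"
    by (meson conn_mono conn_step subsetD)
  then show ?case ..
qed auto

lemma conn_restrict:
  assumes "conn F x y" "x \<in> S" "\<And>e a b. e \<in> F \<Longrightarrow> e = {a, b} \<Longrightarrow> a \<in> S \<Longrightarrow> b \<in> S"
  shows "conn {e \<in> F. e \<subseteq> S} x y"
proof -
  have "y \<in> S \<and> conn {e \<in> F. e \<subseteq> S} x y"
    using assms(1)
  proof (induction rule: conn_induct)
    case (step y z)
    then have "z \<in> S" using assms(3) by blast
    with step show ?case by (auto intro: conn_step)
  qed (use assms(2) in auto)
  then show ?thesis ..
qed

text \<open>For the converse direction a path in the image is pulled back step by step, injectivity
  making the preimage of each edge start at the vertex reached so far.\<close>

lemma conn_image: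
  assumes "inj_on f V" "\<Union>F \<subseteq> V" "x \<in> V" "y \<in> V"
  shows "conn ((`) f ` F) (f x) (f y) \<longleftrightarrow> conn F x y"
proof
  assume "conn F x y"
  then show "conn ((`) f ` F) (f x) (f y)"
  proof (induction rule: conn_induct)
    case (step y z)
    then have "{f y, f z} \<in> (`) f ` F"
      by (metis image_empty image_eqI image_insert)
    with step show ?case by (auto intro: conn_step)
  qed auto
next
  assume "conn ((`) f ` F) (f x) (f y)"
  then have "\<exists>y' \<in> V. f y = f y' \<and> conn F x y'"
  proof (induction rule: conn_induct)
    case (step z w)
    then obtain y' where y': "y' \<in> V" "z = f y'" "conn F x y'" by auto
    from step(2) obtain e where e: "e \<in> F" "f ` e = {z, w}" by auto
    then have "e \<subseteq> V" using assms by auto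
    from e obtain a b where ab: "a \<in> e" "b \<in> e" "f a = z" "f b = w"
      by (metis image_iff insertCI)
    have "a = y'" using ab y' assms(1) \<open>e \<subseteq> V\<close> by (auto dest: inj_onD)
    have "e = {a, b}"
    proof -
      have "c = a \<or> c = b" if "c \<in> e" for c
      proof -
        have "f c = z \<or> f c = w" using e that by auto
        then show ?thesis using ab that assms(1) \<open>e \<subseteq> V\<close> by (auto dest: inj_onD)
      qed
      then show ?thesis using ab by auto
    qed
    then have "conn F x b" using y' \<open>a = y'\<close> e(1) conn_step by metis
    then show ?case using ab \<open>e \<subseteq> V\<close> by (intro bexI[of _ b]) auto
  qed (use assms in auto)
  then show "conn F x y"
    using assms by (auto dest: inj_onD)
qed

text \<open>The edges are cut down to those inside the vertex set because a walk may not leave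
  it.\<close>

lemma walks_conn:
  "walks X u v \<noteq> {} \<longleftrightarrow> u \<in> verts X \<and> conn {e \<in> edges X. e \<subseteq> verts X} u v"
proof
  assume "walks X u v \<noteq> {}"
  then obtain xs where xs: "xs \<noteq> []" "hd xs = u" "last xs = v" "set xs \<subseteq> verts X"
      "successively (adjacent X) xs"
    by (auto simp: walks_def)
  then show "u \<in> verts X \<and> conn {e \<in> edges X. e \<subseteq> verts X} u v"
  proof (induction xs arbitrary: u rule: list_nonempty_induct)
    case (cons x xs)
    then have "{x, hd xs} \<in> {e \<in> edges X. e \<subseteq> verts X}"
      by (cases xs) (auto simp: adjacent_def)
    moreover have "conn {e \<in> edges X. e \<subseteq> verts X} (hd xs) v"
      using cons by (cases xs) auto
    ultimately show ?case
      using cons by (auto intro: conn_trans conn_edge)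
  qed auto
next
  assume A: "u \<in> verts X \<and> conn {e \<in> edges X. e \<subseteq> verts X} u v"
  then have "conn {e \<in> edges X. e \<subseteq> verts X} u v" by simp
  then show "walks X u v \<noteq> {}"
  proof (induction rule: conn_induct)
    case refl
    have "[u] \<in> walks X u u" using A by (auto simp: walks_def)
    then show ?case by blast
  next
    case (step y z)
    then obtain xs where "xs \<in> walks X u y" by auto
    then have "xs @ [z] \<in> walks X u z"
      using step(2) by (auto simp: walks_def successively_append_iff adjacent_def)
    then show ?case by blast
  qed
qed

lemma component_conn:
  "v \<in> verts X \<Longrightarrow> component X v = {w \<in> verts X. conn {e \<in> edges X. e \<subseteq> verts X} v w}"
  by (auto simp: component_def walks_conn)

lemma connected_graph_conn:
  "connected_graph X \<longleftrightarrow> (\<forall>u \<in> verts X. \<forall>v \<in> verts X. conn {e \<in> edges X. e \<subseteq> verts X} u v)"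
  by (auto simp: connected_graph_def walks_conn)

section \<open>Independent uniform labels\<close>

abbreviation unif :: "real measure" where
  "unif \<equiv> uniform_measure lborel {0..1}"

lemma prob_space_unif: "prob_space unif"
  by (rule prob_space_uniform_measure) auto

lemma sets_unif [measurable_cong]: "sets unif = sets borel"
  by simp

lemma space_unif [simp]: "space unif = UNIV"
  by simp

lemma emeasure_unif_less:
  assumes "0 \<le> p" "p \<le> 1"
  shows "emeasure unif {..<p} = ennreal p"
proof -
  have "{0..1} \<inter> {..<p} = {0..<p}" using assms by auto
  then show ?thesis using assms by (simp add: emeasure_uniform_measure divide_ennreal_def)
qed

lemma measure_unif_less:
  assumes "0 \<le> p" "p \<le> 1"
  shows "measure unif {..<p} = p"
  using emeasure_unif_less[OF assms] assms by (simp add: measure_def)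

lemma AE_unif_less_1: "AE x in unif. x < 1"
proof -
  have "AE x in lborel. x \<noteq> (1::real)" by (rule AE_lborel_singleton)
  then show ?thesis
    by (subst AE_uniform_measure) (auto elim!: AE_mp)
qed

lemma AE_unif_neq: "AE x in unif. x \<noteq> c"
proof -
  have "AE x in lborel. x \<noteq> (c::real)" by (rule AE_lborel_singleton)
  then show ?thesis
    by (subst AE_uniform_measure) (auto elim!: AE_mp)
qed

abbreviation labels :: "'j set \<Rightarrow> ('j \<Rightarrow> real) measure" where
  "labels J \<equiv> PiM J (\<lambda>_. unif)"

lemma prob_space_labels: "prob_space (labels J)"
  by (intro prob_space_PiM prob_space_unif)

lemma product_prob_space_unif: "product_prob_space (\<lambda>_. unif)"
proof -
  interpret prob_space unif by (rule prob_space_unif)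
  show ?thesis by unfold_locales
qed

text \<open>An injective renaming of indices preserves independence and the common law. This gives
  invariance of the labels under \<Gamma> as well as the marginals on two indices.\<close>

lemma labels_reindex:
  assumes "inj_on f I" "f \<in> I \<rightarrow> K"
  shows "distr (labels K) (labels I) (\<lambda>U. \<lambda>n\<in>I. U (f n)) = labels I"
  using distr_PiM_reindex[of K "\<lambda>_. unif" f I, OF prob_space_unif assms] by simp

lemma AE_labels_less_1:
  assumes "j \<in> J"
  shows "AE U in labels J. U j < 1"
  using AE_PiM_component[of J "\<lambda>_. unif", OF prob_space_unif assms AE_unif_less_1] .

text \<open>Once reduced to the marginal on two indices, this is Fubini: for a fixed value of one
  label, the other almost surely avoids it.\<close>

lemma AE_labels_distinct:
  assumes "i \<in> J" "j \<in> J" "i \<noteq> j"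
  shows "AE U in labels J. U i \<noteq> U j"
proof -
  interpret labels: product_prob_space "\<lambda>_. unif" J by (rule product_prob_space_unif)
  let ?L = "labels {i, j}"
  have "distr (labels {i, j}) unif (\<lambda>U. U i) = unif" by (rule distr_PiM_component) (auto simp: prob_space_unif)
  have *: "AE U in labels {i, j}. U i \<noteq> U j"
  proof -
    let ?S = "{U \<in> space ?L. U i = U j}"
    have S [measurable]: "?S \<in> sets ?L" by measurable
    have "emeasure ?L ?S = (\<integral>\<^sup>+U. indicator ?S U \<partial>labels (insert i {j}))"
      by (rule nn_integral_indicator[OF S, symmetric])
    also have "\<dots> = (\<integral>\<^sup>+U. \<integral>\<^sup>+y. indicator ?S (U(i := y)) \<partial>unif \<partial>labels {j})"
      by (rule labels.product_nn_integral_insert) (use assms S in auto)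
    also have "\<dots> = (\<integral>\<^sup>+U. \<integral>\<^sup>+y. indicator {U j} y \<partial>unif \<partial>labels {j})"
      using assms by (intro nn_integral_cong) (auto simp: indicator_def space_PiM PiE_def extensional_def)
    also have "\<dots> = (\<integral>\<^sup>+U. 0 \<partial>labels {j})"
    proof (rule nn_integral_cong)
      fix U
      have "AE y in unif. indicator {U j} y = (0::ennreal)"
        using AE_unif_neq[of "U j"] by (auto elim!: AE_mp)
      then show "(\<integral>\<^sup>+y. indicator {U j} y \<partial>unif) = 0"
        by (subst nn_integral_0_iff_AE) auto
    qed
    finally have "emeasure ?L {U \<in> space ?L. \<not> U i \<noteq> U j} = 0"
      by simp
    moreover have "{U \<in> space ?L. \<not> U i \<noteq> U j} \<in> sets ?L" by measurable
    ultimately show ?thesis by (subst AE_iff_measurable) auto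
  qed
  have d: "distr (labels J) (labels {i, j}) (\<lambda>U. \<lambda>n\<in>{i,j}. U n) = labels {i, j}"
    by (rule labels_reindex[of "\<lambda>x. x"]) (use assms in auto)
  have "AE U in distr (labels J) (labels {i, j}) (\<lambda>U. \<lambda>n\<in>{i,j}. U n). U i \<noteq> U j"
    unfolding d by (rule *)
  then have "AE U in labels J. (\<lambda>n\<in>{i,j}. U n) i \<noteq> (\<lambda>n\<in>{i,j}. U n) j"
    by (rule AE_distrD[rotated]) (use assms in \<open>auto intro!: measurable_restrict measurable_component_singleton\<close>)
  then show ?thesis by simp
qed

lemma prob_labels_Ball:
  assumes "finite A" "A \<subseteq> J" "X \<in> sets borel"
  shows "emeasure (labels J) {U \<in> space (labels J). \<forall>j\<in>A. U j \<in> X} = emeasure unif X ^ card A"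
  using product_prob_space.emeasure_PiM_Collect[OF product_prob_space_unif, of A J "\<lambda>_. X"] assms by simp

section \<open>Measurability of countable constructions\<close>

lemma borel_measurable_count_nn_integral:
  assumes "countable V" "\<And>z. z \<in> V \<Longrightarrow> f z \<in> borel_measurable M"
  shows "(\<lambda>w. \<integral>\<^sup>+z. f z w \<partial>count_space V) \<in> borel_measurable M"
proof -
  interpret sigma_finite_measure "count_space V"
    by (rule sigma_finite_measure_count_space_countable) fact
  have "case_prod f \<in> borel_measurable (count_space V \<Otimes>\<^sub>M M)"
    by (rule measurable_pair_measure_countable1) (use assms in auto)
  then have "case_prod (\<lambda>w z. f z w) \<in> borel_measurable (M \<Otimes>\<^sub>M count_space V)"
    by (subst measurable_pair_swap_iff) (simp add: case_prod_beta')
  then show ?thesis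
    by (rule borel_measurable_nn_integral)
qed

text \<open>Sorting paths by their length writes \<open>conn\<close> as a countable disjunction of
  formulas whose quantifiers range over V; measurability follows by induction on the length.\<close>

primrec reach :: "'a set \<Rightarrow> 'a set set \<Rightarrow> nat \<Rightarrow> 'a \<Rightarrow> 'a \<Rightarrow> bool" where
  "reach V F 0 x y \<longleftrightarrow> x = y"
| "reach V F (Suc n) x y \<longleftrightarrow> (\<exists>z\<in>V. reach V F n x z \<and> {z, y} \<in> F)"

lemma conn_reach:
  assumes "\<Union>F \<subseteq> V" "x \<in> V"
  shows "conn F x y \<longleftrightarrow> (\<exists>n. reach V F n x y)"
proof
  assume "conn F x y"
  then show "\<exists>n. reach V F n x y"
  proof (induction rule: conn_induct)
    case refl
    show ?case by (rule exI[of _ 0]) simp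
  next
    case (step y z)
    then obtain n where "reach V F n x y" by auto
    moreover have "y \<in> V" using step(2) assms(1) by auto
    ultimately have "reach V F (Suc n) x z" using step by auto
    then show ?case ..
  qed
next
  assume "\<exists>n. reach V F n x y"
  then obtain n where "reach V F n x y" ..
  then show "conn F x y"
    by (induction n arbitrary: y) (auto intro: conn_step)
qed

lemma measurable_conn:
  assumes V: "countable V" and F: "\<And>w. w \<in> space M \<Longrightarrow> \<Union>(F w) \<subseteq> V"
    and m: "\<And>x y. x \<in> V \<Longrightarrow> y \<in> V \<Longrightarrow> Measurable.pred M (\<lambda>w. {x, y} \<in> F w)"
    and xy: "x \<in> V" "y \<in> V"
  shows "Measurable.pred M (\<lambda>w. conn (F w) x y)"
proof -
  have "Measurable.pred M (\<lambda>w. reach V (F w) n x y)" if "y \<in> V" for n y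
    using that
  proof (induction n arbitrary: y)
    case (Suc n)
    then show ?case
      unfolding reach.simps using m V xy by (intro measurable_pred_countable pred_intros_logic) auto
  qed simp
  then have "Measurable.pred M (\<lambda>w. \<exists>n. reach V (F w) n x y)"
    using xy by (intro pred_intros_countable) auto
  then show ?thesis
    by (rule measurable_cong[THEN iffD2, rotated]) (use conn_reach[OF F xy(1)] in blast)
qed

text \<open>A countable set has only countably many finite subsets, so this turns infinity of a
  random set into a countable formula.\<close>

lemma infinite_iff_avoids_finite:
  "infinite {x \<in> V. P x} \<longleftrightarrow> (\<forall>A \<in> {A. finite A \<and> A \<subseteq> V}. \<exists>x\<in>V. x \<notin> A \<and> P x)"
proof
  assume inf: "infinite {x \<in> V. P x}"
  show "\<forall>A \<in> {A. finite A \<and> A \<subseteq> V}. \<exists>x\<in>V. x \<notin> A \<and> P x"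
  proof (rule ccontr)
    assume "\<not> ?thesis"
    then obtain A where "finite A" "{x \<in> V. P x} \<subseteq> A" by blast
    with inf show False by (meson finite_subset)
  qed
next
  assume "\<forall>A \<in> {A. finite A \<and> A \<subseteq> V}. \<exists>x\<in>V. x \<notin> A \<and> P x"
  from this[rule_format, of "{x \<in> V. P x}"] show "infinite {x \<in> V. P x}" by auto
qed

lemma measurable_infinite:
  assumes "countable V" "\<And>x. x \<in> V \<Longrightarrow> Measurable.pred M (\<lambda>w. P w x)"
  shows "Measurable.pred M (\<lambda>w. infinite {x \<in> V. P w x})"
  unfolding infinite_iff_avoids_finite
  using assms countable_Collect_finite_subset[OF assms(1)]
  by (intro measurable_pred_countable pred_intros_conj1') auto

lemma measurable_card_Collect:
  assumes "finite N" "\<And>x. x \<in> N \<Longrightarrow> Measurable.pred M (\<lambda>w. P w x)"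
  shows "(\<lambda>w. card {x \<in> N. P w x}) \<in> measurable M (count_space UNIV)"
proof -
  have "card {x \<in> N. P w x} = (\<Sum>x\<in>N. if P w x then 1 else 0)" for w
    using assms(1) by (simp add: sum.If_cases Int_def)
  then show ?thesis
    using assms by (simp del: sum.inter_filter)
qed

section \<open>Critical probability in terms of labels\<close>

lemma unif_threshold:
  assumes "0 \<le> p" "p \<le> 1"
  shows "emeasure unif {x. (x < p) \<in> F} = emeasure (measure_pmf (bernoulli_pmf p)) F"
proof -
  have t: "emeasure unif {x. x < p} = ennreal p"
    using emeasure_unif_less[OF assms] by (simp add: lessThan_def)
  have f: "emeasure unif {x. \<not> x < p} = ennreal (1 - p)"
  proof -
    have "{x. \<not> x < p} = space unif - {..<p}" by auto
    then have "measure unif {x. \<not> x < p} = 1 - p"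
      using prob_space.prob_compl[OF prob_space_unif, of "{..<p}"] measure_unif_less[OF assms] by simp
    then show ?thesis
      by (simp add: finite_measure.emeasure_eq_measure prob_space.finite_measure prob_space_unif)
  qed
  have "F \<in> Pow {True, False}" by (auto simp: UNIV_bool[symmetric])
  then consider "F = {}" | "F = {True}" | "F = {False}" | "F = UNIV"
    by (auto simp: Pow_insert UNIV_bool)
  then show ?thesis
  proof cases
    case 4
    then show ?thesis
      using prob_space.emeasure_space_1[OF prob_space_unif] measure_pmf.emeasure_space_1[of "bernoulli_pmf p"] by simp
  qed (use assms in \<open>auto simp: emeasure_pmf_single t f\<close>)
qed

text \<open>The standard coupling: one family of labels realises percolation at all levels
  simultaneously, increasing in the level. The injection \<iota> picks the labels of the edges out
  of an index set that serves other purposes too.\<close>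

lemma labels_threshold:
  assumes p: "0 \<le> p" "p \<le> 1" and i: "inj_on \<iota> I" "\<iota> \<in> I \<rightarrow> J"
  shows "distr (labels J) (PiM I (\<lambda>_. measure_pmf (bernoulli_pmf p))) (\<lambda>U. \<lambda>e\<in>I. U (\<iota> e) < p) =
         PiM I (\<lambda>_. measure_pmf (bernoulli_pmf p))" (is "?D = ?B")
proof -
  interpret B: product_prob_space "\<lambda>_. measure_pmf (bernoulli_pmf p)" I
    by unfold_locales
  have meas [measurable]: "(\<lambda>U. \<lambda>e\<in>I. U (\<iota> e) < p) \<in> measurable (labels J) ?B"
  proof (rule measurable_restrict)
    fix e assume "e \<in> I"
    then have "\<iota> e \<in> J" using i by auto
    then have [measurable]: "(\<lambda>U. U (\<iota> e)) \<in> borel_measurable (labels J)"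
      using measurable_component_singleton[of "\<iota> e" J "\<lambda>_. unif"] by simp
    have "Measurable.pred (labels J) (\<lambda>U. U (\<iota> e) < p)" by measurable
    then show "(\<lambda>U. U (\<iota> e) < p) \<in> measurable (labels J) (measure_pmf (bernoulli_pmf p))"
      by (simp add: measurable_def)
  qed
  show ?thesis
  proof (rule B.PiM_eq)
    show "sets ?D = sets ?B" by simp
    fix K F assume K: "finite K" "K \<subseteq> I" and F: "\<And>j. j \<in> K \<Longrightarrow> F j \<in> sets (measure_pmf (bernoulli_pmf p))"
    have inj: "inj_on \<iota> K" using i K by (auto intro: inj_on_subset)
    let ?X = "\<lambda>j. {x. (x < p) \<in> F (the_inv_into K \<iota> j)}"
    have X: "?X j \<in> sets unif" for j
    proof -
      have "Measurable.pred borel (\<lambda>x::real. (x < p) \<in> F (the_inv_into K \<iota> j))" by measurable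
      then show ?thesis by (simp add: pred_def)
    qed
    have emb: "prod_emb I (\<lambda>_. measure_pmf (bernoulli_pmf p)) K (Pi\<^sub>E K F) \<in> sets ?B"
      by (rule sets_PiM_I) (use K in auto)
    have "emeasure ?D (prod_emb I (\<lambda>_. measure_pmf (bernoulli_pmf p)) K (Pi\<^sub>E K F)) =
       emeasure (labels J) {U \<in> space (labels J). \<forall>j\<in>\<iota> ` K. U j \<in> ?X j}"
      unfolding emeasure_distr[OF meas emb]
      using K by (intro arg_cong2[where f = emeasure])
        (auto simp: prod_emb_def the_inv_into_f_f[OF inj] Pi_iff PiE_iff extensional_def space_PiM restrict_def subset_iff split: if_splits)
    also have "\<dots> = (\<Prod>j\<in>\<iota> ` K. emeasure unif (?X j))"
      by (rule product_prob_space.emeasure_PiM_Collect[OF product_prob_space_unif]) (use K i X in auto)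
    also have "\<dots> = (\<Prod>j\<in>K. emeasure unif (?X (\<iota> j)))"
      by (subst prod.reindex[OF inj]) simp
    also have "\<dots> = (\<Prod>j\<in>K. emeasure (measure_pmf (bernoulli_pmf p)) (F j))"
      by (intro prod.cong refl) (simp add: the_inv_into_f_f[OF inj] unif_threshold[OF p])
    finally show "emeasure ?D (prod_emb I (\<lambda>_. measure_pmf (bernoulli_pmf p)) K (Pi\<^sub>E K F)) =
       (\<Prod>j\<in>K. emeasure (measure_pmf (bernoulli_pmf p)) (F j))" .
  qed
qed

text \<open>\<open>Q\<close> says which edges are open, so that configurations and thresholds of
  labels are covered alike. Edges are restricted to the vertex set because an arbitrary point of the
  product space may have edges outside of it.\<close>

definition infcomp :: "'a ugraph \<Rightarrow> ('a set \<Rightarrow> bool) \<Rightarrow> bool" where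
  "infcomp \<omega> Q \<longleftrightarrow> (\<exists>v \<in> verts \<omega>. infinite {w \<in> verts \<omega>. conn {e \<in> edges \<omega>. e \<subseteq> verts \<omega> \<and> Q e} v w})"

lemma infcomp_mono:
  assumes "infcomp \<omega> Q" "\<And>e. e \<in> edges \<omega> \<Longrightarrow> Q e \<Longrightarrow> Q' e"
  shows "infcomp \<omega> Q'"
proof -
  obtain v where v: "v \<in> verts \<omega>" "infinite {w \<in> verts \<omega>. conn {e \<in> edges \<omega>. e \<subseteq> verts \<omega> \<and> Q e} v w}"
    using assms(1) by (auto simp: infcomp_def)
  have "{w \<in> verts \<omega>. conn {e \<in> edges \<omega>. e \<subseteq> verts \<omega> \<and> Q e} v w} \<subseteq>
        {w \<in> verts \<omega>. conn {e \<in> edges \<omega>. e \<subseteq> verts \<omega> \<and> Q' e} v w}"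
    using assms(2) by (auto elim!: conn_mono)
  with v show ?thesis unfolding infcomp_def by (meson infinite_super)
qed

lemma measurable_infcomp:
  assumes V: "countable V"
    and v: "\<And>x. x \<in> V \<Longrightarrow> Measurable.pred M (\<lambda>w. x \<in> verts (Y w))"
    and e: "\<And>x y. x \<in> V \<Longrightarrow> y \<in> V \<Longrightarrow> Measurable.pred M (\<lambda>w. {x, y} \<in> edges (Y w) \<and> Q w {x, y})"
    and sub: "\<And>w. w \<in> space M \<Longrightarrow> verts (Y w) \<subseteq> V"
  shows "Measurable.pred M (\<lambda>w. infcomp (Y w) (Q w))"
proof -
  have c: "Measurable.pred M (\<lambda>w. conn {e \<in> edges (Y w). e \<subseteq> verts (Y w) \<and> Q w e} x y)" if "x \<in> V" "y \<in> V" for x y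
  proof (rule measurable_conn[OF V _ _ that])
    show "\<Union> {e \<in> edges (Y w). e \<subseteq> verts (Y w) \<and> Q w e} \<subseteq> V" if "w \<in> space M" for w
      using sub[OF that] by auto
    fix x y assume xy: "x \<in> V" "y \<in> V"
    have "Measurable.pred M (\<lambda>w. ({x, y} \<in> edges (Y w) \<and> Q w {x, y}) \<and> x \<in> verts (Y w) \<and> y \<in> verts (Y w))"
      by (rule pred_intros_logic(3)[OF e[OF xy] pred_intros_logic(3)[OF v[OF xy(1)] v[OF xy(2)]]])
    then show "Measurable.pred M (\<lambda>w. {x, y} \<in> {e \<in> edges (Y w). e \<subseteq> verts (Y w) \<and> Q w e})"
      by (rule measurable_cong[THEN iffD2, rotated]) auto
  qed
  have "Measurable.pred M (\<lambda>w. \<exists>x\<in>V. x \<in> verts (Y w) \<and> infinite {y\<in>V. y \<in> verts (Y w) \<and>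
      conn {e \<in> edges (Y w). e \<subseteq> verts (Y w) \<and> Q w e} x y})"
    using c v V by (intro measurable_pred_countable pred_intros_logic measurable_infinite) auto
  moreover have "infcomp (Y w) (Q w) \<longleftrightarrow> (\<exists>x\<in>V. x \<in> verts (Y w) \<and> infinite {y\<in>V. y \<in> verts (Y w) \<and>
      conn {e \<in> edges (Y w). e \<subseteq> verts (Y w) \<and> Q w e} x y})" if "w \<in> space M" for w
  proof -
    have "{y\<in>V. y \<in> verts (Y w) \<and> C y} = {y \<in> verts (Y w). C y}" for C using sub[OF that] by auto
    then show ?thesis using sub[OF that] unfolding infcomp_def by auto
  qed
  ultimately show ?thesis by (subst measurable_cong) auto
qed

lemma AE_bernoulli_labels:
  assumes p: "0 \<le> p" "p \<le> 1" and i: "inj_on \<iota> (edges \<omega>)" "\<iota> \<in> edges \<omega> \<rightarrow> J"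
    and c: "countable (verts \<omega>)"
  shows "(AE \<eta> in (\<Pi>\<^sub>M e \<in> edges \<omega>. measure_pmf (bernoulli_pmf p)).
       \<not> (\<exists>v \<in> verts \<omega>. infinite (component (verts \<omega>, {e \<in> edges \<omega>. \<eta> e}) v))) \<longleftrightarrow>
     (AE U in labels J. \<not> infcomp \<omega> (\<lambda>e. U (\<iota> e) < p))"
proof -
  let ?B = "\<Pi>\<^sub>M e \<in> edges \<omega>. measure_pmf (bernoulli_pmf p)"
  let ?f = "\<lambda>U. \<lambda>e\<in>edges \<omega>. U (\<iota> e) < p"
  have e: "(\<exists>v \<in> verts \<omega>. infinite (component (verts \<omega>, {e \<in> edges \<omega>. \<eta> e}) v)) \<longleftrightarrow> infcomp \<omega> \<eta>" for \<eta>
  proof -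
    have "{e \<in> {e \<in> edges \<omega>. \<eta> e}. e \<subseteq> verts \<omega>} = {e \<in> edges \<omega>. e \<subseteq> verts \<omega> \<and> \<eta> e}" by auto
    then show ?thesis
      by (simp add: infcomp_def component_conn cong: bex_cong)
  qed
  have meas: "?f \<in> measurable (labels J) ?B"
  proof (rule measurable_restrict)
    fix e assume "e \<in> edges \<omega>"
    then have "\<iota> e \<in> J" using i by auto
    then have [measurable]: "(\<lambda>U. U (\<iota> e)) \<in> borel_measurable (labels J)"
      using measurable_component_singleton[of "\<iota> e" J "\<lambda>_. unif"] by simp
    have "Measurable.pred (labels J) (\<lambda>U. U (\<iota> e) < p)" by measurable
    then show "(\<lambda>U. U (\<iota> e) < p) \<in> measurable (labels J) (measure_pmf (bernoulli_pmf p))"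
      by (simp add: measurable_def)
  qed
  have "Measurable.pred ?B (\<lambda>\<eta>. infcomp \<omega> \<eta>)"
  proof (rule measurable_infcomp[OF c])
    fix x y
    show "Measurable.pred ?B (\<lambda>\<eta>. {x, y} \<in> edges \<omega> \<and> \<eta> {x, y})"
    proof (rule pred_intros_conj1')
      assume "{x, y} \<in> edges \<omega>"
      then have "(\<lambda>\<eta>. \<eta> {x, y}) \<in> measurable ?B (measure_pmf (bernoulli_pmf p))"
        by (rule measurable_component_singleton)
      then show "Measurable.pred ?B (\<lambda>\<eta>. \<eta> {x, y})" by (simp add: measurable_def)
    qed
  qed auto
  then have "{\<eta> \<in> space ?B. \<not> infcomp \<omega> \<eta>} \<in> sets ?B" by measurable
  then have "(AE \<eta> in distr (labels J) ?B ?f. \<not> infcomp \<omega> \<eta>) \<longleftrightarrow> (AE U in labels J. \<not> infcomp \<omega> (?f U))"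
    by (rule AE_distr_iff[OF meas])
  moreover have "infcomp \<omega> (?f U) \<longleftrightarrow> infcomp \<omega> (\<lambda>e. U (\<iota> e) < p)" for U
    by (auto elim!: infcomp_mono)
  ultimately show ?thesis
    unfolding labels_threshold[OF p i] by (simp add: e)
qed

lemma AE_unif_nonneg: "AE x in unif. 0 \<le> x"
  by (subst AE_uniform_measure) auto

text \<open>Absence of infinite clusters is inherited by lower levels, so countably many levels
  tending to one decide whether the supremum is one. In this form the condition can be handled as an
  event.\<close>

lemma p_c_eq_1_iff:
  assumes i: "inj_on \<iota> (edges \<omega>)" "\<iota> \<in> edges \<omega> \<rightarrow> J"
    and c: "countable (verts \<omega>)" "countable (edges \<omega>)"
  shows "p_c \<omega> = 1 \<longleftrightarrow> (\<forall>k::nat. AE U in labels J. \<not> infcomp \<omega> (\<lambda>e. U (\<iota> e) < 1 - 1 / (real k + 1)))"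
proof -
  define S where "S = {p \<in> {0..1}. AE U in labels J. \<not> infcomp \<omega> (\<lambda>e. U (\<iota> e) < p)}"
  have pc: "p_c \<omega> = Sup S"
    unfolding p_c_def S_def using AE_bernoulli_labels[OF _ _ i c(1)]
    by (intro arg_cong[where f = Sup] Collect_cong) auto
  \<comment> \<open>At level 0 almost surely no edge is open. Thus \<open>S\<close> is nonempty,
    which its supremum needs in order to be meaningful.\<close>
  have "AE U in labels J. \<forall>e\<in>edges \<omega>. 0 \<le> U (\<iota> e)"
    using c i by (subst AE_ball_countable) (auto intro!: AE_PiM_component prob_space_unif AE_unif_nonneg)
  then have "AE U in labels J. \<not> infcomp \<omega> (\<lambda>e. U (\<iota> e) < 0)"
  proof (rule AE_mp, intro AE_I2 impI)
    fix U assume "\<forall>e\<in>edges \<omega>. 0 \<le> (U (\<iota> e) :: real)"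
    then have "\<not> U (\<iota> e) < 0" if "e \<in> edges \<omega>" for e using that by (simp add: not_less)
    then have "{e \<in> edges \<omega>. e \<subseteq> verts \<omega> \<and> U (\<iota> e) < 0} = {}" by blast
    moreover have "{w \<in> verts \<omega>. conn {} v w} \<subseteq> {v}" for v by (auto simp: conn_def)
    ultimately show "\<not> infcomp \<omega> (\<lambda>e. U (\<iota> e) < 0)"
      unfolding infcomp_def by (metis finite.emptyI finite.insertI finite_subset)
  qed
  then have S0: "0 \<in> S" by (auto simp: S_def)
  have bdd: "bdd_above S" by (auto simp: S_def)
  have down: "p \<in> S" if "q \<in> S" "0 \<le> p" "p \<le> q" for p q
  proof -
    have "AE U in labels J. \<not> infcomp \<omega> (\<lambda>e. U (\<iota> e) < q)" using that by (simp add: S_def)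
    then have "AE U in labels J. \<not> infcomp \<omega> (\<lambda>e. U (\<iota> e) < p)"
    proof (rule eventually_mono)
      fix U :: "'b \<Rightarrow> real"
      assume "\<not> infcomp \<omega> (\<lambda>e. U (\<iota> e) < q)"
      then show "\<not> infcomp \<omega> (\<lambda>e. U (\<iota> e) < p)"
        using that infcomp_mono[of \<omega> "\<lambda>e. U (\<iota> e) < p" "\<lambda>e. U (\<iota> e) < q"] by auto
    qed
    then show ?thesis using that by (simp add: S_def)
  qed
  show ?thesis
  proof
    assume "p_c \<omega> = 1"
    show "\<forall>k::nat. AE U in labels J. \<not> infcomp \<omega> (\<lambda>e. U (\<iota> e) < 1 - 1 / (real k + 1))"
    proof
      fix k :: nat
      have "1 - 1 / (real k + 1) < Sup S" using \<open>p_c \<omega> = 1\<close> pc by simp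
      then obtain q where "q \<in> S" "1 - 1 / (real k + 1) < q"
        using less_cSup_iff[of S] S0 bdd by auto
      moreover have "0 \<le> 1 - 1 / (real k + 1)" by simp
      ultimately have "1 - 1 / (real k + 1) \<in> S" by (meson down less_imp_le)
      then show "AE U in labels J. \<not> infcomp \<omega> (\<lambda>e. U (\<iota> e) < 1 - 1 / (real k + 1))"
        by (simp add: S_def add.commute)
    qed
  next
    assume *: "\<forall>k::nat. AE U in labels J. \<not> infcomp \<omega> (\<lambda>e. U (\<iota> e) < 1 - 1 / (real k + 1))"
    have "1 - 1 / (real k + 1) \<in> S" for k using *[rule_format, of k] by (simp add: S_def)
    then have ge: "1 - 1 / (real k + 1) \<le> Sup S" for k using bdd by (intro cSup_upper) auto
    have "(\<lambda>k. 1 - 1 / (real k + 1)) \<longlonglongrightarrow> 1 - 0"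
      using LIMSEQ_inverse_real_of_nat by (intro tendsto_diff tendsto_const) (simp add: inverse_eq_divide add.commute)
    then have "1 \<le> Sup S" using ge by (intro LIMSEQ_le_const2) auto
    moreover have "S \<noteq> {}" using S0 by auto
    then have "Sup S \<le> 1" by (rule cSup_least) (simp add: S_def)
    ultimately show "p_c \<omega> = 1" using pc by simp
  qed
qed

section \<open>Mass transport\<close>

locale permutation_action =
  fixes V :: "'a set" and \<Gamma> :: "('a \<Rightarrow> 'a) set"
  assumes countable_V [simp]: "countable V"
    and bij: "\<gamma> \<in> \<Gamma> \<Longrightarrow> bij_betw \<gamma> V V"
begin

lemma in_V [simp, intro]: "\<gamma> \<in> \<Gamma> \<Longrightarrow> x \<in> V \<Longrightarrow> \<gamma> x \<in> V"
  using bij bij_betwE by blast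

lemma image_V: "\<gamma> \<in> \<Gamma> \<Longrightarrow> \<gamma> ` V = V"
  using bij by (auto simp: bij_betw_def)

lemma inj_V: "\<gamma> \<in> \<Gamma> \<Longrightarrow> inj_on \<gamma> V"
  using bij by (auto simp: bij_betw_def)

lemma eq_V [simp]: "\<gamma> \<in> \<Gamma> \<Longrightarrow> x \<in> V \<Longrightarrow> y \<in> V \<Longrightarrow> \<gamma> x = \<gamma> y \<longleftrightarrow> x = y"
  using inj_V by (auto dest: inj_onD)

text \<open>Equivariance of a formula is proved below by substituting \<gamma> into each of its
  quantifiers with this rule and its analogues for existence, cardinality and infinity.\<close>

lemma ball_V: "\<gamma> \<in> \<Gamma> \<Longrightarrow> (\<forall>x\<in>V. P x) \<longleftrightarrow> (\<forall>x\<in>V. P (\<gamma> x))"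
  using image_V by (metis imageE in_V)

lemma bex_V: "\<gamma> \<in> \<Gamma> \<Longrightarrow> (\<exists>x\<in>V. P x) \<longleftrightarrow> (\<exists>x\<in>V. P (\<gamma> x))"
  using image_V by (metis imageE in_V)

lemma Collect_V: "\<gamma> \<in> \<Gamma> \<Longrightarrow> {x\<in>V. P x} = \<gamma> ` {x\<in>V. P (\<gamma> x)}"
  using image_V by fastforce

lemma card_V: "\<gamma> \<in> \<Gamma> \<Longrightarrow> card {x\<in>V. P x} = card {x\<in>V. P (\<gamma> x)}"
  by (subst Collect_V, assumption, rule card_image, rule inj_on_subset[OF inj_V]) auto

lemma infinite_V: "\<gamma> \<in> \<Gamma> \<Longrightarrow> infinite {x\<in>V. P x} \<longleftrightarrow> infinite {x\<in>V. P (\<gamma> x)}"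
  by (subst Collect_V, assumption, subst finite_image_iff, rule inj_on_subset[OF inj_V]) auto

lemma image_eq_V: "\<gamma> \<in> \<Gamma> \<Longrightarrow> A \<subseteq> V \<Longrightarrow> B \<subseteq> V \<Longrightarrow> \<gamma> ` A = \<gamma> ` B \<longleftrightarrow> A = B"
  using inj_V by (rule inj_on_image_eq_iff)

lemma image_mem_V: "\<gamma> \<in> \<Gamma> \<Longrightarrow> A \<subseteq> V \<Longrightarrow> x \<in> V \<Longrightarrow> \<gamma> x \<in> \<gamma> ` A \<longleftrightarrow> x \<in> A"
  using inj_on_image_mem_iff[OF inj_V] by blast

lemma conn_V: "\<gamma> \<in> \<Gamma> \<Longrightarrow> \<Union>F \<subseteq> V \<Longrightarrow> x \<in> V \<Longrightarrow> y \<in> V \<Longrightarrow> conn ((`) \<gamma> ` F) (\<gamma> x) (\<gamma> y) \<longleftrightarrow> conn F x y"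
  using conn_image[OF inj_V] .

text \<open>The number separates independent families: 0 is for edges, 1 for vertices (as
  singletons), and n + 2 for the Foelner sets of level n. Indexing by finite sets of vertices lets
  \<Gamma> act on the indices.\<close>

definition J :: "(nat \<times> 'a set) set" where
  "J = UNIV \<times> {A. finite A \<and> A \<subseteq> V}"

definition act_labels :: "('a \<Rightarrow> 'a) \<Rightarrow> (nat \<times> 'a set \<Rightarrow> real) \<Rightarrow> nat \<times> 'a set \<Rightarrow> real" where
  "act_labels \<gamma> U = (\<lambda>j\<in>J. U (fst j, inv_into V \<gamma> ` snd j))"

lemma act_labels_image:
  assumes "\<gamma> \<in> \<Gamma>" "finite A" "A \<subseteq> V"
  shows "act_labels \<gamma> U (n, \<gamma> ` A) = U (n, A)"
proof -
  have "inv_into V \<gamma> ` \<gamma> ` A = A"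
    using inj_V[OF assms(1)] assms(3) by (rule inv_into_image_cancel)
  moreover have "\<gamma> ` A \<subseteq> V" using assms in_V by blast
  ultimately show ?thesis using assms by (simp add: act_labels_def J_def)
qed

lemma act_labels_measure:
  assumes "\<gamma> \<in> \<Gamma>"
  shows "act_labels \<gamma> \<in> measurable (labels J) (labels J)"
    "distr (labels J) (labels J) (act_labels \<gamma>) = labels J"
proof -
  let ?f = "\<lambda>j::nat \<times> 'a set. (fst j, inv_into V \<gamma> ` snd j)"
  have b: "bij_betw (inv_into V \<gamma>) V V" using bij[OF assms] by (rule bij_betw_inv_into)
  have f: "?f \<in> J \<rightarrow> J"
    using bij_betwE[OF b] by (auto simp: J_def)
  have inj: "inj_on ?f J"
    using b inj_on_image_eq_iff[of "inv_into V \<gamma>" V] by (auto simp: inj_on_def J_def bij_betw_def)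
  have e: "act_labels \<gamma> = (\<lambda>U. \<lambda>j\<in>J. U (?f j))" by (auto simp: act_labels_def)
  show "distr (labels J) (labels J) (act_labels \<gamma>) = labels J"
    unfolding e by (rule labels_reindex[OF inj f])
  show "act_labels \<gamma> \<in> measurable (labels J) (labels J)"
    unfolding e using f by (intro measurable_restrict measurable_component_singleton) auto
qed

lemma measurable_label [measurable]:
  "finite A \<Longrightarrow> A \<subseteq> V \<Longrightarrow> (\<lambda>U. U (n, A)) \<in> borel_measurable (labels J)"
  using measurable_component_singleton[of "(n, A)" J "\<lambda>_. unif"] by (simp add: J_def)

end

locale mass_transport = permutation_action V \<Gamma> for V :: "'a set" and \<Gamma> +
  assumes mtp: "\<And>f :: 'a \<Rightarrow> 'a \<Rightarrow> ennreal. (\<And>\<gamma> x y. \<gamma> \<in> \<Gamma> \<Longrightarrow> x \<in> V \<Longrightarrow> y \<in> V \<Longrightarrow> f (\<gamma> x) (\<gamma> y) = f x y) \<Longrightarrow> x \<in> V \<Longrightarrow>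
      (\<integral>\<^sup>+y. f x y \<partial>count_space V) = (\<integral>\<^sup>+y. f y x \<partial>count_space V)"

locale invariant_process = mass_transport V \<Gamma> + prob_space \<Omega>
  for V :: "'a set" and \<Gamma> and \<Omega> :: "'w measure" +
  fixes act :: "('a \<Rightarrow> 'a) \<Rightarrow> 'w \<Rightarrow> 'w"
  assumes act_measurable: "\<gamma> \<in> \<Gamma> \<Longrightarrow> act \<gamma> \<in> measurable \<Omega> \<Omega>"
    and act_distr: "\<gamma> \<in> \<Gamma> \<Longrightarrow> distr \<Omega> \<Omega> (act \<gamma>) = \<Omega>"
begin

text \<open>As \<open>act\<close> preserves the measure, the expectation of \<phi> is invariant
  under the diagonal action, and the deterministic principle applies to it.\<close>

lemma mtp_expectation:
  assumes meas: "\<And>x y. x \<in> V \<Longrightarrow> y \<in> V \<Longrightarrow> \<phi> x y \<in> borel_measurable \<Omega>"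
    and inv: "\<And>\<gamma> x y w. \<gamma> \<in> \<Gamma> \<Longrightarrow> x \<in> V \<Longrightarrow> y \<in> V \<Longrightarrow> w \<in> space \<Omega> \<Longrightarrow> \<phi> (\<gamma> x) (\<gamma> y) (act \<gamma> w) = \<phi> x y w"
    and x: "x \<in> V"
  shows "(\<integral>\<^sup>+w. \<integral>\<^sup>+y. \<phi> x y w \<partial>count_space V \<partial>\<Omega>) = (\<integral>\<^sup>+w. \<integral>\<^sup>+y. (\<phi> y x w :: ennreal) \<partial>count_space V \<partial>\<Omega>)"
proof -
  define f where "f x y = (\<integral>\<^sup>+w. \<phi> x y w \<partial>\<Omega>)" for x y
  have "(\<integral>\<^sup>+y. f x y \<partial>count_space V) = (\<integral>\<^sup>+y. f y x \<partial>count_space V)"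
  proof (rule mtp[OF _ x])
    fix \<gamma> x y assume g: "\<gamma> \<in> \<Gamma>" "x \<in> V" "y \<in> V"
    have "f (\<gamma> x) (\<gamma> y) = (\<integral>\<^sup>+w. \<phi> (\<gamma> x) (\<gamma> y) w \<partial>distr \<Omega> \<Omega> (act \<gamma>))"
      by (simp add: f_def act_distr g)
    also have "\<dots> = (\<integral>\<^sup>+w. \<phi> (\<gamma> x) (\<gamma> y) (act \<gamma> w) \<partial>\<Omega>)"
      using g by (intro nn_integral_distr act_measurable) (auto intro: meas)
    also have "\<dots> = f x y"
      unfolding f_def by (intro nn_integral_cong inv g)
    finally show "f (\<gamma> x) (\<gamma> y) = f x y" .
  qed
  then show ?thesis
    unfolding f_def using x meas
    by (subst (1 2) nn_integral_count_space_nn_integral) auto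
qed

text \<open>On the event A each vertex spreads its mass evenly over its finite cell. It sends out
  its own value of g and receives the average of g over the cell.\<close>

lemma cell_average_identity:
  assumes A: "A \<in> sets \<Omega>" and Ainv: "\<And>\<gamma> w. \<gamma> \<in> \<Gamma> \<Longrightarrow> w \<in> space \<Omega> \<Longrightarrow> act \<gamma> w \<in> A \<longleftrightarrow> w \<in> A"
    and Rm: "\<And>x y. x \<in> V \<Longrightarrow> y \<in> V \<Longrightarrow> Measurable.pred \<Omega> (\<lambda>w. R w x y)"
    and Rinv: "\<And>\<gamma> w x y. \<gamma> \<in> \<Gamma> \<Longrightarrow> w \<in> space \<Omega> \<Longrightarrow> x \<in> V \<Longrightarrow> y \<in> V \<Longrightarrow> R (act \<gamma> w) (\<gamma> x) (\<gamma> y) \<longleftrightarrow> R w x y"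
    and Rrefl: "\<And>w x. w \<in> A \<Longrightarrow> x \<in> V \<Longrightarrow> R w x x"
    and Rsym: "\<And>w x y. w \<in> A \<Longrightarrow> x \<in> V \<Longrightarrow> y \<in> V \<Longrightarrow> R w x y \<Longrightarrow> R w y x"
    and Rtrans: "\<And>w x y z. w \<in> A \<Longrightarrow> x \<in> V \<Longrightarrow> y \<in> V \<Longrightarrow> z \<in> V \<Longrightarrow> R w x y \<Longrightarrow> R w y z \<Longrightarrow> R w x z"
    and Rfin: "\<And>w x. w \<in> A \<Longrightarrow> x \<in> V \<Longrightarrow> finite {y\<in>V. R w x y}"
    and gm: "\<And>x. x \<in> V \<Longrightarrow> g x \<in> borel_measurable \<Omega>"
    and ginv: "\<And>\<gamma> w x. \<gamma> \<in> \<Gamma> \<Longrightarrow> w \<in> space \<Omega> \<Longrightarrow> x \<in> V \<Longrightarrow> g (\<gamma> x) (act \<gamma> w) = g x w"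
    and x: "x \<in> V"
  shows "(\<integral>\<^sup>+w. indicator A w * g x w \<partial>\<Omega>) =
    (\<integral>\<^sup>+w. indicator A w * ((\<Sum>y\<in>{y\<in>V. R w x y}. g y w) / of_nat (card {y\<in>V. R w x y})) \<partial>\<Omega>)"
proof -
  \<comment> \<open>The cell size is written as an integral because then it is measurable and
    invariant on the whole space; it agrees with the cardinality on A.\<close>
  define N where "N x w = (\<integral>\<^sup>+z. (if R w x z then 1 else 0) \<partial>count_space V :: ennreal)" for x w
  have N: "N x w = of_nat (card {y\<in>V. R w x y})" if "w \<in> A" "x \<in> V" for x w
    unfolding N_def using Rfin[OF that]
    by (subst nn_integral_count_space'[of "{y\<in>V. R w x y}"]) auto
  have Nm: "N x \<in> borel_measurable \<Omega>" if "x \<in> V" for x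
    unfolding N_def[abs_def]
    by (rule borel_measurable_count_nn_integral[OF countable_V]) (use Rm that in \<open>auto intro!: measurable_If\<close>)
  have Ninv: "N (\<gamma> x) (act \<gamma> w) = N x w" if "\<gamma> \<in> \<Gamma>" "w \<in> space \<Omega>" "x \<in> V" for \<gamma> w x
    unfolding N_def using that
    by (subst nn_integral_bij_count_space[symmetric, OF bij[OF that(1)]])
       (auto intro!: nn_integral_cong simp: Rinv)
  have card_eq: "{y\<in>V. R w x y} = {y\<in>V. R w z y}" if "w \<in> A" "x \<in> V" "z \<in> V" "R w x z" for w x z
    using that Rsym Rtrans by blast
  have pos: "card {y\<in>V. R w x y} \<noteq> 0" if "w \<in> A" "x \<in> V" for w x
    using Rfin[OF that] Rrefl[OF that] that by auto
  define \<phi> where "\<phi> x z w = indicator A w * (if R w x z then g x w / N x w else 0)" for x z w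
  have "(\<integral>\<^sup>+w. \<integral>\<^sup>+y. \<phi> x y w \<partial>count_space V \<partial>\<Omega>) = (\<integral>\<^sup>+w. \<integral>\<^sup>+y. \<phi> y x w \<partial>count_space V \<partial>\<Omega>)"
  proof (rule mtp_expectation[OF _ _ x])
    fix x y assume xy: "x \<in> V" "y \<in> V"
    have [measurable]: "A \<in> sets \<Omega>" "g x \<in> borel_measurable \<Omega>" "N x \<in> borel_measurable \<Omega>"
      "Measurable.pred \<Omega> (\<lambda>w. R w x y)"
      using A gm Nm Rm xy by auto
    show "\<phi> x y \<in> borel_measurable \<Omega>"
      unfolding \<phi>_def[abs_def] by measurable
  next
    fix \<gamma> x y w assume g: "\<gamma> \<in> \<Gamma>" "x \<in> V" "y \<in> V" "w \<in> space \<Omega>"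
    then show "\<phi> (\<gamma> x) (\<gamma> y) (act \<gamma> w) = \<phi> x y w"
      by (simp add: \<phi>_def Rinv ginv Ninv Ainv indicator_def)
  qed
  moreover have "(\<integral>\<^sup>+y. \<phi> x y w \<partial>count_space V) = indicator A w * g x w" for w
  proof (cases "w \<in> A")
    case True
    let ?C = "{y\<in>V. R w x y}"
    have "(\<integral>\<^sup>+y. \<phi> x y w \<partial>count_space V) = (\<Sum>y\<in>?C. \<phi> x y w)"
      by (rule nn_integral_count_space') (auto simp: \<phi>_def Rfin[OF True x])
    also have "\<dots> = of_nat (card ?C) * (g x w / of_nat (card ?C))"
      using True x by (simp add: \<phi>_def N)
    also have "\<dots> = g x w"
      using pos[OF True x] by (simp add: ennreal_times_divide ennreal_mult_divide_eq mult.commute)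
    finally show ?thesis using True by simp
  qed (simp add: \<phi>_def)
  moreover have "(\<integral>\<^sup>+y. \<phi> y x w \<partial>count_space V) =
      indicator A w * ((\<Sum>y\<in>{y\<in>V. R w x y}. g y w) / of_nat (card {y\<in>V. R w x y}))" for w
  proof (cases "w \<in> A")
    case True
    let ?C = "{y\<in>V. R w x y}"
    have "(\<integral>\<^sup>+y. \<phi> y x w \<partial>count_space V) = (\<Sum>y\<in>?C. \<phi> y x w)"
      by (rule nn_integral_count_space') (use Rsym[OF True _ x] in \<open>auto simp: \<phi>_def Rfin[OF True x]\<close>)
    also have "\<dots> = (\<Sum>y\<in>?C. g y w / of_nat (card ?C))"
    proof (rule sum.cong[OF refl])
      fix y assume y: "y \<in> ?C"
      then have "R w y x" "{z\<in>V. R w y z} = ?C" using Rsym[OF True x] card_eq[OF True x] by auto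
      then show "\<phi> y x w = g y w / of_nat (card ?C)" using True y by (simp add: \<phi>_def N)
    qed
    also have "\<dots> = (\<Sum>y\<in>?C. g y w) / of_nat (card ?C)"
      by (simp add: divide_ennreal_def sum_distrib_right)
    finally show ?thesis using True by simp
  qed (simp add: \<phi>_def)
  ultimately show ?thesis by simp
qed

text \<open>An inequality between sums over finite cells becomes one between expectations at a
  single vertex. It is applied to isoperimetry in percolation cells and to the count of infinite
  branches.\<close>

lemma cell_average:
  assumes A: "A \<in> sets \<Omega>" and Ainv: "\<And>\<gamma> w. \<gamma> \<in> \<Gamma> \<Longrightarrow> w \<in> space \<Omega> \<Longrightarrow> act \<gamma> w \<in> A \<longleftrightarrow> w \<in> A"
    and Rm: "\<And>x y. x \<in> V \<Longrightarrow> y \<in> V \<Longrightarrow> Measurable.pred \<Omega> (\<lambda>w. R w x y)"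
    and Rinv: "\<And>\<gamma> w x y. \<gamma> \<in> \<Gamma> \<Longrightarrow> w \<in> space \<Omega> \<Longrightarrow> x \<in> V \<Longrightarrow> y \<in> V \<Longrightarrow> R (act \<gamma> w) (\<gamma> x) (\<gamma> y) \<longleftrightarrow> R w x y"
    and Rrefl: "\<And>w x. w \<in> A \<Longrightarrow> x \<in> V \<Longrightarrow> R w x x"
    and Rsym: "\<And>w x y. w \<in> A \<Longrightarrow> x \<in> V \<Longrightarrow> y \<in> V \<Longrightarrow> R w x y \<Longrightarrow> R w y x"
    and Rtrans: "\<And>w x y z. w \<in> A \<Longrightarrow> x \<in> V \<Longrightarrow> y \<in> V \<Longrightarrow> z \<in> V \<Longrightarrow> R w x y \<Longrightarrow> R w y z \<Longrightarrow> R w x z"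
    and Rfin: "\<And>w x. w \<in> A \<Longrightarrow> x \<in> V \<Longrightarrow> finite {y\<in>V. R w x y}"
    and gm: "\<And>x. x \<in> V \<Longrightarrow> g x \<in> borel_measurable \<Omega>"
    and ginv: "\<And>\<gamma> w x. \<gamma> \<in> \<Gamma> \<Longrightarrow> w \<in> space \<Omega> \<Longrightarrow> x \<in> V \<Longrightarrow> g (\<gamma> x) (act \<gamma> w) = g x w"
    and hm: "\<And>x. x \<in> V \<Longrightarrow> h x \<in> borel_measurable \<Omega>"
    and hinv: "\<And>\<gamma> w x. \<gamma> \<in> \<Gamma> \<Longrightarrow> w \<in> space \<Omega> \<Longrightarrow> x \<in> V \<Longrightarrow> h (\<gamma> x) (act \<gamma> w) = h x w"
    and le: "\<And>w x. w \<in> A \<Longrightarrow> x \<in> V \<Longrightarrow> (\<Sum>y\<in>{y\<in>V. R w x y}. g y w) \<le> (\<Sum>y\<in>{y\<in>V. R w x y}. h y w)"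
    and x: "x \<in> V"
  shows "(\<integral>\<^sup>+w. indicator A w * g x w \<partial>\<Omega>) \<le> (\<integral>\<^sup>+w. indicator A w * (h x w :: ennreal) \<partial>\<Omega>)"
proof -
  have "(\<integral>\<^sup>+w. indicator A w * g x w \<partial>\<Omega>) = (\<integral>\<^sup>+w. indicator A w *
      ((\<Sum>y\<in>{y\<in>V. R w x y}. g y w) / of_nat (card {y\<in>V. R w x y})) \<partial>\<Omega>)"
    by (rule cell_average_identity; fact)
  also have "\<dots> \<le> (\<integral>\<^sup>+w. indicator A w *
      ((\<Sum>y\<in>{y\<in>V. R w x y}. h y w) / of_nat (card {y\<in>V. R w x y})) \<partial>\<Omega>)"
    by (intro nn_integral_mono) (auto simp: indicator_def intro!: divide_right_mono_ennreal le x)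
  also have "\<dots> = (\<integral>\<^sup>+w. indicator A w * h x w \<partial>\<Omega>)"
    by (rule cell_average_identity[symmetric]; fact)
  finally show ?thesis .
qed

end

section \<open>Random subgraphs\<close>

lemma space_cylinder_space [simp]: "space (cylinder_space I) = Pow I"
  unfolding cylinder_space_def by (rule space_measure_of) auto

lemma pred_cylinder_space: "Measurable.pred (cylinder_space I) (\<lambda>A. i \<in> A)"
proof (cases "i \<in> I")
  case True
  then have "{A \<in> Pow I. i \<in> A} \<in> sets (cylinder_space I)"
    unfolding cylinder_space_def by (intro in_measure_of) auto
  then show ?thesis unfolding pred_def by simp
next
  case False
  have "Measurable.pred (cylinder_space I) (\<lambda>A. False)" by simp
  then show ?thesis by (rule measurable_cong[THEN iffD2, rotated]) (use False in auto)
qed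

lemma measurable_cylinder_space:
  assumes "\<And>w. w \<in> space M \<Longrightarrow> f w \<subseteq> I" "\<And>i. i \<in> I \<Longrightarrow> Measurable.pred M (\<lambda>w. i \<in> f w)"
  shows "f \<in> measurable M (cylinder_space I)"
  unfolding cylinder_space_def
proof (rule measurable_measure_of)
  fix y assume "y \<in> {{A \<in> Pow I. i \<in> A} | i. i \<in> I}"
  then obtain i where i: "i \<in> I" "y = {A \<in> Pow I. i \<in> A}" by auto
  have "f -` y \<inter> space M = {w \<in> space M. i \<in> f w}" using assms(1) i by auto
  then show "f -` y \<inter> space M \<in> sets M" using assms(2)[OF i(1)] by (simp add: pred_def)
qed (use assms in auto)

lemma pred_real:
  fixes f g :: "'w \<Rightarrow> real"
  assumes [measurable]: "f \<in> borel_measurable M" "g \<in> borel_measurable M"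
  shows pred_real_le: "Measurable.pred M (\<lambda>w. f w \<le> g w)"
    and pred_real_less: "Measurable.pred M (\<lambda>w. f w < g w)"
    and pred_real_eq: "Measurable.pred M (\<lambda>w. f w = g w)"
  by measurable

section \<open>Graphs with symmetries: edges, balls and boundaries\<close>

locale graph_symmetry = permutation_action V \<Gamma> for V :: "'a set" and \<Gamma> +
  fixes X :: "'a ugraph"
  assumes verts_X: "verts X = V"
    and simple_X: "simple_graph X"
    and lf_X: "locally_finite_graph X"
    and conn_X: "connected_graph X"
    and aut_X: "\<gamma> \<in> \<Gamma> \<Longrightarrow> x \<in> V \<Longrightarrow> y \<in> V \<Longrightarrow> {\<gamma> x, \<gamma> y} \<in> edges X \<longleftrightarrow> {x, y} \<in> edges X"
begin

abbreviation "E \<equiv> edges X"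

lemma E_edge: "e \<in> E \<Longrightarrow> e \<subseteq> V \<and> card e = 2 \<and> finite e"
  using simple_X verts_X unfolding simple_graph_def
  by (metis card.infinite zero_neq_numeral)

lemma E_obtain:
  assumes "e \<in> E" obtains x y where "x \<in> V" "y \<in> V" "x \<noteq> y" "e = {x, y}"
  using E_edge[OF assms] by (metis card_2_iff insert_subset)

lemma E_V [dest]: "{x, y} \<in> E \<Longrightarrow> x \<in> V \<and> y \<in> V \<and> x \<noteq> y"
  using E_edge[of "{x, y}"] by (auto simp: card_insert_if split: if_splits)

lemma E_sub: "\<Union>E \<subseteq> V"
  using E_edge by auto

lemma countable_E [simp]: "countable E"
proof (rule countable_subset)
  show "E \<subseteq> {A. finite A \<and> A \<subseteq> V}" using E_edge by auto
qed (rule countable_Collect_finite_subset[OF countable_V])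

lemma E_image:
  assumes "\<gamma> \<in> \<Gamma>" "e \<subseteq> V" shows "\<gamma> ` e \<in> E \<longleftrightarrow> e \<in> E"
proof
  assume "e \<in> E"
  then obtain x y where "x \<in> V" "y \<in> V" "e = {x, y}" by (metis E_obtain)
  with \<open>e \<in> E\<close> show "\<gamma> ` e \<in> E" using aut_X[OF assms(1)] by simp
next
  assume g: "\<gamma> ` e \<in> E"
  then have "card e = 2" using E_edge card_image[OF inj_on_subset[OF inj_V]] assms by metis
  then obtain x y where "e = {x, y}" by (metis card_2_iff)
  with g show "e \<in> E" using aut_X[OF assms(1), of x y] assms by simp
qed

lemma E_preimage:
  assumes "\<gamma> \<in> \<Gamma>" "e \<in> E" obtains e' where "e' \<in> E" "e = \<gamma> ` e'"
proof -
  have "e \<subseteq> V" using E_edge[OF assms(2)] by auto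
  then obtain e' where "e' \<subseteq> V" "e = \<gamma> ` e'" using image_V[OF assms(1)] by (metis subset_imageE)
  then show thesis using E_image[OF assms(1)] assms that by blast
qed

lemma finite_nbrs: "x \<in> V \<Longrightarrow> finite {y\<in>V. {x, y} \<in> E}"
  using lf_X verts_X by (auto simp: locally_finite_graph_def neighbours_def adjacent_def)

lemma conn_E: "x \<in> V \<Longrightarrow> y \<in> V \<Longrightarrow> conn E x y"
proof -
  have "{e \<in> E. e \<subseteq> verts X} = E" using E_edge verts_X by auto
  then show "x \<in> V \<Longrightarrow> y \<in> V \<Longrightarrow> conn E x y"
    using conn_X verts_X unfolding connected_graph_conn by auto
qed

text \<open>The ball of radius n in the graph distance (\<open>graph_dist_le\<close>). The recursion
  makes finiteness and equivariance plain inductions.\<close>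

primrec gball :: "'a \<Rightarrow> nat \<Rightarrow> 'a set" where
  "gball x 0 = {x}"
| "gball x (Suc n) = gball x n \<union> {z\<in>V. \<exists>y\<in>gball x n. {y, z} \<in> E}"

lemma gball_sub: "x \<in> V \<Longrightarrow> gball x n \<subseteq> V"
  by (induction n) auto

lemma gball_finite: "x \<in> V \<Longrightarrow> finite (gball x n)"
proof (induction n)
  case (Suc n)
  have "{z\<in>V. \<exists>y\<in>gball x n. {y, z} \<in> E} = (\<Union>y\<in>gball x n. {z\<in>V. {y, z} \<in> E})" by auto
  moreover have "finite (\<Union>y\<in>gball x n. {z\<in>V. {y, z} \<in> E})"
    using Suc gball_sub[OF Suc.prems, of n] by (intro finite_UN_I finite_nbrs) auto
  ultimately show ?case using Suc by simp
qed auto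

lemma gball_mono: "m \<le> n \<Longrightarrow> gball x m \<subseteq> gball x n"
  by (rule lift_Suc_mono_le[of "gball x"]) auto

lemma gball_covers: "x \<in> V \<Longrightarrow> y \<in> V \<Longrightarrow> \<exists>n. y \<in> gball x n"
proof -
  assume "x \<in> V" "y \<in> V"
  then have "conn E x y" by (rule conn_E)
  then show ?thesis
  proof (induction rule: conn_induct)
    case refl
    show ?case by (rule exI[of _ 0]) auto
  next
    case (step y z)
    then obtain n where "y \<in> gball x n" by auto
    then have "z \<in> gball x (Suc n)" using step(2) by auto
    then show ?case ..
  qed
qed

lemma gball_image:
  assumes "\<gamma> \<in> \<Gamma>" "x \<in> V" shows "gball (\<gamma> x) n = \<gamma> ` gball x n"
proof (induction n)
  case (Suc n)
  have "{z\<in>V. \<exists>y\<in>gball (\<gamma> x) n. {y, z} \<in> E} = \<gamma> ` {z\<in>V. \<exists>y\<in>gball x n. {y, z} \<in> E}"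
  proof (subst Collect_V[OF assms(1)], rule arg_cong[where f = "(`) \<gamma>"], rule Collect_cong, rule conj_cong[OF refl])
    fix z assume z: "z \<in> V"
    show "(\<exists>y\<in>gball (\<gamma> x) n. {y, \<gamma> z} \<in> E) \<longleftrightarrow> (\<exists>y\<in>gball x n. {y, z} \<in> E)"
      using Suc gball_sub[OF assms(2), of n] aut_X[OF assms(1) _ z] by auto
  qed
  then show ?case using Suc by (simp add: image_Un)
qed auto

lemma gball_mem: "\<gamma> \<in> \<Gamma> \<Longrightarrow> x \<in> V \<Longrightarrow> y \<in> V \<Longrightarrow> \<gamma> y \<in> gball (\<gamma> x) n \<longleftrightarrow> y \<in> gball x n"
  by (simp add: gball_image image_mem_V gball_sub)

text \<open>In terms of path lengths the symmetry of the relation between centre and point becomes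
  visible.\<close>

lemma gball_relpow: "z \<in> gball x n \<longleftrightarrow> (\<exists>k\<le>n. (x, z) \<in> {(a, b). {a, b} \<in> E} ^^ k)"
proof (induction n arbitrary: z)
  case (Suc n)
  define R where "R = {(a, b). {a, b} \<in> E}"
  note IH = Suc[folded R_def]
  have "z \<in> gball x (Suc n) \<longleftrightarrow> z \<in> gball x n \<or> (\<exists>y\<in>gball x n. (y, z) \<in> R)"
    by (auto simp: R_def)
  also have "(\<exists>y\<in>gball x n. (y, z) \<in> R) \<longleftrightarrow> (\<exists>k\<le>n. (x, z) \<in> R ^^ Suc k)"
    unfolding Bex_def IH relpow.simps by blast
  also have "z \<in> gball x n \<or> (\<exists>k\<le>n. (x, z) \<in> R ^^ Suc k) \<longleftrightarrow> (\<exists>k\<le>Suc n. (x, z) \<in> R ^^ k)"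
    unfolding IH by (metis Suc_le_mono le_Suc_eq)
  finally show ?case unfolding R_def .
qed auto

lemma gball_sym:
  assumes "y \<in> gball x n" shows "x \<in> gball y n"
proof -
  have "(x, z) \<in> {(a, b). {a, b} \<in> E} ^^ k \<Longrightarrow> (z, x) \<in> {(a, b). {a, b} \<in> E} ^^ k" for z k
  proof (induction k arbitrary: z)
    case (Suc k)
    then obtain y where "(x, y) \<in> {(a, b). {a, b} \<in> E} ^^ k" "{y, z} \<in> E" by auto
    then show ?case using Suc.IH by (intro relpow_Suc_I2[of _ y]) (auto simp: insert_commute)
  qed auto
  then show ?thesis using assms unfolding gball_relpow by blast
qed

lemma act_edges_measurable:
  assumes "\<gamma> \<in> \<Gamma>" shows "act_edges \<gamma> \<in> measurable (cylinder_space E) (cylinder_space E)"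
proof (rule measurable_cylinder_space)
  fix F assume "F \<in> space (cylinder_space E)"
  then show "act_edges \<gamma> F \<subseteq> E" using E_image[OF assms] E_edge by (auto simp: act_edges_def)
next
  fix e assume "e \<in> E"
  then obtain e' where e': "e' \<in> E" "e = \<gamma> ` e'" using E_preimage[OF assms] by metis
  have "Measurable.pred (cylinder_space E) (\<lambda>F. e' \<in> F)" by (rule pred_cylinder_space)
  then show "Measurable.pred (cylinder_space E) (\<lambda>F. e \<in> act_edges \<gamma> F)"
  proof (rule measurable_cong[THEN iffD2, rotated])
    fix F assume "F \<in> space (cylinder_space E)"
    then have "F \<subseteq> E" by simp
    show "e \<in> act_edges \<gamma> F \<longleftrightarrow> e' \<in> F"
    proof
      assume "e \<in> act_edges \<gamma> F"
      then obtain f where f: "f \<in> F" "\<gamma> ` e' = \<gamma> ` f" by (auto simp: act_edges_def e')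
      then have "e' = f" using image_eq_V[OF assms] E_edge e' \<open>F \<subseteq> E\<close> by blast
      then show "e' \<in> F" using f by simp
    qed (auto simp: act_edges_def e')
  qed
qed

lemma act_verts_measurable:
  assumes "\<gamma> \<in> \<Gamma>" shows "(`) \<gamma> \<in> measurable (cylinder_space V) (cylinder_space V)"
proof (rule measurable_cylinder_space)
  fix F assume "F \<in> space (cylinder_space V)"
  then show "\<gamma> ` F \<subseteq> V" using assms by auto
next
  fix e assume "e \<in> V"
  then obtain e' where e': "e' \<in> V" "e = \<gamma> e'" using image_V[OF assms] by blast
  have "Measurable.pred (cylinder_space V) (\<lambda>F. e' \<in> F)" by (rule pred_cylinder_space)
  then show "Measurable.pred (cylinder_space V) (\<lambda>F. e \<in> \<gamma> ` F)"
    by (rule measurable_cong[THEN iffD2, rotated]) (simp add: e' image_mem_V[OF assms])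
qed

lemma act_graph_measurable:
  assumes "\<gamma> \<in> \<Gamma>"
  shows "act_graph \<gamma> \<in> measurable (cylinder_space V \<Otimes>\<^sub>M cylinder_space E) (cylinder_space V \<Otimes>\<^sub>M cylinder_space E)"
  unfolding act_graph_def[abs_def]
  using act_edges_measurable[OF assms] act_verts_measurable[OF assms] by measurable

definition boundary :: "'a set \<Rightarrow> 'a set set" where
  "boundary F = {e \<in> E. card (e \<inter> F) = 1}"

lemma boundary_iff:
  assumes "x \<noteq> y" shows "{x, y} \<in> boundary F \<longleftrightarrow> {x, y} \<in> E \<and> (x \<in> F \<longleftrightarrow> y \<notin> F)"
  using assms by (auto simp: boundary_def Int_insert_left)

lemma boundary_obtain:
  assumes "e \<in> boundary F" obtains x y where "e = {x, y}" "x \<in> F" "y \<in> V" "y \<notin> F" "{x, y} \<in> E"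
proof -
  have "e \<in> E" using assms by (simp add: boundary_def)
  then obtain x y where "x \<in> V" "y \<in> V" "x \<noteq> y" "e = {x, y}" by (metis E_obtain)
  then show thesis using assms that[of x y] that[of y x] boundary_iff[of x y F]
    by (auto simp: insert_commute)
qed

lemma card_boundary_le:
  assumes "finite C" "C \<subseteq> V"
  shows "card (boundary C) \<le> (\<Sum>x\<in>C. card {y\<in>V. {x, y} \<in> E \<and> y \<notin> C})" "finite (boundary C)"
proof -
  let ?S = "SIGMA x:C. {y\<in>V. {x, y} \<in> E \<and> y \<notin> C}"
  have fin: "finite {y\<in>V. {x, y} \<in> E \<and> y \<notin> C}" if "x \<in> C" for x
    by (rule finite_subset[OF _ finite_nbrs[of x]]) (use that assms in auto)
  then have S: "finite ?S" using assms by auto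
  have sub: "boundary C \<subseteq> (\<lambda>(x, y). {x, y}) ` ?S"
  proof
    fix e assume "e \<in> boundary C"
    then obtain x y where "e = {x, y}" "x \<in> C" "y \<in> V" "y \<notin> C" "{x, y} \<in> E" by (rule boundary_obtain)
    then show "e \<in> (\<lambda>(x, y). {x, y}) ` ?S" by (intro image_eqI[of _ _ "(x, y)"]) auto
  qed
  then show "finite (boundary C)" using S by (meson finite_imageI finite_subset)
  have "card (boundary C) \<le> card ((\<lambda>(x, y). {x, y}) ` ?S)" by (rule card_mono[OF finite_imageI[OF S] sub])
  also have "\<dots> \<le> card ?S" by (rule card_image_le[OF S])
  also have "card ?S = (\<Sum>x\<in>C. card {y\<in>V. {x, y} \<in> E \<and> y \<notin> C})" using fin assms by (intro card_SigmaI) auto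
  finally show "card (boundary C) \<le> (\<Sum>x\<in>C. card {y\<in>V. {x, y} \<in> E \<and> y \<notin> C})" .
qed

lemma not_amenable_obtain:
  assumes "\<not> amenable_graph X"
  obtains \<epsilon> :: real where "\<epsilon> > 0" "\<And>F. finite F \<Longrightarrow> F \<subseteq> V \<Longrightarrow> \<epsilon> * card F \<le> card (boundary F)"
proof -
  obtain \<epsilon> :: real where e: "\<epsilon> > 0" "\<forall>F. finite F \<and> F \<noteq> {} \<and> F \<subseteq> V \<longrightarrow> \<not> (card (boundary F) \<le> \<epsilon> * card F)"
    using assms unfolding amenable_graph_def verts_X boundary_def by auto
  then have "\<epsilon> * card F \<le> card (boundary F)" if "finite F" "F \<subseteq> V" for F
    using that by (cases "F = {}") force+
  with e(1) show thesis by (rule that)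
qed

end

text \<open>Mass transport concerns V and \<Gamma> alone, so it passes unchanged from a graph to its
  powers.\<close>

locale graph_action = graph_symmetry V \<Gamma> X + mass_transport V \<Gamma> for V :: "'a set" and \<Gamma> X

section \<open>Finite cells from percolation on a random connected subgraph\<close>

locale random_subgraph = graph_action V \<Gamma> X for V :: "'a set" and \<Gamma> X +
  fixes M :: "'a ugraph measure"
  assumes irs: "invariant_random_subgraph \<Gamma> X (\<lambda>\<omega>. verts \<omega> \<noteq> {} \<and> connected_graph \<omega>) M"
begin

lemma prob_M: "prob_space M" and sets_M [measurable_cong]: "sets M = sets (cylinder_space V \<Otimes>\<^sub>M cylinder_space E)"
  and distr_M: "\<gamma> \<in> \<Gamma> \<Longrightarrow> distr M M (act_graph \<gamma>) = M"
  and AE_M: "AE Y in M. subgraph_of Y X \<and> verts Y \<noteq> {} \<and> connected_graph Y"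
  using irs verts_X by (auto simp: invariant_random_subgraph_def)

lemma space_M: "space M = Pow V \<times> Pow E"
  using sets_eq_imp_space_eq[OF sets_M] by (simp add: space_pair_measure)

text \<open>The labels are independent of the subgraph. Those with index 0 drive the percolation,
  those with index 1 break ties between nearest points.\<close>

definition "\<Omega> = M \<Otimes>\<^sub>M labels J"

definition act :: "('a \<Rightarrow> 'a) \<Rightarrow> 'a ugraph \<times> (nat \<times> 'a set \<Rightarrow> real) \<Rightarrow> 'a ugraph \<times> (nat \<times> 'a set \<Rightarrow> real)" where
  "act \<gamma> w = (act_graph \<gamma> (fst w), act_labels \<gamma> (snd w))"

sublocale pair_prob_space M "labels J"
proof -
  interpret a: prob_space M by (rule prob_M)
  interpret b: prob_space "labels J" by (rule prob_space_labels)
  show "pair_prob_space M (labels J)" by unfold_locales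
qed

lemma process: "invariant_process V \<Gamma> \<Omega> act"
  unfolding \<Omega>_def
proof (intro invariant_process.intro invariant_process_axioms.intro mass_transport_axioms P.prob_space_axioms)
  fix \<gamma> assume g: "\<gamma> \<in> \<Gamma>"
  have m: "act_graph \<gamma> \<in> measurable M M"
    using act_graph_measurable[OF g] by measurable
  note l = act_labels_measure[OF g]
  have e: "act \<gamma> = (\<lambda>(x, y). (act_graph \<gamma> x, act_labels \<gamma> y))" by (auto simp: act_def)
  show "act \<gamma> \<in> measurable (M \<Otimes>\<^sub>M labels J) (M \<Otimes>\<^sub>M labels J)"
    unfolding e using m l by measurable
  have "distr M M (act_graph \<gamma>) \<Otimes>\<^sub>M distr (labels J) (labels J) (act_labels \<gamma>) =
    distr (M \<Otimes>\<^sub>M labels J) (M \<Otimes>\<^sub>M labels J) (\<lambda>(x, y). (act_graph \<gamma> x, act_labels \<gamma> y))"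
    by (rule pair_measure_distr[OF m l(1)]) (simp add: l M2.sigma_finite_measure_axioms)
  then show "distr (M \<Otimes>\<^sub>M labels J) (M \<Otimes>\<^sub>M labels J) (act \<gamma>) = M \<Otimes>\<^sub>M labels J"
    by (simp add: e l distr_M g)
qed

sublocale process: invariant_process V \<Gamma> \<Omega> act
  by (rule process)

lemma space_\<Omega>: "w \<in> space \<Omega> \<Longrightarrow> verts (fst w) \<subseteq> V \<and> edges (fst w) \<subseteq> E"
  by (auto simp: \<Omega>_def space_pair_measure space_M)

lemma in_verts_measurable [measurable]: "Measurable.pred \<Omega> (\<lambda>w. x \<in> verts (fst w))"
  unfolding \<Omega>_def by (rule measurable_compose[OF _ pred_cylinder_space]) measurable

lemma in_edges_measurable [measurable]: "Measurable.pred \<Omega> (\<lambda>w. e \<in> edges (fst w))"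
  unfolding \<Omega>_def by (rule measurable_compose[OF _ pred_cylinder_space]) measurable

lemma label_measurable [measurable]:
  "finite A \<Longrightarrow> A \<subseteq> V \<Longrightarrow> (\<lambda>w. snd w (n, A)) \<in> borel_measurable \<Omega>"
  unfolding \<Omega>_def using measurable_compose[OF measurable_snd measurable_label] by blast

text \<open>\<open>near w x v\<close> says that \<open>v\<close> is the point of the random subgraph closest to \<open>x\<close>, where ties are
  broken by the labels of the vertices.\<close>

definition near :: "'a ugraph \<times> (nat \<times> 'a set \<Rightarrow> real) \<Rightarrow> 'a \<Rightarrow> 'a \<Rightarrow> bool" where
  "near w x v \<longleftrightarrow> v \<in> verts (fst w) \<and> (\<exists>n. v \<in> gball x n \<and>
     (\<forall>u\<in>V. u \<in> verts (fst w) \<longrightarrow> (\<forall>m<n. u \<notin> gball x m) \<and> (u \<in> gball x n \<longrightarrow> snd w (1, {v}) \<le> snd w (1, {u}))))"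

definition perc :: "nat \<Rightarrow> 'a ugraph \<times> (nat \<times> 'a set \<Rightarrow> real) \<Rightarrow> 'a set set" where
  "perc k w = {e \<in> edges (fst w). e \<subseteq> verts (fst w) \<and> snd w (0, e) < 1 - 1 / (real k + 1)}"

text \<open>Voronoi cells of the random subgraph, merged along the percolation clusters. A class is
  finite once clusters and Voronoi cells are.\<close>

definition cell :: "nat \<Rightarrow> 'a ugraph \<times> (nat \<times> 'a set \<Rightarrow> real) \<Rightarrow> 'a \<Rightarrow> 'a \<Rightarrow> bool" where
  "cell k w x y \<longleftrightarrow> (\<exists>v\<in>V. \<exists>u\<in>V. near w x v \<and> near w y u \<and> conn (perc k w) v u)"

text \<open>The requirements on a sample, written with countable quantifiers so that measurability
  and invariance can be read off. Labels below one ensure that every edge is open at some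
  level.\<close>

definition good :: "'a ugraph \<times> (nat \<times> 'a set \<Rightarrow> real) \<Rightarrow> bool" where
  "good w \<longleftrightarrow> (\<exists>x\<in>V. x \<in> verts (fst w)) \<and>
     (\<forall>x\<in>V. \<forall>y\<in>V. x \<in> verts (fst w) \<longrightarrow> y \<in> verts (fst w) \<longrightarrow>
        conn {e \<in> edges (fst w). e \<subseteq> verts (fst w)} x y) \<and>
     (\<forall>k. \<not> infcomp (fst w) (\<lambda>e. snd w (0, e) < 1 - 1 / (real k + 1))) \<and>
     (\<forall>x\<in>V. \<forall>y\<in>V. x \<noteq> y \<longrightarrow> snd w (1, {x}) \<noteq> snd w (1, {y})) \<and>
     (\<forall>x\<in>V. \<forall>y\<in>V. snd w (0, {x, y}) < 1)"

lemma goodD: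
  assumes "good w"
  shows "\<exists>x\<in>V. x \<in> verts (fst w)"
    "\<And>x y. x \<in> V \<Longrightarrow> y \<in> V \<Longrightarrow> x \<in> verts (fst w) \<Longrightarrow> y \<in> verts (fst w) \<Longrightarrow>
        conn {e \<in> edges (fst w). e \<subseteq> verts (fst w)} x y"
    "\<And>k. \<not> infcomp (fst w) (\<lambda>e. snd w (0, e) < 1 - 1 / (real k + 1))"
    "\<And>x y. x \<in> V \<Longrightarrow> y \<in> V \<Longrightarrow> snd w (1, {x}) = snd w (1, {y}) \<Longrightarrow> x = y"
    "\<And>x y. x \<in> V \<Longrightarrow> y \<in> V \<Longrightarrow> snd w (0, {x, y}) < 1"
  using assms unfolding good_def by simp_all metis

lemma perc_mono:
  assumes "k \<le> l"
  shows "perc k w \<subseteq> perc l w"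
proof -
  have "1 - 1 / (real k + 1) \<le> 1 - 1 / (real l + 1)" using assms by (simp add: frac_le)
  then show ?thesis unfolding perc_def by auto
qed

lemma perc_sub: "w \<in> space \<Omega> \<Longrightarrow> \<Union>(perc k w) \<subseteq> V"
  using space_\<Omega>[of w] by (auto simp: perc_def)

lemma near_measurable: "x \<in> V \<Longrightarrow> v \<in> V \<Longrightarrow> Measurable.pred \<Omega> (\<lambda>w. near w x v)"
  unfolding near_def
  by (intro pred_intros_logic pred_intros_countable measurable_pred_countable pred_intros_imp' pred_intros_conj1'
      pred_real_le label_measurable in_verts_measurable countable_V) auto

lemma perc_measurable: "x \<in> V \<Longrightarrow> y \<in> V \<Longrightarrow> Measurable.pred \<Omega> (\<lambda>w. {x, y} \<in> perc k w)"
  unfolding perc_def mem_Collect_eq insert_subset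
  by (intro pred_intros_logic pred_real_less label_measurable in_verts_measurable in_edges_measurable
       borel_measurable_const) auto

lemma cell_measurable: "x \<in> V \<Longrightarrow> y \<in> V \<Longrightarrow> Measurable.pred \<Omega> (\<lambda>w. cell k w x y)"
  unfolding cell_def
  by (intro pred_intros_logic measurable_pred_countable near_measurable measurable_conn[OF countable_V]
       perc_measurable countable_V) (auto dest: perc_sub)

lemma good_measurable: "Measurable.pred \<Omega> good"
proof -
  have "Measurable.pred \<Omega> (\<lambda>w. infcomp (fst w) (\<lambda>e. snd w (0, e) < 1 - 1 / (real k + 1)))" for k
    by (rule measurable_infcomp[OF countable_V])
      (auto intro!: in_verts_measurable in_edges_measurable pred_intros_logic label_measurable
        pred_real_less dest: space_\<Omega>)
  moreover have "Measurable.pred \<Omega> (\<lambda>w. conn {e \<in> edges (fst w). e \<subseteq> verts (fst w)} x y)" if "x \<in> V" "y \<in> V" for x y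
    by (rule measurable_conn[OF countable_V _ _ that])
      (auto intro!: in_verts_measurable in_edges_measurable pred_intros_logic dest: space_\<Omega>)
  ultimately show ?thesis
    unfolding good_def[abs_def]
    by (intro pred_intros_logic pred_intros_countable measurable_pred_countable pred_intros_imp'
       pred_real_less pred_real_eq label_measurable in_verts_measurable countable_V
       borel_measurable_const) auto
qed

lemma act_simps:
  assumes "\<gamma> \<in> \<Gamma>" "w \<in> space \<Omega>"
  shows "x \<in> V \<Longrightarrow> \<gamma> x \<in> verts (fst (act \<gamma> w)) \<longleftrightarrow> x \<in> verts (fst w)"
    "e \<subseteq> V \<Longrightarrow> \<gamma> ` e \<in> edges (fst (act \<gamma> w)) \<longleftrightarrow> e \<in> edges (fst w)"
    "finite e \<Longrightarrow> e \<subseteq> V \<Longrightarrow> snd (act \<gamma> w) (n, \<gamma> ` e) = snd w (n, e)"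
    "fst (act \<gamma> w) = (\<gamma> ` verts (fst w), (`) \<gamma> ` edges (fst w))"
proof -
  show *: "fst (act \<gamma> w) = (\<gamma> ` verts (fst w), (`) \<gamma> ` edges (fst w))"
    by (simp add: act_def act_graph_def act_edges_def)
  show "x \<in> V \<Longrightarrow> \<gamma> x \<in> verts (fst (act \<gamma> w)) \<longleftrightarrow> x \<in> verts (fst w)"
    using space_\<Omega>[OF assms(2)] by (simp add: * image_mem_V[OF assms(1)])
  show "e \<subseteq> V \<Longrightarrow> \<gamma> ` e \<in> edges (fst (act \<gamma> w)) \<longleftrightarrow> e \<in> edges (fst w)"
    using space_\<Omega>[OF assms(2)] E_edge image_eq_V[OF assms(1)] by (auto simp: * image_iff)
  show "finite e \<Longrightarrow> e \<subseteq> V \<Longrightarrow> snd (act \<gamma> w) (n, \<gamma> ` e) = snd w (n, e)"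
    by (simp add: act_def act_labels_image[OF assms(1)])
qed

lemma act_near:
  assumes "\<gamma> \<in> \<Gamma>" "w \<in> space \<Omega>" "x \<in> V" "v \<in> V"
  shows "near (act \<gamma> w) (\<gamma> x) (\<gamma> v) \<longleftrightarrow> near w x v"
  unfolding near_def
  by (subst ball_V[OF assms(1)])
    (use assms act_simps(1)[OF assms(1,2)] act_simps(3)[OF assms(1,2), of "{_}"] in
     \<open>simp add: gball_mem cong: ball_cong\<close>)

lemma act_edge_set:
  assumes "\<gamma> \<in> \<Gamma>" "w \<in> space \<Omega>" "\<And>e. e \<in> edges (fst w) \<Longrightarrow> Q (\<gamma> ` e) \<longleftrightarrow> Q' e"
  shows "{e \<in> edges (fst (act \<gamma> w)). e \<subseteq> verts (fst (act \<gamma> w)) \<and> Q e} =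
    (`) \<gamma> ` {e \<in> edges (fst w). e \<subseteq> verts (fst w) \<and> Q' e}"
proof -
  have "\<gamma> ` e \<subseteq> \<gamma> ` verts (fst w) \<longleftrightarrow> e \<subseteq> verts (fst w)" if "e \<in> edges (fst w)" for e
  proof (rule inj_on_image_subset_iff[OF inj_V[OF assms(1)]])
    show "e \<subseteq> V" using that space_\<Omega>[OF assms(2)] E_edge by auto
    show "verts (fst w) \<subseteq> V" using space_\<Omega>[OF assms(2)] by simp
  qed
  then show ?thesis
    using assms(3) by (auto simp: act_simps(4)[OF assms(1,2)])
qed

lemma act_perc:
  assumes "\<gamma> \<in> \<Gamma>" "w \<in> space \<Omega>"
  shows "perc k (act \<gamma> w) = (`) \<gamma> ` perc k w"
  unfolding perc_def
  by (rule act_edge_set[OF assms]) (use act_simps(3)[OF assms] E_edge space_\<Omega>[OF assms(2)] in auto)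

lemma act_cell:
  assumes "\<gamma> \<in> \<Gamma>" "w \<in> space \<Omega>" "x \<in> V" "y \<in> V"
  shows "cell k (act \<gamma> w) (\<gamma> x) (\<gamma> y) \<longleftrightarrow> cell k w x y"
  unfolding cell_def
  by (subst bex_V[OF assms(1)], subst (2) bex_V[OF assms(1)])
    (simp add: act_near assms act_perc conn_V perc_sub cong: bex_cong)

lemma act_infcomp:
  assumes "\<gamma> \<in> \<Gamma>" "w \<in> space \<Omega>" "\<And>e. e \<in> edges (fst w) \<Longrightarrow> Q (\<gamma> ` e) \<longleftrightarrow> Q' e"
  shows "infcomp (fst (act \<gamma> w)) Q \<longleftrightarrow> infcomp (fst w) Q'"
proof -
  have *: "infcomp Y R \<longleftrightarrow> (\<exists>v\<in>V. v \<in> verts Y \<and> infinite {u\<in>V. u \<in> verts Y \<and>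
      conn {e \<in> edges Y. e \<subseteq> verts Y \<and> R e} v u})" if "verts Y \<subseteq> V" for Y R
  proof -
    have "{u\<in>V. u \<in> verts Y \<and> C u} = {u \<in> verts Y. C u}" for C using that by auto
    then show ?thesis using that unfolding infcomp_def by auto
  qed
  have v: "verts (fst (act \<gamma> w)) \<subseteq> V"
    using space_\<Omega>[OF assms(2)] assms(1) by (auto simp: act_simps(4)[OF assms(1,2)])
  have sub: "\<Union> {e \<in> edges (fst w). e \<subseteq> verts (fst w) \<and> Q' e} \<subseteq> V"
    using space_\<Omega>[OF assms(2)] by auto
  have eq: "{e \<in> edges (fst (act \<gamma> w)). e \<subseteq> verts (fst (act \<gamma> w)) \<and> Q e} =
    (`) \<gamma> ` {e \<in> edges (fst w). e \<subseteq> verts (fst w) \<and> Q' e}"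
    by (rule act_edge_set) (use assms in auto)
  show ?thesis
    unfolding *[OF v] *[OF conjunct1[OF space_\<Omega>[OF assms(2)]]]
    by (subst bex_V[OF assms(1)], subst infinite_V[OF assms(1)], subst eq)
      (simp_all add: act_simps(1)[OF assms(1,2)] conn_V[OF assms(1) sub] cong: bex_cong conj_cong)
qed

lemma act_good:
  assumes "\<gamma> \<in> \<Gamma>" "w \<in> space \<Omega>"
  shows "good (act \<gamma> w) \<longleftrightarrow> good w"
proof -
  note s = act_simps(1)[OF assms] act_simps(3)[OF assms, of "{_}", simplified] act_simps(3)[OF assms, of "{_, _}", simplified]
  have 1: "(\<exists>x\<in>V. x \<in> verts (fst (act \<gamma> w))) \<longleftrightarrow> (\<exists>x\<in>V. x \<in> verts (fst w))"
    by (subst bex_V[OF assms(1)]) (simp add: s cong: bex_cong)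
  have e: "{e \<in> edges (fst (act \<gamma> w)). e \<subseteq> verts (fst (act \<gamma> w))} = (`) \<gamma> ` {e \<in> edges (fst w). e \<subseteq> verts (fst w)}"
    using act_edge_set[OF assms, of "\<lambda>_. True" "\<lambda>_. True"] by simp
  have sub: "\<Union> {e \<in> edges (fst w). e \<subseteq> verts (fst w)} \<subseteq> V"
    using space_\<Omega>[OF assms(2)] by auto
  have 2: "(\<forall>x\<in>V. \<forall>y\<in>V. x \<in> verts (fst (act \<gamma> w)) \<longrightarrow> y \<in> verts (fst (act \<gamma> w)) \<longrightarrow>
        conn {e \<in> edges (fst (act \<gamma> w)). e \<subseteq> verts (fst (act \<gamma> w))} x y) \<longleftrightarrow>
      (\<forall>x\<in>V. \<forall>y\<in>V. x \<in> verts (fst w) \<longrightarrow> y \<in> verts (fst w) \<longrightarrow> conn {e \<in> edges (fst w). e \<subseteq> verts (fst w)} x y)"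
    unfolding e by (subst ball_V[OF assms(1)], subst (2) ball_V[OF assms(1)])
       (simp add: s conn_V[OF assms(1) sub] cong: ball_cong)
  have 3: "infcomp (fst (act \<gamma> w)) (\<lambda>e. snd (act \<gamma> w) (0, e) < 1 - 1 / (real k + 1)) \<longleftrightarrow>
     infcomp (fst w) (\<lambda>e. snd w (0, e) < 1 - 1 / (real k + 1))" for k
    by (rule act_infcomp[OF assms]) (use act_simps(3)[OF assms] E_edge space_\<Omega>[OF assms(2)] in auto)
  have 4: "(\<forall>x\<in>V. \<forall>y\<in>V. x \<noteq> y \<longrightarrow> snd (act \<gamma> w) (1, {x}) \<noteq> snd (act \<gamma> w) (1, {y})) \<longleftrightarrow>
     (\<forall>x\<in>V. \<forall>y\<in>V. x \<noteq> y \<longrightarrow> snd w (1, {x}) \<noteq> snd w (1, {y}))"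
    by (subst ball_V[OF assms(1)], subst (2) ball_V[OF assms(1)]) (simp add: s assms cong: ball_cong)
  have 5: "(\<forall>x\<in>V. \<forall>y\<in>V. snd (act \<gamma> w) (0, {x, y}) < 1) \<longleftrightarrow> (\<forall>x\<in>V. \<forall>y\<in>V. snd w (0, {x, y}) < 1)"
    by (subst ball_V[OF assms(1)], subst (2) ball_V[OF assms(1)]) (simp add: s assms cong: ball_cong)
  show ?thesis
    unfolding good_def 1 2 3 4 5 ..
qed

lemma near_exists:
  assumes "good w" "w \<in> space \<Omega>" "x \<in> V"
  obtains v where "v \<in> V" "near w x v"
proof -
  let ?W = "verts (fst w)"
  obtain y where y: "y \<in> V" "y \<in> ?W" using assms(1) by (auto simp: good_def)
  define n where "n = (LEAST n. gball x n \<inter> ?W \<noteq> {})"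
  have ex: "\<exists>n. gball x n \<inter> ?W \<noteq> {}" using gball_covers[OF assms(3) y(1)] y by auto
  have n: "gball x n \<inter> ?W \<noteq> {}" unfolding n_def by (rule LeastI_ex[OF ex])
  have n': "gball x m \<inter> ?W = {}" if "m < n" for m using not_less_Least that unfolding n_def by blast
  have fin: "finite (gball x n \<inter> ?W)" using gball_finite[OF assms(3)] by auto
  obtain v where v: "v \<in> gball x n \<inter> ?W" "\<forall>u\<in>gball x n \<inter> ?W. snd w (1, {v}) \<le> snd w (1, {u})"
    using ex_min_if_finite[OF finite_imageI[OF fin], of "\<lambda>v. snd w (1, {v})"] n
    by (metis (no_types, lifting) fin arg_min_if_finite(1) arg_min_least)
  show thesis
  proof (rule that[of v])
    show "v \<in> V" using v gball_sub[OF assms(3)] by auto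
    show "near w x v" using v n' unfolding near_def by blast
  qed
qed

text \<open>Both points realise the distance from x, so each label bounds the other, and distinct
  vertices have distinct labels.\<close>

lemma near_unique:
  assumes "good w" "w \<in> space \<Omega>" "near w x v" "near w x u"
  shows "v = u"
proof -
  have V: "v \<in> V" "u \<in> V" "v \<in> verts (fst w)" "u \<in> verts (fst w)"
    using assms(3,4) space_\<Omega>[OF assms(2)] by (auto simp: near_def)
  obtain n where n: "v \<in> gball x n" "\<And>u. u\<in>V \<Longrightarrow> u \<in> verts (fst w) \<Longrightarrow> (\<forall>m<n. u \<notin> gball x m) \<and>
      (u \<in> gball x n \<longrightarrow> snd w (1, {v}) \<le> snd w (1, {u}))"
    using assms(3) unfolding near_def by blast
  obtain m where m: "u \<in> gball x m" "\<And>v. v\<in>V \<Longrightarrow> v \<in> verts (fst w) \<Longrightarrow> (\<forall>n<m. v \<notin> gball x n) \<and>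
      (v \<in> gball x m \<longrightarrow> snd w (1, {u}) \<le> snd w (1, {v}))"
    using assms(4) unfolding near_def by blast
  have "n = m" using n m V by (meson linorder_neqE_nat)
  then have "snd w (1, {v}) = snd w (1, {u})" using n m V by (meson order_antisym)
  then show ?thesis using goodD(4)[OF assms(1)] V by blast
qed

text \<open>Every vertex sends unit mass to its nearest point. A vertex then receives mass at most
  one in expectation, and the mass it receives is the size of its Voronoi cell.\<close>

lemma near_AE_finite: "AE w in \<Omega>. good w \<longrightarrow> (\<forall>v\<in>V. finite {x\<in>V. near w x v})"
proof -
  have "AE w in \<Omega>. good w \<longrightarrow> finite {x\<in>V. near w x v}" if v: "v \<in> V" for v
  proof -
    define \<phi> where "\<phi> x v w = (if good w \<and> near w x v then 1 else 0 :: ennreal)" for x v w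
    have m: "\<phi> x v \<in> borel_measurable \<Omega>" if "x \<in> V" "v \<in> V" for x v
      unfolding \<phi>_def[abs_def] using good_measurable near_measurable[OF that] by measurable
    have le1: "(\<integral>\<^sup>+y. \<phi> v y w \<partial>count_space V) \<le> 1" if w: "w \<in> space \<Omega>" for w
    proof (cases "good w")
      case True
      obtain u where u: "u \<in> V" "near w v u" by (rule near_exists[OF True w v])
      have "(\<integral>\<^sup>+y. \<phi> v y w \<partial>count_space V) = (\<Sum>y\<in>{u}. \<phi> v y w)"
      proof (rule nn_integral_count_space')
        fix y assume "y \<in> V" "y \<notin> {u}"
        then have "\<not> near w v y" using near_unique[OF True w, of v y u] u by blast
        then show "\<phi> v y w = 0" by (simp add: \<phi>_def)
      qed (use u in auto)
      then show ?thesis by (simp add: \<phi>_def)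
    qed (simp add: \<phi>_def)
    have "(\<integral>\<^sup>+w. \<integral>\<^sup>+y. \<phi> y v w \<partial>count_space V \<partial>\<Omega>) = (\<integral>\<^sup>+w. \<integral>\<^sup>+y. \<phi> v y w \<partial>count_space V \<partial>\<Omega>)"
      by (rule process.mtp_expectation[symmetric, OF m _ v]) (auto simp: \<phi>_def act_good act_near)
    also have "\<dots> \<le> (\<integral>\<^sup>+w. 1 \<partial>\<Omega>)" by (rule nn_integral_mono) (rule le1)
    also have "\<dots> < \<infinity>" by (simp add: process.emeasure_space_1)
    finally have "AE w in \<Omega>. (\<integral>\<^sup>+y. \<phi> y v w \<partial>count_space V) \<noteq> \<infinity>"
      by (intro nn_integral_PInf_AE borel_measurable_count_nn_integral m v) auto
    then show ?thesis
    proof (rule AE_mp, intro AE_I2 impI)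
      fix w assume "(\<integral>\<^sup>+y. \<phi> y v w \<partial>count_space V) \<noteq> \<infinity>" "good w"
      moreover have "(\<integral>\<^sup>+y. \<phi> y v w \<partial>count_space V) = (\<integral>\<^sup>+y. indicator {x\<in>V. near w x v} y \<partial>count_space V)"
        using \<open>good w\<close> by (intro nn_integral_cong) (auto simp: \<phi>_def)
      moreover have "\<dots> = emeasure (count_space V) {x\<in>V. near w x v}"
        by (rule nn_integral_indicator) auto
      ultimately show "finite {x\<in>V. near w x v}"
        by (metis (no_types, lifting) emeasure_count_space_infinite mem_Collect_eq subsetI)
    qed
  qed
  then have "AE w in \<Omega>. \<forall>v\<in>V. good w \<longrightarrow> finite {x\<in>V. near w x v}"
    by (subst AE_ball_countable) auto
  then show ?thesis by (rule eventually_mono) auto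
qed

definition "A = {w \<in> space \<Omega>. good w \<and> (\<forall>v\<in>V. \<not> infinite {x\<in>V. near w x v})}"

lemma A_sets: "A \<in> sets \<Omega>"
proof -
  have "Measurable.pred \<Omega> (\<lambda>w. good w \<and> (\<forall>v\<in>V. \<not> infinite {x\<in>V. near w x v}))"
    by (intro pred_intros_logic good_measurable measurable_pred_countable countable_V measurable_infinite near_measurable)
  then show ?thesis by (simp add: A_def pred_def)
qed

lemma act_A: "\<gamma> \<in> \<Gamma> \<Longrightarrow> w \<in> space \<Omega> \<Longrightarrow> act \<gamma> w \<in> A \<longleftrightarrow> w \<in> A"
proof -
  assume a: "\<gamma> \<in> \<Gamma>" "w \<in> space \<Omega>"
  have "act \<gamma> w \<in> space \<Omega>" using process.act_measurable[OF a(1)] a(2) by (auto simp: measurable_def)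
  moreover have "(\<forall>v\<in>V. \<not> infinite {x\<in>V. near (act \<gamma> w) x v}) \<longleftrightarrow> (\<forall>v\<in>V. \<not> infinite {x\<in>V. near w x v})"
    by (subst ball_V[OF a(1)], subst infinite_V[OF a(1)]) (simp add: act_near a cong: ball_cong conj_cong)
  ultimately show ?thesis using a by (simp add: A_def act_good)
qed

lemma A_infcomp:
  assumes "w \<in> A" "v \<in> V"
  shows "finite {u\<in>V. conn (perc k w) v u}"
proof (cases "v \<in> verts (fst w)")
  case True
  have "good w" "w \<in> space \<Omega>" using assms by (auto simp: A_def)
  then have "finite {u \<in> verts (fst w). conn (perc k w) v u}"
    using True unfolding good_def infcomp_def perc_def by blast
  moreover have "{u\<in>V. conn (perc k w) v u} \<subseteq> {u \<in> verts (fst w). conn (perc k w) v u}"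
    using conn_in_verts[of "perc k w" v _ "verts (fst w)"] True by (auto simp: perc_def)
  ultimately show ?thesis by (rule finite_subset[rotated])
next
  case False
  have "{u\<in>V. conn (perc k w) v u} \<subseteq> {v}"
  proof
    fix u assume "u \<in> {u\<in>V. conn (perc k w) v u}"
    then have "conn (perc k w) v u" by simp
    then have "u = v"
      by (induction rule: conn_induct) (use False in \<open>auto simp: perc_def\<close>)
    then show "u \<in> {v}" by simp
  qed
  then show ?thesis using finite_subset by blast
qed

lemma cell_equiv:
  assumes "w \<in> A"
  shows "x \<in> V \<Longrightarrow> cell k w x x" "cell k w x y \<Longrightarrow> cell k w y x"
    "cell k w x y \<Longrightarrow> cell k w y z \<Longrightarrow> cell k w x z"
proof -
  have w: "good w" "w \<in> space \<Omega>" using assms by (auto simp: A_def)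
  show "x \<in> V \<Longrightarrow> cell k w x x"
  proof -
    assume "x \<in> V"
    then obtain v where "v \<in> V" "near w x v" by (rule near_exists[OF w])
    then show "cell k w x x" unfolding cell_def by (intro bexI[of _ v] conjI conn_refl)
  qed
  show "cell k w x y \<Longrightarrow> cell k w y x"
    unfolding cell_def by (metis conn_sym)
  show "cell k w x y \<Longrightarrow> cell k w y z \<Longrightarrow> cell k w x z"
  proof -
    assume "cell k w x y" "cell k w y z"
    then obtain v u u' v' where c: "near w x v" "near w y u" "conn (perc k w) v u" "v \<in> V"
       "near w y u'" "near w z v'" "conn (perc k w) u' v'" "v' \<in> V"
      unfolding cell_def by blast
    have "u = u'" using near_unique[OF w c(2) c(5)] .
    then have "conn (perc k w) v v'" using c conn_trans by metis
    then show "cell k w x z" using c unfolding cell_def by blast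
  qed
qed

lemma cell_finite:
  assumes "w \<in> A" "x \<in> V"
  shows "finite {y\<in>V. cell k w x y}"
proof -
  have w: "good w" "w \<in> space \<Omega>" using assms by (auto simp: A_def)
  obtain v where v: "v \<in> V" "near w x v" by (rule near_exists[OF w assms(2)])
  have "{y\<in>V. cell k w x y} \<subseteq> (\<Union>u\<in>{u\<in>V. conn (perc k w) v u}. {y\<in>V. near w y u})"
    using near_unique[OF w v(2)] unfolding cell_def by blast
  moreover have "finite (\<Union>u\<in>{u\<in>V. conn (perc k w) v u}. {y\<in>V. near w y u})"
    using assms A_infcomp[OF assms(1) v(1)] by (intro finite_UN_I) (auto simp: A_def)
  ultimately show ?thesis by (rule finite_subset)
qed

text \<open>The nearest points of x and y are joined by a path in the subgraph, and as labels are
  below one, its finitely many edges are open at a common level.\<close>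

lemma cell_eventually:
  assumes "w \<in> A" "x \<in> V" "y \<in> V"
  shows "\<exists>k. cell k w x y"
proof -
  have w: "good w" "w \<in> space \<Omega>" using assms by (auto simp: A_def)
  obtain v where v: "v \<in> V" "near w x v" by (rule near_exists[OF w assms(2)])
  obtain u where u: "u \<in> V" "near w y u" by (rule near_exists[OF w assms(3)])
  have "v \<in> verts (fst w)" "u \<in> verts (fst w)" using v u by (simp_all add: near_def)
  then have "conn {e \<in> edges (fst w). e \<subseteq> verts (fst w)} v u"
    using goodD(2)[OF w(1)] v u by simp
  moreover have "{e \<in> edges (fst w). e \<subseteq> verts (fst w)} \<subseteq> (\<Union>k. perc k w)"
  proof
    fix e assume e: "e \<in> {e \<in> edges (fst w). e \<subseteq> verts (fst w)}"
    then have "e \<in> E" using space_\<Omega>[OF w(2)] by blast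
    then obtain a b where ab: "a \<in> V" "b \<in> V" "e = {a, b}" by (rule E_obtain)
    then have "snd w (0, e) < 1" using goodD(5)[OF w(1)] by simp
    then obtain k where "inverse (real (Suc k)) < 1 - snd w (0, e)" using reals_Archimedean[of "1 - snd w (0, e)"] by auto
    then have "snd w (0, e) < 1 - 1 / (real k + 1)" by (simp add: inverse_eq_divide add.commute)
    then show "e \<in> (\<Union>k. perc k w)" using e by (auto simp: perc_def)
  qed
  ultimately have c: "conn (\<Union>k. perc k w) v u" by (rule conn_mono)
  have inc: "incseq (\<lambda>k. perc k w)"
    by (simp add: incseq_def perc_mono)
  obtain k where "conn (perc k w) v u" using conn_incseq[OF inc c] ..
  then have "cell k w x y" unfolding cell_def using v u by (intro bexI[of _ v] bexI[of _ u] conjI)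
  then show ?thesis ..
qed

lemma cell_mono: "k \<le> l \<Longrightarrow> cell k w x y \<Longrightarrow> cell l w x y"
proof -
  assume "k \<le> l"
  then have "perc k w \<subseteq> perc l w" by (rule perc_mono)
  then show "cell k w x y \<Longrightarrow> cell l w x y"
    unfolding cell_def by (meson conn_mono)
qed

text \<open>By Fubini it suffices to fix a subgraph of critical probability one; its labels are then
  almost surely good.\<close>

lemma emeasure_A_pos:
  assumes "\<P>(\<omega> in M. p_c \<omega> = 1) > 0"
  shows "emeasure \<Omega> A > 0"
proof -
  let ?S = "{\<omega> \<in> space M. p_c \<omega> = 1}"
  \<comment> \<open>A set outside the sigma-algebra would have measure 0, so the hypothesis itself
    provides measurability.\<close>
  have S [measurable]: "?S \<in> sets M" using assms measure_notin_sets by force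
  have pos: "emeasure M ?S > 0" using assms by (auto simp: measure_def zero_less_iff_neq_zero)
  have "AE w in M \<Otimes>\<^sub>M labels J. fst w \<in> ?S \<longrightarrow> good w"
  proof (rule AE_pair_measure)
    have "Measurable.pred \<Omega> (\<lambda>w. fst w \<in> ?S \<longrightarrow> good w)"
      using good_measurable unfolding \<Omega>_def by measurable
    then show "{w \<in> space (M \<Otimes>\<^sub>M labels J). fst w \<in> ?S \<longrightarrow> good w} \<in> sets (M \<Otimes>\<^sub>M labels J)"
      by (simp add: pred_def \<Omega>_def)
    have d: "AE U in labels J. \<forall>x\<in>V. \<forall>y\<in>V. x \<noteq> y \<longrightarrow> U (1, {x}) \<noteq> U (1, {y})"
      by (subst AE_ball_countable, simp)+ (auto intro!: AE_labels_distinct AE_impI simp: J_def)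
    have l: "AE U in labels J. \<forall>x\<in>V. \<forall>y\<in>V. U (0, {x, y}) < 1"
      by (subst AE_ball_countable, simp)+ (auto intro!: AE_labels_less_1 simp: J_def)
    show "AE x in M. AE y in labels J. fst (x, y) \<in> ?S \<longrightarrow> good (x, y)"
      using AE_M AE_space
    proof eventually_elim
      case (elim \<omega>)
      then have sub: "verts \<omega> \<subseteq> V" "edges \<omega> \<subseteq> E" using verts_X by (auto simp: subgraph_of_def)
      show ?case
      proof (cases "p_c \<omega> = 1")
        case True
        have "\<forall>k. AE U in labels J. \<not> infcomp \<omega> (\<lambda>e. U (0, e) < 1 - 1 / (real k + 1))"
          using p_c_eq_1_iff[of "Pair 0" \<omega> J] sub True E_edge countable_subset[OF sub(1)] countable_subset[OF sub(2)]
          by (auto simp: J_def inj_on_def)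
        then have i: "AE U in labels J. \<forall>k. \<not> infcomp \<omega> (\<lambda>e. U (0, e) < 1 - 1 / (real k + 1))"
          by (subst AE_all_countable)
        show ?thesis
          using d l i
        proof eventually_elim
          case (elim U)
          then show ?case
            using \<open>subgraph_of \<omega> X \<and> verts \<omega> \<noteq> {} \<and> connected_graph \<omega>\<close> sub
            unfolding good_def connected_graph_conn by auto
        qed
      qed auto
    qed
  qed
  with near_AE_finite have "AE w in \<Omega>. fst w \<in> ?S \<longrightarrow> w \<in> A"
    using AE_space unfolding \<Omega>_def[symmetric] by eventually_elim (auto simp: A_def)
  then have "AE w in \<Omega>. w \<in> ?S \<times> space (labels J) \<longrightarrow> w \<in> A"
    by eventually_elim auto
  then have "emeasure \<Omega> (?S \<times> space (labels J)) \<le> emeasure \<Omega> A"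
    by (rule emeasure_mono_AE) (rule A_sets)
  moreover have "emeasure \<Omega> (?S \<times> space (labels J)) = emeasure M ?S"
    unfolding \<Omega>_def by (subst M2.emeasure_pair_measure_Times) (simp_all add: M2.emeasure_space_1)
  ultimately show ?thesis using pos by auto
qed

theorem amenable:
  assumes pos: "\<P>(\<omega> in M. p_c \<omega> = 1) > 0"
  shows "amenable_graph X"
proof (rule ccontr)
  assume "\<not> amenable_graph X"
  then obtain \<epsilon> :: real where e: "\<epsilon> > 0" "\<And>F. finite F \<Longrightarrow> F \<subseteq> V \<Longrightarrow> \<epsilon> * card F \<le> card (boundary F)"
    using not_amenable_obtain by blast
  have "space M \<noteq> {}" by (rule M1.not_empty)
  have "emeasure \<Omega> A > 0" by (rule emeasure_A_pos[OF pos])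
  then obtain w0 where "w0 \<in> A" by (metis emeasure_empty ex_in_conv less_irrefl)
  then obtain x where x: "x \<in> V" by (auto simp: A_def good_def)
  let ?N = "{y\<in>V. {x, y} \<in> E}"
  define q where "q k y = process.prob {w \<in> A. \<not> cell k w x y}" for k y
  have meas: "{w \<in> A. \<not> cell k w x y} \<in> sets \<Omega>" if "y \<in> V" for k y
  proof -
    have "Measurable.pred \<Omega> (\<lambda>w. w \<in> A \<and> \<not> cell k w x y)"
      using A_sets cell_measurable[OF x that] by measurable
    moreover have "{w \<in> space \<Omega>. w \<in> A \<and> \<not> cell k w x y} = {w \<in> A. \<not> cell k w x y}"
      by (auto simp: A_def)
    ultimately show ?thesis by (simp add: pred_def)
  qed
  \<comment> \<open>Each cell C has at least \<epsilon> |C| boundary edges. Averaging over cells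
    makes this a bound at the vertex x that does not depend on k.\<close>
  have le: "\<epsilon> * process.prob A \<le> (\<Sum>y\<in>?N. q k y)" for k
  proof -
    have "(\<integral>\<^sup>+w. indicator A w * ennreal \<epsilon> \<partial>\<Omega>) \<le>
        (\<integral>\<^sup>+w. indicator A w * of_nat (card {y\<in>{y\<in>V. {x, y} \<in> E}. \<not> cell k w x y}) \<partial>\<Omega>)"
    proof (rule process.cell_average[where R = "cell k" and g = "\<lambda>_ _. ennreal \<epsilon>" and
          h = "\<lambda>x w. of_nat (card {y\<in>{y\<in>V. {x, y} \<in> E}. \<not> cell k w x y})"])
      fix x assume x: "x \<in> V"
      have "(\<lambda>w. card {y\<in>{y\<in>V. {x, y} \<in> E}. \<not> cell k w x y}) \<in> measurable \<Omega> (count_space UNIV)"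
        by (rule measurable_card_Collect[OF finite_nbrs[OF x]]) (auto intro!: pred_intros_logic cell_measurable x)
      then show "(\<lambda>w. of_nat (card {y\<in>{y\<in>V. {x, y} \<in> E}. \<not> cell k w x y}) :: ennreal) \<in> borel_measurable \<Omega>"
        by measurable
    next
      fix \<gamma> w x assume g: "\<gamma> \<in> \<Gamma>" "w \<in> space \<Omega>" "x \<in> V"
      have "card {y\<in>V. {\<gamma> x, y} \<in> E \<and> \<not> cell k (act \<gamma> w) (\<gamma> x) y} = card {y\<in>V. {x, y} \<in> E \<and> \<not> cell k w x y}"
        by (subst card_V[OF g(1)]) (simp add: act_cell g aut_X cong: conj_cong)
      then show "of_nat (card {y\<in>{y\<in>V. {\<gamma> x, y} \<in> E}. \<not> cell k (act \<gamma> w) (\<gamma> x) y}) =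
          (of_nat (card {y\<in>{y\<in>V. {x, y} \<in> E}. \<not> cell k w x y}) :: ennreal)"
        by simp
    next
      fix w x assume w: "w \<in> A" "x \<in> V"
      let ?C = "{y\<in>V. cell k w x y}"
      have C: "finite ?C" by (rule cell_finite[OF w])
      have eq: "{y\<in>{z\<in>V. {x', z} \<in> E}. \<not> cell k w x' y} = {z\<in>V. {x', z} \<in> E \<and> z \<notin> ?C}" if "x' \<in> ?C" for x'
        using that cell_equiv[OF w(1)] by blast
      have "\<epsilon> * card ?C \<le> card (boundary ?C)" by (rule e(2)[OF C]) auto
      also have "\<dots> \<le> real (\<Sum>x\<in>?C. card {y\<in>V. {x, y} \<in> E \<and> y \<notin> ?C})"
        by (intro of_nat_mono card_boundary_le C) auto
      also have "(\<Sum>x\<in>?C. card {y\<in>V. {x, y} \<in> E \<and> y \<notin> ?C}) =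
          (\<Sum>x'\<in>?C. card {y\<in>{z\<in>V. {x', z} \<in> E}. \<not> cell k w x' y})"
        by (rule sum.cong[OF refl]) (simp only: eq)
      finally have "ennreal (\<epsilon> * card ?C) \<le> ennreal (real (\<Sum>x'\<in>?C. card {y\<in>{z\<in>V. {x', z} \<in> E}. \<not> cell k w x' y}))"
        by (rule ennreal_leI)
      then show "(\<Sum>y\<in>?C. ennreal \<epsilon>) \<le> (\<Sum>x'\<in>?C. of_nat (card {y\<in>{z\<in>V. {x', z} \<in> E}. \<not> cell k w x' y}))"
        using e(1) by (simp add: ennreal_mult ennreal_of_nat_eq_real_of_nat mult.commute)
    next
      show "x \<in> V" by (rule x)
    next
      fix w x assume "w \<in> A" "x \<in> V" then show "cell k w x x" by (rule cell_equiv(1))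
    next
      fix w x y assume "w \<in> A" "cell k w x y" then show "cell k w y x" by (rule cell_equiv(2))
    next
      fix w x y z assume "w \<in> A" "cell k w x y" "cell k w y z" then show "cell k w x z" by (rule cell_equiv(3))
    qed (rule A_sets act_A cell_measurable act_cell cell_finite borel_measurable_const refl; assumption)+
    also have "\<dots> = (\<integral>\<^sup>+w. (\<Sum>y\<in>?N. indicator {w \<in> A. \<not> cell k w x y} w) \<partial>\<Omega>)"
    proof (rule nn_integral_cong)
      fix w
      have "card {y \<in> ?N. \<not> cell k w x y} = (\<Sum>y\<in>?N. if \<not> cell k w x y then 1 else 0)"
        using finite_nbrs[OF x] by (simp add: sum.If_cases Int_def)
      then show "indicator A w * of_nat (card {y\<in>?N. \<not> cell k w x y}) =
          (\<Sum>y\<in>?N. indicator {w \<in> A. \<not> cell k w x y} w :: ennreal)"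
        by (auto simp: indicator_def of_nat_sum intro!: sum.cong)
    qed
    also have "\<dots> = (\<Sum>y\<in>?N. emeasure \<Omega> {w \<in> A. \<not> cell k w x y})"
      using meas by (subst nn_integral_sum) auto
    also have "\<dots> = ennreal (\<Sum>y\<in>?N. q k y)"
      by (simp add: q_def process.emeasure_eq_measure)
    finally have "(\<integral>\<^sup>+w. indicator A w * ennreal \<epsilon> \<partial>\<Omega>) \<le> ennreal (\<Sum>y\<in>?N. q k y)" .
    moreover have "(\<integral>\<^sup>+w. indicator A w * ennreal \<epsilon> \<partial>\<Omega>) = ennreal (process.prob A * \<epsilon>)"
      using A_sets e(1) by (subst nn_integral_multc) (auto simp: process.emeasure_eq_measure ennreal_mult)
    moreover have "0 \<le> (\<Sum>y\<in>?N. q k y)" by (simp add: q_def sum_nonneg)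
    ultimately show ?thesis by (simp add: mult.commute)
  qed
  \<comment> \<open>The cells grow with k and finally contain any two given vertices, so the events
    decrease to the empty set.\<close>
  have lim: "(\<lambda>k. q k y) \<longlonglongrightarrow> 0" if "y \<in> V" for y
  proof -
    have "(\<lambda>k. q k y) \<longlonglongrightarrow> process.prob (\<Inter>k. {w \<in> A. \<not> cell k w x y})"
      unfolding q_def
    proof (rule process.finite_Lim_measure_decseq)
      show "range (\<lambda>k. {w \<in> A. \<not> cell k w x y}) \<subseteq> sets \<Omega>" using meas[OF that] by auto
      show "decseq (\<lambda>k. {w \<in> A. \<not> cell k w x y})" using cell_mono by (fastforce simp: decseq_def)
    qed
    moreover have "(\<Inter>k. {w \<in> A. \<not> cell k w x y}) = {}" using cell_eventually[OF _ x that] by blast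
    ultimately show ?thesis by simp
  qed
  have "(\<lambda>k. \<Sum>y\<in>?N. q k y) \<longlonglongrightarrow> (\<Sum>y\<in>?N. 0)"
    by (intro tendsto_sum lim) auto
  then have "\<epsilon> * process.prob A \<le> 0"
    using le by (intro LIMSEQ_le_const) auto
  moreover have "process.prob A > 0" using \<open>emeasure \<Omega> A > 0\<close> by (simp add: process.emeasure_eq_measure)
  ultimately show False using e(1) by (simp add: mult_le_0_iff)
qed

end

section \<open>Flows on nonamenable graphs\<close>

lemma half_step:
  fixes s r t d :: real
  assumes "s \<le> r - t" "s \<le> d / 2" "0 < s" shows "s < d" "t + s \<le> r"
  using assms by linarith+

lemma abs_step:
  fixes s r t :: real
  assumes "\<bar>t\<bar> \<le> r" "0 < s" shows "t + s \<le> r \<Longrightarrow> \<bar>t + s\<bar> \<le> r" "- r \<le> t - s \<Longrightarrow> \<bar>t - s\<bar> \<le> r"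
  using assms by linarith+

context graph_symmetry
begin

text \<open>The net flow out of x. The flow through an edge is the difference of the values on its
  two orientations, so any function \<open>t\<close> defines a flow.\<close>

definition excess :: "('a \<times> 'a \<Rightarrow> real) \<Rightarrow> 'a \<Rightarrow> real" where
  "excess t x = (\<Sum>y\<in>{y\<in>V. {x, y} \<in> E}. t (x, y) - t (y, x))"

text \<open>The layers of \<open>a\<close> are removed one by one. Lowering \<open>a\<close> on its
  support S by its least positive value d costs d |S| on the left and d times the number of pairs
  across the boundary of S on the right, to which isoperimetry of S applies.\<close>

lemma coarea:
  fixes a :: "'a \<Rightarrow> real" and \<epsilon> :: real
  assumes h: "\<And>F. finite F \<Longrightarrow> F \<subseteq> V \<Longrightarrow> \<epsilon> * card F \<le> card (boundary F)"
    and W: "finite W" "W \<subseteq> V"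
    and a: "\<And>x. 0 \<le> a x" "\<And>x y. x \<in> V \<Longrightarrow> a x \<noteq> 0 \<Longrightarrow> {x, y} \<in> E \<Longrightarrow> x \<in> W \<and> y \<in> W" "\<And>x. a x \<noteq> 0 \<Longrightarrow> x \<in> W"
  shows "\<epsilon> * (\<Sum>x\<in>W. a x) \<le> (\<Sum>(x, y)\<in>{(x, y)\<in>W \<times> W. {x, y} \<in> E}. \<bar>a x - a y\<bar>)"
  using a
proof (induction "card {x. a x \<noteq> 0}" arbitrary: a rule: less_induct)
  case (less a)
  let ?P = "{(x, y)\<in>W \<times> W. {x, y} \<in> E}"
  define S where "S = {x. a x \<noteq> 0}"
  have SW: "S \<subseteq> W" using less.prems by (auto simp: S_def)
  have S: "finite S" "S \<subseteq> V" using SW W by (auto intro: finite_subset)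
  have P: "finite ?P" using W by (auto intro: finite_subset[of _ "W \<times> W"])
  show ?case
  proof (cases "S = {}")
    case True
    then have "a x = 0" for x by (auto simp: S_def)
    then show ?thesis by simp
  next
    case False
    \<comment> \<open>Lowering by the minimum keeps the function nonnegative and shrinks its
      support, which is the induction measure.\<close>
    define d where "d = Min (a ` S)"
    have "d \<in> a ` S" unfolding d_def using S False by (intro Min_in) auto
    then obtain x0 where x0: "x0 \<in> S" "a x0 = d" by auto
    have d: "d > 0" "\<And>x. x \<in> S \<Longrightarrow> d \<le> a x"
    proof -
      show "d > 0" using x0 less.prems(1)[of x0] by (auto simp: S_def)
      show "d \<le> a x" if "x \<in> S" for x unfolding d_def using S that by simp
    qed
    define b where "b x = (if x \<in> S then a x - d else 0)" for x
    have "{x. b x \<noteq> 0} \<subset> S" using x0 by (auto simp: b_def split: if_splits)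
    then have card: "card {x. b x \<noteq> 0} < card {x. a x \<noteq> 0}"
      unfolding S_def[symmetric] by (rule psubset_card_mono[OF S(1)])
    have IH: "\<epsilon> * (\<Sum>x\<in>W. b x) \<le> (\<Sum>(x, y)\<in>?P. \<bar>b x - b y\<bar>)"
      by (rule less.hyps[OF card]) (use d less.prems in \<open>auto simp: b_def S_def split: if_splits\<close>)
    let ?Q = "{(x, y)\<in>?P. x \<in> S \<longleftrightarrow> y \<notin> S}"
    \<comment> \<open>The hypothesis on \<open>a\<close> puts both endpoints of such an edge into W,
      so no boundary edge is missed by the pairs in \<open>?Q\<close>.\<close>
    have "boundary S \<subseteq> (\<lambda>(x, y). {x, y}) ` ?Q"
    proof
      fix e assume "e \<in> boundary S"
      then obtain x y where e: "e = {x, y}" "x \<in> S" "y \<in> V" "y \<notin> S" "{x, y} \<in> E" by (rule boundary_obtain)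
      then have "x \<in> W \<and> y \<in> W" using less.prems(2)[of x y] S by (auto simp: S_def)
      then show "e \<in> (\<lambda>(x, y). {x, y}) ` ?Q" using e by (intro image_eqI[of _ _ "(x, y)"]) auto
    qed
    moreover have "finite ?Q" by (rule finite_subset[OF _ P]) auto
    ultimately have "card (boundary S) \<le> card ?Q" by (rule surj_card_le[rotated])
    then have c: "\<epsilon> * card S \<le> card ?Q" using h[OF S] by simp
    have "(\<Sum>(x, y)\<in>?P. \<bar>a x - a y\<bar>) = (\<Sum>(x, y)\<in>?P. \<bar>b x - b y\<bar> + (if x \<in> S \<longleftrightarrow> y \<notin> S then d else 0))"
    proof (rule sum.cong[OF refl], clarify)
      fix x y
      have z: "a z = b z + (if z \<in> S then d else 0)" "0 \<le> b z" "z \<notin> S \<Longrightarrow> b z = 0" for z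
        using d by (auto simp: b_def S_def)
      show "\<bar>a x - a y\<bar> = \<bar>b x - b y\<bar> + (if x \<in> S \<longleftrightarrow> y \<notin> S then d else 0)"
        using z(1)[of x] z(1)[of y] z(2)[of x] z(2)[of y] z(3)[of x] z(3)[of y] d(1)
        by (cases "x \<in> S"; cases "y \<in> S") auto
    qed
    also have "\<dots> = (\<Sum>(x, y)\<in>?P. \<bar>b x - b y\<bar>) + (\<Sum>(x, y)\<in>?P. if x \<in> S \<longleftrightarrow> y \<notin> S then d else 0)"
      by (simp add: sum.distrib case_prod_beta')
    also have "(\<Sum>(x, y)\<in>?P. if x \<in> S \<longleftrightarrow> y \<notin> S then d else 0) = d * card ?Q"
      using P by (simp add: case_prod_beta' sum.If_cases Int_def conj_ac cong: conj_cong)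
    finally have e1: "(\<Sum>(x, y)\<in>?P. \<bar>a x - a y\<bar>) = (\<Sum>(x, y)\<in>?P. \<bar>b x - b y\<bar>) + d * card ?Q" .
    have "(\<Sum>x\<in>W. a x) = (\<Sum>x\<in>W. b x + (if x \<in> S then d else 0))"
      by (rule sum.cong[OF refl]) (auto simp: b_def S_def)
    also have "\<dots> = (\<Sum>x\<in>W. b x) + d * card S"
      using W SW by (simp add: sum.distrib sum.If_cases Int_absorb1)
    finally have "\<epsilon> * (\<Sum>x\<in>W. a x) = \<epsilon> * (\<Sum>x\<in>W. b x) + d * (\<epsilon> * card S)"
      by (simp add: algebra_simps)
    also have "\<dots> \<le> (\<Sum>(x, y)\<in>?P. \<bar>b x - b y\<bar>) + d * card ?Q"
      using IH c d(1) by (intro add_mono mult_left_mono) auto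
    finally show ?thesis using e1 by simp
  qed
qed

text \<open>A flow minimising the total squared deficit on \<open>B\<close> sends as much as allowed from larger to
  smaller deficits; by the isoperimetric inequality this forces all deficits to vanish.\<close>

lemma finite_flow:
  fixes \<epsilon> :: real
  assumes e: "\<epsilon> > 0" and h: "\<And>F. finite F \<Longrightarrow> F \<subseteq> V \<Longrightarrow> \<epsilon> * card F \<le> card (boundary F)"
    and B: "finite B" "B \<subseteq> V"
  obtains t where "\<And>p. \<bar>t p\<bar> \<le> 1 / \<epsilon>" "\<And>x. x \<in> B \<Longrightarrow> 1 \<le> excess t x"
proof -
  \<comment> \<open>The capacity 1 / \<epsilon> is chosen for the final comparison: there it
    multiplies the total variation of the deficits, which \<open>coarea\<close> bounds from below by
    \<epsilon> times their sum.\<close>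
  define K where "K = {t :: 'a \<times> 'a \<Rightarrow> real. \<forall>p. \<bar>t p\<bar> \<le> 1 / \<epsilon>}"
  define \<Phi> where "\<Phi> t = (\<Sum>x\<in>B. (max 0 (1 - excess t x))\<^sup>2)" for t
  have "continuous_on K \<Phi>"
  proof -
    have c: "continuous_on K (\<lambda>t. t p)" for p :: "'a \<times> 'a"
      by (rule continuous_on_subset[OF continuous_on_product_coordinates]) auto
    show ?thesis
      unfolding \<Phi>_def excess_def by (intro continuous_intros c)
  qed
  moreover have "compact K" unfolding K_def by (rule compact_bounded_functions)
  moreover have "(\<lambda>_. 0) \<in> K" using e by (simp add: K_def)
  ultimately obtain t where t: "t \<in> K" "\<And>s. s \<in> K \<Longrightarrow> \<Phi> t \<le> \<Phi> s"
    using continuous_attains_inf[of K \<Phi>] by blast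
  define a where "a x = (if x \<in> B then max 0 (1 - excess t x) else 0)" for x
  have a0: "0 \<le> a x" for x by (simp add: a_def)
  \<comment> \<open>Sending s more units from x to y lowers the deficit of x by s and raises that of
    y by at most s. If s is less than the difference of the deficits, the sum of squares drops; a
    vertex outside B costs nothing.\<close>
  have perturb: False if xy: "x \<in> B" "{x, y} \<in> E" "a y < a x" and s: "0 < s" "s < a x - a y" "t' \<in> K"
    and t': "excess t' x = excess t x + s" "excess t' y = excess t y - s" "\<And>z. z \<noteq> x \<Longrightarrow> z \<noteq> y \<Longrightarrow> excess t' z = excess t z"
    for x y s t'
  proof -
    have ne: "x \<noteq> y" using xy by auto
    define f where "f u z = (max 0 (1 - excess u z))\<^sup>2" for u z
    have fx: "f t' x = (a x - s)\<^sup>2" "f t x = (a x)\<^sup>2"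
      using xy s a0[of y] by (auto simp: f_def a_def t' max_def split: if_splits)
    have \<Phi>: "\<Phi> u = f u x + (\<Sum>z\<in>B - {x}. f u z)" for u
      unfolding \<Phi>_def f_def using B(1) xy(1) by (rule sum.remove)
    have le: "\<Phi> t \<le> \<Phi> t'" using t s by auto
    show False
    proof (cases "y \<in> B")
      case True
      have fy: "f t' y \<le> (a y + s)\<^sup>2" "f t y = (a y)\<^sup>2"
        using True s by (auto simp: f_def a_def t' intro!: power_mono)
      have *: "(\<Sum>z\<in>B - {x}. f u z) = f u y + (\<Sum>z\<in>B - {x} - {y}. f u z)" for u
        using B(1) True ne by (intro sum.remove) auto
      have "(\<Sum>z\<in>B - {x} - {y}. f t' z) = (\<Sum>z\<in>B - {x} - {y}. f t z)"
        by (rule sum.cong) (auto simp: f_def t')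
      then have "(a x)\<^sup>2 + (a y)\<^sup>2 \<le> (a x - s)\<^sup>2 + (a y + s)\<^sup>2"
        using le fx fy by (simp add: \<Phi> *)
      then have "0 \<le> 2 * s * (s - (a x - a y))" by (simp add: power2_eq_square algebra_simps)
      then show False using s by (simp add: zero_le_mult_iff)
    next
      case False
      have "(\<Sum>z\<in>B - {x}. f t' z) = (\<Sum>z\<in>B - {x}. f t z)"
      proof (rule sum.cong[OF refl])
        fix z assume "z \<in> B - {x}"
        then have "z \<noteq> x" "z \<noteq> y" using False by auto
        then show "f t' z = f t z" by (simp add: f_def t')
      qed
      then have "(a x)\<^sup>2 \<le> (a x - s)\<^sup>2" using le fx by (simp add: \<Phi>)
      moreover have "(a x - s)\<^sup>2 < (a x)\<^sup>2" using s a0[of y] by (intro power_strict_mono) auto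
      ultimately show False by simp
    qed
  qed
  have upd: "excess (t(p := c)) z = excess t z + (if z = fst p \<and> {fst p, snd p} \<in> E then c - t p else 0) -
       (if z = snd p \<and> {fst p, snd p} \<in> E then c - t p else 0)" if "z \<in> V" "fst p \<noteq> snd p" for p c z
  proof -
    obtain x y where p: "p = (x, y)" by (cases p)
    have "excess (t(p := c)) z - excess t z = (\<Sum>w\<in>{w\<in>V. {z, w} \<in> E}. (if z = x \<and> w = y then c - t p else 0) -
        (if z = y \<and> w = x then c - t p else 0))"
      unfolding excess_def sum_subtractf[symmetric] using that by (intro sum.cong) (auto simp: p)
    also have "\<dots> = (\<Sum>w\<in>{w\<in>V. {z, w} \<in> E}. (if w = y then (if z = x then c - t p else 0) else 0) -
        (if w = x then (if z = y then c - t p else 0) else 0))"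
      by (intro sum.cong) auto
    also have "\<dots> = (if z = x \<and> {x, y} \<in> E then c - t p else 0) - (if z = y \<and> {x, y} \<in> E then c - t p else 0)"
      using finite_nbrs[OF that(1)] by (simp add: sum_subtractf insert_commute E_V) (use E_V[of x y] in \<open>auto simp: insert_commute\<close>)
    finally show ?thesis using p by simp
  qed
  \<comment> \<open>At the minimum every edge towards a smaller deficit is saturated in both of its
    orientations.\<close>
  have full: "t (x, y) = 1 / \<epsilon> \<and> t (y, x) = - (1 / \<epsilon>)" if xy: "x \<in> B" "{x, y} \<in> E" "a y < a x" for x y
  proof (rule ccontr)
    assume n: "\<not> ?thesis"
    have tK: "\<bar>t p\<bar> \<le> 1 / \<epsilon>" for p using t(1) unfolding K_def by blast
    have ne: "x \<noteq> y" "x \<in> V" "y \<in> V" using xy by auto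
    show False
    proof (cases "t (x, y) < 1 / \<epsilon>")
      case True
      \<comment> \<open>Half of the difference is strictly below it, and the other term respects the
        capacity.\<close>
      define s where "s = min (1 / \<epsilon> - t (x, y)) ((a x - a y) / 2)"
      have "s \<le> 1 / \<epsilon> - t (x, y)" "s \<le> (a x - a y) / 2" unfolding s_def by (rule min.cobounded1, rule min.cobounded2)
      moreover have "0 < s" using True xy by (simp add: s_def)
      ultimately have s: "0 < s" "s < a x - a y" "t (x, y) + s \<le> 1 / \<epsilon>"
        using half_step[of s "1 / \<epsilon>" "t (x, y)" "a x - a y"] by simp_all
      have "t((x, y) := t (x, y) + s) \<in> K" using tK abs_step(1)[OF tK s(1,3)] by (simp add: K_def)
      from perturb[OF xy s(1,2) this] show False
      proof
        show "excess (t((x, y) := t (x, y) + s)) x = excess t x + s" using upd ne xy(2) by simp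
        show "excess (t((x, y) := t (x, y) + s)) y = excess t y - s" using upd ne xy(2) by simp
        show "excess (t((x, y) := t (x, y) + s)) z = excess t z" if "z \<noteq> x" "z \<noteq> y" for z
          unfolding excess_def using that by (intro sum.cong) auto
      qed
    next
      case False
      then have "t (x, y) = 1 / \<epsilon>" using tK[of "(x, y)"] by (auto simp: abs_le_iff)
      then have lt: "- (1 / \<epsilon>) < t (y, x)" using n tK[of "(y, x)"] by (auto simp: abs_le_iff)
      define s where "s = min (1 / \<epsilon> + t (y, x)) ((a x - a y) / 2)"
      have "s \<le> 1 / \<epsilon> + t (y, x)" "s \<le> (a x - a y) / 2" unfolding s_def by (rule min.cobounded1, rule min.cobounded2)
      moreover have "0 < s" using lt xy by (simp add: s_def)
      ultimately have s: "0 < s" "s < a x - a y" "- (1 / \<epsilon>) \<le> t (y, x) - s"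
        using half_step[of s "1 / \<epsilon>" "- t (y, x)" "a x - a y"] by simp_all
      have "t((y, x) := t (y, x) - s) \<in> K" using tK abs_step(2)[OF tK s(1,3)] by (simp add: K_def)
      from perturb[OF xy s(1,2) this] show False
      proof
        show "excess (t((y, x) := t (y, x) - s)) x = excess t x + s" using upd ne xy(2) by (simp add: insert_commute)
        show "excess (t((y, x) := t (y, x) - s)) y = excess t y - s" using upd ne xy(2) by (simp add: insert_commute)
        show "excess (t((y, x) := t (y, x) - s)) z = excess t z" if "z \<noteq> x" "z \<noteq> y" for z
          unfolding excess_def using that by (intro sum.cong) auto
      qed
    qed
  qed
  define W where "W = B \<union> (\<Union>x\<in>B. {y\<in>V. {x, y} \<in> E})"
  have W: "finite W" "W \<subseteq> V" using B finite_nbrs by (auto simp: W_def)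
  let ?P = "{(x, y)\<in>W \<times> W. {x, y} \<in> E}"
  have P: "finite ?P" using W by (auto intro: finite_subset[of _ "W \<times> W"])
  define u where "u x y = t (x, y) - t (y, x)" for x y
  have u: "(a x - a y) * u x y = 2 / \<epsilon> * \<bar>a x - a y\<bar>" if "(x, y) \<in> ?P" for x y
  proof -
    have E: "{x, y} \<in> E" "{y, x} \<in> E" using that by (auto simp: insert_commute)
    consider "a x = a y" | "a y < a x" | "a x < a y" by linarith
    then show ?thesis
    proof cases
      case 2
      then have "x \<in> B" using a0[of y] by (auto simp: a_def split: if_splits)
      then show ?thesis using full[OF _ E(1) 2] 2 by (simp add: u_def)
    next
      case 3
      then have "y \<in> B" using a0[of x] by (auto simp: a_def split: if_splits)
      then have "u x y = - (2 / \<epsilon>)" "\<bar>a x - a y\<bar> = - (a x - a y)" using full[OF _ E(2) 3] 3 by (simp_all add: u_def)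
      then show ?thesis by (metis mult.commute mult_minus_left mult_minus_right)
    qed simp
  qed
  \<comment> \<open>Summation by parts: seen from both ends, an edge contributes the product of the
    difference of the deficits and the flow, which saturation makes explicit.\<close>
  have "(\<Sum>x\<in>B. a x * excess t x) = (\<Sum>x\<in>B. \<Sum>y\<in>{y\<in>V. {x, y} \<in> E}. a x * u x y)"
    by (simp add: excess_def u_def sum_distrib_left)
  also have "\<dots> = (\<Sum>(x, y)\<in>(SIGMA x:B. {y\<in>V. {x, y} \<in> E}). a x * u x y)"
    using B finite_nbrs by (intro sum.Sigma) auto
  also have "\<dots> = (\<Sum>(x, y)\<in>?P. a x * u x y)"
    using P by (intro sum.mono_neutral_left) (auto simp: W_def a_def split: if_splits)
  finally have s1: "(\<Sum>x\<in>B. a x * excess t x) = (\<Sum>(x, y)\<in>?P. a x * u x y)" .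
  also have "\<dots> = (\<Sum>(x, y)\<in>?P. a y * u y x)"
    by (rule sum.reindex_bij_witness[of _ prod.swap prod.swap]) (auto simp: insert_commute)
  finally have "2 * (\<Sum>x\<in>B. a x * excess t x) = (\<Sum>(x, y)\<in>?P. a x * u x y) + (\<Sum>(x, y)\<in>?P. a y * u y x)"
    using s1 by simp
  also have "\<dots> = (\<Sum>(x, y)\<in>?P. 2 / \<epsilon> * \<bar>a x - a y\<bar>)"
    unfolding sum.distrib[symmetric]
  proof (rule sum.cong[OF refl])
    fix p assume p: "p \<in> ?P"
    obtain x y where xy: "p = (x, y)" by (cases p)
    have "a x * u x y + a y * u y x = (a x - a y) * u x y" by (simp add: u_def algebra_simps)
    then show "(case p of (x, y) \<Rightarrow> a x * u x y) + (case p of (x, y) \<Rightarrow> a y * u y x) =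
        (case p of (x, y) \<Rightarrow> 2 / \<epsilon> * \<bar>a x - a y\<bar>)"
      using u[of x y] p by (simp add: xy)
  qed
  also have "\<dots> = 2 / \<epsilon> * (\<Sum>(x, y)\<in>?P. \<bar>a x - a y\<bar>)"
    by (simp add: sum_distrib_left case_prod_beta')
  finally have s2: "(\<Sum>x\<in>B. a x * excess t x) = 1 / \<epsilon> * (\<Sum>(x, y)\<in>?P. \<bar>a x - a y\<bar>)" by simp
  have "\<epsilon> * (\<Sum>x\<in>W. a x) \<le> (\<Sum>(x, y)\<in>?P. \<bar>a x - a y\<bar>)"
    by (rule coarea[OF h W a0]) (auto simp: a_def W_def split: if_splits)
  moreover have "(\<Sum>x\<in>W. a x) = (\<Sum>x\<in>B. a x)"
    using W by (intro sum.mono_neutral_right) (auto simp: W_def a_def)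
  ultimately have "(\<Sum>x\<in>B. a x) \<le> (\<Sum>x\<in>B. a x * excess t x)"
    unfolding s2 using e by (simp add: field_simps)
  \<comment> \<open>Where the deficit is positive, the excess equals one minus it; elsewhere both
    sides vanish. Comparison with the sum of the deficits leaves their squares with sum at most
    0.\<close>
  also have "\<dots> = (\<Sum>x\<in>B. a x * (1 - a x))"
    by (rule sum.cong) (auto simp: a_def max_def)
  finally have "(\<Sum>x\<in>B. (a x)\<^sup>2) \<le> 0" by (simp add: algebra_simps power2_eq_square sum_subtractf)
  then have "(\<Sum>x\<in>B. (a x)\<^sup>2) = 0" by (meson order_antisym sum_nonneg zero_le_power2)
  then have "a x = 0" if "x \<in> B" for x using that B by (simp add: sum_nonneg_eq_0_iff)
  then have "1 \<le> excess t x" if "x \<in> B" for x using that by (force simp: a_def max_def split: if_splits)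
  then show thesis using that t(1) by (auto simp: K_def)
qed

text \<open>The flows for the balls around a vertex have the same capacity, so a generalized limit
  exists edge by edge. The excess is a finite sum and commutes with it.\<close>

lemma flow:
  assumes "\<not> amenable_graph X"
  obtains t C where "\<And>p. \<bar>t p\<bar> \<le> C" "\<And>x. x \<in> V \<Longrightarrow> 1 \<le> excess t x"
proof (cases "V = {}")
  case True
  show thesis by (rule that[of "\<lambda>_. 0" 0]) (use True in auto)
next
  case False
  then obtain x0 where x0: "x0 \<in> V" by auto
  obtain \<epsilon> :: real where e: "\<epsilon> > 0" "\<And>F. finite F \<Longrightarrow> F \<subseteq> V \<Longrightarrow> \<epsilon> * card F \<le> card (boundary F)"
    using not_amenable_obtain[OF assms] by blast
  have "\<exists>t. (\<forall>p. \<bar>t p\<bar> \<le> 1 / \<epsilon>) \<and> (\<forall>x\<in>gball x0 n. 1 \<le> excess t x)" for n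
    using finite_flow[OF e gball_finite[OF x0, of n] gball_sub[OF x0]] by metis
  then obtain t where t: "\<And>n p. \<bar>t n p\<bar> \<le> 1 / \<epsilon>" "\<And>n x. x \<in> gball x0 n \<Longrightarrow> 1 \<le> excess (t n) x" by metis
  obtain L where L: "generalized_limit L"
    using generalized_limit_exists by blast
  have bt: "bseq (\<lambda>n. t n p)" for p using t(1) unfolding bseq_def by blast
  define s where "s p = L (\<lambda>n. t n p)" for p
  show thesis
  proof (rule that[of s "1 / \<epsilon>"])
    fix p
    have "L (\<lambda>n. t n p) \<le> L (\<lambda>n. 1 / \<epsilon>)"
      by (rule glim_mono[OF L bt bseq_const]) (use t(1) in \<open>auto simp: abs_le_iff\<close>)
    moreover have "L (\<lambda>n. - (1 / \<epsilon>)) \<le> L (\<lambda>n. t n p)"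
      by (rule glim_mono[OF L bseq_const bt]) (use t(1) in \<open>auto simp: abs_le_iff minus_le_iff\<close>)
    ultimately show "\<bar>s p\<bar> \<le> 1 / \<epsilon>" unfolding s_def glim_const[OF L] by (simp add: abs_le_iff)
  next
    fix x assume x: "x \<in> V"
    have b: "bseq (\<lambda>n. t n (x, y) - t n (y, x))" for y by (rule bseq_diff[OF L bt bt])
    note sum = glim_sum[OF L finite_nbrs[OF x], of "\<lambda>y n. t n (x, y) - t n (y, x)", OF b]
    have ex: "excess s x = L (\<lambda>n. excess (t n) x)"
      using sum unfolding excess_def s_def by (simp add: glim_diff[OF L bt bt])
    have "L (\<lambda>n. 1) \<le> L (\<lambda>n. excess (t n) x)"
    proof (rule glim_mono[OF L bseq_const])
      show "bseq (\<lambda>n. excess (t n) x)" using sum by (simp add: excess_def)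
      obtain N where "x \<in> gball x0 N" using gball_covers[OF x0 x] by auto
      then have "1 \<le> excess (t n) x" if "N \<le> n" for n using t(2) gball_mono[OF that] by blast
      then show "\<forall>\<^sub>F n in sequentially. 1 \<le> excess (t n) x" by (auto simp: eventually_sequentially)
    qed
    then show "1 \<le> excess s x" by (simp add: ex glim_const[OF L])
  qed
qed

end

section \<open>Unimodular automorphism groups\<close>

lemma closedin_Collect_ball:
  assumes "\<And>i. i \<in> I \<Longrightarrow> closedin P {f \<in> topspace P. Q i f}"
  shows "closedin P {f \<in> topspace P. \<forall>i\<in>I. Q i f}"
proof (cases "I = {}")
  case False
  have "closedin P (\<Inter>i\<in>I. {f \<in> topspace P. Q i f})" using False assms by (rule closedin_INT)
  moreover have "(\<Inter>i\<in>I. {f \<in> topspace P. Q i f}) = {f \<in> topspace P. \<forall>i\<in>I. Q i f}" using False by auto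
  ultimately show ?thesis by simp
qed simp

lemma closedin_Collect_bex_finite:
  assumes "finite I" "\<And>i. i \<in> I \<Longrightarrow> closedin P {f \<in> topspace P. Q i f}"
  shows "closedin P {f \<in> topspace P. \<exists>i\<in>I. Q i f}"
proof -
  have "closedin P (\<Union>i\<in>I. {f \<in> topspace P. Q i f})" using assms by (intro closedin_Union) auto
  moreover have "(\<Union>i\<in>I. {f \<in> topspace P. Q i f}) = {f \<in> topspace P. \<exists>i\<in>I. Q i f}" by auto
  ultimately show ?thesis by simp
qed

lemma subgroup_automorphisms: "subgroup (automorphisms G) (BijGroup (verts G))"
proof (rule group.subgroupI[OF group_BijGroup])
  show "automorphisms G \<subseteq> carrier (BijGroup (verts G))"
    by (auto simp: automorphisms_def BijGroup_def)
  have "(\<lambda>x\<in>verts G. x) \<in> automorphisms G"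
    by (auto simp: automorphisms_def id_Bij)
  then show "automorphisms G \<noteq> {}" by blast
next
  fix f assume f: "f \<in> automorphisms G"
  then have B: "f \<in> Bij (verts G)" by (simp add: automorphisms_def)
  let ?h = "restrict (inv_into (verts G) f) (verts G)"
  have h: "?h \<in> Bij (verts G)" by (rule restrict_inv_into_Bij[OF B])
  have fh: "f (inv_into (verts G) f v) = v" "inv_into (verts G) f v \<in> verts G" if "v \<in> verts G" for v
    using B that by (auto simp: Bij_def bij_betw_def f_inv_into_f inv_into_into)
  have "adjacent G (?h u) (?h v) \<longleftrightarrow> adjacent G u v" if "u \<in> verts G" "v \<in> verts G" for u v
  proof -
    have "\<forall>u \<in> verts G. \<forall>v \<in> verts G. adjacent G (f u) (f v) \<longleftrightarrow> adjacent G u v"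
      using f by (simp add: automorphisms_def)
    from this[rule_format, OF fh(2)[OF that(1)] fh(2)[OF that(2)]]
    show ?thesis using that by (simp add: fh)
  qed
  then show "inv\<^bsub>BijGroup (verts G)\<^esub> f \<in> automorphisms G"
    using h B by (simp add: inv_BijGroup automorphisms_def)
next
  fix f g assume fg: "f \<in> automorphisms G" "g \<in> automorphisms G"
  then have B: "f \<in> Bij (verts G)" "g \<in> Bij (verts G)" by (simp_all add: automorphisms_def)
  moreover have "g u \<in> verts G" if "u \<in> verts G" for u using Bij_imp_funcset[OF B(2)] that by auto
  ultimately show "f \<otimes>\<^bsub>BijGroup (verts G)\<^esub> g \<in> automorphisms G"
    using fg by (simp add: automorphisms_def BijGroup_def compose_Bij compose_eq)
qed

locale unimodular_action =
  fixes G :: "'a ugraph" and \<Gamma> :: "('a \<Rightarrow> 'a) set"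
  assumes simple: "simple_graph G"
    and countable: "countable (verts G)"
    and infinite: "infinite (verts G)"
    and lf: "locally_finite_graph G"
    and connected: "connected_graph G"
    and subgroup: "subgroup \<Gamma> (aut_group G)"
    and closed: "closedin (aut_topology G) \<Gamma>"
    and unimod: "unimodular (aut_group G \<lparr>carrier := \<Gamma>\<rparr>) (subtopology (aut_topology G) \<Gamma>)"
    and trans: "transitive_on_verts \<Gamma> G"
begin

abbreviation "V \<equiv> verts G"

definition "\<G> = aut_group G \<lparr>carrier := \<Gamma>\<rparr>"
definition "T = subtopology (aut_topology G) \<Gamma>"

lemma aut_group_group: "group (aut_group G)"
  unfolding aut_group_def by (rule subgroup.subgroup_is_group[OF subgroup_automorphisms group_BijGroup])

lemma group_\<G>: "group \<G>"
  unfolding \<G>_def by (rule subgroup.subgroup_is_group[OF subgroup aut_group_group])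

lemma carrier_\<G> [simp]: "carrier \<G> = \<Gamma>"
  by (simp add: \<G>_def)

lemma \<Gamma>_aut: "\<gamma> \<in> \<Gamma> \<Longrightarrow> \<gamma> \<in> automorphisms G"
  using subgroup.subset[OF subgroup] by (auto simp: aut_group_def)

lemma \<Gamma>_Bij: "\<gamma> \<in> \<Gamma> \<Longrightarrow> \<gamma> \<in> Bij V"
  using \<Gamma>_aut by (auto simp: automorphisms_def)

lemma \<Gamma>_ext: "\<gamma> \<in> \<Gamma> \<Longrightarrow> \<gamma> \<in> extensional V"
  using \<Gamma>_Bij by (rule Bij_imp_extensional)

lemma mult_\<G>: "g \<in> \<Gamma> \<Longrightarrow> h \<in> \<Gamma> \<Longrightarrow> g \<otimes>\<^bsub>\<G>\<^esub> h = compose V g h"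
  using \<Gamma>_Bij by (simp add: \<G>_def aut_group_def BijGroup_def)

lemma mult_\<G>_apply: "g \<in> \<Gamma> \<Longrightarrow> h \<in> \<Gamma> \<Longrightarrow> x \<in> V \<Longrightarrow> (g \<otimes>\<^bsub>\<G>\<^esub> h) x = g (h x)"
  by (simp add: mult_\<G> compose_eq)

sublocale group \<G> by (rule group_\<G>)

sublocale graph_symmetry V \<Gamma> G
proof
  fix \<gamma> assume g: "\<gamma> \<in> \<Gamma>"
  show "bij_betw \<gamma> V V" using \<Gamma>_Bij[OF g] by (simp add: Bij_def)
  fix x y assume "x \<in> V" "y \<in> V"
  then show "{\<gamma> x, \<gamma> y} \<in> edges G \<longleftrightarrow> {x, y} \<in> edges G"
    using \<Gamma>_aut[OF g] by (simp add: automorphisms_def adjacent_def)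
qed (use simple countable lf connected in auto)

lemma cancel_\<G>:
  assumes "g \<in> \<Gamma>" "x \<in> \<Gamma>"
  shows "inv\<^bsub>\<G>\<^esub> g \<otimes>\<^bsub>\<G>\<^esub> (g \<otimes>\<^bsub>\<G>\<^esub> x) = x" "g \<otimes>\<^bsub>\<G>\<^esub> (inv\<^bsub>\<G>\<^esub> g \<otimes>\<^bsub>\<G>\<^esub> x) = x"
    "(x \<otimes>\<^bsub>\<G>\<^esub> g) \<otimes>\<^bsub>\<G>\<^esub> inv\<^bsub>\<G>\<^esub> g = x" "(x \<otimes>\<^bsub>\<G>\<^esub> inv\<^bsub>\<G>\<^esub> g) \<otimes>\<^bsub>\<G>\<^esub> g = x"
proof -
  have c: "g \<in> carrier \<G>" "x \<in> carrier \<G>" using assms by simp_all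
  then have i: "inv\<^bsub>\<G>\<^esub> g \<in> carrier \<G>" by (rule_tac inv_closed)
  show "inv\<^bsub>\<G>\<^esub> g \<otimes>\<^bsub>\<G>\<^esub> (g \<otimes>\<^bsub>\<G>\<^esub> x) = x" using m_assoc[OF i c(1) c(2)] l_inv[OF c(1)] l_one[OF c(2)] by simp
  show "g \<otimes>\<^bsub>\<G>\<^esub> (inv\<^bsub>\<G>\<^esub> g \<otimes>\<^bsub>\<G>\<^esub> x) = x" using m_assoc[OF c(1) i c(2)] r_inv[OF c(1)] l_one[OF c(2)] by simp
  show "(x \<otimes>\<^bsub>\<G>\<^esub> g) \<otimes>\<^bsub>\<G>\<^esub> inv\<^bsub>\<G>\<^esub> g = x" using m_assoc[OF c(2) c(1) i] r_inv[OF c(1)] r_one[OF c(2)] by simp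
  show "(x \<otimes>\<^bsub>\<G>\<^esub> inv\<^bsub>\<G>\<^esub> g) \<otimes>\<^bsub>\<G>\<^esub> g = x" using m_assoc[OF c(2) i c(1)] l_inv[OF c(1)] r_one[OF c(2)] by simp
qed

lemma mult_closed: "g \<in> \<Gamma> \<Longrightarrow> h \<in> \<Gamma> \<Longrightarrow> g \<otimes>\<^bsub>\<G>\<^esub> h \<in> \<Gamma>"
  using m_closed[of g h] by simp

lemma one_apply: "x \<in> V \<Longrightarrow> \<one>\<^bsub>\<G>\<^esub> x = x"
  by (simp add: \<G>_def aut_group_def BijGroup_def)

lemma inv_apply:
  assumes "g \<in> \<Gamma>" "x \<in> V"
  shows "(inv\<^bsub>\<G>\<^esub> g) (g x) = x" "g ((inv\<^bsub>\<G>\<^esub> g) x) = x" "inv\<^bsub>\<G>\<^esub> g \<in> \<Gamma>" "(inv\<^bsub>\<G>\<^esub> g) x = inv_into V g x"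
proof -
  show i: "inv\<^bsub>\<G>\<^esub> g \<in> \<Gamma>" using inv_closed[of g] assms by simp
  show "(inv\<^bsub>\<G>\<^esub> g) (g x) = x"
    using l_inv[of g] mult_\<G>_apply[OF i assms(1) assms(2)] one_apply[OF assms(2)] assms by simp
  show *: "g ((inv\<^bsub>\<G>\<^esub> g) x) = x"
    using r_inv[of g] mult_\<G>_apply[OF assms(1) i assms(2)] one_apply[OF assms(2)] assms by simp
  show "(inv\<^bsub>\<G>\<^esub> g) x = inv_into V g x"
    by (rule inv_into_f_eq[symmetric, OF inj_V[OF assms(1)]]) (use * assms i in auto)
qed

lemma inv_into_V:
  assumes "\<gamma> \<in> \<Gamma>" "x \<in> V"
  shows "inv_into V \<gamma> x \<in> V" "\<gamma> (inv_into V \<gamma> x) = x" "inv_into V \<gamma> (\<gamma> x) = x"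
  using image_V[OF assms(1)] assms inv_into_f_f[OF inj_V[OF assms(1)]]
  by (simp_all add: inv_into_into f_inv_into_f)

lemma transitive:
  assumes "x \<in> V" "y \<in> V" obtains g where "g \<in> \<Gamma>" "g x = y"
  using trans assms unfolding transitive_on_verts_def by blast

section \<open>Pointwise topology: open cosets and compact stabilisers\<close>

abbreviation "P \<equiv> product_topology (\<lambda>_. discrete_topology V) V"

lemma aut_sub_P: "automorphisms G \<subseteq> topspace P"
  by (auto simp: automorphisms_def Bij_def PiE_def bij_betwE)

lemma topspace_T: "topspace T = \<Gamma>"
  unfolding T_def aut_topology_def using aut_sub_P \<Gamma>_aut by auto

lemma openin_P:
  assumes "x \<in> V" shows "openin P {f \<in> topspace P. f x \<in> A}"
proof -
  have "continuous_map P (discrete_topology V) (\<lambda>f. f x)"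
    using assms by (rule continuous_map_product_projection)
  then have "openin P {f \<in> topspace P. f x \<in> A \<inter> V}"
    by (rule openin_continuous_map_preimage) simp
  moreover have "{f \<in> topspace P. f x \<in> A \<inter> V} = {f \<in> topspace P. f x \<in> A}"
    using assms by auto
  ultimately show ?thesis by simp
qed

text \<open>The coordinates are discrete, so any condition on two values is closed.\<close>

lemma closedin_P2:
  assumes "x \<in> V" "y \<in> V" shows "closedin P {f \<in> topspace P. Q (f x) (f y)}"
proof -
  have "openin P (\<Union>(a, b)\<in>{(a, b). \<not> Q a b}. {f \<in> topspace P. f x \<in> {a}} \<inter> {f \<in> topspace P. f y \<in> {b}})"
  proof (rule openin_Union)
    fix U assume "U \<in> (\<lambda>(a, b). {f \<in> topspace P. f x \<in> {a}} \<inter> {f \<in> topspace P. f y \<in> {b}}) ` {(a, b). \<not> Q a b}"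
    then obtain a b where "U = {f \<in> topspace P. f x \<in> {a}} \<inter> {f \<in> topspace P. f y \<in> {b}}" by auto
    then show "openin P U" by (simp only: openin_Int openin_P assms)
  qed
  moreover have "(\<Union>(a, b)\<in>{(a, b). \<not> Q a b}. {f \<in> topspace P. f x \<in> {a}} \<inter> {f \<in> topspace P. f y \<in> {b}}) =
      topspace P - {f \<in> topspace P. Q (f x) (f y)}" by auto
  ultimately show ?thesis unfolding closedin_def by auto
qed

text \<open>For vertices these are cosets: left cosets of the stabiliser of x, and right cosets of
  the stabiliser of y.\<close>

definition S :: "'a \<Rightarrow> 'a \<Rightarrow> ('a \<Rightarrow> 'a) set" where
  "S x y = {\<gamma>\<in>\<Gamma>. \<gamma> x = y}"

lemma openin_T:
  assumes "x \<in> V" shows "openin T {\<gamma>\<in>\<Gamma>. \<gamma> x \<in> A}"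
proof -
  have "openin P {f \<in> topspace P. f x \<in> A}" by (rule openin_P[OF assms])
  then have "openin (aut_topology G) ({f \<in> topspace P. f x \<in> A} \<inter> automorphisms G)"
    unfolding aut_topology_def by (rule openin_subtopology_Int)
  then have "openin T ({f \<in> topspace P. f x \<in> A} \<inter> automorphisms G \<inter> \<Gamma>)"
    unfolding T_def by (rule openin_subtopology_Int)
  moreover have "{f \<in> topspace P. f x \<in> A} \<inter> automorphisms G \<inter> \<Gamma> = {\<gamma>\<in>\<Gamma>. \<gamma> x \<in> A}"
    using aut_sub_P \<Gamma>_aut by auto
  ultimately show ?thesis by simp
qed

lemma openin_S: "x \<in> V \<Longrightarrow> openin T (S x y)"
  using openin_T[of x "{y}"] by (simp add: S_def)

text \<open>An element fixing \<open>v0\<close> preserves all balls around it, so the stabiliser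
  lies in a product of finite sets, where it is closed.\<close>

lemma compact_S:
  assumes o: "v0 \<in> V" shows "compactin T (S v0 v0)"
proof -
  have "\<exists>n. v \<in> gball v0 n" if "v \<in> V" for v by (rule gball_covers[OF o that])
  then obtain d where d: "\<And>v. v \<in> V \<Longrightarrow> v \<in> gball v0 (d v)" by metis
  define B where "B v = gball v0 (d v)" for v
  have B: "finite (B v)" "B v \<subseteq> V" "v \<in> V \<Longrightarrow> v \<in> B v" for v
    using gball_finite[OF o] gball_sub[OF o] d by (auto simp: B_def)
  \<comment> \<open>Surjectivity is not a closed condition as such. Here a preimage of w must lie in
    the finite set \<open>B w\<close>, which makes it a finite union of closed conditions for every
    w.\<close>
  define K1 where "K1 = {f \<in> topspace P. f v0 = v0 \<and> (\<forall>v\<in>V. f v \<in> B v) \<and>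
      (\<forall>u\<in>V. \<forall>v\<in>V. (adjacent G (f u) (f v) \<longleftrightarrow> adjacent G u v) \<and> (f u = f v \<longrightarrow> u = v)) \<and>
      (\<forall>w\<in>V. \<exists>v\<in>B w. f v = w)}"
  have K1: "closedin P K1"
  proof -
    have 1: "closedin P {f \<in> topspace P. f v0 = v0}"
      using closedin_P2[OF o o, of "\<lambda>a b. a = v0"] .
    have 2: "closedin P {f \<in> topspace P. \<forall>v\<in>V. f v \<in> B v}"
    proof (rule closedin_Collect_ball)
      fix v assume v: "v \<in> V"
      show "closedin P {f \<in> topspace P. f v \<in> B v}" using closedin_P2[OF v v, of "\<lambda>a b. a \<in> B v"] .
    qed
    have 3: "closedin P {f \<in> topspace P. \<forall>u\<in>V. \<forall>v\<in>V. (adjacent G (f u) (f v) \<longleftrightarrow> adjacent G u v) \<and> (f u = f v \<longrightarrow> u = v)}"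
    proof (intro closedin_Collect_ball)
      fix u v assume uv: "u \<in> V" "v \<in> V"
      show "closedin P {f \<in> topspace P. (adjacent G (f u) (f v) \<longleftrightarrow> adjacent G u v) \<and> (f u = f v \<longrightarrow> u = v)}"
        using closedin_P2[OF uv, of "\<lambda>a b. (adjacent G a b \<longleftrightarrow> adjacent G u v) \<and> (a = b \<longrightarrow> u = v)"] .
    qed
    have 4: "closedin P {f \<in> topspace P. \<forall>w\<in>V. \<exists>v\<in>B w. f v = w}"
    proof (intro closedin_Collect_ball closedin_Collect_bex_finite B)
      fix w v assume "v \<in> B w"
      then have v: "v \<in> V" using B by auto
      show "closedin P {f \<in> topspace P. f v = w}" using closedin_P2[OF v v, of "\<lambda>a b. a = w"] .
    qed
    have "K1 = {f \<in> topspace P. f v0 = v0} \<inter> {f \<in> topspace P. \<forall>v\<in>V. f v \<in> B v} \<inter>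
      {f \<in> topspace P. \<forall>u\<in>V. \<forall>v\<in>V. (adjacent G (f u) (f v) \<longleftrightarrow> adjacent G u v) \<and> (f u = f v \<longrightarrow> u = v)} \<inter>
      {f \<in> topspace P. \<forall>w\<in>V. \<exists>v\<in>B w. f v = w}"
      unfolding K1_def by auto
    then show ?thesis using 1 2 3 4 by (simp only: closedin_Int)
  qed
  have K1_aut: "K1 \<subseteq> automorphisms G"
  proof
    fix f assume f: "f \<in> K1"
    have "inj_on f V" using f by (auto simp: K1_def inj_on_def)
    moreover have "f ` V = V"
    proof
      show "f ` V \<subseteq> V" using f by (auto simp: K1_def)
      show "V \<subseteq> f ` V"
      proof
        fix w assume "w \<in> V"
        then obtain v where "v \<in> B w" "f v = w" using f by (auto simp: K1_def)
        then show "w \<in> f ` V" using B(2) by auto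
      qed
    qed
    ultimately have "f \<in> Bij V" using f by (auto simp: K1_def Bij_def bij_betw_def PiE_def)
    then show "f \<in> automorphisms G" using f by (auto simp: K1_def automorphisms_def)
  qed
  obtain C where C: "closedin P C" "\<Gamma> = C \<inter> automorphisms G"
    using closed unfolding aut_topology_def closedin_subtopology by auto
  have SK: "S v0 v0 = C \<inter> K1"
  proof
    show "C \<inter> K1 \<subseteq> S v0 v0"
    proof
      fix g assume g: "g \<in> C \<inter> K1"
      then have "g \<in> \<Gamma>" using K1_aut C(2) by blast
      moreover have "g v0 = v0" using g by (simp add: K1_def)
      ultimately show "g \<in> S v0 v0" by (simp add: S_def)
    qed
    show "S v0 v0 \<subseteq> C \<inter> K1"
    proof
      fix g assume g: "g \<in> S v0 v0"
      then have G: "g \<in> \<Gamma>" "g v0 = v0" by (auto simp: S_def)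
      have gB: "g ` B v = B v" for v using gball_image[OF G(1) o] G(2) by (simp add: B_def)
      have gB': "\<exists>u\<in>B v. g u = v" if "v \<in> V" for v
      proof -
        have "v \<in> g ` B v" unfolding gB by (rule B(3)[OF that])
        then show ?thesis by auto
      qed
      have "g \<in> topspace P" using G \<Gamma>_aut aut_sub_P by blast
      moreover have "g v \<in> B v" if "v \<in> V" for v using imageI[OF B(3)[OF that], of g] unfolding gB .
      moreover have "\<forall>w\<in>V. \<exists>v\<in>B w. g v = w" using gB' by simp
      moreover have "\<forall>u\<in>V. \<forall>v\<in>V. (adjacent G (g u) (g v) \<longleftrightarrow> adjacent G u v) \<and> (g u = g v \<longrightarrow> u = v)"
        using aut_X[OF G(1)] eq_V[OF G(1)] by (simp add: adjacent_def)
      ultimately have "g \<in> K1" using G(2) unfolding K1_def by blast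
      then show "g \<in> C \<inter> K1" using G(1) C(2) by blast
    qed
  qed
  have "compactin P (PiE V B)"
    by (subst compactin_PiE) (use B in \<open>auto simp: compactin_discrete_topology\<close>)
  moreover have "S v0 v0 \<subseteq> PiE V B" unfolding SK K1_def by (auto simp: PiE_def)
  moreover have "closedin P (S v0 v0)" unfolding SK using C K1 by (intro closedin_Int)
  ultimately have "compactin P (S v0 v0)" by (rule closed_compactin)
  moreover have "S v0 v0 \<subseteq> \<Gamma>" by (auto simp: S_def)
  ultimately show ?thesis
    unfolding T_def aut_topology_def compactin_subtopology using \<Gamma>_aut by auto
qed

section \<open>Haar measure and the mass transport principle\<close>

definition \<mu> :: "('a \<Rightarrow> 'a) measure" where
  "\<mu> = (SOME \<mu>. left_haar_measure \<G> T \<mu> \<and> (\<forall>g \<in> carrier \<G>. \<forall>A \<in> sets \<mu>. emeasure \<mu> (A #>\<^bsub>\<G>\<^esub> g) = emeasure \<mu> A))"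

lemma \<mu>_haar: "left_haar_measure \<G> T \<mu>"
  and \<mu>_right: "g \<in> \<Gamma> \<Longrightarrow> A \<in> sets \<mu> \<Longrightarrow> emeasure \<mu> (A #>\<^bsub>\<G>\<^esub> g) = emeasure \<mu> A"
  using someI_ex[OF unimod[unfolded unimodular_def, folded \<G>_def T_def]] unfolding \<mu>_def[symmetric] by auto

lemma haar_sets:
  assumes "left_haar_measure \<G> T \<nu>"
  shows "space \<nu> = \<Gamma>" "openin T U \<Longrightarrow> U \<in> sets \<nu>" "sets \<nu> = sigma_sets \<Gamma> {U. openin T U}"
proof -
  have sub: "{U. openin T U} \<subseteq> Pow (topspace T)" using openin_subset by auto
  have s: "sets \<nu> = sets (borel_of T)" using assms by (simp add: left_haar_measure_def)
  have sp: "space (borel_of T) = topspace T" unfolding borel_of_def using sub by (rule space_measure_of)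
  show "space \<nu> = \<Gamma>" using sets_eq_imp_space_eq[OF s] sp topspace_T by simp
  show e: "sets \<nu> = sigma_sets \<Gamma> {U. openin T U}"
    unfolding s borel_of_def using sets_measure_of[OF sub] by (simp add: topspace_T)
  show "openin T U \<Longrightarrow> U \<in> sets \<nu>" unfolding e by (auto intro: sigma_sets.Basic)
qed

lemmas sets_\<mu> = haar_sets[OF \<mu>_haar]

lemma S_sets: "x \<in> V \<Longrightarrow> S x y \<in> sets \<mu>"
  using sets_\<mu>(2) openin_S by blast

lemma \<mu>_left: "g \<in> \<Gamma> \<Longrightarrow> A \<in> sets \<mu> \<Longrightarrow> emeasure \<mu> (g <#\<^bsub>\<G>\<^esub> A) = emeasure \<mu> A"
  using \<mu>_haar by (simp add: left_haar_measure_def)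

lemma l_coset_eq:
  assumes "g \<in> \<Gamma>" "A \<subseteq> \<Gamma>"
  shows "g <#\<^bsub>\<G>\<^esub> A = {\<gamma>\<in>\<Gamma>. inv\<^bsub>\<G>\<^esub> g \<otimes>\<^bsub>\<G>\<^esub> \<gamma> \<in> A}"
proof
  show "g <#\<^bsub>\<G>\<^esub> A \<subseteq> {\<gamma>\<in>\<Gamma>. inv\<^bsub>\<G>\<^esub> g \<otimes>\<^bsub>\<G>\<^esub> \<gamma> \<in> A}"
    using assms cancel_\<G>(1)[OF assms(1)] mult_closed[OF assms(1)] by (auto simp: l_coset_def subset_iff)
  show "{\<gamma>\<in>\<Gamma>. inv\<^bsub>\<G>\<^esub> g \<otimes>\<^bsub>\<G>\<^esub> \<gamma> \<in> A} \<subseteq> g <#\<^bsub>\<G>\<^esub> A"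
  proof
    fix \<gamma> assume "\<gamma> \<in> {\<gamma>\<in>\<Gamma>. inv\<^bsub>\<G>\<^esub> g \<otimes>\<^bsub>\<G>\<^esub> \<gamma> \<in> A}"
    moreover from this have "\<gamma> = g \<otimes>\<^bsub>\<G>\<^esub> (inv\<^bsub>\<G>\<^esub> g \<otimes>\<^bsub>\<G>\<^esub> \<gamma>)"
      using cancel_\<G>(2)[OF assms(1)] by simp
    ultimately show "\<gamma> \<in> g <#\<^bsub>\<G>\<^esub> A" unfolding l_coset_def by blast
  qed
qed

lemma r_coset_eq:
  assumes "g \<in> \<Gamma>" "A \<subseteq> \<Gamma>"
  shows "A #>\<^bsub>\<G>\<^esub> g = {\<gamma>\<in>\<Gamma>. \<gamma> \<otimes>\<^bsub>\<G>\<^esub> inv\<^bsub>\<G>\<^esub> g \<in> A}"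
proof
  show "A #>\<^bsub>\<G>\<^esub> g \<subseteq> {\<gamma>\<in>\<Gamma>. \<gamma> \<otimes>\<^bsub>\<G>\<^esub> inv\<^bsub>\<G>\<^esub> g \<in> A}"
    using assms cancel_\<G>(3)[OF assms(1)] mult_closed[OF _ assms(1)] by (auto simp: r_coset_def subset_iff)
  show "{\<gamma>\<in>\<Gamma>. \<gamma> \<otimes>\<^bsub>\<G>\<^esub> inv\<^bsub>\<G>\<^esub> g \<in> A} \<subseteq> A #>\<^bsub>\<G>\<^esub> g"
  proof
    fix \<gamma> assume "\<gamma> \<in> {\<gamma>\<in>\<Gamma>. \<gamma> \<otimes>\<^bsub>\<G>\<^esub> inv\<^bsub>\<G>\<^esub> g \<in> A}"
    moreover from this have "\<gamma> = (\<gamma> \<otimes>\<^bsub>\<G>\<^esub> inv\<^bsub>\<G>\<^esub> g) \<otimes>\<^bsub>\<G>\<^esub> g"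
      using cancel_\<G>(4)[OF assms(1)] by simp
    ultimately show "\<gamma> \<in> A #>\<^bsub>\<G>\<^esub> g" unfolding r_coset_def by blast
  qed
qed

lemma S_sub: "S x y \<subseteq> \<Gamma>"
  by (auto simp: S_def)

text \<open>Left translation moves the target and right translation the source. The second half is
  where unimodularity enters.\<close>

lemma \<mu>_S:
  assumes "x \<in> V" "y \<in> V" "x' \<in> V" "y' \<in> V"
  shows "emeasure \<mu> (S x y) = emeasure \<mu> (S x' y')"
proof -
  obtain g where g: "g \<in> \<Gamma>" "g y = y'" by (rule transitive[OF assms(2,4)])
  obtain h where h: "h \<in> \<Gamma>" "h x' = x" by (rule transitive[OF assms(3,1)])
  have "g <#\<^bsub>\<G>\<^esub> S x y = S x y'"
  proof -
    have "\<gamma> x = y' \<longleftrightarrow> (inv\<^bsub>\<G>\<^esub> g) (\<gamma> x) = y" if "\<gamma> \<in> \<Gamma>" for \<gamma>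
      using g assms inv_apply[OF g(1)] that by (metis in_V)
    then have "inv\<^bsub>\<G>\<^esub> g \<otimes>\<^bsub>\<G>\<^esub> \<gamma> \<in> S x y \<longleftrightarrow> \<gamma> \<in> S x y'" if "\<gamma> \<in> \<Gamma>" for \<gamma>
      using that inv_apply(3)[OF g(1) assms(1)] assms(1) by (simp add: S_def mult_\<G>_apply mult_closed)
    then show ?thesis
      unfolding l_coset_eq[OF g(1) S_sub] using S_sub by blast
  qed
  then have 1: "emeasure \<mu> (S x y) = emeasure \<mu> (S x y')"
    using \<mu>_left[OF g(1) S_sets[OF assms(1), of y]] by simp
  have "S x y' #>\<^bsub>\<G>\<^esub> h = S x' y'"
  proof -
    have "(inv\<^bsub>\<G>\<^esub> h) x = x'" using h assms inv_apply[OF h(1)] by metis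
    then have "\<gamma> \<otimes>\<^bsub>\<G>\<^esub> inv\<^bsub>\<G>\<^esub> h \<in> S x y' \<longleftrightarrow> \<gamma> \<in> S x' y'" if "\<gamma> \<in> \<Gamma>" for \<gamma>
      using that inv_apply(3)[OF h(1) assms(1)] assms(1) by (simp add: S_def mult_\<G>_apply mult_closed)
    then show ?thesis
      unfolding r_coset_eq[OF h(1) S_sub] using S_sub by blast
  qed
  then have "emeasure \<mu> (S x y') = emeasure \<mu> (S x' y')"
    using \<mu>_right[OF h(1) S_sets[OF assms(1), of y']] by simp
  with 1 show ?thesis by simp
qed

definition v0 :: 'a where "v0 = (SOME v. v \<in> V)"

lemma v0: "v0 \<in> V"
  using infinite unfolding v0_def by (metis finite.emptyI some_in_eq)

definition c :: ennreal where "c = emeasure \<mu> (S v0 v0)"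

lemma emeasure_S: "x \<in> V \<Longrightarrow> y \<in> V \<Longrightarrow> emeasure \<mu> (S x y) = c"
  unfolding c_def using \<mu>_S v0 by blast

lemma c_finite: "c < \<infinity>"
  using \<mu>_haar compact_S[OF v0] unfolding left_haar_measure_def c_def by blast

text \<open>Countably many sets \<open>S v0 y\<close> cover \<Gamma>; if one of them were null, so
  would be all of them and the Haar measure.\<close>

lemma c_pos: "c > 0"
proof (rule ccontr)
  assume "\<not> c > 0"
  then have z: "emeasure \<mu> (S v0 y) = 0" if "y \<in> V" for y
    using emeasure_S[OF v0 that] by (simp add: zero_less_iff_neq_zero)
  have "emeasure \<mu> (\<Union>y\<in>V. S v0 y) = 0"
    using null_sets_UN'[OF countable, of "S v0" \<mu>] z S_sets[OF v0] by (auto simp: null_sets_def)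
  moreover have "(\<Union>y\<in>V. S v0 y) = space \<mu>"
    using v0 by (auto simp: S_def sets_\<mu>)
  ultimately show False using \<mu>_haar by (simp add: left_haar_measure_def)
qed

text \<open>Invariance gives f x (\<gamma> x) = f z x, where \<gamma> takes z to x. Integrated over
  \<gamma>, the two sides become c times the outflow and c times the inflow, since every
  \<open>S x y\<close> has measure c; as c is positive and finite, it cancels.\<close>

sublocale graph_action V \<Gamma> G
proof
  fix f :: "'a \<Rightarrow> 'a \<Rightarrow> ennreal" and x
  assume f: "\<And>\<gamma> x y. \<gamma> \<in> \<Gamma> \<Longrightarrow> x \<in> V \<Longrightarrow> y \<in> V \<Longrightarrow> f (\<gamma> x) (\<gamma> y) = f x y" and x: "x \<in> V"
  have "c * (\<integral>\<^sup>+y. f x y \<partial>count_space V) = (\<integral>\<^sup>+y. f x y * emeasure \<mu> (S x y) \<partial>count_space V)"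
    using x by (subst nn_integral_cmult[symmetric]) (auto intro!: nn_integral_cong simp: emeasure_S mult.commute)
  also have "\<dots> = (\<integral>\<^sup>+y. \<integral>\<^sup>+\<gamma>. f x y * indicator (S x y) \<gamma> \<partial>\<mu> \<partial>count_space V)"
    using S_sets[OF x] by (intro nn_integral_cong) (simp add: nn_integral_cmult_indicator)
  also have "\<dots> = (\<integral>\<^sup>+\<gamma>. \<integral>\<^sup>+y. f x y * indicator (S x y) \<gamma> \<partial>count_space V \<partial>\<mu>)"
    using S_sets[OF x] by (intro nn_integral_count_space_nn_integral[symmetric]) auto
  also have "\<dots> = (\<integral>\<^sup>+\<gamma>. \<integral>\<^sup>+y. f y x * indicator (S y x) \<gamma> \<partial>count_space V \<partial>\<mu>)"
  proof (rule nn_integral_cong)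
    fix \<gamma> assume "\<gamma> \<in> space \<mu>"
    then have g: "\<gamma> \<in> \<Gamma>" by (simp add: sets_\<mu>)
    let ?z = "inv_into V \<gamma> x"
    have z: "?z \<in> V" "\<gamma> ?z = x" by (rule inv_into_V[OF g x])+
    have zu: "y = ?z" if "y \<in> V" "\<gamma> y = x" for y using inv_into_V(3)[OF g that(1)] that(2) by simp
    \<comment> \<open>For fixed \<gamma> only one vertex contributes to each sum: the image of x to
      the first, its preimage to the second.\<close>
    have "(\<integral>\<^sup>+y. f x y * indicator (S x y) \<gamma> \<partial>count_space V) = (\<Sum>y\<in>{\<gamma> x}. f x y * indicator (S x y) \<gamma>)"
      using g x by (intro nn_integral_count_space') (auto simp: S_def)
    also have "\<dots> = f x (\<gamma> x)" using g by (simp add: S_def)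
    also have "\<dots> = f ?z x" using f[OF g z(1) x] z(2) by simp
    also have "\<dots> = (\<Sum>y\<in>{?z}. f y x * indicator (S y x) \<gamma>)" using z g by (simp add: S_def)
    also have "\<dots> = (\<integral>\<^sup>+y. f y x * indicator (S y x) \<gamma> \<partial>count_space V)"
    proof (rule nn_integral_count_space'[symmetric])
      fix y assume "y \<in> V" "y \<notin> {?z}"
      then have "\<gamma> y \<noteq> x" using zu by blast
      then show "f y x * indicator (S y x) \<gamma> = 0" by (simp add: S_def)
    qed (use z in auto)
    finally show "(\<integral>\<^sup>+y. f x y * indicator (S x y) \<gamma> \<partial>count_space V) = (\<integral>\<^sup>+y. f y x * indicator (S y x) \<gamma> \<partial>count_space V)" .
  qed
  also have "\<dots> = (\<integral>\<^sup>+y. \<integral>\<^sup>+\<gamma>. f y x * indicator (S y x) \<gamma> \<partial>\<mu> \<partial>count_space V)"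
    using S_sets by (intro nn_integral_count_space_nn_integral) auto
  also have "\<dots> = (\<integral>\<^sup>+y. f y x * emeasure \<mu> (S y x) \<partial>count_space V)"
    using S_sets by (intro nn_integral_cong) (simp add: nn_integral_cmult_indicator)
  also have "\<dots> = c * (\<integral>\<^sup>+y. f y x \<partial>count_space V)"
    using x by (subst nn_integral_cmult[symmetric]) (auto intro!: nn_integral_cong simp: emeasure_S mult.commute)
  finally show "(\<integral>\<^sup>+y. f x y \<partial>count_space V) = (\<integral>\<^sup>+y. f y x \<partial>count_space V)"
    using c_pos c_finite by (auto simp: ennreal_mult_cancel_left)
qed

section \<open>Amenability of the group\<close>

lemma inv_into_mult:
  assumes "g \<in> \<Gamma>" "\<gamma> \<in> \<Gamma>" "x \<in> V"
  shows "inv_into V (inv\<^bsub>\<G>\<^esub> g \<otimes>\<^bsub>\<G>\<^esub> \<gamma>) x = inv_into V \<gamma> (g x)"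
proof (rule inv_into_f_eq)
  have i: "inv\<^bsub>\<G>\<^esub> g \<in> \<Gamma>" by (rule inv_apply(3)[OF assms(1,3)])
  have m: "inv\<^bsub>\<G>\<^esub> g \<otimes>\<^bsub>\<G>\<^esub> \<gamma> \<in> \<Gamma>" using m_closed[of "inv\<^bsub>\<G>\<^esub> g" \<gamma>] i assms by simp
  show "inj_on (inv\<^bsub>\<G>\<^esub> g \<otimes>\<^bsub>\<G>\<^esub> \<gamma>) V" by (rule inj_V[OF m])
  have z: "inv_into V \<gamma> (g x) \<in> V" "\<gamma> (inv_into V \<gamma> (g x)) = g x"
    using inv_into_V[OF assms(2)] assms by simp_all
  show "inv_into V \<gamma> (g x) \<in> V" by fact
  show "(inv\<^bsub>\<G>\<^esub> g \<otimes>\<^bsub>\<G>\<^esub> \<gamma>) (inv_into V \<gamma> (g x)) = x"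
    using mult_\<G>_apply[OF i assms(2) z(1)] z(2) inv_apply(1)[OF assms(1,3)] by simp
qed

text \<open>The function depends only on the preimages of x and y under \<gamma>, so it is locally
  constant.\<close>

lemma local_measurable:
  assumes "left_haar_measure \<G> T \<nu>" "x \<in> V" "y \<in> V"
  shows "(\<lambda>\<gamma>. q (inv_into V \<gamma> x) (inv_into V \<gamma> y) :: real) \<in> borel_measurable \<nu>"
proof (rule measurableI)
  fix A :: "real set" assume "A \<in> sets borel"
  have "openin T (\<Union>(a, b)\<in>{(a, b). a \<in> V \<and> b \<in> V \<and> q a b \<in> A}. S a x \<inter> S b y)"
    using openin_S by (intro openin_Union) auto
  moreover have "(\<Union>(a, b)\<in>{(a, b). a \<in> V \<and> b \<in> V \<and> q a b \<in> A}. S a x \<inter> S b y) =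
     {\<gamma>\<in>\<Gamma>. q (inv_into V \<gamma> x) (inv_into V \<gamma> y) \<in> A}" (is "?L = ?R")
  proof
    show "?L \<subseteq> ?R"
      using inv_into_f_f[OF inj_V] by (auto simp: S_def)
    show "?R \<subseteq> ?L"
    proof
      fix \<gamma> assume g: "\<gamma> \<in> ?R"
      then have "\<gamma> (inv_into V \<gamma> z) = z" "inv_into V \<gamma> z \<in> V" if "z \<in> V" for z
        using that inv_into_V[of \<gamma>] g by simp_all
      then show "\<gamma> \<in> ?L" using g assms by (auto simp: S_def intro!: bexI[of _ "(inv_into V \<gamma> x, inv_into V \<gamma> y)"])
    qed
  qed
  ultimately show "(\<lambda>\<gamma>. q (inv_into V \<gamma> x) (inv_into V \<gamma> y)) -` A \<inter> space \<nu> \<in> sets \<nu>"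
    using haar_sets[OF assms(1)] by (simp add: vimage_def Int_def conj_commute)
qed simp

text \<open>The mean of a flow over its translates keeps an excess of at least one, but being
  invariant it has as much inflow as outflow at each vertex.\<close>

theorem amenable_group_imp_amenable_graph:
  assumes "amenable_group \<G> T"
  shows "amenable_graph G"
proof (rule ccontr)
  assume "\<not> amenable_graph G"
  then obtain t C where t: "\<And>p. \<bar>t p\<bar> \<le> C" "\<And>x. x \<in> V \<Longrightarrow> 1 \<le> excess t x"
    using flow by blast
  obtain \<nu> m where \<nu>: "left_haar_measure \<G> T \<nu>" and m: "left_invariant_mean \<G> \<nu> m"
    using assms unfolding amenable_group_def by auto
  let ?B = "ess_bounded \<nu>"
  have add: "m (\<lambda>x. f x + h x) = m f + m h" if "f \<in> ?B" "h \<in> ?B" for f h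
    using m that by (simp add: left_invariant_mean_def)
  have cm: "m (\<lambda>x. c * f x) = c * m f" if "f \<in> ?B" for f c
    using m that by (simp add: left_invariant_mean_def)
  have pos: "0 \<le> m f" if "f \<in> ?B" "\<And>\<gamma>. \<gamma> \<in> \<Gamma> \<Longrightarrow> 0 \<le> f \<gamma>" for f
    using m that haar_sets(1)[OF \<nu>] by (auto simp: left_invariant_mean_def intro!: AE_I2)
  have one: "m (\<lambda>x. 1) = 1"
    using m by (simp add: left_invariant_mean_def)
  have inv: "m (\<lambda>x. f (g \<otimes>\<^bsub>\<G>\<^esub> x)) = m f" if "f \<in> ?B" "g \<in> \<Gamma>" for f g
    using m that by (simp add: left_invariant_mean_def)
  have Badd: "(\<lambda>x. f x + h x) \<in> ?B" if fh: "f \<in> ?B" "h \<in> ?B" for f h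
  proof -
    obtain C1 where C1: "AE x in \<nu>. \<bar>f x\<bar> \<le> C1" using fh by (auto simp: ess_bounded_def)
    obtain C2 where C2: "AE x in \<nu>. \<bar>h x\<bar> \<le> C2" using fh by (auto simp: ess_bounded_def)
    have "AE x in \<nu>. \<bar>f x + h x\<bar> \<le> C1 + C2" using C1 C2 by eventually_elim auto
    then show ?thesis using fh by (auto simp: ess_bounded_def)
  qed
  have Bcm: "(\<lambda>x. c * f x) \<in> ?B" if fh: "f \<in> ?B" for f and c :: real
  proof -
    obtain C1 where C1: "AE x in \<nu>. \<bar>f x\<bar> \<le> C1" using fh by (auto simp: ess_bounded_def)
    have "AE x in \<nu>. \<bar>c * f x\<bar> \<le> \<bar>c\<bar> * C1" using C1 by eventually_elim (simp add: abs_mult mult_left_mono)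
    then show ?thesis using fh by (auto simp: ess_bounded_def)
  qed
  have Bconst: "(\<lambda>x. c) \<in> ?B" for c by (auto simp: ess_bounded_def intro!: exI[of _ "\<bar>c\<bar>"])
  have diff: "m (\<lambda>x. f x - h x) = m f - m h" "(\<lambda>x. f x - h x) \<in> ?B" if "f \<in> ?B" "h \<in> ?B" for f h
    using add[OF that(1) Bcm[OF that(2), of "-1"]] cm[OF that(2), of "-1"] Badd[OF that(1) Bcm[OF that(2), of "-1"]] by simp_all
  have mono: "m f \<le> m h" if "f \<in> ?B" "h \<in> ?B" "\<And>\<gamma>. \<gamma> \<in> \<Gamma> \<Longrightarrow> f \<gamma> \<le> h \<gamma>" for f h
    using pos[OF diff(2)[OF that(2,1)]] diff(1)[OF that(2,1)] that(3) by simp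
  have cong: "m f = m h" if "f \<in> ?B" "h \<in> ?B" "\<And>\<gamma>. \<gamma> \<in> \<Gamma> \<Longrightarrow> f \<gamma> = h \<gamma>" for f h
    using mono[OF that(1,2)] mono[OF that(2,1)] that(3) by (simp add: order_antisym)
  have const: "m (\<lambda>x. c) = c" for c using cm[OF Bconst[of 1], of c] one by simp
  have sum: "(\<lambda>x. \<Sum>i\<in>I. f i x) \<in> ?B \<and> m (\<lambda>x. \<Sum>i\<in>I. f i x) = (\<Sum>i\<in>I. m (f i))"
    if "finite I" "\<And>i. i \<in> I \<Longrightarrow> f i \<in> ?B" for I :: "'a set" and f
    using that by (induction I rule: finite_induct) (auto simp: Bconst const Badd add)
  \<comment> \<open>The value on (x, y) of the translate of the flow by \<gamma>.\<close>
  define F where "F x y = (\<lambda>\<gamma> :: 'a \<Rightarrow> 'a. t (inv_into V \<gamma> x, inv_into V \<gamma> y))" for x y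
  have F: "F x y \<in> ?B" if "x \<in> V" "y \<in> V" for x y
    using local_measurable[OF \<nu> that, of "\<lambda>a b. t (a, b)"] t(1) by (auto simp: F_def ess_bounded_def)
  define \<theta> where "\<theta> x y = m (F x y)" for x y
  have \<theta>_inv: "\<theta> (g x) (g y) = \<theta> x y" if g: "g \<in> \<Gamma>" "x \<in> V" "y \<in> V" for g x y
  proof -
    have i: "inv\<^bsub>\<G>\<^esub> g \<in> \<Gamma>" by (rule inv_apply(3)[OF g(1,2)])
    have eq: "F (g x) (g y) \<gamma> = F x y (inv\<^bsub>\<G>\<^esub> g \<otimes>\<^bsub>\<G>\<^esub> \<gamma>)" if "\<gamma> \<in> \<Gamma>" for \<gamma>
      using inv_into_mult[OF g(1) that] g by (simp add: F_def)
    have B': "(\<lambda>\<gamma>. F x y (inv\<^bsub>\<G>\<^esub> g \<otimes>\<^bsub>\<G>\<^esub> \<gamma>)) \<in> ?B"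
    proof -
      have "F (g x) (g y) \<in> borel_measurable \<nu> \<longleftrightarrow> (\<lambda>\<gamma>. F x y (inv\<^bsub>\<G>\<^esub> g \<otimes>\<^bsub>\<G>\<^esub> \<gamma>)) \<in> borel_measurable \<nu>"
        by (rule measurable_cong) (simp add: eq haar_sets(1)[OF \<nu>])
      then show ?thesis using F[of "g x" "g y"] g t(1) by (auto simp: F_def ess_bounded_def)
    qed
    have "m (F (g x) (g y)) = m (\<lambda>\<gamma>. F x y (inv\<^bsub>\<G>\<^esub> g \<otimes>\<^bsub>\<G>\<^esub> \<gamma>))"
      using g by (intro cong F B' eq) auto
    then show ?thesis using inv[OF F[OF g(2,3)] i] by (simp add: \<theta>_def)
  qed
  have C0: "0 \<le> C" using t(1)[of "(v0, v0)"] by simp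
  have \<theta>_bound: "0 \<le> \<theta> x y + C" if "x \<in> V" "y \<in> V" for x y
  proof -
    have "m (\<lambda>x. - C) \<le> m (F x y)" by (rule mono[OF Bconst F[OF that]]) (use t(1) in \<open>auto simp: F_def abs_le_iff minus_le_iff\<close>)
    then show ?thesis by (simp add: const \<theta>_def)
  qed
  let ?N = "{y\<in>V. {v0, y} \<in> E}"
  have N: "finite ?N" by (rule finite_nbrs[OF v0])
  \<comment> \<open>The mean flow may be negative; adding C on every oriented edge makes it a mass,
    and the additions cancel in the difference of outflow and inflow.\<close>
  define f where "f x y = (if {x, y} \<in> E then ennreal (\<theta> x y + C) else 0)" for x y
  have "(\<integral>\<^sup>+y. f v0 y \<partial>count_space V) = (\<integral>\<^sup>+y. f y v0 \<partial>count_space V)"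
    by (rule mtp[OF _ v0]) (simp add: f_def aut_X \<theta>_inv)
  moreover have "(\<integral>\<^sup>+y. f v0 y \<partial>count_space V) = (\<Sum>y\<in>?N. f v0 y)"
    using N by (intro nn_integral_count_space') (auto simp: f_def)
  moreover have "(\<integral>\<^sup>+y. f y v0 \<partial>count_space V) = (\<Sum>y\<in>?N. f y v0)"
    using N by (intro nn_integral_count_space') (auto simp: f_def insert_commute)
  moreover have "(\<Sum>y\<in>?N. f v0 y) = ennreal (\<Sum>y\<in>?N. \<theta> v0 y + C)"
    using \<theta>_bound v0 by (subst sum_ennreal[symmetric]) (auto simp: f_def)
  moreover have "(\<Sum>y\<in>?N. f y v0) = ennreal (\<Sum>y\<in>?N. \<theta> y v0 + C)"
    using \<theta>_bound v0 by (subst sum_ennreal[symmetric]) (auto simp: f_def insert_commute)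
  ultimately have "ennreal (\<Sum>y\<in>?N. \<theta> v0 y + C) = ennreal (\<Sum>y\<in>?N. \<theta> y v0 + C)" by simp
  then have "(\<Sum>y\<in>?N. \<theta> v0 y + C) = (\<Sum>y\<in>?N. \<theta> y v0 + C)"
    using \<theta>_bound v0 by (subst (asm) ennreal_inj) (auto intro!: sum_nonneg)
  then have zero: "(\<Sum>y\<in>?N. \<theta> v0 y - \<theta> y v0) = 0" by (simp add: sum.distrib sum_subtractf)
  define H where "H y = (\<lambda>\<gamma>. F v0 y \<gamma> - F y v0 \<gamma>)" for y
  have H: "H y \<in> ?B" "m (H y) = \<theta> v0 y - \<theta> y v0" if "y \<in> ?N" for y
    using diff[OF F F, of v0 y y v0] that v0 by (auto simp: H_def \<theta>_def)
  have s: "(\<lambda>x. \<Sum>i\<in>?N. H i x) \<in> ?B \<and> m (\<lambda>x. \<Sum>i\<in>?N. H i x) = (\<Sum>i\<in>?N. m (H i))"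
    by (rule sum[OF N H(1)])
  have "m (\<lambda>x. 1) \<le> m (\<lambda>x. \<Sum>i\<in>?N. H i x)"
  proof (rule mono[OF Bconst])
    show "(\<lambda>x. \<Sum>i\<in>?N. H i x) \<in> ?B" using s by simp
    fix \<gamma> assume g: "\<gamma> \<in> \<Gamma>"
    let ?z = "inv_into V \<gamma> v0"
    have i: "\<gamma> (inv_into V \<gamma> z) = z" "inv_into V \<gamma> z \<in> V" if "z \<in> V" for z
      using that inv_into_V[OF g] by simp_all
    \<comment> \<open>The excess at \<open>v0\<close> of a translate is the excess of the original
      flow at the preimage of \<open>v0\<close>, since \<gamma> maps neighbours to
      neighbours.\<close>
    have "excess t ?z = (\<Sum>y\<in>{y\<in>V. {?z, y} \<in> E}. t (?z, y) - t (y, ?z))" by (simp add: excess_def)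
    also have "\<dots> = (\<Sum>y\<in>?N. H y \<gamma>)"
    proof (rule sum.reindex_bij_witness[of _ "inv_into V \<gamma>" \<gamma>])
      fix y assume y: "y \<in> {y\<in>V. {?z, y} \<in> E}"
      show "inv_into V \<gamma> (\<gamma> y) = y" using y inv_into_f_f[OF inj_V[OF g]] by auto
      then show "H (\<gamma> y) \<gamma> = t (?z, y) - t (y, ?z)" by (simp add: H_def F_def)
      have "{\<gamma> ?z, \<gamma> y} \<in> E" using aut_X[OF g, of ?z y] y i[OF v0] by auto
      then show "\<gamma> y \<in> ?N" using i[OF v0] y g by auto
    next
      fix y assume y: "y \<in> ?N"
      show "\<gamma> (inv_into V \<gamma> y) = y" using i y by auto
      have "{?z, inv_into V \<gamma> y} \<in> E" using aut_X[OF g, of ?z "inv_into V \<gamma> y"] i[of y] i[OF v0] y by auto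
      then show "inv_into V \<gamma> y \<in> {y\<in>V. {?z, y} \<in> E}" using i y by auto
    qed
    finally show "1 \<le> (\<Sum>i\<in>?N. H i \<gamma>)" using t(2)[of ?z] i[OF v0] by simp
  qed
  then show False using s H zero one by simp
qed

section \<open>An invariant mean from Foelner sets\<close>

lemma card_gball:
  assumes "x \<in> V" shows "card (gball x n) = card (gball v0 n)"
proof -
  obtain g where g: "g \<in> \<Gamma>" "g v0 = x" by (rule transitive[OF v0 assms])
  have "card (g ` gball v0 n) = card (gball v0 n)"
    by (rule card_image) (rule inj_on_subset[OF inj_V[OF g(1)] gball_sub[OF v0]])
  then show ?thesis using gball_image[OF g(1) v0] g(2) by simp
qed

lemma ball_boundary:
  assumes "x \<in> F" "x \<in> V" "\<not> gball x n \<subseteq> F"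
  shows "\<exists>e\<in>boundary F. \<exists>z\<in>e. z \<in> gball x n"
  using assms(3)
proof (induction n)
  case (Suc n)
  show ?case
  proof (cases "gball x n \<subseteq> F")
    case True
    then obtain y z where yz: "y \<in> gball x n" "z \<in> V" "{y, z} \<in> E" "z \<notin> F" "y \<in> F" using Suc.prems by auto
    then have "{y, z} \<in> boundary F" by (subst boundary_iff) auto
    then show ?thesis using yz(1) by (intro bexI[of _ "{y, z}"] bexI[of _ y]) auto
  next
    case False
    then show ?thesis using Suc.IH by (meson UnI1 gball.simps(2) subsetD gball_mono le_SucI order_refl)
  qed
qed (use assms in simp)

text \<open>Such a point is within distance n of an endpoint of a boundary edge. There are at most 2
  |boundary F| endpoints, and by transitivity all balls of radius n have the same size.\<close>

lemma card_near_boundary: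
  assumes "finite F" "F \<subseteq> V"
  shows "card {x\<in>F. \<not> gball x n \<subseteq> F} \<le> 2 * card (gball v0 n) * card (boundary F)"
proof -
  have fb: "finite (boundary F)" by (rule card_boundary_le[OF assms])
  have eb: "finite e \<and> e \<subseteq> V \<and> card e = 2" if "e \<in> boundary F" for e
    using that E_edge by (auto simp: boundary_def)
  have fin: "finite (\<Union>e\<in>boundary F. \<Union>z\<in>e. gball z n)"
    using fb eb gball_finite by (intro finite_UN_I) blast+
  have "{x\<in>F. \<not> gball x n \<subseteq> F} \<subseteq> (\<Union>e\<in>boundary F. \<Union>z\<in>e. gball z n)"
  proof
    fix x assume x: "x \<in> {x\<in>F. \<not> gball x n \<subseteq> F}"
    then obtain e z where "e \<in> boundary F" "z \<in> e" "z \<in> gball x n" using ball_boundary[of x F n] assms by blast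
    then show "x \<in> (\<Union>e\<in>boundary F. \<Union>z\<in>e. gball z n)" using gball_sym by blast
  qed
  then have "card {x\<in>F. \<not> gball x n \<subseteq> F} \<le> card (\<Union>e\<in>boundary F. \<Union>z\<in>e. gball z n)"
    by (rule card_mono[OF fin])
  also have "\<dots> \<le> (\<Sum>e\<in>boundary F. card (\<Union>z\<in>e. gball z n))"
    by (rule card_UN_le[OF fb])
  also have "\<dots> \<le> (\<Sum>e\<in>boundary F. 2 * card (gball v0 n))"
  proof (rule sum_mono)
    fix e assume e: "e \<in> boundary F"
    have "card (\<Union>z\<in>e. gball z n) \<le> (\<Sum>z\<in>e. card (gball z n))" using eb[OF e] by (intro card_UN_le) auto
    also have "\<dots> = (\<Sum>z\<in>e. card (gball v0 n))" using eb[OF e] card_gball by (intro sum.cong refl) blast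
    also have "\<dots> = 2 * card (gball v0 n)" using eb[OF e] by simp
    finally show "card (\<Union>z\<in>e. gball z n) \<le> 2 * card (gball v0 n)" .
  qed
  finally show ?thesis by (simp add: mult.commute)
qed

text \<open>The elements that take some point of A to y. In this way a finite set of vertices
  becomes a set of measure c |A| in the group, over which functions on \<Gamma> can be
  averaged.\<close>

definition SU :: "'a set \<Rightarrow> 'a \<Rightarrow> ('a \<Rightarrow> 'a) set" where
  "SU A y = (\<Union>x\<in>A. S x y)"

definition cc :: real where "cc = enn2real c"

lemma cc: "cc > 0" "c = ennreal cc"
  using c_pos c_finite by (auto simp: cc_def enn2real_positive_iff ennreal_enn2real)

lemma SU_iff: "A \<subseteq> V \<Longrightarrow> y \<in> V \<Longrightarrow> \<gamma> \<in> SU A y \<longleftrightarrow> \<gamma> \<in> \<Gamma> \<and> inv_into V \<gamma> y \<in> A"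
proof -
  assume A: "A \<subseteq> V" "y \<in> V"
  have "(\<exists>x\<in>A. \<gamma> x = y) \<longleftrightarrow> inv_into V \<gamma> y \<in> A" if "\<gamma> \<in> \<Gamma>"
  proof
    assume "\<exists>x\<in>A. \<gamma> x = y"
    then obtain x where x: "x \<in> A" "\<gamma> x = y" by blast
    then have "inv_into V \<gamma> y = x" using inv_into_V(3)[OF that, of x] A(1) by auto
    then show "inv_into V \<gamma> y \<in> A" using x by simp
  qed (use inv_into_V(2)[OF that A(2)] in blast)
  then show "\<gamma> \<in> SU A y \<longleftrightarrow> \<gamma> \<in> \<Gamma> \<and> inv_into V \<gamma> y \<in> A"
    by (auto simp: SU_def S_def)
qed

lemma SU_measure:
  assumes "finite A" "A \<subseteq> V" "y \<in> V"
  shows "SU A y \<in> sets \<mu>" "emeasure \<mu> (SU A y) = ennreal (cc * card A)" "measure \<mu> (SU A y) = cc * card A"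
proof -
  show m: "SU A y \<in> sets \<mu>" unfolding SU_def using assms S_sets by (intro sets.finite_UN) auto
  have "emeasure \<mu> (SU A y) = (\<Sum>x\<in>A. emeasure \<mu> (S x y))"
    unfolding SU_def
  proof (rule sum_emeasure[symmetric])
    show "disjoint_family_on (\<lambda>x. S x y) A"
      unfolding disjoint_family_on_def
    proof (intro ballI impI)
      fix x x' assume "x \<in> A" "x' \<in> A" "x \<noteq> x'"
      then have ne: "\<gamma> x \<noteq> \<gamma> x'" if "\<gamma> \<in> \<Gamma>" for \<gamma> using eq_V[OF that, of x x'] assms by auto
      show "S x y \<inter> S x' y = {}"
      proof (rule equals0I)
        fix \<gamma> assume "\<gamma> \<in> S x y \<inter> S x' y"
        then show False using ne[of \<gamma>] by (simp add: S_def)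
      qed
    qed
  qed (use assms S_sets in auto)
  also have "\<dots> = of_nat (card A) * c" using assms emeasure_S by (simp add: subset_iff)
  also have "\<dots> = ennreal (cc * card A)"
    using cc by (simp add: ennreal_mult ennreal_of_nat_eq_real_of_nat mult.commute)
  finally show e: "emeasure \<mu> (SU A y) = ennreal (cc * card A)" .
  show "measure \<mu> (SU A y) = cc * card A" using cc by (simp add: measure_def e)
qed

lemma SU_integrable:
  assumes "finite A" "A \<subseteq> V" "y \<in> V" "f \<in> ess_bounded \<mu>"
  shows "integrable \<mu> (\<lambda>\<gamma>. indicator (SU A y) \<gamma> * f \<gamma>)"
proof -
  obtain C where C: "AE \<gamma> in \<mu>. \<bar>f \<gamma>\<bar> \<le> C" using assms(4) by (auto simp: ess_bounded_def)
  have "integrable \<mu> (\<lambda>\<gamma>. indicator (SU A y) \<gamma> *\<^sub>R f \<gamma>)"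
  proof (rule integrableI_bounded_set_indicator)
    show "AE \<gamma> in \<mu>. \<gamma> \<in> SU A y \<longrightarrow> norm (f \<gamma>) \<le> C" using C by eventually_elim auto
  qed (use assms SU_measure[OF assms(1-3)] in \<open>auto simp: ess_bounded_def\<close>)
  then show ?thesis by simp
qed

lemma SU_const:
  assumes "finite A" "A \<subseteq> V" "y \<in> V"
  shows "integrable \<mu> (\<lambda>\<gamma>. indicator (SU A y) \<gamma> :: real)" "(LINT \<gamma>|\<mu>. indicator (SU A y) \<gamma>) = cc * card A"
  using SU_measure[OF assms] by (auto simp: less_top[symmetric] integrable_indicator_iff integral_indicator)

lemma translation_measurable:
  assumes g: "g \<in> \<Gamma>" shows "(\<lambda>\<gamma>. g \<otimes>\<^bsub>\<G>\<^esub> \<gamma>) \<in> measurable \<mu> \<mu>"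
proof -
  have "continuous_map T P (\<lambda>\<gamma>. g \<otimes>\<^bsub>\<G>\<^esub> \<gamma>)"
    unfolding continuous_map_componentwise
  proof (intro conjI ballI)
    show "(\<lambda>\<gamma>. g \<otimes>\<^bsub>\<G>\<^esub> \<gamma>) ` topspace T \<subseteq> extensional V"
      using \<Gamma>_ext mult_closed[OF g] by (auto simp: topspace_T)
    fix k assume k: "k \<in> V"
    show "continuous_map T (discrete_topology V) (\<lambda>\<gamma>. (g \<otimes>\<^bsub>\<G>\<^esub> \<gamma>) k)"
      unfolding continuous_map_def
    proof (intro conjI allI impI)
      show "(\<lambda>\<gamma>. (g \<otimes>\<^bsub>\<G>\<^esub> \<gamma>) k) \<in> topspace T \<rightarrow> topspace (discrete_topology V)"
        using mult_closed[OF g] k by (auto simp: topspace_T)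
      fix U
      have "{\<gamma>\<in>topspace T. (g \<otimes>\<^bsub>\<G>\<^esub> \<gamma>) k \<in> U} = {\<gamma>\<in>\<Gamma>. \<gamma> k \<in> {w. g w \<in> U}}"
        using mult_\<G>_apply[OF g _ k] by (auto simp: topspace_T)
      then show "openin T {\<gamma>\<in>topspace T. (g \<otimes>\<^bsub>\<G>\<^esub> \<gamma>) k \<in> U}" using openin_T[OF k, of "{w. g w \<in> U}"] by simp
    qed
  qed
  then have cont: "continuous_map T T (\<lambda>\<gamma>. g \<otimes>\<^bsub>\<G>\<^esub> \<gamma>)"
    using mult_closed[OF g] \<Gamma>_aut unfolding T_def aut_topology_def continuous_map_in_subtopology
    by (auto simp: topspace_T[unfolded T_def aut_topology_def])
  show ?thesis
  proof (rule measurable_sigma_sets[OF sets_\<mu>(3)])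
    show "{U. openin T U} \<subseteq> Pow \<Gamma>" using openin_subset topspace_T by blast
    show "(\<lambda>\<gamma>. g \<otimes>\<^bsub>\<G>\<^esub> \<gamma>) \<in> space \<mu> \<rightarrow> \<Gamma>" using mult_closed[OF g] by (auto simp: sets_\<mu>(1))
    fix U assume "U \<in> {U. openin T U}"
    then have "openin T {\<gamma>\<in>topspace T. g \<otimes>\<^bsub>\<G>\<^esub> \<gamma> \<in> U}" using openin_continuous_map_preimage[OF cont] by simp
    then show "(\<lambda>\<gamma>. g \<otimes>\<^bsub>\<G>\<^esub> \<gamma>) -` U \<inter> space \<mu> \<in> sets \<mu>"
      using sets_\<mu>(2) by (simp add: vimage_def Int_def conj_commute topspace_T sets_\<mu>(1))
  qed
qed

lemma translation_distr:
  assumes g: "g \<in> \<Gamma>" shows "distr \<mu> \<mu> (\<lambda>\<gamma>. g \<otimes>\<^bsub>\<G>\<^esub> \<gamma>) = \<mu>"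
proof (rule measure_eqI)
  fix A assume "A \<in> sets (distr \<mu> \<mu> (\<lambda>\<gamma>. g \<otimes>\<^bsub>\<G>\<^esub> \<gamma>))"
  then have A: "A \<in> sets \<mu>" by simp
  then have sub: "A \<subseteq> \<Gamma>" using sets.sets_into_space sets_\<mu>(1) by blast
  have i: "inv\<^bsub>\<G>\<^esub> g \<in> \<Gamma>" by (rule inv_apply(3)[OF g v0])
  have "(\<lambda>\<gamma>. g \<otimes>\<^bsub>\<G>\<^esub> \<gamma>) -` A \<inter> space \<mu> = inv\<^bsub>\<G>\<^esub> g <#\<^bsub>\<G>\<^esub> A"
    unfolding l_coset_eq[OF i sub] using g inv_inv[of g] by (auto simp: sets_\<mu>(1))
  then show "emeasure (distr \<mu> \<mu> (\<lambda>\<gamma>. g \<otimes>\<^bsub>\<G>\<^esub> \<gamma>)) A = emeasure \<mu> A"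
    using \<mu>_left[OF i A] by (simp add: emeasure_distr[OF translation_measurable[OF g] A])
qed simp

lemma translation_ess_bounded:
  assumes g: "g \<in> \<Gamma>" and f: "f \<in> ess_bounded \<mu>" "AE \<gamma> in \<mu>. \<bar>f \<gamma>\<bar> \<le> C"
  shows "(\<lambda>\<gamma>. f (g \<otimes>\<^bsub>\<G>\<^esub> \<gamma>)) \<in> ess_bounded \<mu>" "AE \<gamma> in \<mu>. \<bar>f (g \<otimes>\<^bsub>\<G>\<^esub> \<gamma>)\<bar> \<le> C"
proof -
  have "AE \<gamma> in distr \<mu> \<mu> (\<lambda>\<gamma>. g \<otimes>\<^bsub>\<G>\<^esub> \<gamma>). \<bar>f \<gamma>\<bar> \<le> C" unfolding translation_distr[OF g] by (rule f(2))
  then show "AE \<gamma> in \<mu>. \<bar>f (g \<otimes>\<^bsub>\<G>\<^esub> \<gamma>)\<bar> \<le> C" by (rule AE_distrD[OF translation_measurable[OF g]])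
  then show "(\<lambda>\<gamma>. f (g \<otimes>\<^bsub>\<G>\<^esub> \<gamma>)) \<in> ess_bounded \<mu>"
    using f measurable_compose[OF translation_measurable[OF g]] by (auto simp: ess_bounded_def)
qed

text \<open>A change of variables moves the translation from the function to the base point
  \<open>v0\<close>.\<close>

lemma SU_translate:
  assumes g: "g \<in> \<Gamma>" and A: "finite A" "A \<subseteq> V" and f: "f \<in> ess_bounded \<mu>"
  shows "(LINT \<gamma>|\<mu>. indicator (SU A v0) \<gamma> * f (g \<otimes>\<^bsub>\<G>\<^esub> \<gamma>)) = (LINT \<gamma>|\<mu>. indicator (SU A (g v0)) \<gamma> * f \<gamma>)"
proof -
  have gv: "g v0 \<in> V" using g v0 by simp
  have m: "(\<lambda>\<gamma>. indicator (SU A (g v0)) \<gamma> * f \<gamma>) \<in> borel_measurable \<mu>"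
    using SU_integrable[OF A gv f] by (rule borel_measurable_integrable)
  have "(LINT \<gamma>|\<mu>. indicator (SU A (g v0)) \<gamma> * f \<gamma>) =
      (LINT \<gamma>|distr \<mu> \<mu> (\<lambda>\<gamma>. g \<otimes>\<^bsub>\<G>\<^esub> \<gamma>). indicator (SU A (g v0)) \<gamma> * f \<gamma>)"
    by (simp add: translation_distr[OF g])
  also have "\<dots> = (LINT \<gamma>|\<mu>. indicator (SU A (g v0)) (g \<otimes>\<^bsub>\<G>\<^esub> \<gamma>) * f (g \<otimes>\<^bsub>\<G>\<^esub> \<gamma>))"
    by (rule integral_distr[OF translation_measurable[OF g] m])
  also have "\<dots> = (LINT \<gamma>|\<mu>. indicator (SU A v0) \<gamma> * f (g \<otimes>\<^bsub>\<G>\<^esub> \<gamma>))"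
  proof (rule Bochner_Integration.integral_cong[OF refl])
    fix \<gamma> assume "\<gamma> \<in> space \<mu>"
    then have gm: "\<gamma> \<in> \<Gamma>" by (simp add: sets_\<mu>(1))
    have "g \<otimes>\<^bsub>\<G>\<^esub> \<gamma> \<in> S x (g v0) \<longleftrightarrow> \<gamma> \<in> S x v0" if "x \<in> V" for x
      using gm g that v0 mult_closed[OF g gm] by (simp add: S_def mult_\<G>_apply)
    then have "g \<otimes>\<^bsub>\<G>\<^esub> \<gamma> \<in> SU A (g v0) \<longleftrightarrow> \<gamma> \<in> SU A v0" using A unfolding SU_def by blast
    then show "indicator (SU A (g v0)) (g \<otimes>\<^bsub>\<G>\<^esub> \<gamma>) * f (g \<otimes>\<^bsub>\<G>\<^esub> \<gamma>) = indicator (SU A v0) \<gamma> * f (g \<otimes>\<^bsub>\<G>\<^esub> \<gamma>)"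
      by (simp add: indicator_def)
  qed
  finally show ?thesis by simp
qed

text \<open>If \<gamma> belongs to only one of the two sets, the preimages of the two base points
  are at distance at most r, one inside and one outside of A. The inner one then lies in A within
  distance r of its complement.\<close>

lemma SU_difference:
  assumes g: "g \<in> \<Gamma>" and A: "finite A" "A \<subseteq> V" and f: "f \<in> ess_bounded \<mu>" "AE \<gamma> in \<mu>. \<bar>f \<gamma>\<bar> \<le> C"
    and r: "g v0 \<in> gball v0 r"
  shows "\<bar>(LINT \<gamma>|\<mu>. indicator (SU A (g v0)) \<gamma> * f \<gamma>) - (LINT \<gamma>|\<mu>. indicator (SU A v0) \<gamma> * f \<gamma>)\<bar> \<le>
     C * (2 * cc * card {x\<in>A. \<not> gball x r \<subseteq> A})"
proof -
  have gv: "g v0 \<in> V" using g v0 by simp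
  let ?B = "{x\<in>A. \<not> gball x r \<subseteq> A}"
  have B: "finite ?B" "?B \<subseteq> V" using A by auto
  have sub: "\<gamma> \<in> SU ?B y" if "\<gamma> \<in> SU A y" "\<gamma> \<notin> SU A y'" "y \<in> V" "y' \<in> V" "y' \<in> gball y r" for \<gamma> y y'
  proof -
    have gm: "\<gamma> \<in> \<Gamma>" using that SU_iff[OF A(2) that(3)] by auto
    let ?x = "inv_into V \<gamma> y" let ?y = "inv_into V \<gamma> y'"
    have "\<gamma> ?y \<in> gball (\<gamma> ?x) r" using that inv_into_V[OF gm] by simp
    then have "?y \<in> gball ?x r" using gball_mem[OF gm inv_into_V(1)[OF gm that(3)] inv_into_V(1)[OF gm that(4)]] by simp
    moreover have "?x \<in> A" "?y \<notin> A" using that gm SU_iff[OF A(2)] by auto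
    ultimately show ?thesis using gm that(3) by (subst SU_iff[OF B(2)]) auto
  qed
  note int = SU_integrable[OF A gv f(1)] SU_integrable[OF A v0 f(1)]
  have int2: "integrable \<mu> (\<lambda>\<gamma>. C * (indicator (SU ?B (g v0)) \<gamma> + indicator (SU ?B v0) \<gamma>))"
    using SU_const(1)[OF B gv] SU_const(1)[OF B v0] by simp
  have "\<bar>(LINT \<gamma>|\<mu>. indicator (SU A (g v0)) \<gamma> * f \<gamma>) - (LINT \<gamma>|\<mu>. indicator (SU A v0) \<gamma> * f \<gamma>)\<bar> =
     \<bar>LINT \<gamma>|\<mu>. indicator (SU A (g v0)) \<gamma> * f \<gamma> - indicator (SU A v0) \<gamma> * f \<gamma>\<bar>"
    using int by simp
  also have "\<dots> \<le> (LINT \<gamma>|\<mu>. \<bar>indicator (SU A (g v0)) \<gamma> * f \<gamma> - indicator (SU A v0) \<gamma> * f \<gamma>\<bar>)"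
    using integral_norm_bound[of \<mu> "\<lambda>\<gamma>. indicator (SU A (g v0)) \<gamma> * f \<gamma> - indicator (SU A v0) \<gamma> * f \<gamma>"] by simp
  also have "\<dots> \<le> (LINT \<gamma>|\<mu>. C * (indicator (SU ?B (g v0)) \<gamma> + indicator (SU ?B v0) \<gamma>))"
  proof (rule integral_mono_AE[OF _ int2])
    show "integrable \<mu> (\<lambda>\<gamma>. \<bar>indicator (SU A (g v0)) \<gamma> * f \<gamma> - indicator (SU A v0) \<gamma> * f \<gamma>\<bar>)"
      using int by simp
    show "AE \<gamma> in \<mu>. \<bar>indicator (SU A (g v0)) \<gamma> * f \<gamma> - indicator (SU A v0) \<gamma> * f \<gamma>\<bar> \<le>
        C * (indicator (SU ?B (g v0)) \<gamma> + indicator (SU ?B v0) \<gamma>)"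
      using f(2)
    proof eventually_elim
      case (elim \<gamma>)
      have "0 \<le> C" using elim by simp
      then show ?case
        using elim sub[of \<gamma> "g v0" v0, OF _ _ gv v0 gball_sym[OF r]] sub[of \<gamma> v0 "g v0", OF _ _ v0 gv r]
        by (cases "\<gamma> \<in> SU A (g v0)"; cases "\<gamma> \<in> SU A v0") (auto simp: indicator_def)
    qed
  qed
  also have "\<dots> = C * (2 * cc * card ?B)"
    using SU_const[OF B gv] SU_const[OF B v0] by simp
  finally show ?thesis .
qed

theorem amenable_graph_imp_amenable_group:
  assumes "amenable_graph G"
  shows "amenable_group \<G> T"
proof -
  have "\<exists>F. finite F \<and> F \<noteq> {} \<and> F \<subseteq> V \<and> real (card (boundary F)) \<le> 1 / (real n + 1) * real (card F)" for n :: nat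
  proof -
    have "0 < 1 / (real n + 1)" by simp
    then show ?thesis using assms unfolding amenable_graph_def boundary_def by blast
  qed
  then obtain F :: "nat \<Rightarrow> 'a set" where F: "\<And>n. finite (F n)" "\<And>n. F n \<noteq> {}" "\<And>n. F n \<subseteq> V"
    "\<And>n. real (card (boundary (F n))) \<le> 1 / (real n + 1) * real (card (F n))" by metis
  obtain L where L: "generalized_limit L" using generalized_limit_exists by blast
  \<comment> \<open>The average of f over the group elements that bring a point of the n-th Foelner
    set to \<open>v0\<close>.\<close>
  define mn where "mn f n = (LINT \<gamma>|\<mu>. indicator (SU (F n) v0) \<gamma> * f \<gamma>) / (cc * card (F n))" for f n
  have cF: "0 < cc * card (F n)" for n using cc(1) F by (simp add: card_gt_0_iff)
  have bound: "\<bar>mn f n\<bar> \<le> C" if f: "f \<in> ess_bounded \<mu>" "AE \<gamma> in \<mu>. \<bar>f \<gamma>\<bar> \<le> C" for f C n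
  proof -
    have "\<bar>LINT \<gamma>|\<mu>. indicator (SU (F n) v0) \<gamma> * f \<gamma>\<bar> \<le> (LINT \<gamma>|\<mu>. \<bar>indicator (SU (F n) v0) \<gamma> * f \<gamma>\<bar>)"
      using integral_norm_bound[of \<mu> "\<lambda>\<gamma>. indicator (SU (F n) v0) \<gamma> * f \<gamma>"] by simp
    also have "\<dots> \<le> (LINT \<gamma>|\<mu>. C * indicator (SU (F n) v0) \<gamma>)"
    proof (rule integral_mono_AE)
      show "AE \<gamma> in \<mu>. \<bar>indicator (SU (F n) v0) \<gamma> * f \<gamma>\<bar> \<le> C * indicator (SU (F n) v0) \<gamma>"
        using f(2) by eventually_elim (auto simp: indicator_def)
    qed (use SU_integrable[OF F(1,3) v0 f(1)] SU_const(1)[OF F(1,3) v0] in auto)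
    also have "\<dots> = C * (cc * card (F n))" using SU_const(2)[OF F(1,3) v0] by simp
    finally show ?thesis using cF[of n] unfolding mn_def abs_divide abs_of_pos[OF cF] by (simp only: pos_divide_le_eq)
  qed
  have bs: "bseq (mn f)" if f: "f \<in> ess_bounded \<mu>" for f
    using bound[OF f] f unfolding bseq_def ess_bounded_def by blast
  define m where "m f = L (mn f)" for f
  have "left_invariant_mean \<G> \<mu> m"
    unfolding left_invariant_mean_def
  proof (intro conjI ballI allI impI)
    fix f h assume f: "f \<in> ess_bounded \<mu>" and h: "h \<in> ess_bounded \<mu>"
    have "mn (\<lambda>x. f x + h x) = (\<lambda>n. mn f n + mn h n)"
      using SU_integrable[OF F(1,3) v0 f] SU_integrable[OF F(1,3) v0 h]
      by (auto simp: mn_def distrib_left add_divide_distrib)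
    then show "m (\<lambda>x. f x + h x) = m f + m h"
      unfolding m_def using glim_add[OF L bs[OF f] bs[OF h]] by simp
  next
    fix f c assume f: "f \<in> ess_bounded \<mu>"
    have "mn (\<lambda>x. c * f x) = (\<lambda>n. c * mn f n)"
      by (auto simp: mn_def mult.left_commute)
    then show "m (\<lambda>x. c * f x) = c * m f"
      unfolding m_def using glim_mult[OF L bs[OF f]] by simp
  next
    fix f assume f: "f \<in> ess_bounded \<mu>" "AE x in \<mu>. 0 \<le> f x"
    have "0 \<le> mn f n" for n
    proof -
      have "0 \<le> (LINT \<gamma>|\<mu>. indicator (SU (F n) v0) \<gamma> * f \<gamma>)"
        by (rule integral_nonneg_AE) (use f(2) in \<open>eventually_elim, auto simp: indicator_def\<close>)
      then show ?thesis using cF[of n] by (simp add: mn_def)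
    qed
    then show "0 \<le> m f" unfolding m_def using bs[OF f(1)] by (intro glim_nonneg[OF L]) auto
  next
    have "mn (\<lambda>x. 1) = (\<lambda>n. 1)"
    proof
      fix n
      show "mn (\<lambda>x. 1) n = 1"
        unfolding mn_def mult_1_right SU_const(2)[OF F(1,3) v0] by (rule divide_self[OF less_imp_neq[OF cF, symmetric]])
    qed
    then show "m (\<lambda>x. 1) = 1" unfolding m_def using glim_const[OF L] by simp
  next
    fix f g assume f: "f \<in> ess_bounded \<mu>" and "g \<in> carrier \<G>"
    then have g: "g \<in> \<Gamma>" by simp
    obtain C where C: "AE \<gamma> in \<mu>. \<bar>f \<gamma>\<bar> \<le> C" using f by (auto simp: ess_bounded_def)
    let ?f = "\<lambda>\<gamma>. f (g \<otimes>\<^bsub>\<G>\<^esub> \<gamma>)"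
    have f': "?f \<in> ess_bounded \<mu>" by (rule translation_ess_bounded[OF g f C])
    have gv: "g v0 \<in> V" using g v0 by simp
    obtain r where r: "g v0 \<in> gball v0 r" using gball_covers[OF v0 gv] by auto
    \<comment> \<open>One factor 2 stems from the two halves of the symmetric difference in
      \<open>SU_difference\<close>, the other from the two endpoints of a boundary edge.\<close>
    let ?K = "4 * \<bar>C\<bar> * card (gball v0 r)"
    have le: "\<bar>mn ?f n - mn f n\<bar> \<le> ?K / (real n + 1)" for n
    proof -
      let ?B = "{x\<in>F n. \<not> gball x r \<subseteq> F n}"
      have "AE \<gamma> in \<mu>. \<bar>f \<gamma>\<bar> \<le> \<bar>C\<bar>" using C by eventually_elim auto
      note d = SU_difference[OF g F(1,3) f this r, of n]
      have "\<bar>mn ?f n - mn f n\<bar> \<le> \<bar>C\<bar> * (2 * cc * card ?B) / (cc * card (F n))"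
        unfolding mn_def SU_translate[OF g F(1,3) f] diff_divide_distrib[symmetric] abs_divide abs_of_pos[OF cF]
        by (rule divide_right_mono[OF d less_imp_le[OF cF]])
      also have "\<dots> = 2 * \<bar>C\<bar> * (card ?B / card (F n))" using cc(1) by simp
      also have "\<dots> \<le> 2 * \<bar>C\<bar> * (2 * card (gball v0 r) * (1 / (real n + 1)))"
      proof (rule mult_left_mono)
        have "real (card ?B) \<le> real (2 * card (gball v0 r) * card (boundary (F n)))"
          using card_near_boundary[OF F(1,3), of n r] by (rule of_nat_mono)
        also have "\<dots> = 2 * card (gball v0 r) * real (card (boundary (F n)))" by simp
        also have "\<dots> \<le> 2 * card (gball v0 r) * (1 / (real n + 1) * real (card (F n)))"
          using F(4)[of n] by (intro mult_left_mono) auto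
        finally have "real (card ?B) \<le> 2 * card (gball v0 r) * (1 / (real n + 1)) * real (card (F n))" by simp
        then show "real (card ?B) / real (card (F n)) \<le> 2 * card (gball v0 r) * (1 / (real n + 1))"
          using F(1,2) by (subst pos_divide_le_eq) (auto simp: card_gt_0_iff)
      qed simp
      finally show ?thesis by simp
    qed
    have "(\<lambda>n. ?K * inverse (real (Suc n))) \<longlonglongrightarrow> ?K * 0"
      by (intro tendsto_mult tendsto_const LIMSEQ_inverse_real_of_nat)
    then have "(\<lambda>n. ?K / (real n + 1)) \<longlonglongrightarrow> 0" by (simp add: divide_inverse add.commute)
    then have "(\<lambda>n. mn ?f n - mn f n) \<longlonglongrightarrow> 0"
      by (rule Lim_null_comparison[rotated]) (use le in simp)
    then have "L (\<lambda>n. mn ?f n - mn f n) = 0"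
      by (rule glim_eq[OF L]) (rule bseq_diff[OF L bs[OF f'] bs[OF f]])
    then show "m ?f = m f" unfolding m_def using glim_diff[OF L bs[OF f'] bs[OF f]] by simp
  qed
  then show ?thesis unfolding amenable_group_def using \<mu>_haar by blast
qed

end

section \<open>Rays\<close>

lemma measurable_label_component: "j \<in> J \<Longrightarrow> (\<lambda>U. U j) \<in> borel_measurable (labels J)"
  by (subst measurable_cong_sets[OF refl sets_unif, symmetric]) (rule measurable_component_singleton)

text \<open>Koenig's lemma for arbitrary edge sets. The state consists of the visited vertices and a
  current vertex whose component after their removal is still infinite; remembering the visited
  vertices makes the ray injective.\<close>

lemma konig:
  assumes fin: "\<And>x. finite {y. {x, y} \<in> F}" and inf: "infinite {w. conn F v w}"
  obtains r where "r 0 = v" "inj r" "\<And>n. {r n, r (Suc n)} \<in> F"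
proof -
  define comp where "comp S x = {w. conn {e \<in> F. e \<inter> S = {}} x w}" for S x
  define Q where "Q p \<longleftrightarrow> finite (fst p) \<and> snd p \<notin> fst p \<and> infinite (comp (fst p) (snd p))" for p :: "'a set \<times> 'a"
  define R where "R p q \<longleftrightarrow> fst q = insert (snd p) (fst p) \<and> {snd p, snd q} \<in> F" for p q :: "'a set \<times> 'a"
  have "Q ({}, v)" using inf by (simp add: Q_def comp_def)
  have step: "\<exists>q. Q q \<and> R p q" if "Q p" for p
  proof -
    obtain S x where p: "p = (S, x)" by (cases p)
    have Q: "finite S" "x \<notin> S" "infinite (comp S x)" using that by (auto simp: Q_def p)
    let ?N = "{y. {x, y} \<in> F \<and> y \<notin> insert x S}"
    \<comment> \<open>Removing x splits its component into finitely many pieces, each attached to a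
      neighbour of x, so one of them is infinite.\<close>
    have "comp S x \<subseteq> insert x (\<Union>y\<in>?N. comp (insert x S) y)"
    proof
      fix w assume "w \<in> comp S x"
      then have "conn {e \<in> F. e \<inter> S = {}} x w" by (simp add: comp_def)
      then show "w \<in> insert x (\<Union>y\<in>?N. comp (insert x S) y)"
      proof (induction rule: conn_induct)
        case (step a b)
        show ?case
        proof (cases "a = x \<or> b = x")
          case True
          then show ?thesis using step(2) by (cases "b = x") (auto simp: comp_def)
        next
          case False
          then obtain y where y: "y \<in> ?N" "conn {e \<in> F. e \<inter> insert x S = {}} y a"
            using step(3) by (auto simp: comp_def)
          have "conn {e \<in> F. e \<inter> insert x S = {}} y b"
            by (rule conn_step[OF y(2)]) (use step(2) False in auto)
          then show ?thesis using y(1) by (auto simp: comp_def)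
        qed
      qed simp
    qed
    moreover have "finite ?N" by (rule finite_subset[OF _ fin[of x]]) auto
    ultimately obtain y where y: "y \<in> ?N" "infinite (comp (insert x S) y)"
      using Q(3) by (meson finite_UN_I finite_insert finite_subset)
    then have "Q (insert x S, y) \<and> R p (insert x S, y)" using Q by (auto simp: Q_def R_def p)
    then show ?thesis ..
  qed
  obtain f where f: "\<And>n. Q (f n)" "\<And>n. R (f n) (f (Suc n))" "f 0 = ({}, v)"
  proof -
    have "\<exists>f. \<forall>n. (Q (f n) \<and> (n = 0 \<longrightarrow> f n = ({}, v))) \<and> R (f n) (f (Suc n))"
      by (rule dependent_nat_choice) (use \<open>Q ({}, v)\<close> step in auto)
    then show thesis using that by blast
  qed
  have mem: "snd (f m) \<in> fst (f n)" if "m < n" for m n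
    using that
  proof (induction n)
    case (Suc n)
    then show ?case using f(2)[of n] by (cases "m = n") (auto simp: R_def)
  qed simp
  have "snd (f m) \<noteq> snd (f n)" if "m < n" for m n
    using mem[OF that] f(1)[of n] by (auto simp: Q_def)
  then have "inj (\<lambda>n. snd (f n))" by (intro injI) (metis linorder_neqE_nat)
  then show thesis
    using that[of "\<lambda>n. snd (f n)"] f(2,3) by (auto simp: R_def)
qed

text \<open>The start is moved along one edge at a time. If the new vertex lies on the ray, the ray
  is cut there, otherwise the vertex is put in front; tails stay the same up to a shift.\<close>

lemma ray_from_other_vertex:
  assumes "conn E w v" "s 0 = w" "inj s" "\<And>n. {s n, s (Suc n)} \<in> E"
  shows "\<exists>r N M. r 0 = v \<and> inj r \<and> (\<forall>n. {r n, r (Suc n)} \<in> E) \<and> (\<forall>n. r (N + n) = s (M + n))"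
  using assms(1)
proof (induction rule: conn_induct)
  case refl
  show ?case using assms by (intro exI[of _ s] exI[of _ 0]) auto
next
  case (step y z)
  then obtain r N M where r: "r 0 = y" "inj r" "\<And>n. {r n, r (Suc n)} \<in> E" "\<And>n. r (N + n) = s (M + n)" by blast
  show ?case
  proof (cases "z \<in> range r")
    case True
    then obtain i where i: "z = r i" by auto
    have "inj (\<lambda>n. r (i + n))" by (rule injI) (metis r(2) injD add_left_cancel)
    moreover have "r (i + (N + n)) = s (M + i + n)" for n
      using r(4)[of "i + n"] by (simp add: ac_simps)
    ultimately show ?thesis using r(3) i
      by (intro exI[of _ "\<lambda>n. r (i + n)"] exI[of _ N] exI[of _ "M + i"]) auto
  next
    case False
    have "inj (case_nat z r)" using r(2) False by (auto simp: inj_on_def split: nat.splits)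
    moreover have "{case_nat z r n, case_nat z r (Suc n)} \<in> E" for n
      using r(1,3) step(2) by (cases n) (auto simp: insert_commute)
    ultimately show ?thesis using r(4)
      by (intro exI[of _ "case_nat z r"] exI[of _ "Suc N"] exI[of _ M]) auto
  qed
qed

lemma AE_not_open_path:
  assumes e: "inj e" "\<And>n. e n \<in> J" and q: "0 \<le> q" "q < 1"
  shows "AE U in labels J. \<not> (\<forall>n\<ge>N::nat. U (e n) < q)"
proof -
  interpret prob_space "labels J" by (rule prob_space_labels)
  have [measurable]: "(\<lambda>U. U (e n)) \<in> borel_measurable (labels J)" for n
    by (rule measurable_label_component[OF e(2)])
  let ?A = "{U \<in> space (labels J). \<forall>n\<ge>N. U (e n) < q}"
  have A: "?A \<in> sets (labels J)" by measurable
  have le: "prob ?A \<le> q ^ m" for m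
  proof -
    let ?I = "e ` {N..<N+m}"
    have I: "finite ?I" "?I \<subseteq> J" "card ?I = m" using e by (auto simp: card_image inj_on_subset[OF e(1)])
    have B: "{U \<in> space (labels J). \<forall>j\<in>?I. U j \<in> {..<q}} \<in> sets (labels J)"
    proof -
      have "Measurable.pred (labels J) (\<lambda>U. \<forall>j\<in>?I. U j < q)"
        using I(2) by (intro pred_intros_finite I(1) pred_real_less measurable_label_component borel_measurable_const) auto
      then show ?thesis by (simp add: pred_def)
    qed
    have "emeasure (labels J) ?A \<le> emeasure (labels J) {U \<in> space (labels J). \<forall>j\<in>?I. U j \<in> {..<q}}"
      by (rule emeasure_mono[OF _ B]) auto
    also have "\<dots> = ennreal q ^ m"
      using prob_labels_Ball[OF I(1,2), of "{..<q}"] I(3) emeasure_unif_less[of q] q by simp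
    finally show ?thesis using q by (simp add: emeasure_eq_measure ennreal_power)
  qed
  have "(\<lambda>m. q ^ m) \<longlonglongrightarrow> 0" using q by (intro LIMSEQ_realpow_zero) auto
  then have "prob ?A \<le> 0" using le by (intro LIMSEQ_le_const) auto
  then have "emeasure (labels J) ?A = 0" by (simp add: emeasure_eq_measure measure_le_0_iff)
  with A show ?thesis by (subst AE_iff_measurable[OF A]) auto
qed

text \<open>An infinite cluster below level one contains an open ray, which shares a tail with one
  of the finitely many rays from v. There are countably many such tails, and each almost surely has
  a closed edge.\<close>

lemma p_c_eq_1_of_finite_rays:
  assumes simple: "simple_graph Y" and c: "countable (verts Y)" and lf: "locally_finite_graph Y"
    and conn: "connected_graph Y" and v: "v \<in> verts Y" and rays: "finite (rays_from Y v)"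
  shows "p_c Y = 1"
proof -
  have edge: "e \<subseteq> verts Y" "finite e" "card e = 2" if "e \<in> edges Y" for e
    using simple that unfolding simple_graph_def by (auto intro: card_ge_0_finite)
  have cE: "countable (edges Y)"
    by (rule countable_subset[OF _ countable_Collect_finite_subset[OF c]]) (use edge in auto)
  have E: "{e \<in> edges Y. e \<subseteq> verts Y} = edges Y" using edge by auto
  have fin: "finite {y. {x, y} \<in> edges Y}" for x
  proof (cases "x \<in> verts Y")
    case True
    have "{y. {x, y} \<in> edges Y} = neighbours Y x"
      using edge(1) by (force simp: neighbours_def adjacent_def)
    then show ?thesis using lf True by (simp add: locally_finite_graph_def)
  next
    case False
    then have "{y. {x, y} \<in> edges Y} = {}" using edge(1) by force
    then show ?thesis by simp
  qed
  have "AE U in labels (edges Y). \<not> infcomp Y (\<lambda>e. U e < q)" if q: "0 \<le> q" "q < 1" for q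
  proof -
    have "AE U in labels (edges Y). \<not> (\<forall>n\<ge>N. U {r n, r (Suc n)} < q)" if "r \<in> rays_from Y v" for r N
    proof (rule AE_not_open_path[OF _ _ q])
      have r: "inj r" "\<And>n. {r n, r (Suc n)} \<in> edges Y" using that by (auto simp: rays_from_def adjacent_def)
      \<comment> \<open>The edges of a ray are distinct, hence their labels are independent.\<close>
      show "inj (\<lambda>n. {r n, r (Suc n)})"
      proof (rule injI)
        fix m n assume "{r m, r (Suc m)} = {r n, r (Suc n)}"
        then have "r m = r n \<or> (r m = r (Suc n) \<and> r (Suc m) = r n)" by (auto simp: doubleton_eq_iff)
        then show "m = n" by (auto simp: inj_eq[OF r(1)])
      qed
      show "{r n, r (Suc n)} \<in> edges Y" for n by (rule r(2))
    qed
    then have "AE U in labels (edges Y). \<forall>r\<in>rays_from Y v. \<forall>N. \<not> (\<forall>n\<ge>N. U {r n, r (Suc n)} < q)"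
      using rays by (subst AE_ball_countable) (auto simp: AE_all_countable countable_finite)
    then show ?thesis
    proof (rule eventually_mono)
      fix U :: "'a set \<Rightarrow> real" assume U: "\<forall>r\<in>rays_from Y v. \<forall>N. \<not> (\<forall>n\<ge>N. U {r n, r (Suc n)} < q)"
      show "\<not> infcomp Y (\<lambda>e. U e < q)"
      proof
        assume "infcomp Y (\<lambda>e. U e < q)"
        then obtain w where w: "w \<in> verts Y"
          "infinite {u \<in> verts Y. conn {e \<in> edges Y. e \<subseteq> verts Y \<and> U e < q} w u}"
          by (auto simp: infcomp_def)
        let ?F = "{e \<in> edges Y. e \<subseteq> verts Y \<and> U e < q}"
        have finF: "finite {y. {x, y} \<in> ?F}" for x by (rule finite_subset[OF _ fin[of x]]) auto
        have infF: "infinite {u. conn ?F w u}" using w(2) by (rule infinite_super[rotated]) auto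
        obtain s where s: "s 0 = w" "inj s" "\<And>n. {s n, s (Suc n)} \<in> ?F"
          by (rule konig[OF finF infF]) blast
        have cE: "conn (edges Y) w v" using conn w(1) v unfolding connected_graph_conn E by blast
        obtain r N M where r: "r 0 = v" "inj r" "\<forall>n. {r n, r (Suc n)} \<in> edges Y" "\<forall>n. r (N + n) = s (M + n)"
          using ray_from_other_vertex[of "edges Y" w v s] cE s by blast
        have "range r \<subseteq> verts Y" using r(3) edge(1) by blast
        then have "r \<in> rays_from Y v" using r by (auto simp: rays_from_def adjacent_def)
        moreover have "U {r n, r (Suc n)} < q" if "n \<ge> N" for n
        proof -
          have "n = N + (n - N)" "Suc n = N + Suc (n - N)" using that by auto
          then have "r n = s (M + (n - N))" "r (Suc n) = s (M + Suc (n - N))" using r(4) by metis+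
          then show ?thesis using s(3)[of "M + (n - N)"] by simp
        qed
        ultimately show False using U by blast
      qed
    qed
  qed
  from this[of "1 - 1 / (real k + 1)" for k]
  have "\<forall>k::nat. AE U in labels (edges Y). \<not> infcomp Y (\<lambda>e. U (id e) < 1 - 1 / (real k + 1))"
    by simp
  then show ?thesis
    by (subst p_c_eq_1_iff[of id Y "edges Y"]) (auto simp: c cE)
qed

section \<open>Minimal spanning trees\<close>

lemma conn_finite_subset:
  assumes "conn F x y" shows "\<exists>F0\<subseteq>F. finite F0 \<and> conn F0 x y"
  using assms
proof (induction rule: conn_induct)
  case refl
  show ?case by (rule exI[of _ "{}"]) auto
next
  case (step y z)
  then obtain F0 where F0: "F0 \<subseteq> F" "finite F0" "conn F0 x y" by auto
  have "conn (insert {y, z} F0) x z" by (rule conn_step[OF conn_mono[OF F0(3)]]) auto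
  then show ?case using F0 step(2) by (intro exI[of _ "insert {y, z} F0"]) auto
qed

lemma conn_remove_edge:
  assumes "conn F x y"
  shows "conn (F - {{a, b}}) x y \<or> (conn (F - {{a, b}}) x a \<and> conn (F - {{a, b}}) b y) \<or>
    (conn (F - {{a, b}}) x b \<and> conn (F - {{a, b}}) a y)"
  using assms
proof (induction rule: conn_induct)
  case (step y z)
  show ?case
  proof (cases "{y, z} = {a, b}")
    case True
    then have "y = a \<and> z = b \<or> y = b \<and> z = a" by (auto simp: doubleton_eq_iff)
    then show ?thesis using step.IH by auto
  next
    case False
    then have "{y, z} \<in> F - {{a, b}}" using step(2) by auto
    then show ?thesis using step.IH conn_step[of "F - {{a, b}}"] by blast
  qed
qed auto

locale edge_order =
  fixes V :: "'a set" and E :: "'a set set" and lt :: "'a set \<Rightarrow> 'a set \<Rightarrow> bool"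
  assumes edge: "e \<in> E \<Longrightarrow> \<exists>x y. x \<in> V \<and> y \<in> V \<and> x \<noteq> y \<and> e = {x, y}"
    and lt_irrefl: "\<not> lt e e"
    and lt_trans: "lt e f \<Longrightarrow> lt f g \<Longrightarrow> lt e g"
    and lt_total: "e \<in> E \<Longrightarrow> f \<in> E \<Longrightarrow> e = f \<or> lt e f \<or> lt f e"
begin

text \<open>The free minimal spanning forest: an edge is discarded when it is the largest one in
  some cycle. This makes sense in infinite graphs and commutes with isomorphisms that respect the
  order.\<close>

definition mst :: "'a set set" where
  "mst = {e \<in> E. \<forall>x y. e = {x, y} \<longrightarrow> \<not> conn {f \<in> E. lt f e} x y}"

lemma finite_has_max:
  assumes "finite F" "F \<noteq> {}" "F \<subseteq> E"
  obtains m where "m \<in> F" "\<And>f. f \<in> F \<Longrightarrow> f = m \<or> lt f m"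
proof -
  have "\<exists>m\<in>F. \<forall>f\<in>F. f = m \<or> lt f m"
    using assms
  proof (induction F rule: finite_ne_induct)
    case (insert e F)
    then obtain m where m: "m \<in> F" "\<forall>f\<in>F. f = m \<or> lt f m" by auto
    consider "e = m" | "lt e m" | "lt m e" using lt_total[of e m] insert m by auto
    then show ?case
    proof cases
      case 3
      have "f = e \<or> lt f e" if "f \<in> insert e F" for f
        using m(2)[rule_format, of f] 3 lt_trans[of f m e] that by auto
      then show ?thesis by blast
    qed (use m in auto)
  qed auto
  then show thesis using that by blast
qed

text \<open>In a cycle of tree edges the remaining edges join the ends of the largest one, which
  would therefore have been discarded.\<close>

lemma mst_bridge:
  assumes e: "{x, y} \<in> mst"
  shows "\<not> conn (mst - {{x, y}}) x y"
proof
  assume "conn (mst - {{x, y}}) x y"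
  then have ex: "\<exists>F. F \<subseteq> mst - {{x, y}} \<and> finite F \<and> conn F x y" by (drule_tac conn_finite_subset) auto
  \<comment> \<open>Minimality ensures that each chosen edge is needed. After removing one of them,
    the rest together with xy joins its endpoints.\<close>
  define n where "n = (LEAST n. \<exists>F. F \<subseteq> mst - {{x, y}} \<and> finite F \<and> conn F x y \<and> card F = n)"
  have "\<exists>F. F \<subseteq> mst - {{x, y}} \<and> finite F \<and> conn F x y \<and> card F = n"
    unfolding n_def
  proof (rule LeastI_ex)
    obtain F where "F \<subseteq> mst - {{x, y}} \<and> finite F \<and> conn F x y" using ex by auto
    then show "\<exists>n F. F \<subseteq> mst - {{x, y}} \<and> finite F \<and> conn F x y \<and> card F = n"
      by (intro exI[of _ "card F"] exI[of _ F]) simp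
  qed
  then obtain F where F: "F \<subseteq> mst - {{x, y}}" "finite F" "conn F x y" "card F = n" by auto
  have min: "\<not> conn (F - {f}) x y" if "f \<in> F" for f
  proof
    assume "conn (F - {f}) x y"
    have "n \<le> card (F - {f})" unfolding n_def
    proof (rule Least_le)
      show "\<exists>F'. F' \<subseteq> mst - {{x, y}} \<and> finite F' \<and> conn F' x y \<and> card F' = card (F - {f})"
        using F(1,2) \<open>conn (F - {f}) x y\<close> by (intro exI[of _ "F - {f}"]) auto
    qed
    then show False using F that by (metis card_Diff1_less not_less)
  qed
  have sub: "insert {x, y} F \<subseteq> E" using F e by (auto simp: mst_def)
  obtain m where m: "m \<in> insert {x, y} F" "\<And>f. f \<in> insert {x, y} F \<Longrightarrow> f = m \<or> lt f m"
    using finite_has_max[of "insert {x, y} F"] F(2) sub by blast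
  show False
  proof (cases "m = {x, y}")
    case True
    have "F \<subseteq> {f \<in> E. lt f {x, y}}" using m True F sub by blast
    then have "conn {f \<in> E. lt f {x, y}} x y" by (rule conn_mono[OF F(3)])
    then show False using e by (auto simp: mst_def)
  next
    case False
    then have mF: "m \<in> F" using m by auto
    then have "m \<in> E" using sub by auto
    then obtain a b where ab: "m = {a, b}" using edge by blast
    let ?F = "F - {{a, b}}"
    have sub': "insert {x, y} ?F \<subseteq> {f \<in> E. lt f m}" using m sub ab False by blast
    have "(conn ?F x a \<and> conn ?F b y) \<or> (conn ?F x b \<and> conn ?F a y)"
      using conn_remove_edge[OF F(3), of a b] min[OF mF] ab by auto
    then have "conn (insert {x, y} ?F) a b"
    proof
      assume "conn ?F x a \<and> conn ?F b y"
      then have c: "conn ?F a x" "conn ?F y b" by (simp_all add: conn_commute)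
      have "conn (insert {x, y} ?F) a y" by (rule conn_step[OF conn_mono[OF c(1)]]) auto
      then show ?thesis by (rule conn_trans) (rule conn_mono[OF c(2)], blast)
    next
      assume "conn ?F x b \<and> conn ?F a y"
      then have c: "conn ?F a y" "conn ?F x b" by simp_all
      have "conn (insert {x, y} ?F) a x" by (rule conn_step[OF conn_mono[OF c(1)]]) (auto simp: insert_commute)
      then show ?thesis by (rule conn_trans) (rule conn_mono[OF c(2)], blast)
    qed
    then have "conn {f \<in> E. lt f m} a b" by (rule conn_mono) (rule sub')
    moreover have "m \<in> mst" using mF F by auto
    ultimately show False using ab by (auto simp: mst_def)
  qed
qed

text \<open>The hypothesis, that from x only finitely many vertices can be reached through smaller
  edges, takes the place of well-foundedness: a discarded edge is replaced by a path of smaller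
  edges, and this process stays in a finite set.\<close>

lemma mst_conn:
  assumes fin: "\<And>e x y. e \<in> E \<Longrightarrow> e = {x, y} \<Longrightarrow> \<exists>S. finite S \<and> x \<in> S \<and>
      (\<forall>f a b. f \<in> E \<longrightarrow> lt f e \<longrightarrow> f = {a, b} \<longrightarrow> a \<in> S \<longrightarrow> b \<in> S)"
    and xy: "{x, y} \<in> E"
  shows "conn mst x y"
proof -
  obtain S where S: "finite S" "x \<in> S" "\<And>f a b. f \<in> E \<Longrightarrow> lt f {x, y} \<Longrightarrow> f = {a, b} \<Longrightarrow> a \<in> S \<Longrightarrow> b \<in> S"
    using fin[OF xy refl] by blast
  \<comment> \<open>The edge xy itself is not among the smaller edges, so y may lie outside
    S.\<close>
  define S' where "S' = insert y S"
  have S': "finite S'" using S by (simp add: S'_def)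
  define below where "below e = {f \<in> E. f \<subseteq> S' \<and> lt f e}" for e
  have fb: "finite (below e)" for e
    by (rule finite_subset[of _ "Pow S'"]) (use S' in \<open>auto simp: below_def\<close>)
  have "conn mst a b" if "{a, b} \<in> E" "{a, b} = {x, y} \<or> (lt {a, b} {x, y} \<and> a \<in> S \<and> b \<in> S)" for a b
    using that
  proof (induction "card (below {a, b})" arbitrary: a b rule: less_induct)
    case less
    show ?case
    proof (cases "{a, b} \<in> mst")
      case True
      then show ?thesis by (rule conn_edge)
    next
      case False
      then obtain c d where cd: "{a, b} = {c, d}" "conn {f \<in> E. lt f {a, b}} c d"
        using less.prems by (auto simp: mst_def)
      then have c: "conn {f \<in> E. lt f {a, b}} a b" by (auto simp: doubleton_eq_iff conn_commute)
      have lt_xy: "lt f {x, y}" if "lt f {a, b}" for f using less.prems(2) that lt_trans by metis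
      have aS: "a \<in> S \<or> b \<in> S" using less.prems(2) S(2) by (auto simp: doubleton_eq_iff)
      have closed: "d \<in> S" if "f \<in> {f \<in> E. lt f {a, b}}" "f = {c, d}" "c \<in> S" for f c d
        using that S(3) lt_xy by blast
      have "b \<in> S" if "a \<in> S" by (rule conn_closed[OF c that]) (rule closed)
      moreover have "a \<in> S" if "b \<in> S" by (rule conn_closed[OF conn_sym[OF c] that]) (rule closed)
      ultimately have both: "a \<in> S \<and> b \<in> S" using aS by blast
      have "conn {e \<in> {f \<in> E. lt f {a, b}}. e \<subseteq> S} a b"
        by (rule conn_restrict[OF c]) (use both closed in blast)+
      then show ?thesis
      proof (rule conn_lift)
        fix c d assume cd: "{c, d} \<in> {e \<in> {f \<in> E. lt f {a, b}}. e \<subseteq> S}"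
        have "below {c, d} \<subset> below {a, b}"
        proof
          show "below {c, d} \<subseteq> below {a, b}" using cd lt_trans by (auto simp: below_def)
          have "{c, d} \<in> below {a, b}" using cd by (auto simp: below_def S'_def)
          moreover have "{c, d} \<notin> below {c, d}" using lt_irrefl by (auto simp: below_def)
          ultimately show "below {c, d} \<noteq> below {a, b}" by auto
        qed
        then have "card (below {c, d}) < card (below {a, b})" by (rule psubset_card_mono[OF fb])
        then show "conn mst c d" using cd lt_xy by (intro less.hyps) auto
      qed
    qed
  qed
  then show ?thesis using xy by blast
qed

end

section \<open>Infinite branches of a tree\<close>

definition branch :: "'a set \<Rightarrow> 'a set set \<Rightarrow> 'a \<Rightarrow> 'a \<Rightarrow> 'a set" where
  "branch V T x y = {w\<in>V. conn {e\<in>T. x \<notin> e} y w}"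

definition big :: "'a set \<Rightarrow> 'a set set \<Rightarrow> 'a \<Rightarrow> 'a set" where
  "big V T x = {y\<in>V. {x, y} \<in> T \<and> infinite (branch V T x y)}"

locale infinite_tree =
  fixes V :: "'a set" and T :: "'a set set"
  assumes T_edge: "e \<in> T \<Longrightarrow> \<exists>x y. x \<in> V \<and> y \<in> V \<and> x \<noteq> y \<and> e = {x, y}"
    and T_fin: "x \<in> V \<Longrightarrow> finite {y\<in>V. {x, y} \<in> T}"
    and T_conn: "x \<in> V \<Longrightarrow> y \<in> V \<Longrightarrow> conn T x y"
    and T_bridge: "{x, y} \<in> T \<Longrightarrow> \<not> conn (T - {{x, y}}) x y"
    and V_inf: "infinite V"
begin

abbreviation "br \<equiv> branch V T"
abbreviation "\<tau> \<equiv> big V T"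

lemma T_V [dest]: "{x, y} \<in> T \<Longrightarrow> x \<in> V \<and> y \<in> V \<and> x \<noteq> y"
  using T_edge[of "{x, y}"] by (auto simp: doubleton_eq_iff)

lemma acyclic:
  assumes "{x, y} \<in> T" "{x, z} \<in> T" "y \<noteq> z" shows "\<not> conn {e\<in>T. x \<notin> e} y z"
proof
  assume "conn {e\<in>T. x \<notin> e} y z"
  then have "conn (T - {{x, y}}) y z" by (rule conn_mono) auto
  moreover have "{z, x} \<in> T - {{x, y}}" using assms by (auto simp: doubleton_eq_iff insert_commute)
  ultimately have "conn (T - {{x, y}}) y x" by (rule conn_step)
  then show False using T_bridge[OF assms(1)] by (simp add: conn_commute)
qed

lemma br_self: "y \<in> V \<Longrightarrow> y \<in> br x y"
  by (simp add: branch_def)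

lemma br_not: "x \<noteq> y \<Longrightarrow> x \<notin> br x y"
proof
  assume "x \<noteq> y" "x \<in> br x y"
  then have c: "conn {e\<in>T. x \<notin> e} y x" by (simp add: branch_def)
  have "x \<in> - {x}" by (rule conn_closed[OF c]) (use \<open>x \<noteq> y\<close> in auto)
  then show False by simp
qed

lemma br_closed: "a \<in> br x y \<Longrightarrow> {a, b} \<in> T \<Longrightarrow> b \<noteq> x \<Longrightarrow> x \<noteq> y \<Longrightarrow> b \<in> br x y"
proof -
  assume a: "a \<in> br x y" "{a, b} \<in> T" "b \<noteq> x" "x \<noteq> y"
  have "a \<noteq> x" using br_not[OF a(4)] a(1) by auto
  then have "{a, b} \<in> {e\<in>T. x \<notin> e}" using a by auto
  then show "b \<in> br x y" using a conn_step[of "{e\<in>T. x \<notin> e}" y a b] by (auto simp: branch_def)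
qed

lemma br_disjoint:
  assumes "{x, y} \<in> T" "{x, z} \<in> T" "y \<noteq> z" shows "br x y \<inter> br x z = {}"
proof (rule equals0I)
  fix w assume "w \<in> br x y \<inter> br x z"
  then have "conn {e\<in>T. x \<notin> e} y w" "conn {e\<in>T. x \<notin> e} z w" by (simp_all add: branch_def)
  then have "conn {e\<in>T. x \<notin> e} y z" by (rule conn_trans[OF _ conn_sym])
  then show False using acyclic[OF assms] by simp
qed

lemma br_nested:
  assumes "{y, z} \<in> T" "{y, x} \<in> T" "z \<noteq> x" shows "br y z \<subseteq> br x y"
proof
  fix w assume w: "w \<in> br y z"
  have ne: "y \<noteq> z" "x \<noteq> y" using assms by auto
  have x: "x \<notin> br y z" using acyclic[OF assms] by (simp add: branch_def)
  have "conn {e\<in>T. y \<notin> e} z w" using w by (simp add: branch_def)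
  then have "conn {e\<in>{e\<in>T. y \<notin> e}. e \<subseteq> br y z} z w"
  proof (rule conn_restrict)
    show "z \<in> br y z" using assms by (auto intro: br_self)
    fix e a b assume "e \<in> {e\<in>T. y \<notin> e}" "e = {a, b}" "a \<in> br y z"
    then show "b \<in> br y z" using br_closed[of a y z b] ne by auto
  qed
  then have "conn {e\<in>T. x \<notin> e} z w" by (rule conn_mono) (use x in auto)
  moreover have "conn {e\<in>T. x \<notin> e} y z" by (rule conn_edge) (use assms ne in auto)
  ultimately have "conn {e\<in>T. x \<notin> e} y w" by (rule conn_trans[rotated])
  then show "w \<in> br x y" using w by (simp add: branch_def)
qed

lemma cover:
  assumes "x \<in> V" "w \<in> V" "w \<noteq> x" obtains y where "{x, y} \<in> T" "w \<in> br x y"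
proof -
  have "conn T x w" by (rule T_conn[OF assms(1,2)])
  then have "w = x \<or> (\<exists>y. {x, y} \<in> T \<and> conn {e\<in>T. x \<notin> e} y w)"
  proof (induction rule: conn_induct)
    case (step a b)
    show ?case
    proof (cases "a = x \<or> b = x")
      case True
      then show ?thesis using step(2) by (auto intro: exI[of _ b])
    next
      case False
      then obtain y where y: "{x, y} \<in> T" "conn {e\<in>T. x \<notin> e} y a" using step.IH by auto
      have "conn {e\<in>T. x \<notin> e} y b" by (rule conn_step[OF y(2)]) (use step(2) False in auto)
      then show ?thesis using y(1) by blast
    qed
  qed simp
  then show thesis using assms that by (auto simp: branch_def)
qed

lemma br_opposite:
  assumes "{x, y} \<in> T" shows "br x y \<inter> br y x = {}"
proof (rule equals0I)
  fix w assume w: "w \<in> br x y \<inter> br y x"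
  have ne: "x \<noteq> y" using assms by auto
  have "conn {e\<in>T. y \<notin> e} x w" using w by (simp add: branch_def)
  then have "w \<in> - br x y"
  proof (rule conn_closed)
    show "x \<in> - br x y" using br_not[OF ne] by simp
    fix e a b assume e: "e \<in> {e\<in>T. y \<notin> e}" "e = {a, b}" "a \<in> - br x y"
    show "b \<in> - br x y"
    proof
      assume b: "b \<in> br x y"
      show False
      proof (cases "a = x")
        case True
        then show False using acyclic[OF assms, of b] e b by (auto simp: branch_def)
      next
        case False
        then show False using br_closed[of b x y a] b e ne by (auto simp: insert_commute)
      qed
    qed
  qed
  then show False using w by simp
qed

lemma br_union:
  assumes "{x, y} \<in> T" shows "br x y \<union> br y x = V"
proof
  show "br x y \<union> br y x \<subseteq> V" by (auto simp: branch_def)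
  show "V \<subseteq> br x y \<union> br y x"
  proof
    fix w assume w: "w \<in> V"
    show "w \<in> br x y \<union> br y x"
    proof (cases "w = x")
      case True
      then show ?thesis using assms by (auto intro: br_self)
    next
      case False
      obtain z where z: "{x, z} \<in> T" "w \<in> br x z" by (rule cover[OF _ w False]) (use assms in auto)
      show ?thesis
      proof (cases "z = y")
        case False
        then show ?thesis using br_nested[OF z(1) assms False] z(2) by auto
      qed (use z in auto)
    qed
  qed
qed

lemma br_decompose:
  assumes "{x, y} \<in> T" shows "br x y = insert y (\<Union>z\<in>{z\<in>V. {y, z} \<in> T \<and> z \<noteq> x}. br y z)"
proof
  have yx: "{y, x} \<in> T" using assms by (simp add: insert_commute)
  show "br x y \<subseteq> insert y (\<Union>z\<in>{z\<in>V. {y, z} \<in> T \<and> z \<noteq> x}. br y z)"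
  proof
    fix w assume w: "w \<in> br x y"
    show "w \<in> insert y (\<Union>z\<in>{z\<in>V. {y, z} \<in> T \<and> z \<noteq> x}. br y z)"
    proof (cases "w = y")
      case False
      obtain z where z: "{y, z} \<in> T" "w \<in> br y z" by (rule cover[of y w]) (use w assms False in \<open>auto simp: branch_def\<close>)
      have "z \<noteq> x" using br_opposite[OF assms] w z by auto
      then show ?thesis using z by auto
    qed simp
  qed
  show "insert y (\<Union>z\<in>{z\<in>V. {y, z} \<in> T \<and> z \<noteq> x}. br y z) \<subseteq> br x y"
    using br_nested[OF _ yx] assms br_self[of y x] by auto
qed

lemma finite_\<tau>: "x \<in> V \<Longrightarrow> finite (\<tau> x)"
  by (rule finite_subset[OF _ T_fin]) (auto simp: big_def)

lemma \<tau>_iff: "y \<in> \<tau> x \<longleftrightarrow> {x, y} \<in> T \<and> infinite (br x y)"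
  by (auto simp: big_def)

text \<open>Seen from y, another infinite branch at x lies behind x.\<close>

lemma \<tau>_back:
  assumes "y \<in> \<tau> x" "z \<in> \<tau> x" "y \<noteq> z" shows "x \<in> \<tau> y"
proof -
  have "br x z \<subseteq> br y x" by (rule br_nested) (use assms in \<open>auto simp: \<tau>_iff\<close>)
  then show ?thesis using assms infinite_super by (auto simp: \<tau>_iff insert_commute)
qed

text \<open>An infinite branch splits at its first vertex into finitely many branches, one of which
  is infinite.\<close>

lemma \<tau>_forward:
  assumes "y \<in> \<tau> x" obtains z where "z \<in> \<tau> y" "z \<noteq> x"
proof -
  have e: "{x, y} \<in> T" "infinite (br x y)" using assms by (auto simp: \<tau>_iff)
  have "finite {z\<in>V. {y, z} \<in> T \<and> z \<noteq> x}" by (rule finite_subset[OF _ T_fin[of y]]) (use e in auto)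
  then obtain z where "{y, z} \<in> T" "z \<noteq> x" "infinite (br y z)"
    using e(2) unfolding br_decompose[OF e(1)] by auto
  then show thesis using that by (auto simp: \<tau>_iff)
qed

lemma \<tau>_nonempty:
  assumes "x \<in> V" shows "\<tau> x \<noteq> {}"
proof
  assume "\<tau> x = {}"
  then have "finite (br x y)" if "{x, y} \<in> T" for y using that by (auto simp: \<tau>_iff)
  then have "finite (insert x (\<Union>y\<in>{y\<in>V. {x, y} \<in> T}. br x y))" using T_fin[OF assms] by auto
  moreover have "V \<subseteq> insert x (\<Union>y\<in>{y\<in>V. {x, y} \<in> T}. br x y)"
    using cover[OF assms] by blast
  ultimately show False using V_inf finite_subset by blast
qed

text \<open>With edges oriented towards a fixed vertex r, each vertex has at most one outgoing edge.
  Hence W spans at most |W| edges, each of which is counted as two ordered pairs.\<close>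

lemma card_edges_within:
  assumes W: "finite W" "W \<subseteq> V" shows "card {(x, y)\<in>W \<times> W. {x, y} \<in> T} \<le> 2 * card W"
proof -
  obtain r where r: "r \<in> V" using V_inf by (metis ex_in_conv finite.emptyI)
  let ?A = "{(x, y)\<in>W \<times> W. {x, y} \<in> T \<and> r \<in> br x y}" and ?B = "{(x, y)\<in>W \<times> W. {x, y} \<in> T \<and> r \<in> br y x}"
  have "{(x, y)\<in>W \<times> W. {x, y} \<in> T} \<subseteq> ?A \<union> ?B" using br_union r by blast
  moreover have f: "finite ?A" "finite ?B" using W by (auto intro: finite_subset[of _ "W \<times> W"])
  ultimately have "card {(x, y)\<in>W \<times> W. {x, y} \<in> T} \<le> card ?A + card ?B"
    by (meson card_Un_le card_mono finite_UnI le_trans)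
  moreover have u: "y = y'" if "{x, y} \<in> T" "r \<in> br x y" "{x, y'} \<in> T" "r \<in> br x y'" for x y y'
    using br_disjoint[OF that(1,3)] that by auto
  have "card ?A \<le> card W"
    by (rule card_inj_on_le[of fst]) (use W u in \<open>auto simp: inj_on_def\<close>)
  moreover have "card ?B \<le> card W"
    by (rule card_inj_on_le[of snd]) (use W u in \<open>auto simp: inj_on_def insert_commute\<close>)
  ultimately show ?thesis by simp
qed

text \<open>Let D be the vertices of C with at least two infinite branches. An infinite branch at a
  vertex of D starts with a vertex of D or leaves C at once. Within D there are at most 2 |D| such
  directions, which is just what the subtraction of two accounts for.\<close>

lemma excess_branches:
  assumes C: "finite C" "C \<subseteq> V"
  shows "(\<Sum>x\<in>C. card (\<tau> x) - 2) \<le> (\<Sum>x\<in>C. card {y\<in>V. {x, y} \<in> T \<and> y \<notin> C})"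
proof -
  define D where "D = {x\<in>C. 2 \<le> card (\<tau> x)}"
  have D: "finite D" "D \<subseteq> V" "D \<subseteq> C" using C by (auto simp: D_def)
  \<comment> \<open>Seen from y, the way back to x is infinite because of a second branch at x, and
    the branch through y continues forward.\<close>
  have in_D: "y \<in> D" if D': "x \<in> D" "y \<in> \<tau> x" "y \<in> C" for x y
  proof -
    have "\<exists>z\<in>\<tau> x. z \<noteq> y"
    proof (rule ccontr)
      assume "\<not> ?thesis"
      then have "\<tau> x \<subseteq> {y}" by auto
      then have "card (\<tau> x) \<le> 1" using card_mono[of "{y}" "\<tau> x"] by simp
      then show False using D' by (simp add: D_def)
    qed
    then have x: "x \<in> \<tau> y" using \<tau>_back D' by metis
    obtain z where z: "z \<in> \<tau> y" "z \<noteq> x" by (rule \<tau>_forward[OF D'(2)])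
    have "card {x, z} \<le> card (\<tau> y)" using x z finite_\<tau>[of y] D' C by (intro card_mono) auto
    then show ?thesis using z D' by (simp add: D_def)
  qed
  let ?in = "{(x, y)\<in>D \<times> D. {x, y} \<in> T}" and ?out = "SIGMA x:C. {y\<in>V. {x, y} \<in> T \<and> y \<notin> C}"
  have fout: "finite {y\<in>V. {x, y} \<in> T \<and> y \<notin> C}" if "x \<in> C" for x
    by (rule finite_subset[OF _ T_fin[of x]]) (use that C in auto)
  have fin: "finite ?in" "finite ?out" using D C fout by (auto intro: finite_subset[of _ "D \<times> D"])
  have "(\<Sum>x\<in>D. card (\<tau> x)) = card (SIGMA x:D. \<tau> x)" using D finite_\<tau> by (subst card_SigmaI) auto
  also have "(SIGMA x:D. \<tau> x) \<subseteq> ?in \<union> ?out" using in_D D by (auto simp: \<tau>_iff)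
  then have "card (SIGMA x:D. \<tau> x) \<le> card ?in + card ?out"
    using fin by (meson card_Un_le card_mono finite_UnI le_trans)
  also have "\<dots> \<le> 2 * card D + card ?out" using card_edges_within[OF D(1,2)] by simp
  also have "card ?out = (\<Sum>x\<in>C. card {y\<in>V. {x, y} \<in> T \<and> y \<notin> C})" using C fout by (intro card_SigmaI) auto
  finally have le: "(\<Sum>x\<in>D. card (\<tau> x)) \<le> 2 * card D + (\<Sum>x\<in>C. card {y\<in>V. {x, y} \<in> T \<and> y \<notin> C})" .
  \<comment> \<open>Subtraction of naturals is truncated, so vertices outside of D contribute
    0.\<close>
  have "(\<Sum>x\<in>C. card (\<tau> x) - 2) = (\<Sum>x\<in>D. card (\<tau> x) - 2)"
    using C by (intro sum.mono_neutral_right) (auto simp: D_def)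
  moreover have "(\<Sum>x\<in>D. card (\<tau> x) - 2) + 2 * card D = (\<Sum>x\<in>D. card (\<tau> x))"
  proof -
    have "(\<Sum>x\<in>D. card (\<tau> x)) = (\<Sum>x\<in>D. (card (\<tau> x) - 2) + 2)" by (rule sum.cong) (auto simp: D_def)
    also have "\<dots> = (\<Sum>x\<in>D. card (\<tau> x) - 2) + (\<Sum>x\<in>D. 2)" by (rule sum.distrib)
    finally show ?thesis by simp
  qed
  ultimately show ?thesis using le by simp
qed

lemma T_tree: "tree (V, T)"
proof -
  have s: "e \<subseteq> V" "card e = 2" if "e \<in> T" for e using T_edge[OF that] by auto
  have e: "{e \<in> T. e \<subseteq> V} = T" using s by auto
  have "\<not> cycle_in (V, T) xs" for xs
  proof
    assume c: "cycle_in (V, T) xs"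
    then have l: "length xs \<ge> 3" "distinct xs" "successively (\<lambda>u v. {u, v} \<in> T) xs" "{last xs, hd xs} \<in> T"
      by (auto simp: cycle_in_def adjacent_def[abs_def])
    then obtain x ys where xs: "xs = x # ys" by (cases xs) auto
    then have ys: "length ys \<ge> 2" "distinct ys" "x \<notin> set ys" "successively (\<lambda>u v. {u, v} \<in> T) ys" "ys \<noteq> []"
        "{x, hd ys} \<in> T" "{last ys, x} \<in> T"
      using l by (auto simp: successively_Cons split: if_splits)
    have "conn {e\<in>T. x \<notin> e} (hd ys) (last ys)"
      using ys(5,3,4)
    proof (induction ys rule: list_nonempty_induct)
      case (cons y ys)
      then have "{y, hd ys} \<in> {e\<in>T. x \<notin> e}" by (cases ys) auto
      moreover have "conn {e\<in>T. x \<notin> e} (hd ys) (last ys)" using cons by (cases ys) auto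
      ultimately show ?case using cons by (auto intro: conn_trans conn_edge)
    qed simp
    moreover have "hd ys \<noteq> last ys" using ys(1,2) by (cases ys) (auto simp: last_in_set)
    ultimately show False using acyclic[of x "hd ys" "last ys"] ys by (simp add: insert_commute)
  qed
  then show ?thesis
    using V_inf s T_conn by (auto simp: tree_def simple_graph_def connected_graph_conn e)
qed

lemma ray_\<tau>:
  assumes "r \<in> rays_from (V, T) v" shows "r (Suc n) \<in> \<tau> (r n)"
proof -
  have r: "inj r" "\<And>n. {r n, r (Suc n)} \<in> T" using assms by (auto simp: rays_from_def adjacent_def)
  have "r (Suc n + k) \<in> br (r n) (r (Suc n))" for k
  proof (induction k)
    case 0
    show ?case using r(2)[of n] by (auto intro: br_self)
  next
    case (Suc k)
    show ?case
      by (rule br_closed[OF Suc]) (use r(2)[of "Suc n + k"] r(2)[of n] r(1) in \<open>auto dest: injD\<close>)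
  qed
  then have "range (\<lambda>k. r (Suc n + k)) \<subseteq> br (r n) (r (Suc n))" by auto
  moreover have "infinite (range (\<lambda>k. r (Suc n + k)))"
    by (intro range_inj_infinite injI) (metis r(1) injD add_left_cancel)
  ultimately show ?thesis using r(2)[of n] infinite_super by (auto simp: \<tau>_iff)
qed

text \<open>Where c leaves the common part it provides an infinite branch that lies behind every
  later vertex of a. At the vertex where a and b finally separate there are thus three infinite
  branches: those of a, of b, and the one back.\<close>

lemma no_three_rays:
  assumes small: "\<And>x. x \<in> V \<Longrightarrow> card (\<tau> x) \<le> 2"
    and a: "a \<in> rays_from (V, T) v" and b: "b \<in> rays_from (V, T) v" and c: "c \<in> rays_from (V, T) v"
    and n: "\<And>j. j < n \<Longrightarrow> a j = b j \<and> a j = c j" "a n = b n" "c n \<noteq> a n" and ab: "a \<noteq> b"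
  shows False
proof -
  have three: False if "x \<in> V" "p \<in> \<tau> x" "q \<in> \<tau> x" "s \<in> \<tau> x" "p \<noteq> q" "p \<noteq> s" "q \<noteq> s" for x p q s
  proof -
    have "card {p, q, s} \<le> card (\<tau> x)" using that finite_\<tau>[OF that(1)] by (intro card_mono) auto
    then show False using small[OF that(1)] that by simp
  qed
  have inj_ab: "a i = a j \<longleftrightarrow> i = j" "b i = b j \<longleftrightarrow> i = j" for i j using a b by (auto simp: rays_from_def dest: injD)
  have aV: "a i \<in> V" for i using a by (auto simp: rays_from_def)
  have "a 0 = c 0" using a c by (auto simp: rays_from_def)
  then obtain n' where n': "n = Suc n'" using n(3) by (cases n) auto
  define m where "m = (LEAST m. a m \<noteq> b m)"
  have m: "a m \<noteq> b m" unfolding m_def by (rule LeastI_ex) (use ab in auto)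
  have m': "a j = b j" if "j < m" for j using not_less_Least[of j "\<lambda>m. a m \<noteq> b m"] that unfolding m_def by auto
  have "n < m"
    using m n by (metis linorder_neqE_nat)
  \<comment> \<open>The way back is infinite from the separation of c on, and this propagates along
    a.\<close>
  have bk: "a j \<in> \<tau> (a (Suc j))" if "n' \<le> j" for j
    using that
  proof (induction rule: dec_induct)
    case base
    have "c n \<in> \<tau> (a n')" using ray_\<tau>[OF c, of n'] n(1)[of n'] n' by (metis lessI)
    then show ?case using \<tau>_back[OF ray_\<tau>[OF a, of n']] n(3) n' by metis
  next
    case (step j)
    then show ?case using \<tau>_back[OF ray_\<tau>[OF a, of "Suc j"] step.IH] inj_ab by simp
  qed
  obtain k where k: "m = Suc (Suc k)" "n' \<le> k" using \<open>n < m\<close> n' by (metis Suc_le_D Suc_le_mono less_eq_Suc_le)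
  have "b m \<in> \<tau> (a (Suc k))" using ray_\<tau>[OF b, of "Suc k"] m'[of "Suc k"] k by simp
  moreover have "a m \<in> \<tau> (a (Suc k))" using ray_\<tau>[OF a, of "Suc k"] k by simp
  moreover have "a k \<in> \<tau> (a (Suc k))" using bk k by simp
  moreover have "a k \<noteq> a m" "a k \<noteq> b m" using inj_ab m'[of k] k by auto
  ultimately show False using three[OF aV, of "b m" "Suc k" "a m" "a k"] m by auto
qed

text \<open>At the first index where three rays do not all agree, either exactly two of them still
  agree, or all three separate at one vertex, which then has three infinite branches.\<close>

lemma rays_le_2:
  assumes small: "\<And>x. x \<in> V \<Longrightarrow> card (\<tau> x) \<le> 2"
  shows "finite (rays_from (V, T) v) \<and> card (rays_from (V, T) v) \<le> 2"
proof (rule ccontr)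
  let ?R = "rays_from (V, T) v"
  assume "\<not> (finite ?R \<and> card ?R \<le> 2)"
  then have "\<exists>B. finite B \<and> card B = 3 \<and> B \<subseteq> ?R"
  proof (cases "finite ?R")
    case True
    then have "3 \<le> card ?R" using \<open>\<not> (finite ?R \<and> card ?R \<le> 2)\<close> by simp
    then obtain B where "B \<subseteq> ?R" "card B = 3" "finite B" by (rule obtain_subset_with_card_n)
    then show ?thesis by blast
  qed (rule infinite_arbitrarily_large)
  then obtain a b c where abc: "a \<in> ?R" "b \<in> ?R" "c \<in> ?R" "a \<noteq> b" "a \<noteq> c" "b \<noteq> c"
    by (auto simp: card_3_iff)
  define n where "n = (LEAST n. \<not> (a n = b n \<and> a n = c n))"
  have "\<exists>n. \<not> (a n = b n \<and> a n = c n)" using abc(4) by auto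
  then have n: "\<not> (a n = b n \<and> a n = c n)" unfolding n_def by (rule LeastI_ex)
  have n': "a j = b j \<and> a j = c j" if "j < n" for j
    using not_less_Least[of j "\<lambda>n. \<not> (a n = b n \<and> a n = c n)"] that unfolding n_def by auto
  consider "a n = b n" "c n \<noteq> a n" | "a n = c n" "b n \<noteq> a n" | "b n = c n" "a n \<noteq> b n"
    | "a n \<noteq> b n" "a n \<noteq> c n" "b n \<noteq> c n" using n by metis
  then show False
  proof cases
    case 1
    then show False using no_three_rays[OF small abc(1,2,3), of n] n' abc(4) by blast
  next
    case 2
    then show False using no_three_rays[OF small abc(1,3,2), of n] n' abc(5) by blast
  next
    case 3
    then show False using no_three_rays[OF small abc(2,3,1), of n] n' abc(6) by metis
  next
    case 4
    have "a 0 = b 0" using abc by (auto simp: rays_from_def)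
    then obtain k where k: "n = Suc k" using 4 by (cases n) auto
    have "a n \<in> \<tau> (a k)" "b n \<in> \<tau> (a k)" "c n \<in> \<tau> (a k)"
      using ray_\<tau>[OF abc(1), of k] ray_\<tau>[OF abc(2), of k] ray_\<tau>[OF abc(3), of k] n'[of k] k by auto
    moreover have aV: "a k \<in> V" using abc(1) by (auto simp: rays_from_def)
    ultimately have "card {a n, b n, c n} \<le> card (\<tau> (a k))" using finite_\<tau>[OF aV] by (intro card_mono) auto
    then show False using small[OF aV] 4 by simp
  qed
qed

lemma num_ends_le_2:
  assumes "\<And>x. x \<in> V \<Longrightarrow> card (\<tau> x) \<le> 2" shows "num_ends (V, T) \<le> 2"
  using rays_le_2[OF assms] by (simp add: num_ends_def Let_def numeral_eq_enat)

end

section \<open>Double rays in the cube of a tree\<close>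

text \<open>Let \<open>T\<close> be a tree in which every vertex has one or two infinite branches. The other
  neighbours of \<open>v\<close> are its children, and the block of \<open>v\<close> consists of \<open>v\<close> and its finite
  branches. Traversing blocks recursively from \<open>v\<close> to its last child (in the order of labels),
  where the blocks of the children are traversed backwards, gives a path with steps of length at most
  three, and these paths fit together to a double ray. Each vertex \<open>v\<close> gets one neighbour \<open>S\<close> outside
  of its block, and one further neighbour \<open>I\<close>, which lies inside its block unless the
  block is trivial. \<open>E\<close> is the neighbour outside of the block of its other end vertex. If
  \<open>v\<close> has two infinite branches, then the one with the smaller label is attached to \<open>v\<close>, the other one to
  the other end vertex of the block.\<close>

definition highest :: "('a \<Rightarrow> real) \<Rightarrow> 'a set \<Rightarrow> 'a \<Rightarrow> bool" where
  "highest l A w \<longleftrightarrow> w \<in> A \<and> (\<forall>z\<in>A. l z \<le> l w)"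

definition lowest :: "('a \<Rightarrow> real) \<Rightarrow> 'a set \<Rightarrow> 'a \<Rightarrow> bool" where
  "lowest l A w \<longleftrightarrow> w \<in> A \<and> (\<forall>z\<in>A. l w \<le> l z)"

definition children :: "'a set \<Rightarrow> 'a set set \<Rightarrow> 'a \<Rightarrow> 'a set" where
  "children V T v = {y\<in>V. {v, y} \<in> T \<and> \<not> infinite (branch V T v y)}"

text \<open>Says that \<open>p\<close> is the parent of \<open>v\<close> (\<open>ch_dang\<close>).
  Vertices without a parent form the trunk and have two infinite branches.\<close>

definition dangling :: "'a set \<Rightarrow> 'a set set \<Rightarrow> 'a \<Rightarrow> 'a \<Rightarrow> bool" where
  "dangling V T v p \<longleftrightarrow> p \<in> big V T v \<and> (\<forall>z\<in>big V T v. z = p)"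

text \<open>With children c1, ..., ck in increasing order of labels, the path of a block reads: v,
  the block of c1 from its end to c1, and so on, finally the block of ck from its end to ck. Hence
  it ends in ck, or in v if there are no children.\<close>

definition is_end :: "'a set \<Rightarrow> 'a set set \<Rightarrow> ('a \<Rightarrow> real) \<Rightarrow> 'a \<Rightarrow> 'a \<Rightarrow> bool" where
  "is_end V T l v w \<longleftrightarrow> ((\<exists>z\<in>V. z \<in> children V T v) \<and> highest l (children V T v) w) \<or>
     (\<not> (\<exists>z\<in>V. z \<in> children V T v) \<and> w = v)"

definition is_slot :: "'a set \<Rightarrow> 'a set set \<Rightarrow> ('a \<Rightarrow> real) \<Rightarrow> 'a \<Rightarrow> 'a \<Rightarrow> 'a \<Rightarrow> bool" where
  "is_slot V T l t t' w \<longleftrightarrow> (lowest l (big V T t) t' \<and> w = t) \<or> (\<not> lowest l (big V T t) t' \<and> is_end V T l t w)"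

text \<open>In the path of the parent, the block of a child comes right after the preceding sibling,
  or after the parent itself for the first child. On the trunk, E points to the infinite branch with
  the larger label.\<close>

definition is_E :: "'a set \<Rightarrow> 'a set set \<Rightarrow> ('a \<Rightarrow> real) \<Rightarrow> 'a \<Rightarrow> 'a \<Rightarrow> bool" where
  "is_E V T l v w \<longleftrightarrow>
     (\<exists>p\<in>V. dangling V T v p \<and> (highest l {z\<in>children V T p. l z < l v} w \<or>
        (\<not> (\<exists>z\<in>V. z \<in> children V T p \<and> l z < l v) \<and> w = p))) \<or>
     (\<not> (\<exists>p\<in>V. dangling V T v p) \<and> (\<exists>t\<in>V. highest l (big V T v) t \<and> is_slot V T l t v w))"

text \<open>The path of the parent continues after a child with the end of the next sibling; after
  the last child it leaves the parent's block, so the neighbour is E of the parent. On the trunk, S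
  points to the infinite branch with the smaller label.\<close>

definition is_S :: "'a set \<Rightarrow> 'a set set \<Rightarrow> ('a \<Rightarrow> real) \<Rightarrow> 'a \<Rightarrow> 'a \<Rightarrow> bool" where
  "is_S V T l v w \<longleftrightarrow>
     (\<exists>p\<in>V. dangling V T v p \<and> ((\<exists>u\<in>V. lowest l {z\<in>children V T p. l v < l z} u \<and> is_end V T l u w) \<or>
        (\<not> (\<exists>z\<in>V. z \<in> children V T p \<and> l v < l z) \<and> is_E V T l p w))) \<or>
     (\<not> (\<exists>p\<in>V. dangling V T v p) \<and> (\<exists>t\<in>V. lowest l (big V T v) t \<and> is_slot V T l t v w))"

definition is_I :: "'a set \<Rightarrow> 'a set set \<Rightarrow> ('a \<Rightarrow> real) \<Rightarrow> 'a \<Rightarrow> 'a \<Rightarrow> bool" where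
  "is_I V T l v w \<longleftrightarrow> (\<exists>u\<in>V. lowest l (children V T v) u \<and> is_end V T l u w) \<or>
     (\<not> (\<exists>z\<in>V. z \<in> children V T v) \<and> is_E V T l v w)"

definition double_ray_edges :: "'a set \<Rightarrow> 'a set set \<Rightarrow> ('a \<Rightarrow> real) \<Rightarrow> 'a set set" where
  "double_ray_edges V T l = {{u, w} | u w. u \<in> V \<and> w \<in> V \<and> (is_S V T l u w \<or> is_I V T l u w)}"

lemma highest_exists: "finite A \<Longrightarrow> A \<noteq> {} \<Longrightarrow> \<exists>w. highest l A w"
proof (induction A rule: finite_ne_induct)
  case (insert x A)
  then obtain w where w: "highest l A w" by blast
  show ?case
  proof (cases "l x \<le> l w")
    case True
    then have "highest l (insert x A) w" using w by (auto simp: highest_def)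
    then show ?thesis ..
  next
    case False
    then have "highest l (insert x A) x" using w by (force simp: highest_def)
    then show ?thesis ..
  qed
qed (auto simp: highest_def)

lemma lowest_highest: "lowest l A w \<longleftrightarrow> highest (\<lambda>x. - l x) A w"
  by (simp add: lowest_def highest_def)

lemma lowest_exists: "finite A \<Longrightarrow> A \<noteq> {} \<Longrightarrow> \<exists>w. lowest l A w"
  unfolding lowest_highest by (rule highest_exists)

locale small_tree = infinite_tree V T for V :: "'a set" and T +
  fixes l :: "'a \<Rightarrow> real"
  assumes \<tau>_card: "x \<in> V \<Longrightarrow> card (\<tau> x) \<le> 2"
    and l_inj: "x \<in> V \<Longrightarrow> y \<in> V \<Longrightarrow> l x = l y \<Longrightarrow> x = y"
begin

abbreviation "ch \<equiv> children V T"
abbreviation "dang \<equiv> dangling V T"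

lemma ch_sub: "ch v \<subseteq> V"
  by (auto simp: children_def)

lemma \<tau>_sub: "\<tau> v \<subseteq> V"
  by (auto simp: big_def)

lemma finite_ch: "v \<in> V \<Longrightarrow> finite (ch v)"
  by (rule finite_subset[OF _ T_fin]) (auto simp: children_def)

lemma ch_edge: "y \<in> ch v \<Longrightarrow> {v, y} \<in> T"
  by (simp add: children_def)

lemma highest_unique: "highest l A v \<Longrightarrow> highest l A w \<Longrightarrow> A \<subseteq> V \<Longrightarrow> v = w"
  using l_inj[of v w] unfolding highest_def by (meson order_antisym subsetD)

lemma lowest_unique: "lowest l A v \<Longrightarrow> lowest l A w \<Longrightarrow> A \<subseteq> V \<Longrightarrow> v = w"
  using l_inj[of v w] unfolding lowest_def by (meson order_antisym subsetD)

lemma nbr_cases: "{v, y} \<in> T \<Longrightarrow> y \<in> ch v \<or> y \<in> \<tau> v"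
  by (auto simp: children_def big_def)

lemma ch_not_\<tau>: "y \<in> ch v \<Longrightarrow> y \<notin> \<tau> v"
  by (auto simp: children_def big_def)

lemma dang_iff: "dang v p \<longleftrightarrow> \<tau> v = {p}"
  by (auto simp: dangling_def)

text \<open>The part behind a child is finite, so the way to the parent is its only infinite branch;
  conversely a vertex with a single infinite branch has only finitely much behind it.\<close>

lemma ch_dang: "p \<in> V \<Longrightarrow> v \<in> ch p \<longleftrightarrow> v \<in> V \<and> dang v p"
proof
  assume p: "p \<in> V" and v: "v \<in> ch p"
  then have e: "{p, v} \<in> T" "finite (br p v)" "v \<in> V" by (auto simp: children_def)
  have "infinite (br v p)" using br_union[OF e(1)] V_inf e(2) by (metis finite_UnI)
  then have "p \<in> \<tau> v" using e(1) by (simp add: \<tau>_iff insert_commute)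
  moreover have "z = p" if "z \<in> \<tau> v" for z
  proof (rule ccontr)
    assume "z \<noteq> p"
    then have "br v z \<subseteq> br p v" using that e(1) by (intro br_nested) (auto simp: \<tau>_iff insert_commute)
    then show False using e(2) that finite_subset by (auto simp: \<tau>_iff)
  qed
  ultimately show "v \<in> V \<and> dang v p" unfolding dangling_def using e(3) by blast
next
  assume p: "p \<in> V" and v: "v \<in> V \<and> dang v p"
  then have t: "\<tau> v = {p}" by (simp add: dang_iff)
  then have e: "{p, v} \<in> T" by (auto simp: \<tau>_iff insert_commute)
  have "finite (br v z)" if "z \<in> V" "{v, z} \<in> T" "z \<noteq> p" for z
  proof (rule ccontr)
    assume "infinite (br v z)"
    then have "z \<in> \<tau> v" using that by (simp add: \<tau>_iff)
    then show False using t that by auto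
  qed
  moreover have "finite {z\<in>V. {v, z} \<in> T \<and> z \<noteq> p}" by (rule finite_subset[OF _ T_fin[of v]]) (use v in auto)
  ultimately have "finite (br p v)" unfolding br_decompose[OF e] by auto
  then show "v \<in> ch p" using e v by (simp add: children_def)
qed

lemma trunk_card: "v \<in> V \<Longrightarrow> \<not> (\<exists>p\<in>V. dang v p) \<Longrightarrow> card (\<tau> v) = 2"
proof -
  assume v: "v \<in> V" "\<not> (\<exists>p\<in>V. dang v p)"
  have "card (\<tau> v) \<noteq> 0" using \<tau>_nonempty[OF v(1)] finite_\<tau>[OF v(1)] by auto
  moreover have "card (\<tau> v) \<noteq> 1"
  proof
    assume "card (\<tau> v) = 1"
    then obtain p where "\<tau> v = {p}" by (auto simp: card_1_singleton_iff)
    then show False using v(2) \<tau>_sub[of v] by (auto simp: dang_iff)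
  qed
  ultimately show ?thesis using \<tau>_card[OF v(1)] by linarith
qed

text \<open>The trunk is closed under following infinite branches: \<open>\<tau>_back\<close> gives
  the branch back to v, and \<open>\<tau>_forward\<close> a second one.\<close>

lemma trunk_nbr:
  assumes v: "v \<in> V" "\<not> (\<exists>p\<in>V. dang v p)" and t: "t \<in> \<tau> v"
  shows "v \<in> \<tau> t" "t \<in> V" "\<not> (\<exists>p\<in>V. dang t p)"
proof -
  obtain s where s: "s \<in> \<tau> v" "s \<noteq> t"
    using trunk_card[OF v] t by (metis card_2_iff insert_iff)
  show vt: "v \<in> \<tau> t" using \<tau>_back[OF t s(1)] s(2) by auto
  obtain z where z: "z \<in> \<tau> t" "z \<noteq> v" by (rule \<tau>_forward[OF t])
  show "t \<in> V" using t \<tau>_sub by auto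
  show "\<not> (\<exists>p\<in>V. dang t p)" using vt z unfolding dangling_def by metis
qed

lemma trunk_two:
  assumes v: "v \<in> V" "\<not> (\<exists>p\<in>V. dang v p)"
  obtains a b where "\<tau> v = {a, b}" "l a < l b" "lowest l (\<tau> v) a" "highest l (\<tau> v) b" "a \<in> V" "b \<in> V"
proof -
  obtain a b where ab: "\<tau> v = {a, b}" "a \<noteq> b" using trunk_card[OF v] by (auto simp: card_2_iff)
  have V: "a \<in> V" "b \<in> V" using \<tau>_sub[of v] ab by auto
  consider "l a < l b" | "l b < l a" using l_inj[OF V] ab by fastforce
  then show thesis
  proof cases
    case 1
    then show thesis using ab V by (intro that[of a b]) (auto simp: lowest_def highest_def)
  next
    case 2
    then show thesis using ab V by (intro that[of b a]) (auto simp: lowest_def highest_def)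
  qed
qed

definition en :: "'a \<Rightarrow> 'a" where "en v = (THE w. is_end V T l v w)"
definition sl :: "'a \<Rightarrow> 'a \<Rightarrow> 'a" where "sl t t' = (if lowest l (\<tau> t) t' then t else en t)"
definition Ef :: "'a \<Rightarrow> 'a" where "Ef v = (THE w. is_E V T l v w)"
definition Sf :: "'a \<Rightarrow> 'a" where "Sf v = (THE w. is_S V T l v w)"
definition Jf :: "'a \<Rightarrow> 'a" where "Jf v = (THE w. is_I V T l v w)"

lemma ch_empty: "ch v = {} \<longleftrightarrow> \<not> (\<exists>z\<in>V. z \<in> ch v)"
  using ch_sub by blast

lemma en_props:
  assumes "v \<in> V"
  shows "is_end V T l v w \<longleftrightarrow> w = en v" "ch v = {} \<Longrightarrow> en v = v" "ch v \<noteq> {} \<Longrightarrow> highest l (ch v) (en v)"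
proof -
  have "\<exists>x. \<forall>w. is_end V T l v w \<longleftrightarrow> w = x"
  proof (cases "ch v = {}")
    case True
    then show ?thesis by (intro exI[of _ v]) (simp add: is_end_def)
  next
    case False
    obtain x where x: "highest l (ch v) x" using highest_exists[OF finite_ch[OF assms] False, of l] by (elim exE)
    have "is_end V T l v w \<longleftrightarrow> w = x" for w
    proof
      assume "is_end V T l v w"
      then have "highest l (ch v) w" using False unfolding is_end_def ch_empty[symmetric] by simp
      then show "w = x" by (rule highest_unique[OF _ x ch_sub])
    qed (use x False in \<open>simp add: is_end_def ch_empty\<close>)
    then show ?thesis by auto
  qed
  then obtain x where x: "\<And>w. is_end V T l v w \<longleftrightarrow> w = x" by auto
  have "en v = x" unfolding en_def by (rule the_equality) (simp_all add: x)
  then show iff: "is_end V T l v w \<longleftrightarrow> w = en v" for w using x by simp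
  have e: "is_end V T l v (en v)" using iff by simp
  show "ch v = {} \<Longrightarrow> en v = v" "ch v \<noteq> {} \<Longrightarrow> highest l (ch v) (en v)"
    using e unfolding is_end_def ch_empty[symmetric] by auto
qed

lemma en_cases:
  assumes "v \<in> V" obtains "en v = v" "ch v = {}" | "en v \<in> ch v" "highest l (ch v) (en v)"
  using en_props(2,3)[OF assms] by (cases "ch v = {}") (auto simp: highest_def)

lemma slot_iff: "t \<in> V \<Longrightarrow> is_slot V T l t t' w \<longleftrightarrow> w = sl t t'"
  by (auto simp: is_slot_def sl_def en_props(1))

lemma dang_unique: "dang v p \<Longrightarrow> dang v q \<Longrightarrow> p = q"
  by (auto simp: dangling_def)

lemma siblings_sub: "{z\<in>ch p. Q z} \<subseteq> V" "finite {z\<in>ch p. Q z}" if "p \<in> V"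
  using ch_sub[of p] finite_ch[OF that] by auto

lemma lowest_sibling: "p \<in> V \<Longrightarrow> {z\<in>ch p. l v < l z} \<noteq> {} \<Longrightarrow> \<exists>u. lowest l {z\<in>ch p. l v < l z} u"
  by (rule lowest_exists[OF siblings_sub(2)])

lemma highest_sibling: "p \<in> V \<Longrightarrow> {z\<in>ch p. l z < l v} \<noteq> {} \<Longrightarrow> \<exists>u. highest l {z\<in>ch p. l z < l v} u"
  by (rule highest_exists[OF siblings_sub(2)])

text \<open>The three situations in \<open>is_E\<close> exclude each other, and each determines the
  neighbour because labels are injective; so the relation is the graph of \<open>Ef\<close>.\<close>

lemma E_props:
  assumes "v \<in> V"
  shows "is_E V T l v w \<longleftrightarrow> w = Ef v"
    "\<And>p. p \<in> V \<Longrightarrow> dang v p \<Longrightarrow> {z\<in>ch p. l z < l v} = {} \<Longrightarrow> Ef v = p"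
    "\<And>p. p \<in> V \<Longrightarrow> dang v p \<Longrightarrow> {z\<in>ch p. l z < l v} \<noteq> {} \<Longrightarrow> highest l {z\<in>ch p. l z < l v} (Ef v)"
    "\<And>t. \<not> (\<exists>p\<in>V. dang v p) \<Longrightarrow> highest l (\<tau> v) t \<Longrightarrow> Ef v = sl t v"
proof -
  have emp: "{z\<in>ch p. l z < l v} = {} \<longleftrightarrow> \<not> (\<exists>z\<in>V. z \<in> ch p \<and> l z < l v)" for p
    using ch_sub by blast
  have d1: "is_E V T l v w \<longleftrightarrow> w = p" if "p \<in> V" "dang v p" "{z\<in>ch p. l z < l v} = {}" for p w
  proof -
    have "\<not> highest l {z\<in>ch p. l z < l v} u" for u unfolding that(3) by (simp add: highest_def)
    then have "is_E V T l v w \<longleftrightarrow> (\<exists>q\<in>V. q = p \<and> w = p)"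
      unfolding is_E_def using that dang_unique[OF that(2)] emp[of p] by (metis (no_types, lifting))
    then show ?thesis using that by simp
  qed
  have d2: "is_E V T l v w \<longleftrightarrow> w = u" if "p \<in> V" "dang v p" "highest l {z\<in>ch p. l z < l v} u" for p u w
  proof -
    have ne: "{z\<in>ch p. l z < l v} \<noteq> {}" using that(3) by (auto simp: highest_def)
    have uq: "u' = u" if "highest l {z\<in>ch p. l z < l v} u'" for u'
      using highest_unique[OF that \<open>highest l {z\<in>ch p. l z < l v} u\<close> siblings_sub(1)[OF \<open>p \<in> V\<close>]] .
    show ?thesis
      unfolding is_E_def using that uq ne dang_unique[OF that(2)] emp[of p] by (metis (no_types, lifting))
  qed
  have d3: "is_E V T l v w \<longleftrightarrow> w = sl t v" if "\<not> (\<exists>p\<in>V. dang v p)" "highest l (\<tau> v) t" for t w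
  proof -
    have t: "t \<in> V" using that(2) \<tau>_sub[of v] by (auto simp: highest_def)
    have uq: "t' = t" if "highest l (\<tau> v) t'" for t'
      using highest_unique[OF that \<open>highest l (\<tau> v) t\<close> \<tau>_sub] .
    show ?thesis
      using that t uq slot_iff[OF t] unfolding is_E_def by (metis (no_types, lifting))
  qed
  have "\<exists>x. \<forall>w. is_E V T l v w \<longleftrightarrow> w = x"
  proof (cases "\<exists>p\<in>V. dang v p")
    case True
    then obtain p where p: "p \<in> V" "dang v p" by auto
    show ?thesis
    proof (cases "{z\<in>ch p. l z < l v} = {}")
      case True
      then show ?thesis using d1[OF p] by auto
    next
      case False
      obtain u where "highest l {z\<in>ch p. l z < l v} u" using highest_sibling[OF p(1) False] by (elim exE)
      then show ?thesis using d2[OF p] by auto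
    qed
  next
    case False
    obtain a b where "highest l (\<tau> v) b" by (rule trunk_two[OF assms False])
    then show ?thesis using d3[OF False] by auto
  qed
  then obtain x where x: "\<And>w. is_E V T l v w \<longleftrightarrow> w = x" by auto
  have "Ef v = x" unfolding Ef_def by (rule the_equality) (simp_all add: x)
  then show iff: "is_E V T l v w \<longleftrightarrow> w = Ef v" for w using x by simp
  show "Ef v = p" if "p \<in> V" "dang v p" "{z\<in>ch p. l z < l v} = {}" for p
    using d1[OF that, of "Ef v"] iff by simp
  show "highest l {z\<in>ch p. l z < l v} (Ef v)" if p: "p \<in> V" "dang v p" "{z\<in>ch p. l z < l v} \<noteq> {}" for p
  proof -
    obtain u where u: "highest l {z\<in>ch p. l z < l v} u" using highest_sibling[OF p(1,3)] by (elim exE)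
    then show ?thesis using d2[OF p(1,2) u, of "Ef v"] iff by simp
  qed
  show "Ef v = sl t v" if "\<not> (\<exists>p\<in>V. dang v p)" "highest l (\<tau> v) t" for t
    using d3[OF that, of "Ef v"] iff by simp
qed

lemma S_props:
  assumes "v \<in> V"
  shows "is_S V T l v w \<longleftrightarrow> w = Sf v"
    "\<And>p. p \<in> V \<Longrightarrow> dang v p \<Longrightarrow> {z\<in>ch p. l v < l z} = {} \<Longrightarrow> Sf v = Ef p"
    "\<And>p u. p \<in> V \<Longrightarrow> dang v p \<Longrightarrow> lowest l {z\<in>ch p. l v < l z} u \<Longrightarrow> Sf v = en u"
    "\<And>t. \<not> (\<exists>p\<in>V. dang v p) \<Longrightarrow> lowest l (\<tau> v) t \<Longrightarrow> Sf v = sl t v"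
proof -
  have emp: "{z\<in>ch p. l v < l z} = {} \<longleftrightarrow> \<not> (\<exists>z\<in>V. z \<in> ch p \<and> l v < l z)" for p
    using ch_sub by auto
  have d1: "is_S V T l v w \<longleftrightarrow> w = Ef p" if "p \<in> V" "dang v p" "{z\<in>ch p. l v < l z} = {}" for p w
  proof -
    have "\<not> lowest l {z\<in>ch p. l v < l z} u" for u using that(3) by (auto simp: lowest_def)
    then show ?thesis
      using that dang_unique[OF that(2)] E_props(1)[OF that(1)] unfolding is_S_def emp[of p] by (metis (no_types, lifting))
  qed
  have d2: "is_S V T l v w \<longleftrightarrow> w = en u" if "p \<in> V" "dang v p" "lowest l {z\<in>ch p. l v < l z} u" for p u w
  proof -
    have u: "u \<in> V" "u \<in> ch p" "l v < l u" using that(3) ch_sub[of p] by (auto simp: lowest_def)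
    have uq: "u' = u" if "lowest l {z\<in>ch p. l v < l z} u'" for u'
      using lowest_unique[OF that \<open>lowest l {z\<in>ch p. l v < l z} u\<close> siblings_sub(1)[OF \<open>p \<in> V\<close>]] .
    show ?thesis
      using that u uq dang_unique[OF that(2)] en_props(1)[OF u(1)] unfolding is_S_def by (metis (no_types, lifting))
  qed
  have d3: "is_S V T l v w \<longleftrightarrow> w = sl t v" if "\<not> (\<exists>p\<in>V. dang v p)" "lowest l (\<tau> v) t" for t w
  proof -
    have t: "t \<in> V" using that(2) \<tau>_sub[of v] by (auto simp: lowest_def)
    have uq: "t' = t" if "lowest l (\<tau> v) t'" for t'
      using lowest_unique[OF that \<open>lowest l (\<tau> v) t\<close> \<tau>_sub] .
    show ?thesis
      using that t uq slot_iff[OF t] unfolding is_S_def by (metis (no_types, lifting))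
  qed
  have "\<exists>x. \<forall>w. is_S V T l v w \<longleftrightarrow> w = x"
  proof (cases "\<exists>p\<in>V. dang v p")
    case True
    then obtain p where p: "p \<in> V" "dang v p" by auto
    show ?thesis
    proof (cases "{z\<in>ch p. l v < l z} = {}")
      case True
      then show ?thesis using d1[OF p] by auto
    next
      case False
      obtain u where "lowest l {z\<in>ch p. l v < l z} u" using lowest_sibling[OF p(1) False] by (elim exE)
      then show ?thesis using d2[OF p] by auto
    qed
  next
    case False
    obtain a b where "lowest l (\<tau> v) a" by (rule trunk_two[OF assms False])
    then show ?thesis using d3[OF False] by auto
  qed
  then obtain x where x: "\<And>w. is_S V T l v w \<longleftrightarrow> w = x" by auto
  have "Sf v = x" unfolding Sf_def by (rule the_equality) (simp_all add: x)
  then show iff: "is_S V T l v w \<longleftrightarrow> w = Sf v" for w using x by simp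
  show "Sf v = Ef p" if "p \<in> V" "dang v p" "{z\<in>ch p. l v < l z} = {}" for p
    using d1[OF that, of "Sf v"] iff by simp
  show "Sf v = en u" if "p \<in> V" "dang v p" "lowest l {z\<in>ch p. l v < l z} u" for p u
    using d2[OF that, of "Sf v"] iff by simp
  show "Sf v = sl t v" if "\<not> (\<exists>p\<in>V. dang v p)" "lowest l (\<tau> v) t" for t
    using d3[OF that, of "Sf v"] iff by simp
qed

lemma I_props:
  assumes "v \<in> V"
  shows "is_I V T l v w \<longleftrightarrow> w = Jf v" "ch v = {} \<Longrightarrow> Jf v = Ef v" "\<And>u. lowest l (ch v) u \<Longrightarrow> Jf v = en u"
proof -
  have d1: "is_I V T l v w \<longleftrightarrow> w = Ef v" if "ch v = {}" for w
    using that E_props(1)[OF assms] by (simp add: is_I_def lowest_def)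
  have d2: "is_I V T l v w \<longleftrightarrow> w = en u" if "lowest l (ch v) u" for u w
  proof -
    have u: "u \<in> V" "u \<in> ch v" using that ch_sub[of v] by (auto simp: lowest_def)
    have uq: "u' = u" if "lowest l (ch v) u'" for u'
      using lowest_unique[OF that \<open>lowest l (ch v) u\<close> ch_sub] .
    show ?thesis
      using that u uq en_props(1)[OF u(1)] unfolding is_I_def by (metis (no_types, lifting))
  qed
  have "\<exists>x. \<forall>w. is_I V T l v w \<longleftrightarrow> w = x"
  proof (cases "ch v = {}")
    case True
    then show ?thesis using d1 by auto
  next
    case False
    obtain u where "lowest l (ch v) u" using lowest_exists[OF finite_ch[OF assms] False, of l] by (elim exE)
    then show ?thesis using d2 by auto
  qed
  then obtain x where x: "\<And>w. is_I V T l v w \<longleftrightarrow> w = x" by auto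
  have "Jf v = x" unfolding Jf_def by (rule the_equality) (simp_all add: x)
  then show iff: "is_I V T l v w \<longleftrightarrow> w = Jf v" for w using x by simp
  show "Jf v = Ef v" if "ch v = {}" using d1[OF that, of "Jf v"] iff by simp
  show "Jf v = en u" if "lowest l (ch v) u" for u using d2[OF that, of "Jf v"] iff by simp
qed

section \<open>Symmetry of the chosen neighbours\<close>

definition N :: "'a \<Rightarrow> 'a set" where "N u = {Sf u, Jf u}"

text \<open>The end of a block is v itself, with \<open>Ef v\<close> as its inner neighbour, or the
  last child, whose neighbour S is by definition E of its parent.\<close>

lemma Ef_in_N_en:
  assumes "v \<in> V" shows "Ef v \<in> N (en v)"
proof (cases rule: en_cases[OF assms])
  case 1
  then show ?thesis using I_props(2)[OF assms] by (simp add: N_def)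
next
  case 2
  have w: "en v \<in> V" "dang (en v) v" using ch_dang[OF assms] 2 by auto
  have "{z\<in>ch v. l (en v) < l z} = {}" using 2(2) by (force simp: highest_def)
  then show ?thesis using S_props(2)[OF w(1) assms w(2)] by (simp add: N_def)
qed

text \<open>For a first child, the parent has the end of its block as inner neighbour; for a later
  child, the preceding sibling has it as neighbour S. On the trunk p attaches its far end to b, and
  b answers with S or E according to which of its two ends p is attached to.\<close>

lemma en_in_N_Ef:
  assumes p: "p \<in> V" shows "en p \<in> N (Ef p)"
proof (cases "\<exists>q\<in>V. dang p q")
  case True
  then obtain q where q: "q \<in> V" "dang p q" by blast
  then have pq: "p \<in> ch q" using ch_dang[OF q(1)] p by simp
  let ?A = "{z\<in>ch q. l z < l p}"
  show ?thesis
  proof (cases "?A = {}")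
    case True
    then have "lowest l (ch q) p" using pq by (force simp: lowest_def not_less)
    then show ?thesis using I_props(3)[OF q(1)] E_props(2)[OF p q True] by (simp add: N_def)
  next
    case False
    let ?u = "Ef p"
    have u: "highest l ?A ?u" by (rule E_props(3)[OF p q False])
    then have uc: "?u \<in> ch q" "l ?u < l p" by (auto simp: highest_def)
    have uV: "?u \<in> V" "dang ?u q" using ch_dang[OF q(1)] uc by auto
    have "lowest l {z\<in>ch q. l ?u < l z} p"
      using u pq uc unfolding lowest_def highest_def by (force simp: not_less[symmetric])
    then show ?thesis using S_props(3)[OF uV(1) q(1) uV(2)] by (simp add: N_def)
  qed
next
  case False
  obtain a b where ab: "\<tau> p = {a, b}" "l a < l b" "lowest l (\<tau> p) a" "highest l (\<tau> p) b" "a \<in> V" "b \<in> V"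
    by (rule trunk_two[OF p False])
  have E: "Ef p = sl b p" by (rule E_props(4)[OF p False ab(4)])
  have nb: "\<not> lowest l (\<tau> p) b" using ab(1,2) by (auto simp: lowest_def)
  have bt: "p \<in> \<tau> b" "\<not> (\<exists>q\<in>V. dang b q)" using trunk_nbr[OF p False, of b] ab(1) by auto
  show ?thesis
  proof (cases "lowest l (\<tau> b) p")
    case True
    then have "Ef p = b" using E by (simp add: sl_def)
    moreover have "Sf b = sl p b" by (rule S_props(4)[OF ab(6) bt(2) True])
    moreover have "sl p b = en p" using nb by (simp add: sl_def)
    ultimately show ?thesis by (simp add: N_def)
  next
    case False
    then have "Ef p = en b" using E by (simp add: sl_def)
    obtain a' b' where ab': "\<tau> b = {a', b'}" "lowest l (\<tau> b) a'" "highest l (\<tau> b) b'" by (rule trunk_two[OF ab(6) bt(2)])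
    then have "highest l (\<tau> b) p" using False bt(1) by auto
    then have "Ef b = sl p b" by (rule E_props(4)[OF ab(6) bt(2)])
    also have "\<dots> = en p" using nb by (simp add: sl_def)
    finally show ?thesis using Ef_in_N_en[OF ab(6)] \<open>Ef p = en b\<close> by simp
  qed
qed

lemma trunk_in_N_Sf:
  assumes v: "v \<in> V" "\<not> (\<exists>p\<in>V. dang v p)" shows "v \<in> N (Sf v)"
proof -
  obtain t b where t: "lowest l (\<tau> v) t" "t \<in> V" by (rule trunk_two[OF v])
  then have tv: "t \<in> \<tau> v" by (simp add: lowest_def)
  note nb = trunk_nbr[OF v tv]
  have S: "Sf v = sl t v" by (rule S_props(4)[OF v t(1)])
  have s: "sl v t = v" using t(1) by (simp add: sl_def)
  show ?thesis
  proof (cases "lowest l (\<tau> t) v")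
    case True
    then show ?thesis using S_props(4)[OF nb(2,3) True] s S by (simp add: N_def sl_def)
  next
    case False
    obtain a' b' where ab': "\<tau> t = {a', b'}" "lowest l (\<tau> t) a'" "highest l (\<tau> t) b'" by (rule trunk_two[OF nb(2,3)])
    then have "highest l (\<tau> t) v" using False nb(1) by auto
    then have "Ef t = v" using E_props(4)[OF nb(2,3)] s by simp
    then show ?thesis using Ef_in_N_en[OF nb(2)] S False by (simp add: sl_def)
  qed
qed

text \<open>Each vertex chooses two neighbours from its own point of view. Only because these
  choices are mutual does their union have degree two.\<close>

lemma N_sym:
  assumes u: "u \<in> V" and w: "w \<in> N u" shows "u \<in> N w"
proof -
  have first: "Ef v = u" if "lowest l (ch u) v" for v
  proof -
    have "v \<in> ch u" using that by (simp add: lowest_def)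
    then have v: "v \<in> V" "dang v u" using ch_dang[OF u] by auto
    have "{z\<in>ch u. l z < l v} = {}" using that by (force simp: lowest_def)
    then show ?thesis by (rule E_props(2)[OF v(1) u v(2)])
  qed
  consider "w = Sf u" | "w = Jf u" using w by (auto simp: N_def)
  then show ?thesis
  proof cases
    case 1
    show ?thesis
    proof (cases "\<exists>p\<in>V. dang u p")
      case True
      then obtain p where p: "p \<in> V" "dang u p" by blast
      then have up: "u \<in> ch p" using ch_dang[OF p(1)] u by simp
      let ?A = "{z\<in>ch p. l u < l z}"
      show ?thesis
      proof (cases "?A = {}")
        case True
        then have "highest l (ch p) u" using up by (force simp: highest_def not_less)
        then have "en p = u" using en_props(3)[OF p(1)] up highest_unique[OF _ _ ch_sub] by blast
        moreover have "w = Ef p" using 1 S_props(2)[OF u p True] by simp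
        ultimately show ?thesis using en_in_N_Ef[OF p(1)] by simp
      next
        case False
        obtain v where v: "lowest l ?A v" using lowest_sibling[OF p(1) False] by (elim exE)
        then have vc: "v \<in> ch p" "l u < l v" by (auto simp: lowest_def)
        have vV: "v \<in> V" "dang v p" using ch_dang[OF p(1)] vc by auto
        have g: "highest l {z\<in>ch p. l z < l v} u"
          using v up vc unfolding lowest_def highest_def by (force simp: not_less[symmetric])
        then have "{z\<in>ch p. l z < l v} \<noteq> {}" by (auto simp: highest_def)
        then have "Ef v = u" by (rule highest_unique[OF E_props(3)[OF vV(1) p(1) vV(2)] g siblings_sub(1)[OF p(1)]])
        moreover have "w = en v" using 1 S_props(3)[OF u p v] by simp
        ultimately show ?thesis using Ef_in_N_en[OF vV(1)] by simp
      qed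
    next
      case False
      then show ?thesis using trunk_in_N_Sf[OF u False] 1 by simp
    qed
  next
    case 2
    show ?thesis
    proof (cases "ch u = {}")
      case True
      then show ?thesis using en_in_N_Ef[OF u] en_props(2)[OF u True] I_props(2)[OF u True] 2 by simp
    next
      case False
      obtain v where v: "lowest l (ch u) v" using lowest_exists[OF finite_ch[OF u] False, of l] by (elim exE)
      then have "v \<in> V" using ch_sub[of u] by (auto simp: lowest_def)
      then show ?thesis using Ef_in_N_en[of v] first[OF v] I_props(3)[OF u v] 2 by simp
    qed
  qed
qed

section \<open>Blocks keep the two neighbours apart\<close>

definition blk :: "'a \<Rightarrow> 'a set" where "blk v = insert v (\<Union>y\<in>ch v. br v y)"

lemma blk_ch: "p \<in> V \<Longrightarrow> v \<in> ch p \<Longrightarrow> blk v = br p v"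
proof -
  assume p: "p \<in> V" "v \<in> ch p"
  then have e: "{p, v} \<in> T" "\<tau> v = {p}" using ch_dang[OF p(1)] by (auto simp: children_def dang_iff)
  have "ch v = {z\<in>V. {v, z} \<in> T \<and> z \<noteq> p}"
    using e(2) ch_not_\<tau>[of p v] nbr_cases[of v] ch_edge subsetD[OF ch_sub] by blast
  then show ?thesis unfolding blk_def br_decompose[OF e(1)] by simp
qed

lemma blk_finite: "v \<in> V \<Longrightarrow> finite (blk v)"
  using finite_ch by (auto simp: blk_def children_def)

lemma blk_V: "v \<in> V \<Longrightarrow> blk v \<subseteq> V"
  by (auto simp: blk_def branch_def)

lemma blk_self [simp]: "v \<in> blk v"
  by (simp add: blk_def)

lemma blk_nested: "p \<in> V \<Longrightarrow> v \<in> ch p \<Longrightarrow> blk v \<subseteq> blk p \<and> p \<notin> blk v"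
proof -
  assume p: "p \<in> V" "v \<in> ch p"
  have "p \<noteq> v" using ch_edge[OF p(2)] by auto
  then show ?thesis using br_not[of p v] p(2) unfolding blk_ch[OF p] unfolding blk_def by auto
qed

lemma blk_siblings: "p \<in> V \<Longrightarrow> v \<in> ch p \<Longrightarrow> w \<in> ch p \<Longrightarrow> v \<noteq> w \<Longrightarrow> blk v \<inter> blk w = {}"
  using br_disjoint[of p v w] by (simp add: blk_ch ch_edge)

lemma blk_trunk:
  assumes v: "v \<in> V" "\<not> (\<exists>p\<in>V. dang v p)" and t: "t \<in> \<tau> v"
  shows "blk t \<subseteq> br v t" "blk v \<inter> br v t = {}"
proof -
  note nb = trunk_nbr[OF v t]
  have e: "{v, t} \<in> T" "v \<noteq> t" using t by (auto simp: \<tau>_iff)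
  have "br t y \<subseteq> br v t" if "y \<in> ch t" for y
    by (rule br_nested) (use that e nb(1) ch_not_\<tau>[OF that] ch_edge[OF that] in \<open>auto simp: insert_commute\<close>)
  then show "blk t \<subseteq> br v t" using br_self[OF nb(2)] by (auto simp: blk_def)
  have "br v y \<inter> br v t = {}" if "y \<in> ch v" for y
    by (rule br_disjoint[OF ch_edge[OF that] e(1)]) (use that t ch_not_\<tau>[OF that] in auto)
  then show "blk v \<inter> br v t = {}" using br_not[OF e(2)] by (auto simp: blk_def)
qed

lemma en_blk:
  assumes "v \<in> V" shows "en v \<in> blk v"
proof (cases rule: en_cases[OF assms])
  case 2
  then have "en v \<in> br v (en v)" using ch_sub[of v] by (intro br_self) auto
  then show ?thesis using 2 by (auto simp: blk_def)
qed simp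

lemma sl_blk: "t \<in> V \<Longrightarrow> sl t v \<in> blk t"
  using en_blk by (simp add: sl_def)

lemma Ef_blk:
  assumes v: "v \<in> V" shows "Ef v \<notin> blk v" "Ef v \<in> V"
    "\<And>p. p \<in> V \<Longrightarrow> dang v p \<Longrightarrow> Ef v = p \<or> (Ef v \<in> ch p \<and> l (Ef v) < l v)"
proof -
  show d: "Ef v = p \<or> (Ef v \<in> ch p \<and> l (Ef v) < l v)" if "p \<in> V" "dang v p" for p
    using E_props(2,3)[OF v that] by (cases "{z\<in>ch p. l z < l v} = {}") (auto simp: highest_def)
  have "Ef v \<notin> blk v \<and> Ef v \<in> V"
  proof (cases "\<exists>p\<in>V. dang v p")
    case True
    then obtain p where p: "p \<in> V" "dang v p" by blast
    then have vp: "v \<in> ch p" using ch_dang[OF p(1)] v by simp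
    from d[OF p] show ?thesis
    proof
      assume "Ef v = p"
      then show ?thesis using blk_nested[OF p(1) vp] p(1) by simp
    next
      assume e: "Ef v \<in> ch p \<and> l (Ef v) < l v"
      then have "blk v \<inter> blk (Ef v) = {}" by (intro blk_siblings[OF p(1) vp]) auto
      then show ?thesis using e ch_sub[of p] by (metis blk_self disjoint_iff subsetD)
    qed
  next
    case False
    obtain a b where ab: "\<tau> v = {a, b}" "highest l (\<tau> v) b" "b \<in> V" by (rule trunk_two[OF v False])
    have b: "b \<in> \<tau> v" using ab by simp
    have "Ef v = sl b v" by (rule E_props(4)[OF v False ab(2)])
    then have "Ef v \<in> blk b" using sl_blk[OF ab(3)] by simp
    then show ?thesis using blk_trunk[OF v False b] blk_V[OF ab(3)] by blast
  qed
  then show "Ef v \<notin> blk v" "Ef v \<in> V" by auto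
qed

lemma Sf_blk:
  assumes v: "v \<in> V" shows "Sf v \<notin> blk v \<and> Sf v \<in> V"
proof (cases "\<exists>p\<in>V. dang v p")
  case True
  then obtain p where p: "p \<in> V" "dang v p" by blast
  then have vp: "v \<in> ch p" using ch_dang[OF p(1)] v by simp
  show ?thesis
  proof (cases "{z\<in>ch p. l v < l z} = {}")
    case True
    then show ?thesis using S_props(2)[OF v p True] Ef_blk[OF p(1)] blk_nested[OF p(1) vp] by auto
  next
    case False
    obtain u where u: "lowest l {z\<in>ch p. l v < l z} u" using lowest_sibling[OF p(1) False] by (elim exE)
    then have uc: "u \<in> ch p" "u \<noteq> v" by (auto simp: lowest_def)
    have uV: "u \<in> V" using uc ch_sub by auto
    have "Sf v = en u" by (rule S_props(3)[OF v p u])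
    moreover have "blk v \<inter> blk u = {}" by (rule blk_siblings[OF p(1) vp uc(1) uc(2)[symmetric]])
    ultimately show ?thesis using en_blk[OF uV] blk_V[OF uV] by auto
  qed
next
  case False
  obtain a b where ab: "\<tau> v = {a, b}" "lowest l (\<tau> v) a" "a \<in> V" by (rule trunk_two[OF v False])
  have a: "a \<in> \<tau> v" using ab by simp
  have "Sf v = sl a v" by (rule S_props(4)[OF v False ab(2)])
  then have "Sf v \<in> blk a" using sl_blk[OF ab(3)] by simp
  then show ?thesis using blk_trunk[OF v False a] blk_V[OF ab(3)] by blast
qed

text \<open>\<open>Sf v\<close> lies outside of the block and \<open>Jf v\<close> in the block of a
  child. If v has no children, both lie outside, and they are separated by the blocks of siblings,
  by the block of the parent, or by the two infinite branches of the trunk.\<close>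

lemma N_distinct:
  assumes v: "v \<in> V" shows "Sf v \<noteq> Jf v" "Sf v \<noteq> v" "Jf v \<noteq> v" "Sf v \<in> V" "Jf v \<in> V"
proof -
  show "Sf v \<noteq> v" "Sf v \<in> V" using Sf_blk[OF v] by auto
  have "Sf v \<noteq> Jf v \<and> Jf v \<noteq> v \<and> Jf v \<in> V"
  proof (cases "ch v = {}")
    case False
    obtain u where u: "lowest l (ch v) u" using lowest_exists[OF finite_ch[OF v] False, of l] by (elim exE)
    then have uc: "u \<in> ch v" by (simp add: lowest_def)
    then have uV: "u \<in> V" using ch_sub by auto
    have "Jf v \<in> blk u" using I_props(3)[OF v u] en_blk[OF uV] by simp
    then show ?thesis using blk_nested[OF v uc] Sf_blk[OF v] blk_V[OF uV] by auto
  next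
    case True
    then have I: "Jf v = Ef v" by (rule I_props(2)[OF v])
    have "Sf v \<noteq> Ef v"
    proof (cases "\<exists>p\<in>V. dang v p")
      case True
      then obtain p where p: "p \<in> V" "dang v p" by blast
      then have vp: "v \<in> ch p" using ch_dang[OF p(1)] v by simp
      show ?thesis
      proof (cases "{z\<in>ch p. l v < l z} = {}")
        case True
        have "Ef v \<in> blk p" using Ef_blk(3)[OF v p] blk_nested[OF p(1)] blk_self by (metis subsetD)
        then show ?thesis using S_props(2)[OF v p True] Ef_blk(1)[OF p(1)] by auto
      next
        case False
        obtain u where u: "lowest l {z\<in>ch p. l v < l z} u" using lowest_sibling[OF p(1) False] by (elim exE)
        then have uc: "u \<in> ch p" "l v < l u" by (auto simp: lowest_def)
        have uV: "u \<in> V" using uc ch_sub by auto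
        have S: "Sf v \<in> blk u" using S_props(3)[OF v p u] en_blk[OF uV] by simp
        from Ef_blk(3)[OF v p] show ?thesis
        proof
          assume "Ef v = p"
          then show ?thesis using S blk_nested[OF p(1) uc(1)] by auto
        next
          assume e: "Ef v \<in> ch p \<and> l (Ef v) < l v"
          then have "blk u \<inter> blk (Ef v) = {}" using uc by (intro blk_siblings[OF p(1) uc(1)]) auto
          then show ?thesis using S blk_self[of "Ef v"] by auto
        qed
      qed
    next
      case False
      obtain a b where ab: "\<tau> v = {a, b}" "l a < l b" "lowest l (\<tau> v) a" "highest l (\<tau> v) b" "a \<in> V" "b \<in> V"
        by (rule trunk_two[OF v False])
      have t: "a \<in> \<tau> v" "b \<in> \<tau> v" using ab(1) by simp_all
      have "Sf v \<in> blk a" using S_props(4)[OF v False ab(3)] sl_blk[OF ab(5)] by simp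
      then have S: "Sf v \<in> br v a" by (rule subsetD[OF blk_trunk(1)[OF v False t(1)]])
      have "Ef v \<in> blk b" using E_props(4)[OF v False ab(4)] sl_blk[OF ab(6)] by simp
      then have E: "Ef v \<in> br v b" by (rule subsetD[OF blk_trunk(1)[OF v False t(2)]])
      have "br v a \<inter> br v b = {}"
      proof (rule br_disjoint)
        show "{v, a} \<in> T" "{v, b} \<in> T" using t by (simp_all only: \<tau>_iff)
        show "a \<noteq> b" using ab(2) by blast
      qed
      then show ?thesis using S E by (metis disjoint_iff)
    qed
    then show ?thesis using I Ef_blk(1,2)[OF v] blk_self[of v] by metis
  qed
  then show "Sf v \<noteq> Jf v" "Jf v \<noteq> v" "Jf v \<in> V" by auto
qed

section \<open>The length of the steps\<close>

definition near :: "'a \<Rightarrow> 'a \<Rightarrow> bool" where "near x y \<longleftrightarrow> x = y \<or> {x, y} \<in> T"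

lemma near_en:
  assumes "v \<in> V" shows "near v (en v)"
  by (cases rule: en_cases[OF assms]) (use ch_edge[of "en v" v] in \<open>auto simp: near_def\<close>)

lemma near_sl: "t \<in> V \<Longrightarrow> near t (sl t v)"
  using near_en by (simp add: sl_def near_def)

lemma near_dang: "dang v p \<Longrightarrow> near v p"
  by (auto simp: dangling_def \<tau>_iff near_def)

lemma near_ch: "y \<in> ch v \<Longrightarrow> near v y"
  using ch_edge by (auto simp: near_def)

lemma near_Ef:
  assumes v: "v \<in> V" shows "\<exists>a. near v a \<and> near a (Ef v)"
proof (cases "\<exists>p\<in>V. dang v p")
  case True
  then obtain p where p: "p \<in> V" "dang v p" by blast
  have "near p (Ef v)" using Ef_blk(3)[OF v p] near_ch[of "Ef v" p] by (auto simp: near_def)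
  then show ?thesis using near_dang[OF p(2)] by blast
next
  case False
  obtain a b where ab: "\<tau> v = {a, b}" "highest l (\<tau> v) b" "b \<in> V" by (rule trunk_two[OF v False])
  have "b \<in> \<tau> v" using ab by simp
  then have "near v b" by (simp add: \<tau>_iff near_def)
  then show ?thesis using E_props(4)[OF v False ab(2)] near_sl[OF ab(3), of v] by metis
qed

text \<open>Three steps occur in going up to the parent, down to a sibling and on to its last child,
  and in going up to the parent and then on to E of it, which is up to two steps away.\<close>

lemma near_N:
  assumes v: "v \<in> V" and w: "w \<in> N v" shows "\<exists>a b. near v a \<and> near a b \<and> near b w"
proof -
  have refl: "near x x" for x by (simp add: near_def)
  consider "w = Sf v" | "w = Jf v" using w by (auto simp: N_def)
  then show ?thesis
  proof cases
    case 1
    show ?thesis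
    proof (cases "\<exists>p\<in>V. dang v p")
      case True
      then obtain p where p: "p \<in> V" "dang v p" by blast
      show ?thesis
      proof (cases "{z\<in>ch p. l v < l z} = {}")
        case True
        then show ?thesis using near_Ef[OF p(1)] near_dang[OF p(2)] S_props(2)[OF v p True] 1 by metis
      next
        case False
        obtain u where u: "lowest l {z\<in>ch p. l v < l z} u" using lowest_sibling[OF p(1) False] by (elim exE)
        then have uc: "u \<in> ch p" by (simp add: lowest_def)
        then have "u \<in> V" using ch_sub by auto
        then show ?thesis using near_dang[OF p(2)] near_ch[OF uc] near_en[of u] S_props(3)[OF v p u] 1 by metis
      qed
    next
      case False
      obtain a b where ab: "\<tau> v = {a, b}" "lowest l (\<tau> v) a" "a \<in> V" by (rule trunk_two[OF v False])
      have "a \<in> \<tau> v" using ab by simp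
      then have "near v a" by (simp add: \<tau>_iff near_def)
      then show ?thesis using S_props(4)[OF v False ab(2)] near_sl[OF ab(3), of v] 1 refl by metis
    qed
  next
    case 2
    show ?thesis
    proof (cases "ch v = {}")
      case True
      then show ?thesis using near_Ef[OF v] I_props(2)[OF v True] 2 refl by metis
    next
      case False
      obtain u where u: "lowest l (ch v) u" using lowest_exists[OF finite_ch[OF v] False, of l] by (elim exE)
      then have uc: "u \<in> ch v" by (simp add: lowest_def)
      then have "u \<in> V" using ch_sub by auto
      then show ?thesis using near_ch[OF uc] near_en[of u] I_props(3)[OF v u] 2 refl by metis
    qed
  qed
qed

section \<open>Degrees and connectedness of the double ray\<close>

abbreviation "D \<equiv> double_ray_edges V T l"

lemma D_iff: "{u, w} \<in> D \<longleftrightarrow> u \<in> V \<and> w \<in> N u"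
proof
  assume "{u, w} \<in> D"
  then obtain a b where ab: "{u, w} = {a, b}" "a \<in> V" "b \<in> V" "is_S V T l a b \<or> is_I V T l a b"
    by (auto simp: double_ray_edges_def)
  then have "b \<in> N a" using S_props(1) I_props(1) by (auto simp: N_def)
  moreover have "a \<in> N b" using N_sym ab(2) \<open>b \<in> N a\<close> by simp
  ultimately show "u \<in> V \<and> w \<in> N u" using ab by (auto simp: doubleton_eq_iff)
next
  assume u: "u \<in> V \<and> w \<in> N u"
  then have "w \<in> V" "is_S V T l u w \<or> is_I V T l u w"
    using N_distinct(4,5) S_props(1) I_props(1) by (auto simp: N_def)
  then show "{u, w} \<in> D" using u by (auto simp: double_ray_edges_def)
qed

lemma D_edge: "e \<in> D \<Longrightarrow> \<exists>u w. e = {u, w} \<and> u \<in> V \<and> w \<in> V \<and> u \<noteq> w \<and> (\<exists>a b. near u a \<and> near a b \<and> near b w)"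
proof -
  assume e: "e \<in> D"
  then obtain u w where uw: "e = {u, w}" "u \<in> V" "w \<in> V" by (auto simp: double_ray_edges_def)
  then have "w \<in> N u" using e D_iff by auto
  then show ?thesis using uw N_distinct(2,3)[OF uw(2)] near_N[OF uw(2)] by (intro exI[of _ u] exI[of _ w]) (auto simp: N_def)
qed

lemma D_degree: "v \<in> V \<Longrightarrow> card (neighbours (V, D) v) = 2"
proof -
  assume v: "v \<in> V"
  have "neighbours (V, D) v = {Sf v, Jf v}"
    using v N_distinct(4,5)[OF v] by (auto simp: neighbours_def adjacent_def D_iff N_def)
  then show ?thesis using N_distinct(1)[OF v] by simp
qed

text \<open>Outer induction on the size of the block joins each child to its own block; an inner
  induction along the siblings in the order of labels joins the children to v.\<close>

lemma D_blk:
  assumes "v \<in> V" "w \<in> blk v" shows "conn D v w"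
  using assms
proof (induction "card (blk v)" arbitrary: v w rule: less_induct)
  case less
  note v = less.prems(1)
  have IH: "conn D y w" if "y \<in> ch v" "w \<in> blk y" for y w
  proof (rule less.hyps[OF _ _ that(2)])
    have "blk y \<subset> blk v" using blk_nested[OF v that(1)] by auto
    then show "card (blk y) < card (blk v)" by (rule psubset_card_mono[OF blk_finite[OF v]])
    show "y \<in> V" using that ch_sub by auto
  qed
  have ch: "conn D v y" if "y \<in> ch v" for y
    using that
  proof (induction "card {z\<in>ch v. l z < l y}" arbitrary: y rule: less_induct)
    case (less y)
    have y: "y \<in> V" "dang y v" using ch_dang[OF v] less.prems by auto
    have c: "conn D y (en y)" by (rule IH[OF less.prems en_blk[OF y(1)]])
    show ?case
    proof (cases "{z\<in>ch v. l z < l y} = {}")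
      case True
      then have "lowest l (ch v) y" using less.prems by (force simp: lowest_def not_less)
      then have "en y \<in> N v" using I_props(3)[OF v] by (simp add: N_def)
      then have "conn D v (en y)" using D_iff v by (intro conn_edge) auto
      then show ?thesis using c by (metis conn_trans conn_sym)
    next
      case False
      obtain u where u: "highest l {z\<in>ch v. l z < l y} u" using highest_sibling[OF v False] by (elim exE)
      then have uc: "u \<in> ch v" "l u < l y" by (auto simp: highest_def)
      have uV: "u \<in> V" "dang u v" using ch_dang[OF v] uc by auto
      have "lowest l {z\<in>ch v. l u < l z} y"
        using u less.prems uc unfolding lowest_def highest_def by (force simp: not_less[symmetric])
      then have "en y \<in> N u" using S_props(3)[OF uV(1) v uV(2)] by (simp add: N_def)
      then have ue: "conn D u (en y)" using D_iff uV(1) by (intro conn_edge) auto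
      have "{z\<in>ch v. l z < l u} \<subset> {z\<in>ch v. l z < l y}" using uc by auto
      then have "conn D v u"
        using less.hyps[OF psubset_card_mono[OF siblings_sub(2)[OF v]] uc(1)] by simp
      then have "conn D v (en y)" using ue by (rule conn_trans)
      then show ?thesis by (rule conn_trans) (rule conn_sym[OF c])
    qed
  qed
  show ?case
  proof (cases "w = v")
    case False
    then obtain y where y: "y \<in> ch v" "w \<in> br v y" using less.prems(2) by (auto simp: blk_def)
    then have "w \<in> blk y" using blk_ch[OF v y(1)] by simp
    then show ?thesis using ch[OF y(1)] IH[OF y(1)] conn_trans[of D v y w] by blast
  qed simp
qed

text \<open>Every tree edge is replaced by a connection in D. Edges to children stay within a block;
  for an edge of the trunk the two blocks are joined at the slots assigned to each other.\<close>

lemma D_conn: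
  assumes "x \<in> V" "y \<in> V" shows "conn D x y"
  using T_conn[OF assms]
proof (rule conn_lift)
  fix a b assume e: "{a, b} \<in> T"
  then have V: "a \<in> V" "b \<in> V" by auto
  have child: "conn D p v" if "p \<in> V" "v \<in> ch p" for p v
  proof (rule D_blk[OF that(1)])
    show "v \<in> blk p" using blk_nested[OF that] by (metis blk_self subsetD)
  qed
  consider "b \<in> ch a" | "a \<in> ch b" | "b \<in> \<tau> a" "a \<in> \<tau> b" "b \<notin> ch a" "a \<notin> ch b"
    using nbr_cases[of a b] nbr_cases[of b a] e by (auto simp: insert_commute)
  then show "conn D a b"
  proof cases
    case 1
    then show ?thesis using child V by simp
  next
    case 2
    then show ?thesis by (rule conn_sym[OF child[OF V(2)]])
  next
    case 3
    have na: "\<not> (\<exists>p\<in>V. dang a p)"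
    proof
      assume "\<exists>p\<in>V. dang a p"
      then have "dang a b" using 3(1) by (metis dangling_def)
      then show False using ch_dang[OF V(2)] V 3(4) by simp
    qed
    obtain p q where pq: "\<tau> a = {p, q}" "lowest l (\<tau> a) p" "highest l (\<tau> a) q" "p \<in> V" "q \<in> V" by (rule trunk_two[OF V(1) na])
    have sb: "conn D b (sl b a)" by (rule D_blk[OF V(2) sl_blk[OF V(2)]])
    have "conn D a (sl b a)"
    proof (cases "b = p")
      case True
      then have "sl b a \<in> N a" using S_props(4)[OF V(1) na pq(2)] by (simp add: N_def)
      then show ?thesis using D_iff V by (intro conn_edge) auto
    next
      case False
      then have "b = q" using 3(1) pq(1) by auto
      then have "sl b a \<in> N (en a)" using E_props(4)[OF V(1) na pq(3)] Ef_in_N_en[OF V(1)] by simp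
      moreover have "en a \<in> V" using en_blk[OF V(1)] blk_V[OF V(1)] by auto
      ultimately have "conn D (en a) (sl b a)" using D_iff by (intro conn_edge) auto
      moreover have "conn D a (en a)" by (rule D_blk[OF V(1) en_blk[OF V(1)]])
      ultimately show ?thesis by (rule conn_trans[rotated])
    qed
    then show ?thesis by (rule conn_trans) (rule conn_sym[OF sb])
  qed
qed

end

section \<open>Random spanning trees from Foelner sets\<close>

context graph_symmetry
begin

lemma measurable_big:
  assumes sub: "\<And>w. w \<in> space M \<Longrightarrow> \<Union>(T w) \<subseteq> V"
    and m: "\<And>x y. x \<in> V \<Longrightarrow> y \<in> V \<Longrightarrow> Measurable.pred M (\<lambda>w. {x, y} \<in> T w)"
    and xy: "x \<in> V" "y \<in> V"
  shows "Measurable.pred M (\<lambda>w. infinite (branch V (T w) x y))" "Measurable.pred M (\<lambda>w. y \<in> big V (T w) x)"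
proof -
  have c: "Measurable.pred M (\<lambda>w. conn {e \<in> T w. x \<notin> e} y z)" if "z \<in> V" for z
  proof (rule measurable_conn[OF countable_V _ _ xy(2) that])
    fix a b assume "a \<in> V" "b \<in> V"
    then have "Measurable.pred M (\<lambda>w. {a, b} \<in> T w \<and> x \<notin> {a, b})"
      using m by (intro pred_intros_logic) auto
    then show "Measurable.pred M (\<lambda>w. {a, b} \<in> {e \<in> T w. x \<notin> e})" by (simp only: mem_Collect_eq)
  qed (use sub in blast)
  show i: "Measurable.pred M (\<lambda>w. infinite (branch V (T w) x y))"
    unfolding branch_def by (rule measurable_infinite[OF countable_V c])
  have "Measurable.pred M (\<lambda>w. {x, y} \<in> T w \<and> infinite (branch V (T w) x y))"
    by (rule pred_intros_logic(3)[OF m[OF xy] i])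
  then show "Measurable.pred M (\<lambda>w. y \<in> big V (T w) x)"
    using xy by (simp add: big_def)
qed

lemma measurable_card_big:
  assumes sub: "\<And>w. w \<in> space M \<Longrightarrow> T w \<subseteq> E"
    and m: "\<And>x y. x \<in> V \<Longrightarrow> y \<in> V \<Longrightarrow> Measurable.pred M (\<lambda>w. {x, y} \<in> T w)"
    and x: "x \<in> V"
  shows "(\<lambda>w. card (big V (T w) x)) \<in> measurable M (count_space UNIV)"
proof -
  let ?N = "{y\<in>V. {x, y} \<in> E}"
  have "(\<lambda>w. card {y \<in> ?N. y \<in> big V (T w) x}) \<in> measurable M (count_space UNIV)"
    using x sub E_sub by (intro measurable_card_Collect[OF finite_nbrs[OF x]] measurable_big(2) m) blast+
  moreover have "{y \<in> ?N. y \<in> big V (T w) x} = big V (T w) x" if "w \<in> space M" for w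
    using sub[OF that] by (auto simp: big_def)
  ultimately show ?thesis by (subst measurable_cong) auto
qed

lemma act_edge:
  assumes g: "\<gamma> \<in> \<Gamma>" and T: "\<Union>T \<subseteq> V" "T' = (`) \<gamma> ` T" and xy: "x \<in> V" "y \<in> V"
  shows "{\<gamma> x, \<gamma> y} \<in> T' \<longleftrightarrow> {x, y} \<in> T"
proof
  assume "{\<gamma> x, \<gamma> y} \<in> T'"
  then obtain e where e: "e \<in> T" "\<gamma> ` {x, y} = \<gamma> ` e" using T by auto
  have "e \<subseteq> V" using e(1) T(1) by blast
  then have "{x, y} = e" using image_eq_V[OF g, of "{x, y}" e] e xy by simp
  then show "{x, y} \<in> T" using e by simp
next
  assume "{x, y} \<in> T"
  then have "\<gamma> ` {x, y} \<in> T'" using T by blast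
  then show "{\<gamma> x, \<gamma> y} \<in> T'" by simp
qed

lemma big_act:
  assumes g: "\<gamma> \<in> \<Gamma>" and T: "\<Union>T \<subseteq> V" "T' = (`) \<gamma> ` T" and xy: "x \<in> V" "y \<in> V"
  shows "infinite (branch V T' (\<gamma> x) (\<gamma> y)) \<longleftrightarrow> infinite (branch V T x y)"
    "\<gamma> y \<in> big V T' (\<gamma> x) \<longleftrightarrow> y \<in> big V T x"
proof -
  have e: "e \<subseteq> V" if "e \<in> T" for e using T(1) that by blast
  have "{e \<in> T'. \<gamma> x \<notin> e} = (`) \<gamma> ` {e \<in> T. x \<notin> e}"
    using image_mem_V[OF g e xy(1)] T by auto
  moreover have "\<Union>{e \<in> T. x \<notin> e} \<subseteq> V" using T by blast
  ultimately have "conn {e \<in> T'. \<gamma> x \<notin> e} (\<gamma> y) (\<gamma> z) \<longleftrightarrow> conn {e \<in> T. x \<notin> e} y z" if "z \<in> V" for z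
    using conn_V[OF g _ xy(2) that] by simp
  then show i: "infinite (branch V T' (\<gamma> x) (\<gamma> y)) \<longleftrightarrow> infinite (branch V T x y)"
    unfolding branch_def by (subst infinite_V[OF g]) (simp cong: conj_cong)
  have "{\<gamma> x, \<gamma> y} \<in> T' \<longleftrightarrow> {x, y} \<in> T" by (rule act_edge[OF g T xy])
  then show "\<gamma> y \<in> big V T' (\<gamma> x) \<longleftrightarrow> y \<in> big V T x"
    using i xy g by (simp add: big_def)
qed

text \<open>A measurable equivariant function of the labels has an invariant law. \<open>Q\<close>
  is a criterion for \<open>P\<close> that is known to be measurable, so that it can be transferred
  to this law.\<close>

lemma factor_spanning_subgraph:
  assumes F: "\<And>U. U \<in> space (labels J) \<Longrightarrow> F U \<subseteq> E"
    and m: "\<And>e. e \<in> E \<Longrightarrow> Measurable.pred (labels J) (\<lambda>U. e \<in> F U)"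
    and eq: "\<And>\<gamma> U. \<gamma> \<in> \<Gamma> \<Longrightarrow> U \<in> space (labels J) \<Longrightarrow> F (act_labels \<gamma> U) = (`) \<gamma> ` F U"
    and Q: "Measurable.pred (cylinder_space E) Q" "\<And>F. F \<subseteq> E \<Longrightarrow> Q F \<Longrightarrow> P (V, F)"
    and ae: "AE U in labels J. Q (F U)"
  shows "invariant_random_spanning_subgraph \<Gamma> X P (distr (labels J) (cylinder_space E) F)"
proof -
  let ?C = "cylinder_space E"
  have mF: "F \<in> measurable (labels J) ?C"
    by (rule measurable_cylinder_space) (use F m in auto)
  interpret L: prob_space "labels J" by (rule prob_space_labels)
  have "distr (distr (labels J) ?C F) (distr (labels J) ?C F) (act_edges \<gamma>) = distr (labels J) ?C F"
    if g: "\<gamma> \<in> \<Gamma>" for \<gamma>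
  proof -
    note a = act_labels_measure[OF g]
    have "distr (distr (labels J) ?C F) (distr (labels J) ?C F) (act_edges \<gamma>) =
        distr (distr (labels J) ?C F) ?C (act_edges \<gamma>)"
      by (rule distr_cong) auto
    also have "\<dots> = distr (labels J) ?C (act_edges \<gamma> \<circ> F)"
      by (rule distr_distr[OF act_edges_measurable[OF g] mF])
    also have "\<dots> = distr (labels J) ?C (F \<circ> act_labels \<gamma>)"
      by (rule distr_cong) (auto simp: eq[OF g] act_edges_def)
    also have "\<dots> = distr (distr (labels J) (labels J) (act_labels \<gamma>)) ?C F"
      by (rule distr_distr[OF mF a(1), symmetric])
    finally show ?thesis by (simp only: a(2))
  qed
  moreover have "AE Y in distr (labels J) ?C F. subgraph_of (V, Y) X \<and> True"
    by (rule AE_I2) (use simple_X verts_X in \<open>auto simp: subgraph_of_def simple_graph_def\<close>)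
  moreover have "AE Y in distr (labels J) ?C F. P (V, Y)"
  proof (rule AE_mp)
    have "{Y \<in> space ?C. Q Y} \<in> sets ?C" using Q(1) by (simp add: pred_def)
    then show "AE Y in distr (labels J) ?C F. Q Y" by (subst AE_distr_iff[OF mF]) (use ae in auto)
    show "AE Y in distr (labels J) ?C F. Q Y \<longrightarrow> P (V, Y)"
      by (rule AE_I2) (use Q(2) in auto)
  qed
  ultimately show ?thesis
    unfolding invariant_random_spanning_subgraph_def verts_X
    using L.prob_space_distr[OF mF] by simp
qed

end

text \<open>The sets in \<open>KK n\<close> are chosen independently with probability \<open>p n\<close>. Level \<open>n\<close> keeps the edges that lie
  in a chosen set and are separated by none; the last assumption bounds the probability of the contrary.\<close>

locale foelner_cover = graph_action V \<Gamma> X for V :: "'a set" and \<Gamma> X +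
  fixes KK :: "nat \<Rightarrow> 'a set set" and p :: "nat \<Rightarrow> real"
  assumes inf_V: "infinite V"
    and KK_fin: "A \<in> KK n \<Longrightarrow> finite A"
    and KK_V: "A \<in> KK n \<Longrightarrow> A \<subseteq> V"
    and KK_act: "\<gamma> \<in> \<Gamma> \<Longrightarrow> A \<subseteq> V \<Longrightarrow> \<gamma> ` A \<in> KK n \<longleftrightarrow> A \<in> KK n"
    and KK_local: "x \<in> V \<Longrightarrow> finite {A\<in>KK n. x \<in> A}"
    and p_range: "0 \<le> p n" "p n \<le> 1"
    and KK_bound: "{x, y} \<in> E \<Longrightarrow>
      (1 - p n) ^ card {A\<in>KK n. x \<in> A} + p n * card {A\<in>KK n. x \<in> A \<longleftrightarrow> y \<notin> A} \<le> (1/2) ^ n"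
begin

definition kept :: "nat \<Rightarrow> (nat \<times> 'a set \<Rightarrow> real) \<Rightarrow> 'a set set" where
  "kept n U = {e \<in> E. (\<exists>A\<in>KK n. U (n + 2, A) < p n \<and> e \<subseteq> A) \<and>
     (\<forall>A\<in>KK n. U (n + 2, A) < p n \<longrightarrow> A \<inter> e = {} \<or> e \<subseteq> A)}"

text \<open>Single levels are not nested. Demanding that an edge be kept at all later levels too
  makes these sets increase with n.\<close>

definition tail :: "nat \<Rightarrow> (nat \<times> 'a set \<Rightarrow> real) \<Rightarrow> 'a set set" where
  "tail n U = {e \<in> E. \<forall>k\<ge>n. e \<in> kept k U}"

text \<open>Edges are compared by the level from which they are kept for good, and for equal levels
  by their labels.\<close>

definition before :: "(nat \<times> 'a set \<Rightarrow> real) \<Rightarrow> 'a set \<Rightarrow> 'a set \<Rightarrow> bool" where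
  "before U e f \<longleftrightarrow> (\<exists>n. e \<in> tail n U \<and> f \<notin> tail n U) \<or>
     ((\<forall>n. e \<in> tail n U \<longleftrightarrow> f \<in> tail n U) \<and> U (0, e) < U (0, f))"

text \<open>This is \<open>mst\<close> for the order \<open>before U\<close>, written out because
  that order is known to be total only for good labels.\<close>

definition tree_edges :: "(nat \<times> 'a set \<Rightarrow> real) \<Rightarrow> 'a set set" where
  "tree_edges U = {e \<in> E. \<forall>x y. e = {x, y} \<longrightarrow> \<not> conn {f \<in> E. before U f e} x y}"

definition good :: "(nat \<times> 'a set \<Rightarrow> real) \<Rightarrow> bool" where
  "good U \<longleftrightarrow> (\<forall>e\<in>E. \<exists>n. e \<in> tail n U) \<and> (\<forall>e\<in>E. \<forall>f\<in>E. e \<noteq> f \<longrightarrow> U (0, e) \<noteq> U (0, f)) \<and>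
     (\<forall>x\<in>V. \<forall>y\<in>V. x \<noteq> y \<longrightarrow> U (1, {x}) \<noteq> U (1, {y}))"

lemma tail_mono: "m \<le> n \<Longrightarrow> tail m U \<subseteq> tail n U"
  by (auto simp: tail_def)

lemma tail_kept: "tail n U \<subseteq> kept n U"
  by (auto simp: tail_def)

lemma tail_E: "tail n U \<subseteq> E"
  by (auto simp: tail_def)

text \<open>If a chosen set of level n contains x, no edge kept at that level leaves it; otherwise
  no kept edge contains x.\<close>

lemma finite_tail_component:
  "\<exists>S. finite S \<and> x \<in> S \<and> (\<forall>e a b. e \<in> tail n U \<longrightarrow> e = {a, b} \<longrightarrow> a \<in> S \<longrightarrow> b \<in> S)"
proof (cases "\<exists>A\<in>KK n. U (n + 2, A) < p n \<and> x \<in> A")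
  case True
  then obtain A where A: "A \<in> KK n" "U (n + 2, A) < p n" "x \<in> A" by blast
  have "b \<in> A" if "e \<in> tail n U" "e = {a, b}" "a \<in> A" for e a b
  proof -
    have "e \<in> kept n U" using that tail_kept by auto
    then have "A \<inter> e = {} \<or> e \<subseteq> A" using A by (auto simp: kept_def)
    then show ?thesis using that by auto
  qed
  then show ?thesis using A KK_fin[OF A(1)] by (intro exI[of _ A] conjI allI impI)
next
  case False
  have "b = x" if "e \<in> tail n U" "e = {a, b}" "a = x" for e a b
  proof -
    have "e \<in> kept n U" using that tail_kept by auto
    then show ?thesis using False that by (auto simp: kept_def)
  qed
  then show ?thesis by (intro exI[of _ "{x}"]) auto
qed

lemma finite_tail: "finite {y\<in>V. conn (tail n U) x y}"
proof -
  obtain S where S: "finite S" "x \<in> S" "\<forall>e a b. e \<in> tail n U \<longrightarrow> e = {a, b} \<longrightarrow> a \<in> S \<longrightarrow> b \<in> S"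
    using finite_tail_component[of x n U] by (elim exE conjE)
  have "{y\<in>V. conn (tail n U) x y} \<subseteq> S"
  proof
    fix y assume "y \<in> {y\<in>V. conn (tail n U) x y}"
    then have "conn (tail n U) x y" by simp
    then show "y \<in> S" by (rule conn_closed[OF _ S(2)]) (use S(3) in blast)
  qed
  then show ?thesis using S(1) by (rule finite_subset)
qed

lemma before_irrefl: "\<not> before U e e"
  by (simp add: before_def)

lemma before_trans:
  assumes "before U e f" "before U f g" shows "before U e g"
proof (cases "\<exists>n. e \<in> tail n U \<and> g \<notin> tail n U")
  case False
  have tail: "h \<in> tail m U" if "h \<in> tail n U" "n \<le> m" for h m n using tail_mono that by blast
  have 1: "e \<notin> tail n U \<or> f \<in> tail n U" for n
  proof (rule ccontr)
    assume "\<not> (e \<notin> tail n U \<or> f \<in> tail n U)"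
    then have n: "e \<in> tail n U" "f \<notin> tail n U" by simp_all
    then have "g \<in> tail n U" using False by blast
    then obtain m where m: "f \<in> tail m U" "g \<notin> tail m U" using assms(2) n(2) unfolding before_def by metis
    show False
    proof (cases "n \<le> m")
      case True
      then have "e \<in> tail m U" by (rule tail[OF n(1)])
      then show False using m(2) False by blast
    next
      case False
      then have "f \<in> tail n U" by (intro tail[OF m(1)]) simp
      then show False using n(2) by blast
    qed
  qed
  have ef: "(\<forall>n. e \<in> tail n U \<longleftrightarrow> f \<in> tail n U) \<and> U (0, e) < U (0, f)"
    using assms(1) 1 unfolding before_def by metis
  have fg: "(\<forall>n. f \<in> tail n U \<longleftrightarrow> g \<in> tail n U) \<and> U (0, f) < U (0, g)"
    using assms(2) ef False unfolding before_def by metis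
  have "U (0, e) < U (0, g)" using ef fg by (metis less_trans)
  then show ?thesis unfolding before_def using ef fg by metis
qed (auto simp: before_def)

lemma edge_order: "good U \<Longrightarrow> edge_order V E (before U)"
proof
  fix e assume "e \<in> E"
  then show "\<exists>x y. x \<in> V \<and> y \<in> V \<and> x \<noteq> y \<and> e = {x, y}" by (metis E_obtain)
next
  fix e f assume "good U" "e \<in> E" "f \<in> E"
  then have "e = f \<or> U (0, e) < U (0, f) \<or> U (0, f) < U (0, e)" unfolding good_def by (metis linorder_less_linear)
  then show "e = f \<or> before U e f \<or> before U f e" unfolding before_def by blast
qed (auto simp: before_irrefl intro: before_trans)

lemma tree_edges_E: "tree_edges U \<subseteq> E"
  by (auto simp: tree_edges_def)

text \<open>Edges smaller than e belong to every tail that contains e, and components of tails are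
  finite. This is the finiteness hypothesis of \<open>mst_conn\<close>.\<close>

lemma infinite_tree:
  assumes "good U" shows "infinite_tree V (tree_edges U)"
proof -
  interpret edge_order V E "before U" by (rule edge_order) fact
  have t: "tree_edges U = mst" by (simp add: tree_edges_def mst_def)
  have edge: "conn mst x y" if xy: "{x, y} \<in> E" for x y
  proof (rule mst_conn[OF _ xy])
    fix e x y assume "e \<in> E" "e = {x, y}"
    then obtain n where n: "e \<in> tail n U" using assms by (auto simp: good_def)
    obtain S where S: "finite S" "x \<in> S" "\<forall>e a b. e \<in> tail n U \<longrightarrow> e = {a, b} \<longrightarrow> a \<in> S \<longrightarrow> b \<in> S"
      using finite_tail_component[of x n U] by (elim exE conjE)
    have "f \<in> tail n U" if "before U f e" for f
      using that
    proof (rule disjE[OF iffD1[OF before_def]])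
      assume "\<exists>m. f \<in> tail m U \<and> e \<notin> tail m U"
      then obtain m where m: "f \<in> tail m U" "e \<notin> tail m U" by blast
      then have "m \<le> n" using n tail_mono[of n m U] by (cases "m \<le> n") auto
      then show ?thesis using m tail_mono by blast
    qed (use n in auto)
    then show "\<exists>S. finite S \<and> x \<in> S \<and> (\<forall>f a b. f \<in> E \<longrightarrow> before U f e \<longrightarrow> f = {a, b} \<longrightarrow> a \<in> S \<longrightarrow> b \<in> S)"
      using S by (intro exI[of _ S]) blast
  qed
  show ?thesis
    unfolding t
  proof
    fix e assume "e \<in> mst"
    then have "e \<in> E" by (simp add: mst_def)
    then show "\<exists>x y. x \<in> V \<and> y \<in> V \<and> x \<noteq> y \<and> e = {x, y}" by (metis E_obtain)
  next
    fix x assume x: "x \<in> V"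
    show "finite {y\<in>V. {x, y} \<in> mst}" by (rule finite_subset[OF _ finite_nbrs[OF x]]) (auto simp: mst_def)
  next
    fix x y assume "x \<in> V" "y \<in> V"
    then show "conn mst x y" using conn_E by (rule_tac conn_lift[OF _ edge]) auto
  next
    fix x y assume "{x, y} \<in> mst"
    then show "\<not> conn (mst - {{x, y}}) x y" by (rule mst_bridge)
  qed (rule inf_V)
qed

lemma KK_countable: "countable (KK n)"
  by (rule countable_subset[OF _ countable_Collect_finite_subset[OF countable_V]]) (use KK_fin KK_V in blast)

lemma measurable_kept:
  assumes "e \<in> E" shows "Measurable.pred (labels J) (\<lambda>U. e \<in> kept n U)"
proof -
  have "Measurable.pred (labels J) (\<lambda>U. U (n + 2, A) < p n)" if "A \<in> KK n" for A
    using that KK_fin KK_V by (intro pred_real_less measurable_label borel_measurable_const) auto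
  then have "Measurable.pred (labels J) (\<lambda>U. (\<exists>A\<in>KK n. U (n + 2, A) < p n \<and> e \<subseteq> A) \<and>
     (\<forall>A\<in>KK n. U (n + 2, A) < p n \<longrightarrow> A \<inter> e = {} \<or> e \<subseteq> A))"
    by (intro pred_intros_logic measurable_pred_countable KK_countable) auto
  then show ?thesis using assms by (simp add: kept_def)
qed

lemma measurable_tail: "Measurable.pred (labels J) (\<lambda>U. e \<in> tail n U)"
proof (cases "e \<in> E")
  case True
  have "Measurable.pred (labels J) (\<lambda>U. \<forall>k. n \<le> k \<longrightarrow> e \<in> kept k U)"
    by (intro pred_intros_countable pred_intros_imp' measurable_kept True)
  moreover have "(\<forall>k. n \<le> k \<longrightarrow> e \<in> kept k U) \<longleftrightarrow> e \<in> tail n U" for U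
    unfolding tail_def using True by blast
  ultimately show ?thesis by (simp only:)
qed (simp add: tail_def)

lemma measurable_before:
  assumes "e \<in> E" "f \<in> E" shows "Measurable.pred (labels J) (\<lambda>U. before U e f)"
proof -
  have "e \<subseteq> V" "finite e" "f \<subseteq> V" "finite f" using E_edge assms by auto
  then show ?thesis
    unfolding before_def
    by (intro pred_intros_logic pred_intros_countable measurable_tail pred_real_less measurable_label)
qed

lemma measurable_conn_tail:
  "x \<in> V \<Longrightarrow> y \<in> V \<Longrightarrow> Measurable.pred (labels J) (\<lambda>U. conn (tail n U) x y)"
  using tail_E E_sub by (intro measurable_conn[OF countable_V] measurable_tail) blast+

lemma measurable_tree_edges: "Measurable.pred (labels J) (\<lambda>U. e \<in> tree_edges U)"
proof (cases "e \<in> E")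
  case True
  have b: "Measurable.pred (labels J) (\<lambda>U. {a, b} \<in> {f \<in> E. before U f e})" for a b
  proof (cases "{a, b} \<in> E")
    case True
    then show ?thesis using measurable_before[OF _ \<open>e \<in> E\<close>] by simp
  qed simp
  have "Measurable.pred (labels J) (\<lambda>U. conn {f \<in> E. before U f e} x y)" if "x \<in> V" "y \<in> V" for x y
    using E_sub by (intro measurable_conn[OF countable_V _ b that]) blast
  then have "Measurable.pred (labels J) (\<lambda>U. \<forall>x\<in>V. \<forall>y\<in>V. e = {x, y} \<longrightarrow> \<not> conn {f \<in> E. before U f e} x y)"
    by (intro measurable_pred_countable pred_intros_imp' pred_intros_logic countable_V) auto
  moreover have "e \<in> tree_edges U \<longleftrightarrow> (\<forall>x\<in>V. \<forall>y\<in>V. e = {x, y} \<longrightarrow> \<not> conn {f \<in> E. before U f e} x y)" for U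
    using True E_edge[OF True] by (auto simp: tree_edges_def)
  ultimately show ?thesis by simp
qed (simp add: tree_edges_def)

lemma measurable_good: "Measurable.pred (labels J) good"
proof -
  have "Measurable.pred (labels J) (\<lambda>U. U (0, e) = U (0, f))" if "e \<in> E" "f \<in> E" for e f
    using E_edge[OF that(1)] E_edge[OF that(2)] by (intro pred_real_eq measurable_label) auto
  moreover have "Measurable.pred (labels J) (\<lambda>U. U (1, {x}) = U (1, {y}))" if "x \<in> V" "y \<in> V" for x y
    using that by (intro pred_real_eq measurable_label) auto
  ultimately show ?thesis
    unfolding good_def[abs_def]
    by (intro pred_intros_logic pred_intros_countable measurable_pred_countable pred_intros_imp' measurable_tail
        countable_E countable_V) simp_all
qed

end

context graph_symmetry
begin

lemma act_E_Collect:
  assumes g: "\<gamma> \<in> \<Gamma>" and Q: "\<And>e. e \<in> E \<Longrightarrow> Q' (\<gamma> ` e) \<longleftrightarrow> Q e"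
  shows "{e \<in> E. Q' e} = (`) \<gamma> ` {e \<in> E. Q e}"
proof (intro equalityI subsetI)
  fix e assume e: "e \<in> {e \<in> E. Q' e}"
  then obtain e' where "e' \<in> E" "e = \<gamma> ` e'" using E_preimage[OF g] by (metis mem_Collect_eq)
  then show "e \<in> (`) \<gamma> ` {e \<in> E. Q e}" using e Q by blast
next
  fix e assume "e \<in> (`) \<gamma> ` {e \<in> E. Q e}"
  then obtain e' where e': "e' \<in> E" "Q e'" "e = \<gamma> ` e'" by blast
  moreover have "e \<in> E" using e' E_image[OF g] E_edge[OF e'(1)] by simp
  ultimately show "e \<in> {e \<in> E. Q' e}" using Q by simp
qed

end

context foelner_cover
begin

section \<open>Equivariance and almost sure properties of the spanning tree\<close>

lemma bex_KK: "\<gamma> \<in> \<Gamma> \<Longrightarrow> (\<exists>A\<in>KK n. Q A) \<longleftrightarrow> (\<exists>A\<in>KK n. Q (\<gamma> ` A))"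
proof -
  assume g: "\<gamma> \<in> \<Gamma>"
  have "KK n = (`) \<gamma> ` KK n"
  proof (intro equalityI subsetI)
    fix A assume A: "A \<in> KK n"
    then have "A \<subseteq> \<gamma> ` V" using KK_V image_V[OF g] by simp
    then obtain B where "B \<subseteq> V" "A = \<gamma> ` B" by (metis subset_imageE)
    then show "A \<in> (`) \<gamma> ` KK n" using A KK_act[OF g] by simp
  next
    fix A assume "A \<in> (`) \<gamma> ` KK n"
    then show "A \<in> KK n" using KK_act[OF g] KK_V by blast
  qed
  then show ?thesis by (metis (no_types, lifting) imageE imageI)
qed

lemma ball_KK: "\<gamma> \<in> \<Gamma> \<Longrightarrow> (\<forall>A\<in>KK n. Q A) \<longleftrightarrow> (\<forall>A\<in>KK n. Q (\<gamma> ` A))"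
  using bex_KK[of \<gamma> n "\<lambda>A. \<not> Q A"] by blast

lemma act_kept:
  assumes g: "\<gamma> \<in> \<Gamma>" and e: "e \<subseteq> V"
  shows "\<gamma> ` e \<in> kept n (act_labels \<gamma> U) \<longleftrightarrow> e \<in> kept n U"
proof -
  have s: "\<gamma> ` e \<subseteq> \<gamma> ` A \<longleftrightarrow> e \<subseteq> A" "\<gamma> ` A \<inter> \<gamma> ` e = {} \<longleftrightarrow> A \<inter> e = {}"
     "act_labels \<gamma> U (n + 2, \<gamma> ` A) = U (n + 2, A)" if "A \<in> KK n" for A
  proof -
    note A = KK_V[OF that] KK_fin[OF that]
    show "\<gamma> ` e \<subseteq> \<gamma> ` A \<longleftrightarrow> e \<subseteq> A" by (rule inj_on_image_subset_iff[OF inj_V[OF g] e A(1)])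
    show "\<gamma> ` A \<inter> \<gamma> ` e = {} \<longleftrightarrow> A \<inter> e = {}"
      using inj_on_image_Int[OF inj_V[OF g] A(1) e] by (metis image_is_empty)
    show "act_labels \<gamma> U (n + 2, \<gamma> ` A) = U (n + 2, A)" by (rule act_labels_image[OF g A(2,1)])
  qed
  show ?thesis
    unfolding kept_def mem_Collect_eq
    by (subst bex_KK[OF g], subst ball_KK[OF g]) (simp add: s E_image[OF g e] del: add_2_eq_Suc' cong: bex_cong ball_cong)
qed

lemma act_tail:
  assumes g: "\<gamma> \<in> \<Gamma>" and e: "e \<subseteq> V"
  shows "\<gamma> ` e \<in> tail n (act_labels \<gamma> U) \<longleftrightarrow> e \<in> tail n U"
  by (simp add: tail_def act_kept[OF assms] E_image[OF assms])

lemma act_before: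
  assumes g: "\<gamma> \<in> \<Gamma>" and e: "e \<in> E" "f \<in> E"
  shows "before (act_labels \<gamma> U) (\<gamma> ` e) (\<gamma> ` f) \<longleftrightarrow> before U e f"
  using E_edge[OF e(1)] E_edge[OF e(2)]
  by (simp add: before_def act_tail[OF g] act_labels_image[OF g])

lemma act_tail_set: "\<gamma> \<in> \<Gamma> \<Longrightarrow> tail n (act_labels \<gamma> U) = (`) \<gamma> ` tail n U"
proof -
  assume g: "\<gamma> \<in> \<Gamma>"
  have t: "tail n U = {e\<in>E. e \<in> tail n U}" for U using tail_E by blast
  show ?thesis
    by (subst (1 2) t, rule act_E_Collect[OF g]) (use E_edge act_tail[OF g] in blast)
qed

lemma act_tree_edges: "\<gamma> \<in> \<Gamma> \<Longrightarrow> tree_edges (act_labels \<gamma> U) = (`) \<gamma> ` tree_edges U"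
  unfolding tree_edges_def
proof (rule act_E_Collect)
  fix e assume g: "\<gamma> \<in> \<Gamma>" and e: "e \<in> E"
  have eV: "e \<subseteq> V" using E_edge[OF e] by simp
  have "{f \<in> E. before (act_labels \<gamma> U) f (\<gamma> ` e)} = (`) \<gamma> ` {f \<in> E. before U f e}"
    by (rule act_E_Collect[OF g]) (rule act_before[OF g _ e])
  moreover have "\<Union>{f \<in> E. before U f e} \<subseteq> V" using E_sub by blast
  ultimately have c: "conn {f \<in> E. before (act_labels \<gamma> U) f (\<gamma> ` e)} (\<gamma> x) (\<gamma> y) \<longleftrightarrow> conn {f \<in> E. before U f e} x y"
    if "x \<in> V" "y \<in> V" for x y
    using conn_V[OF g _ that] by simp
  have all: "(\<forall>x y. f = {x, y} \<longrightarrow> Q x y) \<longleftrightarrow> (\<forall>x\<in>V. \<forall>y\<in>V. f = {x, y} \<longrightarrow> Q x y)" if "f \<subseteq> V" for f Q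
    using that by blast
  have ge: "\<gamma> ` e \<subseteq> V" using eV g by auto
  have eq: "\<gamma> ` e = {\<gamma> x, \<gamma> y} \<longleftrightarrow> e = {x, y}" if "x \<in> V" "y \<in> V" for x y
    using image_eq_V[OF g eV, of "{x, y}"] that by simp
  show "(\<forall>x y. \<gamma> ` e = {x, y} \<longrightarrow> \<not> conn {f \<in> E. before (act_labels \<gamma> U) f (\<gamma> ` e)} x y) \<longleftrightarrow>
      (\<forall>x y. e = {x, y} \<longrightarrow> \<not> conn {f \<in> E. before U f e} x y)"
    unfolding all[OF ge] all[OF eV]
    by (subst ball_V[OF g], subst (2) ball_V[OF g]) (intro ball_cong refl, simp only: c eq)
qed

lemma ball_E: "\<gamma> \<in> \<Gamma> \<Longrightarrow> (\<forall>e\<in>E. Q e) \<longleftrightarrow> (\<forall>e\<in>E. Q (\<gamma> ` e))"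
  using E_preimage E_image E_edge by metis

lemma act_good:
  assumes g: "\<gamma> \<in> \<Gamma>" shows "good (act_labels \<gamma> U) \<longleftrightarrow> good U"
proof -
  have e: "e \<subseteq> V" "finite e" if "e \<in> E" for e using E_edge[OF that] by auto
  have 1: "(\<forall>e\<in>E. \<exists>n. e \<in> tail n (act_labels \<gamma> U)) \<longleftrightarrow> (\<forall>e\<in>E. \<exists>n. e \<in> tail n U)"
    by (subst ball_E[OF g]) (simp add: act_tail[OF g e(1)] cong: ball_cong)
  have 2: "(\<forall>e\<in>E. \<forall>f\<in>E. e \<noteq> f \<longrightarrow> act_labels \<gamma> U (0, e) \<noteq> act_labels \<gamma> U (0, f)) \<longleftrightarrow>
      (\<forall>e\<in>E. \<forall>f\<in>E. e \<noteq> f \<longrightarrow> U (0, e) \<noteq> U (0, f))"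
    by (subst ball_E[OF g], subst (2) ball_E[OF g]) (simp add: e act_labels_image[OF g] image_eq_V[OF g] cong: ball_cong)
  have 3: "(\<forall>x\<in>V. \<forall>y\<in>V. x \<noteq> y \<longrightarrow> act_labels \<gamma> U (1, {x}) \<noteq> act_labels \<gamma> U (1, {y})) \<longleftrightarrow>
      (\<forall>x\<in>V. \<forall>y\<in>V. x \<noteq> y \<longrightarrow> U (1, {x}) \<noteq> U (1, {y}))"
    by (subst ball_V[OF g], subst (2) ball_V[OF g])
      (use act_labels_image[OF g, of "{_}"] g in \<open>simp cong: ball_cong\<close>)
  show ?thesis unfolding good_def 1 2 3 ..
qed

text \<open>An edge is lost only if no chosen set contains x (the event \<open>S\<close>) or some
  chosen set separates x from y (the events \<open>R A\<close>). The first probability is a product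
  by independence, the others are added up.\<close>

lemma prob_not_kept:
  assumes e: "{x, y} \<in> E"
  shows "emeasure (labels J) {U \<in> space (labels J). {x, y} \<notin> kept n U} \<le> ennreal ((1/2) ^ n)"
proof -
  interpret L: prob_space "labels J" by (rule prob_space_labels)
  have V: "x \<in> V" "y \<in> V" using e by auto
  define a where "a = {A\<in>KK n. x \<in> A}"
  define c where "c = {A\<in>KK n. x \<in> A \<longleftrightarrow> y \<notin> A}"
  have fa: "finite a" unfolding a_def by (rule KK_local[OF V(1)])
  have "c \<subseteq> {A\<in>KK n. x \<in> A} \<union> {A\<in>KK n. y \<in> A}" by (auto simp: c_def)
  then have fc: "finite c" using KK_local[OF V(1)] KK_local[OF V(2)] by (meson finite_UnI finite_subset)
  define S where "S = {U \<in> space (labels J). \<forall>j\<in>Pair (n + 2) ` a. U j \<in> {p n..}}"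
  define R where "R A = {U \<in> space (labels J). \<forall>j\<in>{(n + 2, A)}. U j \<in> {..<p n}}" for A
  have J: "(n + 2, A) \<in> J" if "A \<in> KK n" for A using KK_fin[OF that] KK_V[OF that] by (simp add: J_def)
  have aJ: "Pair (n + 2) ` a \<subseteq> J" using J by (auto simp: a_def)
  have "emeasure unif {p n..} = ennreal (1 - p n)"
  proof -
    have "{p n..} = space unif - {..<p n}" by auto
    then have "measure unif {p n..} = 1 - p n"
      using prob_space.prob_compl[OF prob_space_unif, of "{..<p n}"] measure_unif_less[OF p_range] by simp
    then show ?thesis
      by (simp add: finite_measure.emeasure_eq_measure prob_space.finite_measure prob_space_unif)
  qed
  then have S: "emeasure (labels J) S = ennreal ((1 - p n) ^ card a)"
    unfolding S_def using fa aJ p_range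
    by (subst prob_labels_Ball) (auto simp: card_image inj_on_def ennreal_power)
  have R: "emeasure (labels J) (R A) = ennreal (p n)" if "A \<in> KK n" for A
    unfolding R_def using J[OF that] emeasure_unif_less[OF p_range]
    by (subst prob_labels_Ball) auto
  have Ss: "S \<in> sets (labels J)"
  proof -
    have "Measurable.pred (labels J) (\<lambda>U. p n \<le> U j)" if "j \<in> J" for j
      using measurable_label_component[OF that] by (intro pred_real_le borel_measurable_const)
    then have "Measurable.pred (labels J) (\<lambda>U. \<forall>j\<in>Pair (n + 2) ` a. p n \<le> U j)"
      using fa aJ by (intro measurable_pred_countable countable_finite) auto
    then show ?thesis by (simp add: S_def pred_def)
  qed
  have Rs: "R A \<in> sets (labels J)" if "A \<in> KK n" for A
  proof -
    have "Measurable.pred (labels J) (\<lambda>U. U (n + 2, A) < p n)"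
      using measurable_label_component[OF J[OF that]] by (intro pred_real_less borel_measurable_const)
    then show ?thesis by (simp add: R_def pred_def)
  qed
  have sub: "{U \<in> space (labels J). {x, y} \<notin> kept n U} \<subseteq> S \<union> (\<Union>A\<in>c. R A)"
  proof
    fix U assume U: "U \<in> {U \<in> space (labels J). {x, y} \<notin> kept n U}"
    show "U \<in> S \<union> (\<Union>A\<in>c. R A)"
    proof (cases "U \<in> S")
      case False
      then obtain A where A: "A \<in> KK n" "x \<in> A" "U (n + 2, A) < p n" using U by (auto simp: S_def a_def not_le)
      show ?thesis
      proof (cases "y \<in> A")
        case True
        then have "\<exists>B\<in>KK n. U (n + 2, B) < p n \<and> B \<inter> {x, y} \<noteq> {} \<and> \<not> {x, y} \<subseteq> B"
          using U e A unfolding kept_def by blast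
        then obtain B where B: "B \<in> KK n" "U (n + 2, B) < p n" "B \<inter> {x, y} \<noteq> {} \<and> \<not> {x, y} \<subseteq> B" by blast
        then have "B \<in> c" unfolding c_def by blast
        then show ?thesis using B U by (auto simp: R_def)
      next
        case False
        then have "A \<in> c" using A unfolding c_def by blast
        then show ?thesis using A U by (auto simp: R_def)
      qed
    qed simp
  qed
  have cK: "A \<in> KK n" if "A \<in> c" for A using that by (simp add: c_def)
  have Us: "(\<Union>A\<in>c. R A) \<in> sets (labels J)" using fc Rs cK by (intro sets.finite_UN) auto
  have "emeasure (labels J) {U \<in> space (labels J). {x, y} \<notin> kept n U} \<le> emeasure (labels J) (S \<union> (\<Union>A\<in>c. R A))"
    by (rule emeasure_mono[OF sub]) (use Ss Us in auto)
  also have "\<dots> \<le> emeasure (labels J) S + emeasure (labels J) (\<Union>A\<in>c. R A)"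
    by (rule emeasure_subadditive[OF Ss Us])
  also have "emeasure (labels J) (\<Union>A\<in>c. R A) \<le> (\<Sum>A\<in>c. emeasure (labels J) (R A))"
    by (rule emeasure_subadditive_finite[OF fc]) (use Rs cK in auto)
  also have "\<dots> = (\<Sum>A\<in>c. ennreal (p n))" by (rule sum.cong[OF refl R[OF cK]])
  also have "\<dots> = ennreal (p n * card c)"
    using p_range[of n] by (simp add: ennreal_mult ennreal_of_nat_eq_real_of_nat mult.commute)
  also have "emeasure (labels J) S + ennreal (p n * card c) = ennreal ((1 - p n) ^ card a + p n * card c)"
    unfolding S using p_range[of n] by (intro ennreal_plus[symmetric]) auto
  also have "\<dots> \<le> ennreal ((1/2) ^ n)"
    by (rule ennreal_leI) (use KK_bound[OF e, of n] in \<open>simp only: a_def c_def\<close>)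
  finally show ?thesis by (simp add: add_left_mono)
qed

lemma prob_not_tail:
  assumes e: "{x, y} \<in> E"
  shows "emeasure (labels J) {U \<in> space (labels J). {x, y} \<notin> tail n U} \<le> ennreal (2 * (1/2) ^ n)"
proof -
  let ?B = "\<lambda>k. {U \<in> space (labels J). {x, y} \<notin> kept (n + k) U}"
  have B: "?B k \<in> sets (labels J)" for k
  proof -
    have "Measurable.pred (labels J) (\<lambda>U. {x, y} \<notin> kept (n + k) U)" by (intro pred_intros_logic measurable_kept e)
    then show ?thesis by (simp add: pred_def)
  qed
  have "{U \<in> space (labels J). {x, y} \<notin> tail n U} \<subseteq> (\<Union>k. ?B k)"
  proof
    fix U assume "U \<in> {U \<in> space (labels J). {x, y} \<notin> tail n U}"
    then obtain k where k: "U \<in> space (labels J)" "n \<le> k" "{x, y} \<notin> kept k U" using e by (auto simp: tail_def)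
    then have "U \<in> ?B (k - n)" by simp
    then show "U \<in> (\<Union>k. ?B k)" by blast
  qed
  then have "emeasure (labels J) {U \<in> space (labels J). {x, y} \<notin> tail n U} \<le> emeasure (labels J) (\<Union>k. ?B k)"
    by (rule emeasure_mono) (use B in auto)
  also have "\<dots> \<le> (\<Sum>k. emeasure (labels J) (?B k))"
    by (rule emeasure_subadditive_countably) (use B in auto)
  also have "\<dots> \<le> (\<Sum>k. ennreal ((1/2) ^ (n + k)))"
    by (intro suminf_le prob_not_kept e) auto
  also have "\<dots> = ennreal (2 * (1/2) ^ n)"
  proof (rule suminf_ennreal_eq)
    have "(\<lambda>k. (1/2) ^ n * (1/2::real) ^ k) sums ((1/2) ^ n * (1 / (1 - 1/2)))"
      by (intro sums_mult geometric_sums) simp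
    then show "(\<lambda>k. (1/2::real) ^ (n + k)) sums (2 * (1/2) ^ n)" by (simp add: power_add mult.commute)
  qed simp
  finally show ?thesis .
qed

lemma vanishing:
  assumes "\<And>n::nat. x \<le> ennreal (c * (1/2) ^ n)" shows "x = 0"
proof -
  have "(\<lambda>n. ennreal (c * (1/2) ^ n)) \<longlonglongrightarrow> ennreal (c * 0)"
    by (intro tendsto_ennrealI tendsto_intros LIMSEQ_power_zero) simp
  then have "x \<le> ennreal (c * 0)" by (rule LIMSEQ_le_const) (use assms in auto)
  then show ?thesis by simp
qed

lemma AE_good: "AE U in labels J. good U"
proof -
  have 1: "AE U in labels J. \<exists>n. e \<in> tail n U" if e: "e \<in> E" for e
  proof -
    obtain x y where xy: "e = {x, y}" by (rule E_obtain[OF e])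
    have "Measurable.pred (labels J) (\<lambda>U. \<not> (\<exists>n. e \<in> tail n U))"
      by (intro pred_intros_logic pred_intros_countable measurable_tail)
    then have m: "{U \<in> space (labels J). \<not> (\<exists>n. e \<in> tail n U)} \<in> sets (labels J)" by (simp add: pred_def)
    have "emeasure (labels J) {U \<in> space (labels J). \<not> (\<exists>n. e \<in> tail n U)} \<le> ennreal (2 * (1/2) ^ n)" for n
    proof (rule order_trans[OF emeasure_mono])
      have "Measurable.pred (labels J) (\<lambda>U. e \<notin> tail n U)" by (intro pred_intros_logic measurable_tail)
      then show "{U \<in> space (labels J). e \<notin> tail n U} \<in> sets (labels J)" by (simp add: pred_def)
      show "emeasure (labels J) {U \<in> space (labels J). e \<notin> tail n U} \<le> ennreal (2 * (1/2) ^ n)"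
        using prob_not_tail[of x y n] e xy by (simp only:)
    qed auto
    then have "emeasure (labels J) {U \<in> space (labels J). \<not> (\<exists>n. e \<in> tail n U)} = 0" by (rule vanishing)
    then show ?thesis by (rule AE_iff_measurable[OF m refl, THEN iffD2])
  qed
  have "AE U in labels J. \<forall>e\<in>E. \<exists>n. e \<in> tail n U"
    using 1 by (subst AE_ball_countable) auto
  moreover have "AE U in labels J. \<forall>e\<in>E. \<forall>f\<in>E. e \<noteq> f \<longrightarrow> U (0, e) \<noteq> U (0, f)"
  proof (subst AE_ball_countable, simp, intro ballI, subst AE_ball_countable, simp, intro ballI)
    fix e f assume "e \<in> E" "f \<in> E"
    then have "(0, e) \<in> J" "(0, f) \<in> J" using E_edge by (auto simp: J_def)
    then show "AE U in labels J. e \<noteq> f \<longrightarrow> U (0, e) \<noteq> U (0, f)"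
      using AE_labels_distinct[of "(0, e)" J "(0, f)"] by (cases "e = f") auto
  qed
  moreover have "AE U in labels J. \<forall>x\<in>V. \<forall>y\<in>V. x \<noteq> y \<longrightarrow> U (1, {x}) \<noteq> U (1, {y})"
  proof (subst AE_ball_countable, simp, intro ballI, subst AE_ball_countable, simp, intro ballI)
    fix x y assume "x \<in> V" "y \<in> V"
    then have "(1, {x}) \<in> J" "(1, {y}) \<in> J" by (auto simp: J_def)
    then show "AE U in labels J. x \<noteq> y \<longrightarrow> U (1, {x}) \<noteq> U (1, {y})"
      using AE_labels_distinct[of "(1, {x})" J "(1, {y})"] by (cases "x = y") auto
  qed
  ultimately show ?thesis unfolding good_def by eventually_elim simp
qed

sublocale process: invariant_process V \<Gamma> "labels J" act_labels
  by (intro invariant_process.intro invariant_process_axioms.intro mass_transport_axioms prob_space_labels act_labels_measure)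

text \<open>The excess g over two branches does not depend on n, while its expectation is at most
  the expected number of neighbours of x in other components of \<open>tail n\<close>. The latter is
  of order 2 to the power -n, so g vanishes.\<close>

lemma AE_card_big:
  assumes x: "x \<in> V" shows "AE U in labels J. card (big V (tree_edges U) x) \<le> 2"
proof -
  define A where "A = {U \<in> space (labels J). good U}"
  have A: "A \<in> sets (labels J)" using measurable_good by (simp add: A_def pred_def)
  define g :: "'a \<Rightarrow> (nat \<times> 'a set \<Rightarrow> real) \<Rightarrow> ennreal" where "g x U = of_nat (card (big V (tree_edges U) x) - 2)" for x U
  define h :: "nat \<Rightarrow> 'a \<Rightarrow> (nat \<times> 'a set \<Rightarrow> real) \<Rightarrow> ennreal" where
    "h n x U = of_nat (card {y\<in>V. {x, y} \<in> E \<and> \<not> conn (tail n U) x y})" for n x U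
  have TV: "\<Union>(tree_edges U) \<subseteq> V" for U using tree_edges_E E_sub by blast
  have tV: "\<Union>(tail n U) \<subseteq> V" for n U using tail_E E_sub by blast
  have gm: "g x \<in> borel_measurable (labels J)" if "x \<in> V" for x
    unfolding g_def
    by (rule measurable_compose[OF measurable_card_big[OF _ _ that]]) (use tree_edges_E measurable_tree_edges in auto)
  have hm: "h n x \<in> borel_measurable (labels J)" if x: "x \<in> V" for n x
  proof -
    have e: "{y\<in>V. {x, y} \<in> E \<and> \<not> conn (tail n U) x y} = {y \<in> {y\<in>V. {x, y} \<in> E}. \<not> conn (tail n U) x y}" for U by auto
    have "(\<lambda>U. card {y \<in> {y\<in>V. {x, y} \<in> E}. \<not> conn (tail n U) x y}) \<in> measurable (labels J) (count_space UNIV)"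
      by (intro measurable_card_Collect finite_nbrs x pred_intros_logic measurable_conn_tail) auto
    then show ?thesis unfolding h_def e by (rule measurable_compose) simp
  qed
  have ginv: "g (\<gamma> x) (act_labels \<gamma> U) = g x U" if "\<gamma> \<in> \<Gamma>" "x \<in> V" for \<gamma> x U
  proof -
    have b: "big V T x = {y\<in>V. y \<in> big V T x}" for T x by (auto simp: big_def)
    have "card (big V (tree_edges (act_labels \<gamma> U)) (\<gamma> x)) = card (big V (tree_edges U) x)"
      by (subst (1 2) b, subst card_V[OF that(1)])
        (simp add: big_act(2)[OF that(1) TV act_tree_edges[OF that(1)] that(2)] cong: conj_cong)
    then show ?thesis by (simp add: g_def)
  qed
  have Rinv: "conn (tail n (act_labels \<gamma> U)) (\<gamma> x) (\<gamma> y) \<longleftrightarrow> conn (tail n U) x y" if "\<gamma> \<in> \<Gamma>" "x \<in> V" "y \<in> V" for \<gamma> x y n U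
    unfolding act_tail_set[OF that(1)] by (rule conn_V[OF that(1) tV that(2,3)])
  have hinv: "h n (\<gamma> x) (act_labels \<gamma> U) = h n x U" if "\<gamma> \<in> \<Gamma>" "x \<in> V" for \<gamma> x U n
    unfolding h_def by (subst card_V[OF that(1)]) (simp add: Rinv[OF that] aut_X[OF that] cong: conj_cong)
  have le: "(\<Sum>y\<in>{y\<in>V. conn (tail n U) x y}. g y U) \<le> (\<Sum>y\<in>{y\<in>V. conn (tail n U) x y}. h n y U)"
    if U: "U \<in> A" and x: "x \<in> V" for n U x
  proof -
    interpret T: infinite_tree V "tree_edges U" by (rule infinite_tree) (use U in \<open>simp add: A_def\<close>)
    let ?C = "{y\<in>V. conn (tail n U) x y}"
    have "(\<Sum>z\<in>?C. card (big V (tree_edges U) z) - 2) \<le> (\<Sum>z\<in>?C. card {y\<in>V. {z, y} \<in> tree_edges U \<and> y \<notin> ?C})"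
      by (rule T.excess_branches[OF finite_tail]) auto
    also have "\<dots> \<le> (\<Sum>z\<in>?C. card {y\<in>V. {z, y} \<in> E \<and> \<not> conn (tail n U) z y})"
    proof (rule sum_mono, rule card_mono)
      fix z assume z: "z \<in> ?C"
      then show "finite {y\<in>V. {z, y} \<in> E \<and> \<not> conn (tail n U) z y}"
        by (intro finite_subset[OF _ finite_nbrs[of z]]) auto
      have "\<not> conn (tail n U) z y" if "y \<in> V" "y \<notin> ?C" for y
        using z that conn_trans[of "tail n U" x z y] by auto
      then show "{y\<in>V. {z, y} \<in> tree_edges U \<and> y \<notin> ?C} \<subseteq> {y\<in>V. {z, y} \<in> E \<and> \<not> conn (tail n U) z y}"
        using tree_edges_E by blast
    qed
    finally have "of_nat (\<Sum>z\<in>?C. card (big V (tree_edges U) z) - 2) \<le>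
      (of_nat (\<Sum>z\<in>?C. card {y\<in>V. {z, y} \<in> E \<and> \<not> conn (tail n U) z y}) :: ennreal)"
      by (rule of_nat_mono)
    then show ?thesis by (simp add: g_def h_def)
  qed
  have h_small: "(\<integral>\<^sup>+U. h n x U \<partial>labels J) \<le> ennreal (real (card {y\<in>V. {x, y} \<in> E}) * 2 * (1/2) ^ n)" for n
  proof -
    let ?N = "{y\<in>V. {x, y} \<in> E}" and ?B = "\<lambda>y. {U \<in> space (labels J). {x, y} \<notin> tail n U}"
    have B: "?B y \<in> sets (labels J)" for y
    proof -
      have "Measurable.pred (labels J) (\<lambda>U. {x, y} \<notin> tail n U)" by (intro pred_intros_logic measurable_tail)
      then show ?thesis by (simp add: pred_def)
    qed
    have "h n x U \<le> (\<Sum>y\<in>?N. indicator (?B y) U)" if U: "U \<in> space (labels J)" for U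
    proof -
      have "card {y\<in>V. {x, y} \<in> E \<and> \<not> conn (tail n U) x y} \<le> card {y \<in> ?N. {x, y} \<notin> tail n U}"
      proof (rule card_mono)
        show "finite {y \<in> ?N. {x, y} \<notin> tail n U}" using finite_nbrs[OF x] by (rule finite_subset[rotated]) auto
        show "{y\<in>V. {x, y} \<in> E \<and> \<not> conn (tail n U) x y} \<subseteq> {y \<in> ?N. {x, y} \<notin> tail n U}"
          using conn_edge[of x _ "tail n U"] by blast
      qed
      also have "\<dots> = (\<Sum>y\<in>?N. if {x, y} \<notin> tail n U then 1 else 0)"
        using finite_nbrs[OF x] by (simp add: sum.If_cases Int_def)
      finally have "h n x U \<le> of_nat (\<Sum>y\<in>?N. if {x, y} \<notin> tail n U then 1 else 0)"
        unfolding h_def by (rule of_nat_mono)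
      also have "\<dots> = (\<Sum>y\<in>?N. indicator (?B y) U)"
        using U by (auto simp: indicator_def intro!: sum.cong)
      finally show ?thesis .
    qed
    then have "(\<integral>\<^sup>+U. h n x U \<partial>labels J) \<le> (\<integral>\<^sup>+U. (\<Sum>y\<in>?N. indicator (?B y) U) \<partial>labels J)"
      by (intro nn_integral_mono) auto
    also have "\<dots> = (\<Sum>y\<in>?N. emeasure (labels J) (?B y))"
      using B by (subst nn_integral_sum) auto
    also have "\<dots> \<le> (\<Sum>y\<in>?N. ennreal (2 * (1/2) ^ n))"
      by (intro sum_mono prob_not_tail) auto
    also have "\<dots> = ennreal (real (card ?N) * 2 * (1/2) ^ n)"
      by (simp add: ennreal_mult ennreal_of_nat_eq_real_of_nat mult.assoc)
    finally show ?thesis .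
  qed
  have "(\<integral>\<^sup>+U. indicator A U * g x U \<partial>labels J) \<le> ennreal (real (card {y\<in>V. {x, y} \<in> E}) * 2 * (1/2) ^ n)" for n
  proof -
    have "(\<integral>\<^sup>+U. indicator A U * g x U \<partial>labels J) \<le> (\<integral>\<^sup>+U. indicator A U * h n x U \<partial>labels J)"
    proof (rule process.cell_average[OF A, where R = "\<lambda>U. conn (tail n U)"])
      fix \<gamma> w assume g: "\<gamma> \<in> \<Gamma>" and w: "w \<in> space (labels J)"
      then have "act_labels \<gamma> w \<in> space (labels J)" using measurable_space[OF act_labels_measure(1)] by blast
      then show "act_labels \<gamma> w \<in> A \<longleftrightarrow> w \<in> A" using w by (simp add: A_def act_good[OF g])
    qed (rule x gm hm ginv hinv Rinv le finite_tail conn_refl measurable_conn_tail conn_sym conn_trans; assumption)+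
    also have "\<dots> \<le> (\<integral>\<^sup>+U. h n x U \<partial>labels J)"
      by (intro nn_integral_mono) (auto simp: indicator_def)
    finally show ?thesis using h_small[of n] by (rule order_trans)
  qed
  then have "(\<integral>\<^sup>+U. indicator A U * g x U \<partial>labels J) = 0" by (rule vanishing)
  moreover have "(\<lambda>U. indicator A U * g x U) \<in> borel_measurable (labels J)" using A gm[OF x] by simp
  ultimately have "AE U in labels J. indicator A U * g x U = 0" by (simp add: nn_integral_0_iff_AE)
  with AE_good show ?thesis
    using AE_space
  proof eventually_elim
    fix U assume "good U" "indicator A U * g x U = 0" "U \<in> space (labels J)"
    then have "g x U = 0" by (simp add: A_def)
    then have "card (big V (tree_edges U) x) - 2 = 0" unfolding g_def using of_nat_eq_0_iff by blast
    then show "card (big V (tree_edges U) x) \<le> 2" by simp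
  qed
qed

end

section \<open>Foelner covers of amenable graphs\<close>

context graph_symmetry
begin

definition exits :: "'a set \<Rightarrow> 'a \<Rightarrow> nat" where
  "exits A x = card {y\<in>V. {x, y} \<in> E \<and> y \<notin> A}"

lemma sum_exits_le:
  assumes "finite A" "A \<subseteq> V" shows "(\<Sum>x\<in>A. exits A x) \<le> card (boundary A)"
proof -
  let ?S = "SIGMA x:A. {y\<in>V. {x, y} \<in> E \<and> y \<notin> A}"
  have fin: "finite {y\<in>V. {x, y} \<in> E \<and> y \<notin> A}" if "x \<in> A" for x
    by (rule finite_subset[OF _ finite_nbrs[of x]]) (use that assms in auto)
  have "(\<Sum>x\<in>A. exits A x) = card ?S"
    unfolding exits_def using fin assms by (intro card_SigmaI[symmetric]) auto
  also have "\<dots> = card ((\<lambda>(x, y). {x, y}) ` ?S)"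
    by (rule card_image[symmetric]) (auto simp: inj_on_def doubleton_eq_iff)
  also have "\<dots> \<le> card (boundary A)"
  proof (rule card_mono[OF card_boundary_le(2)[OF assms]])
    show "(\<lambda>(x, y). {x, y}) ` ?S \<subseteq> boundary A"
    proof
      fix e assume "e \<in> (\<lambda>(x, y). {x, y}) ` ?S"
      then obtain x y where xy: "x \<in> A" "{x, y} \<in> E" "y \<notin> A" "e = {x, y}" by auto
      then have "x \<noteq> y" by auto
      then show "e \<in> boundary A" using xy boundary_iff[of x y A] by simp
    qed
  qed
  finally show ?thesis .
qed

lemma exits_act:
  assumes "\<gamma> \<in> \<Gamma>" "A \<subseteq> V" "x \<in> V" shows "exits (\<gamma> ` A) (\<gamma> x) = exits A x"
  unfolding exits_def
  by (subst card_V[OF assms(1)]) (simp add: aut_X assms image_mem_V[OF assms(1,2)] cong: conj_cong)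

lemma boundary_act:
  assumes g: "\<gamma> \<in> \<Gamma>" and A: "A \<subseteq> V" shows "card (boundary (\<gamma> ` A)) = card (boundary A)"
proof -
  have "boundary (\<gamma> ` A) = (`) \<gamma> ` boundary A"
    unfolding boundary_def
  proof (rule act_E_Collect[OF g])
    fix e assume "e \<in> E"
    then have e: "e \<subseteq> V" using E_edge by blast
    have "\<gamma> ` e \<inter> \<gamma> ` A = \<gamma> ` (e \<inter> A)" by (rule inj_on_image_Int[OF inj_V[OF g] e A, symmetric])
    moreover have "card (\<gamma> ` (e \<inter> A)) = card (e \<inter> A)" by (rule card_image[OF inj_on_subset[OF inj_V[OF g]]]) (use e in auto)
    ultimately show "card (\<gamma> ` e \<inter> \<gamma> ` A) = 1 \<longleftrightarrow> card (e \<inter> A) = 1" by simp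
  qed
  moreover have "inj_on ((`) \<gamma>) (boundary A)"
  proof (rule inj_onI)
    fix e f assume "e \<in> boundary A" "f \<in> boundary A" "\<gamma> ` e = \<gamma> ` f"
    then show "e = f" using image_eq_V[OF g, of e f] E_edge[of e] E_edge[of f] by (simp add: boundary_def)
  qed
  ultimately show ?thesis by (simp add: card_image)
qed

text \<open>Otherwise A would be closed under adjacency and exhaust the infinite connected graph.
  This will show that many Foelner sets contain a given vertex.\<close>

lemma boundary_nonempty:
  assumes "infinite V" "finite A" "A \<subseteq> V" "A \<noteq> {}" shows "\<exists>x\<in>A. 1 \<le> exits A x"
proof (rule ccontr)
  assume "\<not> ?thesis"
  then have z: "exits A x = 0" if "x \<in> A" for x using that by (simp add: not_le)
  obtain x where x: "x \<in> A" using assms by auto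
  have "V \<subseteq> A"
  proof
    fix y assume "y \<in> V"
    then have "conn E x y" using x assms conn_E by auto
    then show "y \<in> A" using x
    proof (rule conn_closed)
      fix e a b assume e: "e \<in> E" "e = {a, b}" "a \<in> A"
      have "finite {y\<in>V. {a, y} \<in> E \<and> y \<notin> A}"
        by (rule finite_subset[OF _ finite_nbrs[of a]]) (use e in auto)
      then have "{y\<in>V. {a, y} \<in> E \<and> y \<notin> A} = {}" using z[OF e(3)] by (simp add: exits_def)
      then show "b \<in> A" using e by auto
    qed
  qed
  then show False using assms finite_subset by blast
qed

text \<open>All Foelner sets of a bounded diameter are taken at once: the family is then invariant,
  and the bound leaves only finitely many sets through each vertex.\<close>

definition foelner :: "nat \<Rightarrow> real \<Rightarrow> 'a set set" where
  "foelner r \<epsilon> = {A. finite A \<and> A \<subseteq> V \<and> A \<noteq> {} \<and> (\<forall>x\<in>A. A \<subseteq> gball x r) \<and>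
     real (card (boundary A)) \<le> \<epsilon> * real (card A)}"

lemma foelner_act:
  assumes g: "\<gamma> \<in> \<Gamma>" and A: "A \<subseteq> V" shows "\<gamma> ` A \<in> foelner r \<epsilon> \<longleftrightarrow> A \<in> foelner r \<epsilon>"
proof -
  have inj: "inj_on \<gamma> A" using inj_V[OF g] A by (rule inj_on_subset)
  have s: "\<gamma> ` A \<subseteq> gball (\<gamma> x) r \<longleftrightarrow> A \<subseteq> gball x r" if "x \<in> A" for x

  proof -
    have x: "x \<in> V" using that A by auto
    show ?thesis unfolding gball_image[OF g x] by (rule inj_on_image_subset_iff[OF inj_V[OF g] A gball_sub[OF x]])
  qed
  have gA: "\<gamma> ` A \<subseteq> V" using A g by auto
  have "(\<forall>x\<in>\<gamma> ` A. \<gamma> ` A \<subseteq> gball x r) \<longleftrightarrow> (\<forall>x\<in>A. A \<subseteq> gball x r)"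
    by (intro iffI ballI) (use s in blast)+
  then show ?thesis
    using A gA by (simp add: foelner_def boundary_act[OF g A] card_image[OF inj] finite_image_iff[OF inj])
qed

lemma foelner_local: "x \<in> V \<Longrightarrow> finite {A\<in>foelner r \<epsilon>. x \<in> A}"
  by (rule finite_subset[of _ "Pow (gball x r)"]) (auto simp: foelner_def gball_finite)

lemma foelner_exists:
  assumes "amenable_graph X" "\<epsilon> > 0" shows "\<exists>r. foelner r \<epsilon> \<noteq> {}"
proof -
  obtain F where F: "finite F" "F \<noteq> {}" "F \<subseteq> V" "card (boundary F) \<le> \<epsilon> * card F"
    using assms verts_X unfolding amenable_graph_def boundary_def by blast
  have "\<exists>n. snd z \<in> gball (fst z) n" if "z \<in> F \<times> F" for z
    by (rule gball_covers) (use that F(3) in auto)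
  then have "\<forall>z\<in>F \<times> F. \<exists>n. snd z \<in> gball (fst z) n" by (rule ballI)
  then obtain f where f: "\<forall>z\<in>F \<times> F. snd z \<in> gball (fst z) (f z)" by (elim bchoice[THEN exE])
  have F2: "finite (F \<times> F)" using F(1) by simp
  \<comment> \<open>The sum of the radii for all pairs serves as a common upper bound.\<close>
  have "F \<subseteq> gball x (\<Sum>z\<in>F \<times> F. f z)" if "x \<in> F" for x
  proof
    fix y assume "y \<in> F"
    then have xy: "(x, y) \<in> F \<times> F" using that by simp
    then have "f (x, y) \<le> (\<Sum>z\<in>F \<times> F. f z)" by (rule member_le_sum[OF _ _ F2]) simp
    then have "gball x (f (x, y)) \<subseteq> gball x (\<Sum>z\<in>F \<times> F. f z)" by (rule gball_mono)
    moreover have "y \<in> gball x (f (x, y))" using bspec[OF f xy] by simp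
    ultimately show "y \<in> gball x (\<Sum>z\<in>F \<times> F. f z)" by (rule subsetD)
  qed
  then have "F \<in> foelner (\<Sum>z\<in>F \<times> F. f z) \<epsilon>" using F by (auto simp: foelner_def)
  then show ?thesis by blast
qed

end

context graph_action
begin

text \<open>For each set A containing x, the vertex x spreads its exits from A evenly over A. It
  then receives |boundary A| / |A| at most, hence at most \<epsilon>, from each such set; so the
  exits at a fixed vertex are few on average over the family.\<close>

lemma foelner_exits:
  fixes \<epsilon> :: real
  assumes x: "x \<in> V" and \<epsilon>: "\<epsilon> \<ge> 0"
  shows "(\<Sum>A\<in>{A\<in>foelner r \<epsilon>. x \<in> A}. exits A x) \<le> \<epsilon> * card {A\<in>foelner r \<epsilon>. x \<in> A}"
proof -
  let ?K = "foelner r \<epsilon>"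
  define f :: "'a \<Rightarrow> 'a \<Rightarrow> ennreal" where
    "f x y = (\<Sum>A\<in>{A\<in>?K. x \<in> A \<and> y \<in> A}. ennreal (exits A x / card A))" for x y
  have A: "finite A" "A \<subseteq> V" "0 < card A" "card (boundary A) \<le> \<epsilon> * card A" if "A \<in> ?K" for A
    using that by (auto simp: foelner_def card_gt_0_iff)
  have fin: "finite {A\<in>?K. x \<in> A}" by (rule foelner_local[OF x])
  have int: "(\<integral>\<^sup>+y. (\<Sum>A\<in>{A\<in>?K. x \<in> A}. if y \<in> A then c A y else 0) \<partial>count_space V) =
      (\<Sum>A\<in>{A\<in>?K. x \<in> A}. \<Sum>y\<in>A. c A y)" for c :: "'a set \<Rightarrow> 'a \<Rightarrow> ennreal"
  proof (subst nn_integral_sum)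
    show "(\<Sum>A\<in>{A\<in>?K. x \<in> A}. \<integral>\<^sup>+y. (if y \<in> A then c A y else 0) \<partial>count_space V) =
      (\<Sum>A\<in>{A\<in>?K. x \<in> A}. \<Sum>y\<in>A. c A y)"
    proof (rule sum.cong[OF refl])
      fix B assume "B \<in> {A\<in>?K. x \<in> A}"
      then show "(\<integral>\<^sup>+y. (if y \<in> B then c B y else 0) \<partial>count_space V) = (\<Sum>y\<in>B. c B y)"
        using A by (subst nn_integral_count_space'[of B]) auto
    qed
  qed auto
  have "(\<integral>\<^sup>+y. f x y \<partial>count_space V) = (\<integral>\<^sup>+y. f y x \<partial>count_space V)"
  proof (rule mtp[OF _ x])
    fix \<gamma> x y assume g: "\<gamma> \<in> \<Gamma>" and xy: "x \<in> V" "y \<in> V"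
    have e: "{A\<in>?K. \<gamma> x \<in> A \<and> \<gamma> y \<in> A} = (`) \<gamma> ` {A\<in>?K. x \<in> A \<and> y \<in> A}"
    proof (intro equalityI subsetI)
      fix B assume B: "B \<in> {A\<in>?K. \<gamma> x \<in> A \<and> \<gamma> y \<in> A}"
      then have "B \<subseteq> \<gamma> ` V" using A(2) image_V[OF g] by simp
      then obtain C where C: "C \<subseteq> V" "B = \<gamma> ` C" by (metis subset_imageE)
      then have "C \<in> {A\<in>?K. x \<in> A \<and> y \<in> A}"
        using B foelner_act[OF g C(1)] image_mem_V[OF g C(1)] xy by simp
      then show "B \<in> (`) \<gamma> ` {A\<in>?K. x \<in> A \<and> y \<in> A}" using C by blast
    next
      fix B assume "B \<in> (`) \<gamma> ` {A\<in>?K. x \<in> A \<and> y \<in> A}"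
      then obtain C where "C \<in> ?K" "x \<in> C" "y \<in> C" "B = \<gamma> ` C" by blast
      then show "B \<in> {A\<in>?K. \<gamma> x \<in> A \<and> \<gamma> y \<in> A}" using foelner_act[OF g A(2)] by simp
    qed
    have inj: "inj_on ((`) \<gamma>) {A\<in>?K. x \<in> A \<and> y \<in> A}"
    proof (rule inj_onI)
      fix B C assume "B \<in> {A\<in>?K. x \<in> A \<and> y \<in> A}" "C \<in> {A\<in>?K. x \<in> A \<and> y \<in> A}" "\<gamma> ` B = \<gamma> ` C"
      then show "B = C" using image_eq_V[OF g, of B C] A(2) by simp
    qed
    show "f (\<gamma> x) (\<gamma> y) = f x y"
      unfolding f_def e
    proof (subst sum.reindex[OF inj], rule sum.cong[OF refl])
      fix B assume "B \<in> {A\<in>?K. x \<in> A \<and> y \<in> A}"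
      then have B: "B \<subseteq> V" using A(2) by simp
      have "card (\<gamma> ` B) = card B" by (rule card_image[OF inj_on_subset[OF inj_V[OF g] B]])
      then show "((\<lambda>A. ennreal (exits A (\<gamma> x) / card A)) \<circ> (`) \<gamma>) B = ennreal (exits B x / card B)"
        using exits_act[OF g B xy(1)] by simp
    qed
  qed
  moreover have "(\<integral>\<^sup>+y. f x y \<partial>count_space V) = ennreal (\<Sum>A\<in>{A\<in>?K. x \<in> A}. exits A x)"
  proof -
    have "f x y = (\<Sum>A\<in>{A\<in>?K. x \<in> A}. if y \<in> A then ennreal (exits A x / card A) else 0)" for y
      unfolding f_def by (rule sum.mono_neutral_cong_left[OF fin]) auto
    then have "(\<integral>\<^sup>+y. f x y \<partial>count_space V) = (\<Sum>A\<in>{A\<in>?K. x \<in> A}. \<Sum>y\<in>A. ennreal (exits A x / card A))"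
      by (simp only: int)
    also have "\<dots> = (\<Sum>A\<in>{A\<in>?K. x \<in> A}. ennreal (exits A x))"
    proof (rule sum.cong[OF refl])
      fix B assume "B \<in> {A\<in>?K. x \<in> A}"
      then have "0 < card B" using A(3) by simp
      then show "(\<Sum>y\<in>B. ennreal (exits B x / card B)) = ennreal (exits B x)"
        by (simp add: sum_ennreal del: sum_constant) simp
    qed
    finally show ?thesis by simp
  qed
  moreover have "(\<integral>\<^sup>+y. f y x \<partial>count_space V) \<le> ennreal (\<epsilon> * card {A\<in>?K. x \<in> A})"
  proof -
    have "f y x = (\<Sum>A\<in>{A\<in>?K. x \<in> A}. if y \<in> A then ennreal (exits A y / card A) else 0)" for y
      unfolding f_def by (rule sum.mono_neutral_cong_left[OF fin]) auto
    then have "(\<integral>\<^sup>+y. f y x \<partial>count_space V) = (\<Sum>A\<in>{A\<in>?K. x \<in> A}. \<Sum>y\<in>A. ennreal (exits A y / card A))"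
      by (simp only: int)
    also have "\<dots> \<le> (\<Sum>A\<in>{A\<in>?K. x \<in> A}. ennreal \<epsilon>)"
    proof (rule sum_mono)
      fix B assume "B \<in> {A\<in>?K. x \<in> A}"
      then have B: "B \<in> ?K" by simp
      have "(\<Sum>y\<in>B. ennreal (exits B y / card B)) = ennreal ((\<Sum>y\<in>B. exits B y) / card B)"
        by (simp add: sum_divide_distrib)
      also have "\<dots> \<le> ennreal \<epsilon>"
      proof (rule ennreal_leI)
        have "real (\<Sum>y\<in>B. exits B y) \<le> \<epsilon> * card B"
          using sum_exits_le[OF A(1,2)[OF B]] A(4)[OF B] by linarith
        then show "(\<Sum>y\<in>B. exits B y) / card B \<le> \<epsilon>" using A(3)[OF B] by (simp add: divide_le_eq)
      qed
      finally show "(\<Sum>y\<in>B. ennreal (exits B y / card B)) \<le> ennreal \<epsilon>" .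
    qed
    also have "\<dots> = ennreal (\<epsilon> * card {A\<in>?K. x \<in> A})"
      using \<epsilon> by (simp add: ennreal_mult ennreal_of_nat_eq_real_of_nat mult.commute)
    finally show ?thesis .
  qed
  ultimately have "ennreal (\<Sum>A\<in>{A\<in>?K. x \<in> A}. exits A x) \<le> ennreal (\<epsilon> * card {A\<in>?K. x \<in> A})" by simp
  then show ?thesis by (subst (asm) ennreal_le_iff) (use \<epsilon> in auto)
qed

text \<open>By transitivity every vertex lies in the same number m of sets of the family. Choosing
  each set with probability about (n + 1) / m covers a vertex almost certainly, while separations of
  neighbours stay rare because exits are.\<close>

lemma foelner_level:
  assumes trans: "\<And>x y. x \<in> V \<Longrightarrow> y \<in> V \<Longrightarrow> \<exists>\<gamma>\<in>\<Gamma>. \<gamma> x = y" and inf: "infinite V" and am: "amenable_graph X"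
  shows "\<exists>K q. (\<forall>A\<in>K. finite A \<and> A \<subseteq> V) \<and> (\<forall>\<gamma>\<in>\<Gamma>. \<forall>A. A \<subseteq> V \<longrightarrow> (\<gamma> ` A \<in> K \<longleftrightarrow> A \<in> K)) \<and>
    (\<forall>x\<in>V. finite {A\<in>K. x \<in> A}) \<and> 0 \<le> q \<and> q \<le> (1::real) \<and>
    (\<forall>x y. {x, y} \<in> E \<longrightarrow> (1 - q) ^ card {A\<in>K. x \<in> A} + q * card {A\<in>K. x \<in> A \<longleftrightarrow> y \<notin> A} \<le> (1/2) ^ n)"
proof -
  \<comment> \<open>Chosen so that the separation bound q (2 \<epsilon> m) with q = (n + 1) / m is
    exactly half of the permitted error.\<close>
  define \<epsilon> :: real where "\<epsilon> = (1/2) ^ Suc n / (2 * (real n + 1))"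
  have \<epsilon>: "\<epsilon> > 0" by (simp add: \<epsilon>_def)
  obtain r where r: "foelner r \<epsilon> \<noteq> {}" using foelner_exists[OF am \<epsilon>] by blast
  define K where "K = foelner r \<epsilon>"
  define N where "N x = card {A\<in>K. x \<in> A}" for x
  have cut: "real (\<Sum>A\<in>{A\<in>K. x \<in> A}. exits A x) \<le> \<epsilon> * N x" if "x \<in> V" for x
    unfolding N_def K_def using foelner_exits[OF that, of \<epsilon> r] \<epsilon> by simp
  have fin: "finite {A\<in>K. x \<in> A}" if "x \<in> V" for x unfolding K_def by (rule foelner_local[OF that])
  have act: "\<gamma> ` A \<in> K \<longleftrightarrow> A \<in> K" if "\<gamma> \<in> \<Gamma>" "A \<subseteq> V" for \<gamma> A unfolding K_def by (rule foelner_act[OF that])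
  have KA: "finite A" "A \<subseteq> V" "A \<noteq> {}" if "A \<in> K" for A using that by (simp_all add: K_def foelner_def)
  have N_le: "N x \<le> N (\<gamma> x)" if g: "\<gamma> \<in> \<Gamma>" and x: "x \<in> V" for \<gamma> x
    unfolding N_def
  proof (rule card_inj_on_le[of "(`) \<gamma>"])
    show "inj_on ((`) \<gamma>) {A\<in>K. x \<in> A}"
    proof (rule inj_onI)
      fix B C assume "B \<in> {A\<in>K. x \<in> A}" "C \<in> {A\<in>K. x \<in> A}" "\<gamma> ` B = \<gamma> ` C"
      then show "B = C" using image_eq_V[OF g, of B C] KA(2) by simp
    qed
    show "(`) \<gamma> ` {A\<in>K. x \<in> A} \<subseteq> {A\<in>K. \<gamma> x \<in> A}" using act[OF g KA(2)] by auto
    show "finite {A\<in>K. \<gamma> x \<in> A}" using fin g x by simp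
  qed
  obtain B where B: "B \<in> K" using r by (auto simp: K_def)
  obtain b where b: "b \<in> B" "1 \<le> exits B b" using boundary_nonempty[OF inf KA[OF B]] by blast
  have bV: "b \<in> V" using b KA[OF B] by auto
  \<comment> \<open>A single exit already forces 1 \<le> \<epsilon> m. Hence m is at least 1 /
    \<epsilon>, which exceeds n + 1 and makes q a probability.\<close>
  have "exits B b \<le> (\<Sum>A\<in>{A\<in>K. b \<in> A}. exits A b)"
    by (rule member_le_sum[of B _ "\<lambda>A. exits A b"]) (use B b fin[OF bV] in auto)
  then have "1 \<le> \<epsilon> * N b" using b(2) cut[OF bV] by linarith
  then have "1 / \<epsilon> \<le> N b" using \<epsilon> by (simp add: divide_le_eq mult.commute)
  define m where "m = N b"
  have Nm: "N x = m" if x: "x \<in> V" for x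
  proof -
    obtain \<gamma> where "\<gamma> \<in> \<Gamma>" "\<gamma> x = b" using trans[OF x bV] by blast
    moreover obtain \<delta> where "\<delta> \<in> \<Gamma>" "\<delta> b = x" using trans[OF bV x] by blast
    ultimately show ?thesis using N_le[of \<gamma> x] N_le[of \<delta> b] x bV by (simp add: m_def)
  qed
  have "real n + 1 \<le> 1 / \<epsilon>"
  proof -
    have "1 / \<epsilon> = (real n + 1) * (2 * 2 ^ Suc n)" by (simp add: \<epsilon>_def power_one_over field_simps)
    moreover have "(real n + 1) * 1 \<le> (real n + 1) * (2 * 2 ^ Suc n)" by (rule mult_left_mono) (use two_realpow_ge_one[of "n + 2"] in simp_all)
    ultimately show ?thesis by (simp only: mult_1_right mult.assoc mult.left_commute)
  qed
  then have m: "real n + 1 \<le> m" using \<open>1 / \<epsilon> \<le> N b\<close> by (simp add: m_def)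
  then have m0: "0 < real m" by linarith
  define q where "q = (real n + 1) / m"
  have q: "0 \<le> q" "q \<le> 1" using m m0 by (auto simp: q_def divide_le_eq)
  have bound: "(1 - q) ^ card {A\<in>K. x \<in> A} + q * card {A\<in>K. x \<in> A \<longleftrightarrow> y \<notin> A} \<le> (1/2) ^ n" if e: "{x, y} \<in> E" for x y
  proof -
    have V: "x \<in> V" "y \<in> V" using e by auto
    \<comment> \<open>As q m = n + 1, this probability is at most exp (- (n + 1)), which is less
      than the other half of the error.\<close>
    have "(1 - q) ^ m \<le> exp (- q) ^ m"
      by (rule power_mono) (use q exp_ge_add_one_self[of "- q"] in auto)
    also have "\<dots> = exp (- (real n + 1))" using m0 by (simp add: exp_of_nat_mult[symmetric] q_def)
    also have "\<dots> = exp (- 1) ^ Suc n" by (subst exp_of_nat_mult[symmetric]) simp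
    also have "\<dots> \<le> (1/2) ^ Suc n"
    proof (rule power_mono)
      have "2 \<le> exp (1::real)" using exp_ge_add_one_self[of 1] by simp
      then show "exp (- 1) \<le> (1/2::real)" by (simp add: exp_minus field_simps)
    qed simp
    finally have 1: "(1 - q) ^ card {A\<in>K. x \<in> A} \<le> (1/2) ^ Suc n" using Nm[OF V(1)] by (simp add: N_def)
    \<comment> \<open>A set of the family that contains u but not w has the edge uw as an exit at
      u.\<close>
    have half: "card {A\<in>K. u \<in> A \<and> w \<notin> A} \<le> (\<Sum>A\<in>{A\<in>K. u \<in> A}. exits A u)" if uw: "{u, w} \<in> E" for u w
    proof -
      have uV: "u \<in> V" "w \<in> V" using uw by auto
      have "card {A\<in>K. u \<in> A \<and> w \<notin> A} = (\<Sum>A\<in>{A\<in>K. u \<in> A \<and> w \<notin> A}. 1)" by simp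
      also have "\<dots> \<le> (\<Sum>A\<in>{A\<in>K. u \<in> A \<and> w \<notin> A}. exits A u)"
      proof (rule sum_mono)
        fix A assume A: "A \<in> {A\<in>K. u \<in> A \<and> w \<notin> A}"
        have f: "finite {y\<in>V. {u, y} \<in> E \<and> y \<notin> A}" by (rule finite_subset[OF _ finite_nbrs[OF uV(1)]]) auto
        have "w \<in> {y\<in>V. {u, y} \<in> E \<and> y \<notin> A}" using uw uV A by simp
        then have "0 < exits A u" unfolding exits_def by (subst card_gt_0_iff) (use f in blast)
        then show "1 \<le> exits A u" by simp
      qed
      also have "\<dots> \<le> (\<Sum>A\<in>{A\<in>K. u \<in> A}. exits A u)"
        by (rule sum_mono2[OF fin[OF uV(1)]]) auto
      finally show ?thesis .
    qed
    have "{A\<in>K. x \<in> A \<longleftrightarrow> y \<notin> A} = {A\<in>K. x \<in> A \<and> y \<notin> A} \<union> {A\<in>K. y \<in> A \<and> x \<notin> A}" by auto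
    then have "card {A\<in>K. x \<in> A \<longleftrightarrow> y \<notin> A} \<le> card {A\<in>K. x \<in> A \<and> y \<notin> A} + card {A\<in>K. y \<in> A \<and> x \<notin> A}"
      by (simp add: card_Un_le)
    moreover have "{y, x} \<in> E" using e by (simp add: insert_commute)
    ultimately have "card {A\<in>K. x \<in> A \<longleftrightarrow> y \<notin> A} \<le> 2 * \<epsilon> * m"
      using half[OF e] half[of y x] cut[OF V(1)] cut[OF V(2)] unfolding Nm[OF V(1)] Nm[OF V(2)] by linarith
    then have 2: "q * card {A\<in>K. x \<in> A \<longleftrightarrow> y \<notin> A} \<le> q * (2 * \<epsilon> * m)" using q by (intro mult_left_mono)
    have 3: "(a / M) * (2 * (c / (2 * a)) * M) = c" if "a > 0" "M > 0" for a M c :: real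
      using that by simp
    have "q * (2 * \<epsilon> * m) = (1/2) ^ Suc n" unfolding q_def \<epsilon>_def by (rule 3) (use m0 in simp_all)
    then show ?thesis using 1 2 by simp
  qed
  show ?thesis
    using KA fin act q bound by (intro exI[of _ K] exI[of _ q]) simp
qed

lemma foelner_cover_exists:
  assumes trans: "\<And>x y. x \<in> V \<Longrightarrow> y \<in> V \<Longrightarrow> \<exists>\<gamma>\<in>\<Gamma>. \<gamma> x = y" and inf: "infinite V" and am: "amenable_graph X"
  shows "\<exists>KK p. foelner_cover V \<Gamma> X KK p"
proof -
  define P where "P n K q \<longleftrightarrow> (\<forall>A\<in>K. finite A \<and> A \<subseteq> V) \<and> (\<forall>\<gamma>\<in>\<Gamma>. \<forall>A. A \<subseteq> V \<longrightarrow> (\<gamma> ` A \<in> K \<longleftrightarrow> A \<in> K)) \<and>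
    (\<forall>x\<in>V. finite {A\<in>K. x \<in> A}) \<and> 0 \<le> q \<and> q \<le> (1::real) \<and>
    (\<forall>x y. {x, y} \<in> E \<longrightarrow> (1 - q) ^ card {A\<in>K. x \<in> A} + q * card {A\<in>K. x \<in> A \<longleftrightarrow> y \<notin> A} \<le> (1/2) ^ n)"
    for n K q
  have "\<exists>K q. P n K q" for n unfolding P_def by (rule foelner_level[OF assms])
  then obtain KK p where *: "P n (KK n) (p n)" for n by metis
  have "foelner_cover V \<Gamma> X KK p"
    by unfold_locales (use inf * in \<open>simp_all add: P_def\<close>)
  then show ?thesis by blast
qed

end

context foelner_cover
begin

theorem random_spanning_tree:
  "invariant_random_spanning_subgraph \<Gamma> X (\<lambda>T. spanning_tree X T \<and> num_ends T \<le> 2)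
     (distr (labels J) (cylinder_space E) tree_edges)"
proof (rule factor_spanning_subgraph)
  let ?Q = "\<lambda>F. (\<forall>x\<in>V. \<forall>y\<in>V. conn F x y) \<and> (\<forall>x\<in>V. \<forall>y\<in>V. {x, y} \<in> F \<longrightarrow> \<not> conn (F - {{x, y}}) x y) \<and>
     (\<forall>x\<in>V. card (big V F x) \<le> 2)"
  have sub: "\<Union>F \<subseteq> V" if "F \<in> space (cylinder_space E)" for F using that E_sub by auto
  note mE = pred_cylinder_space[where I = E]
  have "Measurable.pred (cylinder_space E) (\<lambda>F. conn F x y)" if "x \<in> V" "y \<in> V" for x y
    by (rule measurable_conn[OF countable_V sub mE that])
  moreover have "Measurable.pred (cylinder_space E) (\<lambda>F. conn (F - {{x, y}}) x y)" if "x \<in> V" "y \<in> V" for x y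
    using sub by (intro measurable_conn[OF countable_V _ _ that]) (auto intro!: pred_intros_logic mE)
  moreover have "Measurable.pred (cylinder_space E) (\<lambda>F. card (big V F x) \<le> 2)" if "x \<in> V" for x
    by (rule measurable_compose[OF measurable_card_big[OF _ mE that]]) auto
  ultimately show "Measurable.pred (cylinder_space E) ?Q"
    by (intro pred_intros_logic measurable_pred_countable countable_V mE)
  show "spanning_tree X (V, F) \<and> num_ends (V, F) \<le> 2" if F: "F \<subseteq> E" and Q: "?Q F" for F
  proof -
    interpret T: infinite_tree V F
    proof
      show "\<exists>x y. x \<in> V \<and> y \<in> V \<and> x \<noteq> y \<and> e = {x, y}" if "e \<in> F" for e
        using that F E_obtain[of e] by (metis subsetD)
      show "finite {y\<in>V. {x, y} \<in> F}" if "x \<in> V" for x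
        by (rule finite_subset[OF _ finite_nbrs[OF that]]) (use F in auto)
      show "\<not> conn (F - {{x, y}}) x y" if "{x, y} \<in> F" for x y
        using Q that F E_V[of x y] by blast
    qed (use Q inf_V in auto)
    have "subgraph_of (V, F) X"
      using F simple_X verts_X by (auto simp: subgraph_of_def simple_graph_def)
    moreover have "num_ends (V, F) \<le> 2" using Q by (intro T.num_ends_le_2) simp
    ultimately show ?thesis using T.T_tree verts_X by (simp add: spanning_tree_def)
  qed
  have "AE U in labels J. \<forall>x\<in>V. card (big V (tree_edges U) x) \<le> 2"
    using AE_card_big by (subst AE_ball_countable) auto
  with AE_good show "AE U in labels J. ?Q (tree_edges U)"
  proof eventually_elim
    fix U assume U: "good U" and c: "\<forall>x\<in>V. card (big V (tree_edges U) x) \<le> 2"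
    interpret T: infinite_tree V "tree_edges U" by (rule infinite_tree[OF U])
    show "?Q (tree_edges U)" using c T.T_conn T.T_bridge by simp
  qed
qed (rule tree_edges_E measurable_tree_edges act_tree_edges; assumption)+

end

section \<open>Powers of graphs\<close>

context graph_symmetry
begin

text \<open>Ties the recursive balls to the distance through which the powers of a graph are
  defined.\<close>

lemma graph_dist_le:
  assumes x: "x \<in> V" and y: "y \<in> V" shows "graph_dist X x y \<le> enat k \<longleftrightarrow> y \<in> gball x k"
proof
  have *: "xs \<noteq> [] \<longrightarrow> hd xs = x \<longrightarrow> set xs \<subseteq> V \<longrightarrow> successively (adjacent X) xs \<longrightarrow> last xs \<in> gball x (length xs - 1)" for xs
  proof (induction xs rule: rev_induct)
    case (snoc z xs)
    show ?case
    proof (cases xs rule: rev_cases)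
      case (snoc ys w)
      show ?thesis
      proof (intro impI)
        assume a: "hd (xs @ [z]) = x" "set (xs @ [z]) \<subseteq> V" "successively (adjacent X) (xs @ [z])"
        have "xs \<noteq> []" using snoc by simp
        moreover have "successively (adjacent X) xs" "{w, z} \<in> E" "w = last xs" using a snoc by (auto simp: successively_append_iff adjacent_def)
        ultimately have "w \<in> gball x (length xs - 1)" using \<open>xs \<noteq> [] \<longrightarrow> _\<close> a by simp
        then have "z \<in> gball x (Suc (length xs - 1))" using \<open>{w, z} \<in> E\<close> by auto
        then show "last (xs @ [z]) \<in> gball x (length (xs @ [z]) - 1)" using \<open>xs \<noteq> []\<close> by simp
      qed
    qed simp
  qed simp
  assume "graph_dist X x y \<le> enat k"
  then have "graph_dist X x y < enat (Suc k)" by (rule order_le_less_trans) simp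
  then obtain xs where xs: "xs \<in> walks X x y" "length xs - 1 \<le> k"
    unfolding graph_dist_def INF_less_iff by auto
  then have "y \<in> gball x (length xs - 1)" using * verts_X by (auto simp: walks_def)
  then show "y \<in> gball x k" using gball_mono[OF xs(2)] by auto
next
  assume "y \<in> gball x k"
  then have "\<exists>xs. xs \<in> walks X x y \<and> length xs - 1 \<le> k"
  proof (induction k arbitrary: y)
    case 0
    then show ?case using x verts_X by (intro exI[of _ "[x]"]) (auto simp: walks_def)
  next
    case (Suc k)
    show ?case
    proof (cases "y \<in> gball x k")
      case True
      then show ?thesis using Suc.IH le_SucI by blast
    next
      case False
      then obtain z where z: "z \<in> gball x k" "{z, y} \<in> E" "y \<in> V" using Suc.prems by auto
      then obtain xs where "xs \<in> walks X x z" "length xs - 1 \<le> k" using Suc.IH by blast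
      then have "xs @ [y] \<in> walks X x y \<and> length (xs @ [y]) - 1 \<le> Suc k"
        using z verts_X by (auto simp: walks_def successively_append_iff adjacent_def)
      then show ?thesis by blast
    qed
  qed
  then obtain xs where xs: "xs \<in> walks X x y" "length xs - 1 \<le> k" by blast
  then have "graph_dist X x y \<le> enat (length xs - 1)" unfolding graph_dist_def by (intro INF_lower)
  also have "\<dots> \<le> enat k" using xs by simp
  finally show "graph_dist X x y \<le> enat k" .
qed

lemma power_edge: "{x, y} \<in> edges (graph_power X k) \<longleftrightarrow> x \<in> V \<and> y \<in> V \<and> x \<noteq> y \<and> y \<in> gball x k"
proof -
  have "{x, y} \<in> edges (graph_power X k) \<longleftrightarrow>
      (\<exists>u v. {x, y} = {u, v} \<and> u \<in> V \<and> v \<in> V \<and> u \<noteq> v \<and> v \<in> gball u k)"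
    by (simp only: graph_power_def verts_X snd_conv mem_Collect_eq graph_dist_le cong: conj_cong)
  moreover have "y \<in> gball x k \<longleftrightarrow> x \<in> gball y k" using gball_sym by blast
  ultimately show ?thesis by (auto simp: doubleton_eq_iff)
qed

lemma power_symmetry:
  assumes "1 \<le> k" shows "graph_symmetry V \<Gamma> (graph_power X k)" "E \<subseteq> edges (graph_power X k)"
proof -
  let ?P = "graph_power X k"
  have v: "verts ?P = V" by (simp add: graph_power_def verts_X)
  show sub: "E \<subseteq> edges ?P"
  proof
    fix e assume "e \<in> E"
    then obtain x y where xy: "x \<in> V" "y \<in> V" "x \<noteq> y" "e = {x, y}" by (rule E_obtain)
    then have "y \<in> gball x 1" using \<open>e \<in> E\<close> by simp
    then have "y \<in> gball x k" using gball_mono[OF assms] by blast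
    then show "e \<in> edges ?P" using xy power_edge by simp
  qed
  have s: "simple_graph ?P"
    by (auto simp: simple_graph_def graph_power_def)
  show "graph_symmetry V \<Gamma> ?P"
  proof
    show "verts ?P = V" "simple_graph ?P" by (fact v s)+
    have "neighbours ?P x \<subseteq> gball x k" for x by (auto simp: neighbours_def adjacent_def power_edge)
    then show "locally_finite_graph ?P"
      unfolding locally_finite_graph_def v using gball_finite finite_subset by blast
    have "{e \<in> edges ?P. e \<subseteq> V} = edges ?P" using s by (auto simp: simple_graph_def v)
    then show "connected_graph ?P"
      unfolding connected_graph_conn v using conn_mono[OF conn_E sub] by simp
    fix \<gamma> x y assume "\<gamma> \<in> \<Gamma>" "x \<in> V" "y \<in> V"
    then show "{\<gamma> x, \<gamma> y} \<in> edges ?P \<longleftrightarrow> {x, y} \<in> edges ?P"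
      by (simp add: power_edge gball_mem)
  qed
qed

end

section \<open>Random double rays\<close>

context permutation_action
begin

lemma Ball_sub: "A \<subseteq> V \<Longrightarrow> (\<forall>z\<in>A. Q z) \<longleftrightarrow> (\<forall>z\<in>V. z \<in> A \<longrightarrow> Q z)"
  by blast

lemma measurable_highest:
  fixes l :: "'w \<Rightarrow> 'a \<Rightarrow> real"
  assumes A: "\<And>U. A U \<subseteq> V" "\<And>z. z \<in> V \<Longrightarrow> Measurable.pred M (\<lambda>U. z \<in> A U)"
    and l: "\<And>z. z \<in> V \<Longrightarrow> (\<lambda>U. l U z) \<in> borel_measurable M" and w: "w \<in> V"
  shows "Measurable.pred M (\<lambda>U. highest (l U) (A U) w)" "Measurable.pred M (\<lambda>U. lowest (l U) (A U) w)"
  unfolding highest_def lowest_def Ball_sub[OF A(1)]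
  by (intro pred_intros_logic measurable_pred_countable countable_V A(2) pred_real_le l w; assumption)+

lemma highest_act:
  assumes g: "\<gamma> \<in> \<Gamma>" and A: "A \<subseteq> V" "A' \<subseteq> V" "\<And>z. z \<in> V \<Longrightarrow> \<gamma> z \<in> A' \<longleftrightarrow> z \<in> A"
    and l: "\<And>z. z \<in> V \<Longrightarrow> l' (\<gamma> z) = l z" and w: "w \<in> V"
  shows "highest l' A' (\<gamma> w) \<longleftrightarrow> highest l A w" "lowest l' A' (\<gamma> w) \<longleftrightarrow> lowest l A w"
  unfolding highest_def lowest_def Ball_sub[OF A(1)] Ball_sub[OF A(2)]
  by (subst ball_V[OF g], simp add: A(3) l w cong: ball_cong)+

end

text \<open>The tree and the labels are moved by \<gamma>. The formulas behind the double ray are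
  shown to be equivariant one after the other, by substituting \<gamma> into their
  quantifiers.\<close>

locale tree_map = graph_symmetry V \<Gamma> X for V :: "'a set" and \<Gamma> X +
  fixes T T' :: "'a set set" and l l' :: "'a \<Rightarrow> real" and \<gamma> :: "'a \<Rightarrow> 'a"
  assumes g: "\<gamma> \<in> \<Gamma>" and T: "T \<subseteq> E" "T' = (`) \<gamma> ` T" and l: "\<And>z. z \<in> V \<Longrightarrow> l' (\<gamma> z) = l z"
begin

lemma T_V: "\<Union>T \<subseteq> V" using T E_sub by blast

lemma big_sub: "big V T x \<subseteq> V" "big V T' x \<subseteq> V" "children V T x \<subseteq> V" "children V T' x \<subseteq> V"
  by (auto simp: big_def children_def)

lemma act_big: "x \<in> V \<Longrightarrow> y \<in> V \<Longrightarrow> \<gamma> y \<in> big V T' (\<gamma> x) \<longleftrightarrow> y \<in> big V T x"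
  by (rule big_act(2)[OF g T_V T(2)])

lemma act_children: "x \<in> V \<Longrightarrow> y \<in> V \<Longrightarrow> \<gamma> y \<in> children V T' (\<gamma> x) \<longleftrightarrow> y \<in> children V T x"
  using big_act(1)[OF g T_V T(2)] act_edge[OF g T_V T(2)] g by (simp add: children_def)

lemma act_highest:
  assumes "x \<in> V" "w \<in> V"
  shows "highest l' (big V T' (\<gamma> x)) (\<gamma> w) \<longleftrightarrow> highest l (big V T x) w"
    "lowest l' (big V T' (\<gamma> x)) (\<gamma> w) \<longleftrightarrow> lowest l (big V T x) w"
    "highest l' (children V T' (\<gamma> x)) (\<gamma> w) \<longleftrightarrow> highest l (children V T x) w"
    "lowest l' (children V T' (\<gamma> x)) (\<gamma> w) \<longleftrightarrow> lowest l (children V T x) w"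
proof -
  note h = highest_act[where l = l and l' = l', OF g _ _ _ l assms(2)]
  show "highest l' (big V T' (\<gamma> x)) (\<gamma> w) \<longleftrightarrow> highest l (big V T x) w"
    "lowest l' (big V T' (\<gamma> x)) (\<gamma> w) \<longleftrightarrow> lowest l (big V T x) w"
    by (rule h[OF big_sub(1,2) act_big[OF assms(1)]]; assumption)+
  show "highest l' (children V T' (\<gamma> x)) (\<gamma> w) \<longleftrightarrow> highest l (children V T x) w"
    "lowest l' (children V T' (\<gamma> x)) (\<gamma> w) \<longleftrightarrow> lowest l (children V T x) w"
    by (rule h[OF big_sub(3,4) act_children[OF assms(1)]]; assumption)+
qed

lemma act_highest_sibling:
  assumes "x \<in> V" "w \<in> V" "v \<in> V"
  shows "highest l' {z\<in>children V T' (\<gamma> x). l' z < l' (\<gamma> v)} (\<gamma> w) \<longleftrightarrow> highest l {z\<in>children V T x. l z < l v} w"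
    "lowest l' {z\<in>children V T' (\<gamma> x). l' (\<gamma> v) < l' z} (\<gamma> w) \<longleftrightarrow> lowest l {z\<in>children V T x. l v < l z} w"
  by (rule highest_act[where l = l and l' = l', OF g];
      use assms big_sub(3,4) in \<open>auto simp: act_children l\<close>)+

lemma act_dangling:
  assumes "v \<in> V" "p \<in> V" shows "dangling V T' (\<gamma> v) (\<gamma> p) \<longleftrightarrow> dangling V T v p"
  unfolding dangling_def Ball_sub[OF big_sub(1)] Ball_sub[OF big_sub(2)]
  by (subst ball_V[OF g]) (use assms g in \<open>simp add: act_big cong: ball_cong\<close>)

lemma act_is_end:
  assumes "v \<in> V" "w \<in> V" shows "is_end V T' l' (\<gamma> v) (\<gamma> w) \<longleftrightarrow> is_end V T l v w"
  unfolding is_end_def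
  by (subst (1 2) bex_V[OF g]) (use assms g in \<open>simp add: act_highest act_children cong: bex_cong\<close>)

lemma act_is_slot:
  assumes "t \<in> V" "t' \<in> V" "w \<in> V" shows "is_slot V T' l' (\<gamma> t) (\<gamma> t') (\<gamma> w) \<longleftrightarrow> is_slot V T l t t' w"
  unfolding is_slot_def using assms g by (simp add: act_highest act_is_end)

lemma act_is_E:
  assumes "v \<in> V" "w \<in> V" shows "is_E V T' l' (\<gamma> v) (\<gamma> w) \<longleftrightarrow> is_E V T l v w"
proof -
  have 1: "(\<exists>z\<in>V. z \<in> children V T' (\<gamma> p) \<and> l' z < l' (\<gamma> v)) \<longleftrightarrow> (\<exists>z\<in>V. z \<in> children V T p \<and> l z < l v)" if "p \<in> V" for p
    by (subst bex_V[OF g]) (use assms that g in \<open>simp add: act_children l cong: bex_cong\<close>)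
  show ?thesis
    unfolding is_E_def
    by (subst (1 3 4) bex_V[OF g])
      (use assms g in \<open>simp add: 1 act_highest act_highest_sibling act_dangling act_is_slot cong: bex_cong\<close>)
qed

lemma act_is_S:
  assumes "v \<in> V" "w \<in> V" shows "is_S V T' l' (\<gamma> v) (\<gamma> w) \<longleftrightarrow> is_S V T l v w"
proof -
  have 1: "(\<exists>z\<in>V. z \<in> children V T' (\<gamma> p) \<and> l' (\<gamma> v) < l' z) \<longleftrightarrow> (\<exists>z\<in>V. z \<in> children V T p \<and> l v < l z)" if "p \<in> V" for p
    by (subst bex_V[OF g]) (use assms that g in \<open>simp add: act_children l cong: bex_cong\<close>)
  have 2: "(\<exists>u\<in>V. lowest l' {z\<in>children V T' (\<gamma> p). l' (\<gamma> v) < l' z} u \<and> is_end V T' l' u (\<gamma> w)) \<longleftrightarrow>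
      (\<exists>u\<in>V. lowest l {z\<in>children V T p. l v < l z} u \<and> is_end V T l u w)" if "p \<in> V" for p
    by (subst bex_V[OF g]) (use assms that g in \<open>simp add: act_highest_sibling act_is_end cong: bex_cong\<close>)
  have 3: "(\<exists>p\<in>V. dangling V T' (\<gamma> v) p \<and> Q' p) \<longleftrightarrow> (\<exists>p\<in>V. dangling V T v p \<and> Q p)"
    if "\<And>p. p \<in> V \<Longrightarrow> Q' (\<gamma> p) \<longleftrightarrow> Q p" for Q Q'
    by (subst bex_V[OF g]) (use assms that in \<open>simp add: act_dangling cong: bex_cong\<close>)
  have 4: "(\<exists>p\<in>V. dangling V T' (\<gamma> v) p) \<longleftrightarrow> (\<exists>p\<in>V. dangling V T v p)"
    using 3[of "\<lambda>_. True" "\<lambda>_. True"] by simp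
  have 5: "(\<exists>t\<in>V. lowest l' (big V T' (\<gamma> v)) t \<and> is_slot V T' l' t (\<gamma> v) (\<gamma> w)) \<longleftrightarrow>
      (\<exists>t\<in>V. lowest l (big V T v) t \<and> is_slot V T l t v w)"
    by (subst bex_V[OF g]) (use assms g in \<open>simp add: act_highest act_is_slot cong: bex_cong\<close>)
  show ?thesis
    unfolding is_S_def 4 5
    by (intro arg_cong2[where f = "(\<or>)"] refl 3) (simp_all add: 1 2 act_is_E assms)
qed

lemma act_is_I:
  assumes "v \<in> V" "w \<in> V" shows "is_I V T' l' (\<gamma> v) (\<gamma> w) \<longleftrightarrow> is_I V T l v w"
  unfolding is_I_def
  by (subst (1 2) bex_V[OF g]) (use assms g in \<open>simp add: act_highest act_children act_is_end act_is_E cong: bex_cong\<close>)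

lemma act_double_ray:
  assumes "x \<in> V" "y \<in> V"
  shows "{\<gamma> x, \<gamma> y} \<in> double_ray_edges V T' l' \<longleftrightarrow> {x, y} \<in> double_ray_edges V T l"
proof -
  have *: "{x, y} \<in> double_ray_edges V T l \<longleftrightarrow> is_S V T l x y \<or> is_I V T l x y \<or> is_S V T l y x \<or> is_I V T l y x"
    if "x \<in> V" "y \<in> V" for x y T and l :: "'a \<Rightarrow> real"
    using that by (auto simp: double_ray_edges_def doubleton_eq_iff)
  show ?thesis using assms g by (simp add: * act_is_S act_is_I)
qed

end

context graph_symmetry
begin

lemma measurable_double_ray:
  fixes l :: "'w \<Rightarrow> 'a \<Rightarrow> real"
  assumes T: "\<And>U. T U \<subseteq> E" "\<And>x y. x \<in> V \<Longrightarrow> y \<in> V \<Longrightarrow> Measurable.pred M (\<lambda>U. {x, y} \<in> T U)"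
    and l: "\<And>z. z \<in> V \<Longrightarrow> (\<lambda>U. l U z) \<in> borel_measurable M" and xy: "x \<in> V" "y \<in> V"
  shows "Measurable.pred M (\<lambda>U. {x, y} \<in> double_ray_edges V (T U) (l U))"
proof -
  have TV: "\<Union>(T U) \<subseteq> V" for U using T(1)[of U] E_sub by blast
  note pred = pred_intros_logic measurable_pred_countable countable_V
  have pred_const: "Measurable.pred M (\<lambda>U. b)" for b by simp
  have inf: "Measurable.pred M (\<lambda>U. infinite (branch V (T U) x y))" and b: "Measurable.pred M (\<lambda>U. y \<in> big V (T U) x)" if "x \<in> V" "y \<in> V" for x y
    by (rule measurable_big[OF TV T(2) that]; assumption)+
  have c: "Measurable.pred M (\<lambda>U. y \<in> children V (T U) x)" if "x \<in> V" "y \<in> V" for x y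
  proof -
    have "Measurable.pred M (\<lambda>U. {x, y} \<in> T U \<and> \<not> infinite (branch V (T U) x y))"
      by (intro pred inf T(2) that)
    then show ?thesis using that by (simp add: children_def)
  qed
  have lt: "Measurable.pred M (\<lambda>U. l U x < l U y)" if "x \<in> V" "y \<in> V" for x y by (intro pred_real_less l that)
  have hb: "Measurable.pred M (\<lambda>U. highest (l U) (big V (T U) x) w)" "Measurable.pred M (\<lambda>U. lowest (l U) (big V (T U) x) w)"
    if "x \<in> V" "w \<in> V" for x w
    by (rule measurable_highest[OF _ b[OF that(1)] l that(2)]; (simp add: big_def)?)+
  have hc: "Measurable.pred M (\<lambda>U. highest (l U) (children V (T U) x) w)" "Measurable.pred M (\<lambda>U. lowest (l U) (children V (T U) x) w)"
    if "x \<in> V" "w \<in> V" for x w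
    by (rule measurable_highest[OF _ c[OF that(1)] l that(2)]; (simp add: children_def)?)+
  have hs: "Measurable.pred M (\<lambda>U. highest (l U) {z\<in>children V (T U) x. l U z < l U v} w)"
    "Measurable.pred M (\<lambda>U. lowest (l U) {z\<in>children V (T U) x. l U v < l U z} w)"
    if "x \<in> V" "w \<in> V" "v \<in> V" for x w v
  proof -
    have m: "Measurable.pred M (\<lambda>U. z \<in> {z\<in>children V (T U) x. l U z < l U v})"
      "Measurable.pred M (\<lambda>U. z \<in> {z\<in>children V (T U) x. l U v < l U z})" if "z \<in> V" for z
      unfolding mem_Collect_eq by (intro pred c lt that \<open>x \<in> V\<close> \<open>v \<in> V\<close>)+
    have sub: "{z\<in>children V (T U) x. Q z} \<subseteq> V" for U Q by (auto simp: children_def)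
    show "Measurable.pred M (\<lambda>U. highest (l U) {z\<in>children V (T U) x. l U z < l U v} w)"
      by (rule measurable_highest(1)[OF sub m(1) l that(2)])
    show "Measurable.pred M (\<lambda>U. lowest (l U) {z\<in>children V (T U) x. l U v < l U z} w)"
      by (rule measurable_highest(2)[OF sub m(2) l that(2)])
  qed
  have d: "Measurable.pred M (\<lambda>U. dangling V (T U) v p)" if "v \<in> V" "p \<in> V" for v p
  proof -
    have sub: "big V (T U) v \<subseteq> V" for U by (auto simp: big_def)
    show ?thesis
      unfolding dangling_def Ball_sub[OF sub] by (intro pred b that pred_const)
  qed
  have en: "Measurable.pred M (\<lambda>U. is_end V (T U) (l U) v w)" if "v \<in> V" "w \<in> V" for v w
    unfolding is_end_def by (intro pred hc c that; (simp; fail)?)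
  have sl: "Measurable.pred M (\<lambda>U. is_slot V (T U) (l U) t t' w)" if "t \<in> V" "t' \<in> V" "w \<in> V" for t t' w
    unfolding is_slot_def by (intro pred hb en that; (simp; fail)?)
  have E: "Measurable.pred M (\<lambda>U. is_E V (T U) (l U) v w)" if "v \<in> V" "w \<in> V" for v w
    unfolding is_E_def by (intro pred hb hs sl d c lt that; (simp; fail)?)
  have S: "Measurable.pred M (\<lambda>U. is_S V (T U) (l U) v w)" if "v \<in> V" "w \<in> V" for v w
    unfolding is_S_def by (intro pred hb hs sl d c lt en E that; (simp; fail)?)
  have I: "Measurable.pred M (\<lambda>U. is_I V (T U) (l U) v w)" if "v \<in> V" "w \<in> V" for v w
    unfolding is_I_def by (intro pred hc c en E that; (simp; fail)?)
  have "{x, y} \<in> double_ray_edges V (T U) (l U) \<longleftrightarrow>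
      is_S V (T U) (l U) x y \<or> is_I V (T U) (l U) x y \<or> is_S V (T U) (l U) y x \<or> is_I V (T U) (l U) y x" for U
    using xy by (auto simp: double_ray_edges_def doubleton_eq_iff)
  moreover have "Measurable.pred M (\<lambda>U. is_S V (T U) (l U) x y \<or> is_I V (T U) (l U) x y \<or> is_S V (T U) (l U) y x \<or> is_I V (T U) (l U) y x)"
    by (intro pred S I xy)
  ultimately show ?thesis by simp
qed

end

context foelner_cover
begin

theorem random_double_ray:
  "\<exists>M. invariant_random_spanning_subgraph \<Gamma> (graph_power X 3) (spanning_double_ray (graph_power X 3)) M"
proof -
  let ?P = "graph_power X 3"
  interpret P: graph_symmetry V \<Gamma> ?P by (rule power_symmetry) simp
  define l where "l U v = U (1::nat, {v})" for U :: "nat \<times> 'a set \<Rightarrow> real" and v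
  \<comment> \<open>Intersecting with the edges of the cube gives a subgraph for all labels; for
    good labels with at most two infinite branches at each vertex nothing is lost, by
    \<open>T.D_edge\<close>.\<close>
  define D where "D U = {e \<in> edges ?P. e \<in> double_ray_edges V (tree_edges U) (l U)}" for U
  let ?Q = "\<lambda>F. (\<forall>x\<in>V. \<forall>y\<in>V. conn F x y) \<and> (\<forall>x\<in>V. card {y\<in>{y\<in>V. {x, y} \<in> edges ?P}. {x, y} \<in> F} = 2)"
  let ?C = "cylinder_space (edges ?P)"
  have ex: "\<exists>M. invariant_random_spanning_subgraph \<Gamma> ?P (spanning_double_ray ?P) M"
    if "invariant_random_spanning_subgraph \<Gamma> ?P (spanning_double_ray ?P) (distr (labels J) ?C D)"
    using that by blast
  show ?thesis
  proof (rule ex, rule P.factor_spanning_subgraph)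
    show "D U \<subseteq> edges ?P" for U by (auto simp: D_def)
    show "Measurable.pred (labels J) (\<lambda>U. e \<in> D U)" if e: "e \<in> edges ?P" for e
    proof -
      obtain x y where xy: "x \<in> V" "y \<in> V" "e = {x, y}" using P.E_obtain[OF e] by metis
      have "Measurable.pred (labels J) (\<lambda>U. {x, y} \<in> double_ray_edges V (tree_edges U) (l U))"
        by (rule measurable_double_ray[OF tree_edges_E measurable_tree_edges _ xy(1,2)])
          (auto simp: l_def intro!: measurable_label)
      then show ?thesis using e xy by (simp add: D_def)
    qed
    show "D (act_labels \<gamma> U) = (`) \<gamma> ` D U" if g: "\<gamma> \<in> \<Gamma>" for \<gamma> U
      unfolding D_def
    proof (rule P.act_E_Collect[OF g])
      interpret tree_map V \<Gamma> X "tree_edges U" "tree_edges (act_labels \<gamma> U)" "l U" "l (act_labels \<gamma> U)" \<gamma>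
      proof
        show "l (act_labels \<gamma> U) (\<gamma> z) = l U z" if "z \<in> V" for z
          using act_labels_image[OF g, of "{z}"] that by (simp add: l_def)
      qed (fact g tree_edges_E act_tree_edges[OF g])+
      fix e assume "e \<in> edges ?P"
      then obtain x y where xy: "x \<in> V" "y \<in> V" "e = {x, y}" using P.E_obtain by metis
      show "\<gamma> ` e \<in> double_ray_edges V (tree_edges (act_labels \<gamma> U)) (l (act_labels \<gamma> U)) \<longleftrightarrow>
          e \<in> double_ray_edges V (tree_edges U) (l U)"
        using act_double_ray[OF xy(1,2)] xy(3) by simp
    qed
    note mE = pred_cylinder_space[where I = "edges ?P"]
    have "Measurable.pred ?C (\<lambda>F. conn F x y)" if "x \<in> V" "y \<in> V" for x y
      by (rule measurable_conn[OF countable_V _ mE that]) (use P.E_sub in auto)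
    moreover have "Measurable.pred ?C (\<lambda>F. card {y\<in>{y\<in>V. {x, y} \<in> edges ?P}. {x, y} \<in> F} = 2)" if "x \<in> V" for x
      by (rule measurable_compose[OF measurable_card_Collect[OF P.finite_nbrs[OF that] mE]]) auto
    ultimately show "Measurable.pred ?C ?Q"
      by (intro pred_intros_logic measurable_pred_countable countable_V)
    show "spanning_double_ray ?P (V, F)" if F: "F \<subseteq> edges ?P" and Q: "?Q F" for F
    proof -
      have s: "subgraph_of (V, F) ?P"
        using F P.simple_X P.verts_X by (auto simp: subgraph_of_def simple_graph_def)
      have "{e \<in> F. e \<subseteq> V} = F" using F P.E_edge by blast
      then have "connected_graph (V, F)" using Q by (simp add: connected_graph_conn)
      moreover have "neighbours (V, F) x = {y\<in>{y\<in>V. {x, y} \<in> edges ?P}. {x, y} \<in> F}" for x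
        using F by (auto simp: neighbours_def adjacent_def)
      ultimately show ?thesis using s Q P.verts_X by (simp add: spanning_double_ray_def)
    qed
    have "AE U in labels J. \<forall>x\<in>V. card (big V (tree_edges U) x) \<le> 2"
      using AE_card_big by (subst AE_ball_countable) auto
    with AE_good show "AE U in labels J. ?Q (D U)"
    proof eventually_elim
      fix U assume U: "good U" and c: "\<forall>x\<in>V. card (big V (tree_edges U) x) \<le> 2"
      interpret T: infinite_tree V "tree_edges U" by (rule infinite_tree[OF U])
      interpret T: small_tree V "tree_edges U" "l U"
        by unfold_locales (use c U in \<open>auto simp: l_def good_def\<close>)
      have near: "{x, y} \<in> E \<or> x = y" if "T.near x y" for x y
        using that tree_edges_E by (auto simp: T.near_def)
      have "double_ray_edges V (tree_edges U) (l U) \<subseteq> edges ?P"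
      proof
        fix e assume "e \<in> double_ray_edges V (tree_edges U) (l U)"
        then obtain u w a b where e: "e = {u, w}" "u \<in> V" "w \<in> V" "u \<noteq> w" and n: "T.near u a" "T.near a b" "T.near b w"
          using T.D_edge by metis
        have "a \<in> gball u (Suc 0)" using near[OF n(1)] E_V by auto
        then have "b \<in> gball u (Suc (Suc 0))" using near[OF n(2)] E_V by auto
        then have "w \<in> gball u (Suc (Suc (Suc 0)))" using near[OF n(3)] E_V by auto
        then show "e \<in> edges ?P" using e power_edge by (simp add: numeral_3_eq_3)
      qed
      then have D: "D U = double_ray_edges V (tree_edges U) (l U)" by (auto simp: D_def)
      have "{y\<in>{y\<in>V. {x, y} \<in> edges ?P}. {x, y} \<in> D U} = neighbours (V, D U) x" for x
        by (auto simp: D_def neighbours_def adjacent_def)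
      then show "?Q (D U)" using T.D_conn T.D_degree by (simp add: D)
    qed
  qed
qed

end

section \<open>Critical probability of random spanning subgraphs\<close>

lemma finite_rays_of_num_ends:
  assumes "num_ends T \<le> 2" shows "finite (rays_from T (SOME v. v \<in> verts T))"
  using assms by (auto simp: num_ends_def Let_def split: if_splits)

text \<open>A ray is determined by its first step: later on, one of the two neighbours is where it
  came from, so the other one is next.\<close>

lemma finite_rays_of_double_ray:
  assumes D: "\<And>v. v \<in> verts D \<Longrightarrow> card (neighbours D v) = 2"
  shows "finite (rays_from D v)"
proof (rule finite_imageD[of "\<lambda>r. r 1"])
  let ?R = "rays_from D v"
  have R: "r 0 = v" "inj r" "r n \<in> verts D" "adjacent D (r n) (r (Suc n))" if "r \<in> ?R" for r n
    using that by (auto simp: rays_from_def)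
  show "finite ((\<lambda>r. r 1) ` ?R)"
  proof (cases "?R = {}")
    case False
    then have "v \<in> verts D" using R(1,3) by (metis ex_in_conv)
    then have "finite (neighbours D v)" using D[of v] by (metis card.infinite zero_neq_numeral)
    moreover have "(\<lambda>r. r 1) ` ?R \<subseteq> neighbours D v"
    proof
      fix w assume "w \<in> (\<lambda>r. r 1) ` ?R"
      then obtain r where r: "r \<in> ?R" "w = r (Suc 0)" by auto
      then show "w \<in> neighbours D v" using R(1)[OF r(1)] R(3)[OF r(1), of "Suc 0"] R(4)[OF r(1), of 0] by (simp add: neighbours_def)
    qed
    ultimately show ?thesis by (rule finite_subset[rotated])
  qed simp
  show "inj_on (\<lambda>r. r 1) ?R"
  proof (rule inj_onI)
    fix r s assume rs: "r \<in> ?R" "s \<in> ?R" "r 1 = s 1"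
    have "r n = s n \<and> r (Suc n) = s (Suc n)" for n
    proof (induction n)
      case 0
      then show ?case using R(1)[OF rs(1)] R(1)[OF rs(2)] rs(3) by simp
    next
      case (Suc n)
      let ?N = "neighbours D (r (Suc n))"
      have c: "card ?N = 2" by (rule D[OF R(3)[OF rs(1)]])
      have n: "q n \<in> neighbours D (q (Suc n))" "q (Suc (Suc n)) \<in> neighbours D (q (Suc n))" "q n \<noteq> q (Suc (Suc n))" if "q \<in> ?R" for q
        using R(3)[OF that, of n] R(3)[OF that, of "Suc (Suc n)"] R(4)[OF that, of n] R(4)[OF that, of "Suc n"]
          inj_eq[OF R(2)[OF that], of n "Suc (Suc n)"]
        by (auto simp: neighbours_def adjacent_def insert_commute)
      obtain a b where ab: "?N = {a, b}" using c by (auto simp: card_2_iff)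
      have "r n \<in> {a, b}" "r (Suc (Suc n)) \<in> {a, b}" "r n \<noteq> r (Suc (Suc n))" using n[OF rs(1)] ab by simp_all
      moreover have "r n \<in> {a, b}" "s (Suc (Suc n)) \<in> {a, b}" "r n \<noteq> s (Suc (Suc n))" using n[OF rs(2)] ab Suc by simp_all
      ultimately have "r (Suc (Suc n)) = s (Suc (Suc n))" by auto
      then show ?case using Suc by simp
    qed
    then show "r = s" by (intro ext) blast
  qed
qed

context graph_symmetry
begin

text \<open>By \<open>p_c_eq_1_iff\<close> the condition says that countably many sections in the
  space of labels are null, and the measure of a section depends measurably on the subgraph.\<close>

lemma p_c_measurable: "{\<omega> \<in> space (cylinder_space V \<Otimes>\<^sub>M cylinder_space E). p_c \<omega> = 1} \<in>
    sets (cylinder_space V \<Otimes>\<^sub>M cylinder_space E)"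
proof -
  let ?N = "cylinder_space V \<Otimes>\<^sub>M cylinder_space E" and ?L = "labels J"
  let ?I = "\<lambda>k \<omega> U. infcomp \<omega> (\<lambda>e. U (0, e) < 1 - 1 / (real k + 1))"
  interpret L: prob_space ?L by (rule prob_space_labels)
  have sp: "verts \<omega> \<subseteq> V" "edges \<omega> \<subseteq> E" if "\<omega> \<in> space ?N" for \<omega>
    using that by (auto simp: space_pair_measure)
  have verts: "Measurable.pred (?N \<Otimes>\<^sub>M ?L) (\<lambda>w. x \<in> verts (fst w))" for x
    by (rule measurable_compose[OF _ pred_cylinder_space]) measurable
  have edges: "Measurable.pred (?N \<Otimes>\<^sub>M ?L) (\<lambda>w. e \<in> edges (fst w))" for e
    by (rule measurable_compose[OF _ pred_cylinder_space]) measurable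
  have "Measurable.pred (?N \<Otimes>\<^sub>M ?L) (\<lambda>w. ?I k (fst w) (snd w))" for k
  proof (rule measurable_infcomp[OF countable_V verts])
    fix x y assume "x \<in> V" "y \<in> V"
    then have "(\<lambda>w. snd w (0, {x, y})) \<in> borel_measurable (?N \<Otimes>\<^sub>M ?L)"
      by (intro measurable_compose[OF measurable_snd measurable_label]) auto
    then show "Measurable.pred (?N \<Otimes>\<^sub>M ?L) (\<lambda>w. {x, y} \<in> edges (fst w) \<and> snd w (0, {x, y}) < 1 - 1 / (real k + 1))"
      by (intro pred_intros_logic edges pred_real_less borel_measurable_const)
  qed (use sp in \<open>auto simp: space_pair_measure\<close>)
  then have I: "{w \<in> space (?N \<Otimes>\<^sub>M ?L). ?I k (fst w) (snd w)} \<in> sets (?N \<Otimes>\<^sub>M ?L)" for k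
    by (simp add: pred_def)
  define S where "S k \<omega> = {U \<in> space ?L. ?I k \<omega> U}" for k \<omega>
  have v: "Pair \<omega> -` {w \<in> space (?N \<Otimes>\<^sub>M ?L). ?I k (fst w) (snd w)} = S k \<omega>" if "\<omega> \<in> space ?N" for \<omega> k
    using that by (auto simp: S_def space_pair_measure)
  have S: "S k \<omega> \<in> sets ?L" if "\<omega> \<in> space ?N" for k \<omega>
    using sets_Pair1[OF I, of \<omega> k] v[OF that] by simp
  have "(\<lambda>\<omega>. emeasure ?L (S k \<omega>)) \<in> borel_measurable ?N" for k
    using L.measurable_emeasure_Pair[OF I[of k]] by (rule measurable_cong[THEN iffD1, rotated]) (rule arg_cong2[where f = emeasure, OF refl v])
  then have "{\<omega> \<in> space ?N. \<forall>k. emeasure ?L (S k \<omega>) = 0} \<in> sets ?N" by measurable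
  moreover have "p_c \<omega> = 1 \<longleftrightarrow> (\<forall>k. emeasure ?L (S k \<omega>) = 0)" if w: "\<omega> \<in> space ?N" for \<omega>
  proof -
    have "p_c \<omega> = 1 \<longleftrightarrow> (\<forall>k::nat. AE U in ?L. \<not> ?I k \<omega> U)"
    proof (rule p_c_eq_1_iff)
      show "inj_on (Pair 0) (edges \<omega>)" by (simp add: inj_on_def)
      show "Pair 0 \<in> edges \<omega> \<rightarrow> J" using sp[OF w] E_edge by (auto simp: J_def)
      show "countable (verts \<omega>)" using sp(1)[OF w] countable_V by (rule countable_subset)
      show "countable (edges \<omega>)" using sp(2)[OF w] countable_E by (rule countable_subset)
    qed
    also have "\<dots> \<longleftrightarrow> (\<forall>k. emeasure ?L (S k \<omega>) = 0)"
      by (intro all_cong1 AE_iff_measurable[OF S[OF w]]) (simp add: S_def)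
    finally show ?thesis .
  qed
  ultimately show ?thesis by (simp cong: conj_cong)
qed

text \<open>The common passage from (ii) and from (v) to the situation of (iii), the latter in a
  power of the graph. The random edge set is pushed forward by adjoining all vertices.\<close>

lemma spanning_subgraph_p_c:
  assumes M: "invariant_random_spanning_subgraph \<Gamma> X P M" and V: "V \<noteq> {}"
    and P: "\<And>F. F \<subseteq> E \<Longrightarrow> P (V, F) \<Longrightarrow> connected_graph (V, F) \<and> (\<exists>v\<in>V. finite (rays_from (V, F) v))"
  shows "\<exists>M'. invariant_random_subgraph \<Gamma> X (\<lambda>\<omega>. verts \<omega> \<noteq> {} \<and> connected_graph \<omega>) M' \<and>
    \<P>(\<omega> in M'. p_c \<omega> = 1) > 0"
proof -
  let ?N = "cylinder_space V \<Otimes>\<^sub>M cylinder_space E"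
  have M': "prob_space M" "sets M = sets (cylinder_space E)" "\<And>\<gamma>. \<gamma> \<in> \<Gamma> \<Longrightarrow> distr M M (act_edges \<gamma>) = M"
    "AE F in M. P (V, F)"
    using M verts_X by (simp_all add: invariant_random_spanning_subgraph_def)
  interpret M: prob_space M by fact
  have spM: "space M = Pow E" using sets_eq_imp_space_eq[OF M'(2)] by simp
  have m: "Pair V \<in> measurable M ?N"
    by (subst measurable_cong_sets[OF M'(2) refl], rule measurable_Pair1') simp
  define M1 where "M1 = distr M ?N (Pair V)"
  have sets1: "sets M1 = sets ?N" and space1: "space M1 = space ?N" by (simp_all add: M1_def)
  have good: "AE F in M. F \<subseteq> E \<and> connected_graph (V, F) \<and> p_c (V, F) = 1"
    using M'(4) AE_space
  proof eventually_elim
    fix F assume "P (V, F)" "F \<in> space M"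
    then have F: "F \<subseteq> E" "P (V, F)" using spM by auto
    have s: "simple_graph (V, F)" using F(1) E_edge by (auto simp: simple_graph_def)
    have lf: "locally_finite_graph (V, F)"
      unfolding locally_finite_graph_def
    proof
      fix v assume "v \<in> verts (V, F)"
      then show "finite (neighbours (V, F) v)"
        by (intro finite_subset[OF _ finite_nbrs[of v]]) (use F in \<open>auto simp: neighbours_def adjacent_def\<close>)
    qed
    obtain v where v: "v \<in> V" "finite (rays_from (V, F) v)" and c: "connected_graph (V, F)" using P[OF F] by blast
    have "p_c (V, F) = 1" by (rule p_c_eq_1_of_finite_rays[OF s _ lf c _ v(2)]) (use v in auto)
    then show "F \<subseteq> E \<and> connected_graph (V, F) \<and> p_c (V, F) = 1" using F c by simp
  qed
  let ?G = "{\<omega> \<in> space ?N. (\<forall>x\<in>V. x \<in> verts \<omega>) \<and> (\<forall>x\<in>V. \<forall>y\<in>V. conn (edges \<omega>) x y)}"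
  have G: "?G \<in> sets ?N"
  proof -
    have v: "Measurable.pred ?N (\<lambda>w. x \<in> verts w)" for x
      by (rule measurable_compose[OF measurable_fst pred_cylinder_space])
    have e: "Measurable.pred ?N (\<lambda>w. e \<in> edges w)" for e
      by (rule measurable_compose[OF measurable_snd pred_cylinder_space])
    have "Measurable.pred ?N (\<lambda>w. conn (edges w) x y)" if "x \<in> V" "y \<in> V" for x y
      by (rule measurable_conn[OF countable_V _ e that]) (use E_edge in \<open>fastforce simp: space_pair_measure\<close>)
    then have "Measurable.pred ?N (\<lambda>\<omega>. (\<forall>x\<in>V. x \<in> verts \<omega>) \<and> (\<forall>x\<in>V. \<forall>y\<in>V. conn (edges \<omega>) x y))"
      by (intro pred_intros_logic measurable_pred_countable countable_V v)
    then show ?thesis by (simp add: pred_def)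
  qed
  have inv: "distr M1 M1 (act_graph \<gamma>) = M1" if g: "\<gamma> \<in> \<Gamma>" for \<gamma>
  proof -
    have a: "act_edges \<gamma> \<in> measurable M M"
      using act_edges_measurable[OF g] measurable_cong_sets[OF M'(2) M'(2)] by simp
    have "distr M1 M1 (act_graph \<gamma>) = distr M1 ?N (act_graph \<gamma>)"
      by (rule distr_cong) (auto simp: sets1)
    also have "\<dots> = distr M ?N (act_graph \<gamma> \<circ> Pair V)"
      unfolding M1_def by (rule distr_distr[OF act_graph_measurable[OF g] m])
    also have "\<dots> = distr M ?N (Pair V \<circ> act_edges \<gamma>)"
      by (rule distr_cong) (auto simp: act_graph_def image_V[OF g])
    also have "\<dots> = distr (distr M M (act_edges \<gamma>)) ?N (Pair V)"
      by (rule distr_distr[OF m a, symmetric])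
    finally show ?thesis by (simp only: M'(3)[OF g] M1_def)
  qed
  have "AE \<omega> in M1. \<omega> \<in> ?G"
    unfolding M1_def
  proof (subst AE_distr_iff[OF m])
    show "{\<omega> \<in> space ?N. \<omega> \<in> ?G} \<in> sets ?N" using G by simp
    show "AE F in M. (V, F) \<in> ?G"
      using good
    proof eventually_elim
      case (elim F)
      then have "{e \<in> F. e \<subseteq> V} = F" using E_edge by blast
      then show ?case using elim by (simp add: space_pair_measure connected_graph_conn)
    qed
  qed
  then have "AE \<omega> in M1. subgraph_of \<omega> X \<and> verts \<omega> \<noteq> {} \<and> connected_graph \<omega>"
  proof (rule AE_mp, intro AE_I2 impI)
    fix \<omega> assume w: "\<omega> \<in> ?G"
    then have s: "verts \<omega> = V" "edges \<omega> \<subseteq> E" by (auto simp: space_pair_measure)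
    then have "{e \<in> edges \<omega>. e \<subseteq> V} = edges \<omega>" using E_edge by blast
    then have "connected_graph \<omega>" using w s by (simp add: connected_graph_conn)
    then show "subgraph_of \<omega> X \<and> verts \<omega> \<noteq> {} \<and> connected_graph \<omega>"
      using s V E_edge verts_X by (auto simp: subgraph_of_def simple_graph_def)
  qed
  then have "invariant_random_subgraph \<Gamma> X (\<lambda>\<omega>. verts \<omega> \<noteq> {} \<and> connected_graph \<omega>) M1"
    using inv sets1 M.prob_space_distr[OF m, folded M1_def] verts_X by (simp add: invariant_random_subgraph_def)
  moreover have "\<P>(\<omega> in M1. p_c \<omega> = 1) = 1"
  proof -
    have "\<P>(\<omega> in M1. p_c \<omega> = 1) = measure M (Pair V -` {\<omega> \<in> space ?N. p_c \<omega> = 1} \<inter> space M)"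
      unfolding M1_def by (subst space_distr, rule measure_distr[OF m p_c_measurable])
    also have "Pair V -` {\<omega> \<in> space ?N. p_c \<omega> = 1} \<inter> space M = {F \<in> space M. p_c (V, F) = 1}"
      by (auto simp: space_pair_measure spM)
    also have "measure M \<dots> = 1"
    proof (rule M.prob_Collect_eq_1[THEN iffD2])
      have "Pair V -` {\<omega> \<in> space ?N. p_c \<omega> = 1} \<inter> space M \<in> sets M" by (rule measurable_sets[OF m p_c_measurable])
      then show "{F \<in> space M. p_c (V, F) = 1} \<in> sets M" by (simp add: space_pair_measure spM vimage_def Int_def conj_commute cong: conj_cong)
      show "AE F in M. p_c (V, F) = 1" using good by eventually_elim simp
    qed
    finally show ?thesis .
  qed
  ultimately show ?thesis by (intro exI[of _ M1]) simp
qed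

text \<open>A Foelner set of the power is one of the graph, because the edges of the graph are among
  those of the power.\<close>

lemma amenable_of_power:
  assumes k: "1 \<le> k" and am: "amenable_graph (graph_power X k)" shows "amenable_graph X"
  unfolding amenable_graph_def
proof (intro allI impI)
  interpret P: graph_symmetry V \<Gamma> "graph_power X k" by (rule power_symmetry(1)[OF k])
  fix \<epsilon> :: real assume "\<epsilon> > 0"
  then obtain F where F: "finite F" "F \<noteq> {}" "F \<subseteq> V" "card (P.boundary F) \<le> \<epsilon> * card F"
    using am P.verts_X unfolding amenable_graph_def P.boundary_def by blast
  have "card {e \<in> E. card (e \<inter> F) = 1} \<le> card (P.boundary F)"
    by (rule card_mono[OF P.card_boundary_le(2)[OF F(1,3)]])
      (use power_symmetry(2)[OF k] in \<open>auto simp: P.boundary_def\<close>)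
  then have "real (card {e \<in> E. card (e \<inter> F) = 1}) \<le> \<epsilon> * real (card F)" using F(4) by linarith
  then show "\<exists>F. finite F \<and> F \<noteq> {} \<and> F \<subseteq> verts X \<and> real (card {e \<in> E. card (e \<inter> F) = 1}) \<le> \<epsilon> * real (card F)"
    using F verts_X by blast
qed

end

theorem corollary3:
  fixes G :: "'a ugraph" and \<Gamma> :: "('a \<Rightarrow> 'a) set"
  assumes "simple_graph G"
    and "countable (verts G)" and "infinite (verts G)"
    and "locally_finite_graph G"
    and "connected_graph G"
    and "subgroup \<Gamma> (aut_group G)"
    and "closedin (aut_topology G) \<Gamma>"
    and "unimodular (aut_group G \<lparr>carrier := \<Gamma>\<rparr>) (subtopology (aut_topology G) \<Gamma>)"
    and "transitive_on_verts \<Gamma> G"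
  defines "i \<equiv> amenable_graph G"
    and "ii \<equiv> \<exists>M. invariant_random_spanning_subgraph \<Gamma> G
                     (\<lambda>T. spanning_tree G T \<and> num_ends T \<le> 2) M"
    and "iii \<equiv> \<exists>M. invariant_random_subgraph \<Gamma> G
                     (\<lambda>\<omega>. verts \<omega> \<noteq> {} \<and> connected_graph \<omega>) M \<and>
                   \<P>(\<omega> in M. p_c \<omega> = 1) > 0"
    and "iv \<equiv> \<exists>M. invariant_random_spanning_subgraph \<Gamma> (graph_power G 3)
                     (spanning_double_ray (graph_power G 3)) M"
    and "v \<equiv> \<exists>k::nat. k \<ge> 1 \<and> (\<exists>M. invariant_random_spanning_subgraph \<Gamma> (graph_power G k)
                     (spanning_double_ray (graph_power G k)) M)"
    and "vi \<equiv> amenable_group (aut_group G \<lparr>carrier := \<Gamma>\<rparr>) (subtopology (aut_topology G) \<Gamma>)"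
  shows "(i \<longleftrightarrow> ii) \<and> (i \<longleftrightarrow> iii) \<and> (i \<longleftrightarrow> iv) \<and> (i \<longleftrightarrow> v) \<and> (i \<longleftrightarrow> vi)"
proof -
  interpret unimodular_action G \<Gamma> by (rule unimodular_action.intro; fact)
  have V: "verts G \<noteq> {}" using assms(3) by auto
  have trans: "\<exists>\<gamma>\<in>\<Gamma>. \<gamma> x = y" if "x \<in> verts G" "y \<in> verts G" for x y
    using assms(9) that unfolding transitive_on_verts_def by blast
  have i_ii: "ii \<and> iv" if "i"
  proof -
    have "\<exists>KK p. foelner_cover (verts G) \<Gamma> G KK p"
      by (rule foelner_cover_exists[OF trans assms(3)]) (use \<open>i\<close> in \<open>simp_all add: i_def\<close>)
    then obtain KK p where "foelner_cover (verts G) \<Gamma> G KK p" by blast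
    then interpret foelner_cover "verts G" \<Gamma> G KK p .
    show ?thesis unfolding ii_def iv_def using random_spanning_tree random_double_ray by blast
  qed
  have ii_iii: "iii" if "ii"
  proof -
    obtain M where M: "invariant_random_spanning_subgraph \<Gamma> G (\<lambda>T. spanning_tree G T \<and> num_ends T \<le> 2) M"
      using \<open>ii\<close> unfolding ii_def by blast
    show ?thesis unfolding iii_def
    proof (rule spanning_subgraph_p_c[OF M V])
      fix F assume F: "spanning_tree G (verts G, F) \<and> num_ends (verts G, F) \<le> 2"
      have "(SOME v. v \<in> verts (verts G, F)) \<in> verts G" using V by (simp add: some_in_eq)
      moreover have "finite (rays_from (verts G, F) (SOME v. v \<in> verts (verts G, F)))"
        by (rule finite_rays_of_num_ends) (use F in blast)
      ultimately show "connected_graph (verts G, F) \<and> (\<exists>v\<in>verts G. finite (rays_from (verts G, F) v))"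
        using F unfolding spanning_tree_def tree_def by blast
    qed
  qed
  have iii_i: "i" if "iii"
  proof -
    obtain M where M: "invariant_random_subgraph \<Gamma> G (\<lambda>\<omega>. verts \<omega> \<noteq> {} \<and> connected_graph \<omega>) M"
        "\<P>(\<omega> in M. p_c \<omega> = 1) > 0"
      using \<open>iii\<close> unfolding iii_def by blast
    interpret random_subgraph "verts G" \<Gamma> G M by unfold_locales (rule M(1))
    show ?thesis unfolding i_def by (rule amenable[OF M(2)])
  qed
  have v_i: "i" if "v"
  proof -
    obtain k M where k: "1 \<le> k" and
      M: "invariant_random_spanning_subgraph \<Gamma> (graph_power G k) (spanning_double_ray (graph_power G k)) M"
      using \<open>v\<close> unfolding v_def by blast
    interpret P: graph_symmetry "verts G" \<Gamma> "graph_power G k" by (rule power_symmetry(1)[OF k])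
    have "\<exists>M'. invariant_random_subgraph \<Gamma> (graph_power G k) (\<lambda>\<omega>. verts \<omega> \<noteq> {} \<and> connected_graph \<omega>) M' \<and>
      \<P>(\<omega> in M'. p_c \<omega> = 1) > 0"
    proof (rule P.spanning_subgraph_p_c[OF M V])
      fix F assume F: "spanning_double_ray (graph_power G k) (verts G, F)"
      then have "finite (rays_from (verts G, F) v)" for v
        by (intro finite_rays_of_double_ray) (auto simp: spanning_double_ray_def)
      then show "connected_graph (verts G, F) \<and> (\<exists>v\<in>verts G. finite (rays_from (verts G, F) v))"
        using F V by (auto simp: spanning_double_ray_def)
    qed
    then obtain M' where M': "invariant_random_subgraph \<Gamma> (graph_power G k) (\<lambda>\<omega>. verts \<omega> \<noteq> {} \<and> connected_graph \<omega>) M'"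
        "\<P>(\<omega> in M'. p_c \<omega> = 1) > 0" by blast
    \<comment> \<open>The argument from (iii) to (i) is run in the power of G, on which \<Gamma>
      acts with the same mass transport principle.\<close>
    interpret Q: random_subgraph "verts G" \<Gamma> "graph_power G k" M' by unfold_locales (rule M'(1))
    show ?thesis unfolding i_def by (rule amenable_of_power[OF k Q.amenable[OF M'(2)]])
  qed
  have "v" if "iv" using that unfolding iv_def v_def by (intro exI[of _ 3]) simp
  moreover have "i \<longleftrightarrow> vi"
    unfolding i_def vi_def using amenable_group_imp_amenable_graph amenable_graph_imp_amenable_group
    unfolding \<G>_def T_def by blast
  ultimately show ?thesis using i_ii ii_iii iii_i v_i by blast
qed

end
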